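(* Let $\mathcal{M}$ be a surface of revolution with profile $R:[0,L]\to[0,\infty)$, let $s_0\in(0,L)$, and let $\Omega_\pm$, $S$, $c$, $V_c$, $E_0=\min V_c$, $-\Delta_c$ and $\mathcal{A}$ be as in the context. Suppose that $V_c^{-1}(E_0)=\{s_0\}$, that is, $$\frac{1}{R^2(s)}>\frac{1}{R^2(s_0)}\ \text{ for } s\in(0,s_0),\qquad\text{and}\qquad \frac{c_-}{R^2(s_0)}<\min_{s\in[s_0,L]}\frac{c_+}{R^2(s)}.$$ Then there exist sequences $(\lambda_n)_{n\in\mathbb{N}}\in\mathbb{R}^{\mathbb{N}}$ and $(u_n)_{n\in\mathbb{N}}\in\mathcal{A}^{\mathbb{N}}$ such that for all measurable $\omega\subset\mathcal{M}$ with $\mathrm{dist}_g(\overline{\omega},S)>0$ there exist $C,d>0$ satisfying $$-\Delta_c u_n=\lambda_n u_n,\qquad \lambda_n\underset{n\to+\infty}{\sim}E_0n^2,\qquad \|u_n\|_{L^2(\mathcal{M})}=1,\qquad \|u_n\|_{L^2(\omega)}\le Ce^{-dn},$$ for all $n\in\mathbb{N}$.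
   Context: $(\mathcal{M},g)$ is a compact connected embedded 2-dimensional submanifold of $\mathbb{R}^3$ with smooth boundary $\partial\mathcal{M}$ (with the induced metric), diffeomorphic to a disk, having $\mathbb{S}^1$ as an effective isometry group: the action $(\theta,m)\mapsto\mathcal{R}_\theta m$ satisfies $\mathcal{R}_\theta\mathcal{M}=\mathcal{M}$ and has exactly one fixed point $N\in\mathcal{M}$ (the pole). Set $L=\mathrm{dist}_g(N,\partial\mathcal{M})$. There are coordinates $\zeta:\mathcal{M}\setminus\{N\}\to(0,L]\times\mathbb{S}^1$, $\zeta(m)=(s,\theta)$, in which $(\zeta^{-1})^*g=ds^2+R(s)^2d\theta^2$, where $R$ is smooth on $[0,L]$, $R(0)=0$, $R>0$ on $(0,L]$; $R(s)$ is the Euclidean distance in $\mathbb{R}^3$ to the symmetry axis (the flat disk of radius $L$ is $R(s)=s$). The Riemannian volume is $R(s)\,ds\,d\theta$. For $s_0\in(0,L)$ set $\Omega_-=\{N\}\cup\zeta^{-1}((0,s_0)\times\mathbb{S}^1)$, $\Omega_+=\zeta^{-1}((s_0,L]\times\mathbb{S}^1)$, $S=\zeta^{-1}(\{s_0\}\times\mathbb{S}^1)$, and $c=c(s)=\mathbf{1}_{\Omega_-}c_-+\mathbf{1}_{\Omega_+}c_+$ with constants $0<c_-<c_+$. The operator is $$\Delta_c=\frac{1}{R(s)}\partial_s\big(c(s)R(s)\partial_s\big)+\frac{c(s)}{R^2(s)}\partial_\theta^2,$$ i.e. $\Delta_c=\mathrm{div}_g(c\nabla_g\,\cdot)$, and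 $-\Delta_c$ has domain $$\mathcal{A}=\{u\in H^1_0(\mathcal{M}) : u|_{\Omega_-}\in H^2(\Omega_-),\ u|_{\Omega_+}\in H^2(\Omega_+),\ c_-\partial_\nu(u|_{\Omega_-})|_S=c_+\partial_\nu(u|_{\Omega_+})|_S\},$$ with $\nu$ the unit normal to $S$ pointing into $\Omega_+$. The effective potential is $V_c(s)=c(s)/R^2(s)$ for $s\in(0,L]\setminus\{s_0\}$, $V_c(s_0)=c_-/R^2(s_0)$, and $E_0=\min_{(0,L]}V_c$. *)

theory Defs
  imports "HOL-Analysis.Analysis" "HOL-Library.Landau_Symbols"
begin

section \<open>Smooth maps, surfaces with boundary, Riemannian distance\<close>

text \<open>Meant for open \<open>U\<close>: all partial derivatives of order at most \<open>k\<close> exist and are continuous.\<close>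

primrec Ck_on :: "nat \<Rightarrow> 'a::euclidean_space set \<Rightarrow> ('a \<Rightarrow> 'b::real_normed_vector) \<Rightarrow> bool" where
  "Ck_on 0 U f \<longleftrightarrow> continuous_on U f"
| "Ck_on (Suc k) U f \<longleftrightarrow>
     (\<forall>x\<in>U. f differentiable (at x)) \<and> (\<forall>v. Ck_on k U (\<lambda>x. frechet_derivative f (at x) v))"

text \<open>Smoothness on an arbitrary subset of a Euclidean space is the local existence of smooth
  extensions to open sets of the ambient space. For a submanifold with boundary this is the usual
  notion, smoothness up to the boundary included.\<close>

definition smooth_on :: "'a::euclidean_space set \<Rightarrow> ('a \<Rightarrow> 'b::real_normed_vector) \<Rightarrow> bool" where
  "smooth_on A f \<longleftrightarrow>
     (\<forall>x\<in>A. \<exists>U F. open U \<and> x \<in> U \<and> (\<forall>k. Ck_on k U F) \<and> (\<forall>y\<in>A \<inter> U. F y = f y))"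

definition diffeo :: "'a::euclidean_space set \<Rightarrow> 'b::euclidean_space set \<Rightarrow> ('a \<Rightarrow> 'b) \<Rightarrow> bool" where
  "diffeo A B f \<longleftrightarrow> bij_betw f A B \<and> smooth_on A f \<and> smooth_on B (inv_into A f)"

definition diffeomorphic :: "'a::euclidean_space set \<Rightarrow> 'b::euclidean_space set \<Rightarrow> bool" where
  "diffeomorphic A B \<longleftrightarrow> (\<exists>f. diffeo A B f)"

definition half_plane :: "(real^2) set" where
  "half_plane = {p. 0 \<le> p $ 2}"

definition surface_with_boundary :: "(real^3) set \<Rightarrow> bool" where
  "surface_with_boundary M \<longleftrightarrow>
     (\<forall>x\<in>M. \<exists>W V. open W \<and> x \<in> W \<and> openin (top_of_set half_plane) V \<and> diffeomorphic (M \<inter> W) V)"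

definition surface_boundary :: "(real^3) set \<Rightarrow> (real^3) set" where
  "surface_boundary M =
     {x\<in>M. \<not> (\<exists>W (V :: (real^2) set). open W \<and> x \<in> W \<and> open V \<and> diffeomorphic (M \<inter> W) V)}"

text \<open>The metric of a surface \<open>M\<close> in space is the induced one, so the Riemannian length of a
  curve in \<open>M\<close> is its Euclidean length. Lengths and distances are extended nonnegative reals: a
  piecewise \<open>C\<^sup>1\<close> curve in the sense of the library may have infinite length, and the distance
  to the empty set is \<open>\<infinity>\<close>.\<close>

definition curve_length :: "(real \<Rightarrow> real^3) \<Rightarrow> ennreal" where
  "curve_length \<gamma> = (\<integral>\<^sup>+ t\<in>{0..1}. ennreal (norm (vector_derivative \<gamma> (at t))) \<partial>lborel)"

definition dist_g :: "(real^3) set \<Rightarrow> real^3 \<Rightarrow> real^3 \<Rightarrow> ennreal" where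
  "dist_g M x y = Inf {curve_length \<gamma> |\<gamma>.
     \<gamma> piecewise_C1_differentiable_on {0..1} \<and> \<gamma> ` {0..1} \<subseteq> M \<and> \<gamma> 0 = x \<and> \<gamma> 1 = y}"

definition setdist_g :: "(real^3) set \<Rightarrow> (real^3) set \<Rightarrow> (real^3) set \<Rightarrow> ennreal" where
  "setdist_g M A B = (INF x\<in>A. INF y\<in>B. dist_g M x y)"

section \<open>Surfaces of revolution\<close>

definition axis_line :: "real^3 \<Rightarrow> real^3 \<Rightarrow> (real^3) set" where
  "axis_line a e = {a + t *\<^sub>R e |t. True}"

text \<open>Rotation by the angle \<open>\<theta>\<close> about the axis through \<open>a\<close> with unit direction \<open>e\<close>
  (Rodrigues' formula).\<close>

definition rot :: "real^3 \<Rightarrow> real^3 \<Rightarrow> real \<Rightarrow> real^3 \<Rightarrow> real^3" where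
  "rot a e \<theta> x = a + cos \<theta> *\<^sub>R (x - a) + sin \<theta> *\<^sub>R cross3 e (x - a)
                   + ((1 - cos \<theta>) * (e \<bullet> (x - a))) *\<^sub>R e"

text \<open>The coordinates \<open>\<zeta>\<close> take values in \<open>(0, L] \<times> S\<^sup>1\<close> with \<open>S\<^sup>1\<close> the unit circle of the
  complex plane. \<open>polar M N \<zeta> (s, \<theta>)\<close> is the point of coordinates \<open>(s, exp (\<i> \<theta>))\<close>; it is
  \<open>2 * pi\<close>-periodic in \<open>\<theta>\<close>.\<close>

definition polar :: "(real^3) set \<Rightarrow> real^3 \<Rightarrow> (real^3 \<Rightarrow> real \<times> complex) \<Rightarrow> real \<times> real \<Rightarrow> real^3" where
  "polar M N \<zeta> p = inv_into (M - {N}) \<zeta> (fst p, cis (snd p))"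

definition surface_of_revolution ::
  "(real^3) set \<Rightarrow> real^3 \<Rightarrow> real^3 \<Rightarrow> real^3 \<Rightarrow> real \<Rightarrow> (real \<Rightarrow> real) \<Rightarrow> (real^3 \<Rightarrow> real \<times> complex) \<Rightarrow> bool"
where
  "surface_of_revolution M a e N L R \<zeta> \<longleftrightarrow>
     compact M \<and> connected M \<and> surface_with_boundary M \<and>
     diffeomorphic M (cball (0 :: real^2) 1) \<and>
     norm e = 1 \<and> (\<forall>\<theta>. rot a e \<theta> ` M = M) \<and> {m\<in>M. \<forall>\<theta>. rot a e \<theta> m = m} = {N} \<and>
     0 < L \<and> ennreal L = setdist_g M {N} (surface_boundary M) \<and>
     diffeo (M - {N}) ({0<..L} \<times> sphere 0 1) \<zeta> \<and>
     smooth_on {0..L} R \<and> R 0 = 0 \<and> (\<forall>s\<in>{0<..L}. 0 < R s) \<and>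
     (\<forall>s\<in>{0<..L}. \<forall>\<theta>.
        let Xs = vector_derivative (\<lambda>\<sigma>. polar M N \<zeta> (\<sigma>, \<theta>)) (at s within {0<..L});
            Xt = vector_derivative (\<lambda>\<tau>. polar M N \<zeta> (s, \<tau>)) (at \<theta>)
        in Xs \<bullet> Xs = 1 \<and> Xs \<bullet> Xt = 0 \<and> Xt \<bullet> Xt = (R s)\<^sup>2) \<and>
     (\<forall>m\<in>M - {N}. infdist m (axis_line a e) = R (fst (\<zeta> m)))"

definition Omega_minus :: "(real^3) set \<Rightarrow> real^3 \<Rightarrow> (real^3 \<Rightarrow> real \<times> complex) \<Rightarrow> real \<Rightarrow> (real^3) set" where
  "Omega_minus M N \<zeta> s0 = {N} \<union> inv_into (M - {N}) \<zeta> ` ({0<..<s0} \<times> sphere 0 1)"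

definition Omega_plus ::
  "(real^3) set \<Rightarrow> real^3 \<Rightarrow> real \<Rightarrow> (real^3 \<Rightarrow> real \<times> complex) \<Rightarrow> real \<Rightarrow> (real^3) set" where
  "Omega_plus M N L \<zeta> s0 = inv_into (M - {N}) \<zeta> ` ({s0<..L} \<times> sphere 0 1)"

definition interface :: "(real^3) set \<Rightarrow> real^3 \<Rightarrow> (real^3 \<Rightarrow> real \<times> complex) \<Rightarrow> real \<Rightarrow> (real^3) set" where
  "interface M N \<zeta> s0 = inv_into (M - {N}) \<zeta> ` ({s0} \<times> sphere 0 1)"

text \<open>Values on \<open>S\<close>: the coefficient \<open>c\<close> vanishes there, being a combination of the indicators of
  \<open>\<Omega>\<^sub>-\<close> and \<open>\<Omega>\<^sub>+\<close>, whereas \<open>V_c\<close> takes the inner coefficient.\<close>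

definition coeff_c :: "real \<Rightarrow> real \<Rightarrow> real \<Rightarrow> real \<Rightarrow> real \<Rightarrow> real" where
  "coeff_c L s0 cm cp s = indicator {0<..<s0} s * cm + indicator {s0<..L} s * cp"

definition V_c :: "real \<Rightarrow> (real \<Rightarrow> real) \<Rightarrow> real \<Rightarrow> real \<Rightarrow> real \<Rightarrow> real \<Rightarrow> real" where
  "V_c L R s0 cm cp s = (if s = s0 then cm else coeff_c L s0 cm cp s) / (R s)\<^sup>2"

text \<open>The infimum is attained whenever \<open>V_c\<close> takes the value \<open>E_0\<close>.\<close>

definition E_0 :: "real \<Rightarrow> (real \<Rightarrow> real) \<Rightarrow> real \<Rightarrow> real \<Rightarrow> real \<Rightarrow> real" where
  "E_0 L R s0 cm cp = (INF s\<in>{0<..L}. V_c L R s0 cm cp s)"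

section \<open>Lebesgue and Sobolev spaces\<close>

text \<open>Functions on \<open>M\<close> are complex-valued; their values off \<open>M\<close> are irrelevant. Integrals are
  computed in the coordinates \<open>(s, \<theta>)\<close>, with respect to the Riemannian volume
  \<open>R(s) ds d\<theta>\<close>; the pole is negligible. In this section \<open>P\<close> stands for \<open>polar M N \<zeta>\<close>.\<close>

definition vol :: "real \<Rightarrow> (real \<Rightarrow> real) \<Rightarrow> (real \<times> real) measure" where
  "vol L R = density (lebesgue_on ({0<..L} \<times> {0..<2 * pi})) (\<lambda>p. ennreal (R (fst p)))"

definition measurable_subset ::
  "real \<Rightarrow> (real \<Rightarrow> real) \<Rightarrow> (real \<times> real \<Rightarrow> real^3) \<Rightarrow> (real^3) set \<Rightarrow> bool" where
  "measurable_subset L R P B \<longleftrightarrow> P -` B \<inter> space (vol L R) \<in> sets (vol L R)"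

definition measurable_fun ::
  "real \<Rightarrow> (real \<Rightarrow> real) \<Rightarrow> (real \<times> real \<Rightarrow> real^3) \<Rightarrow> (real^3 \<Rightarrow> complex) \<Rightarrow> bool" where
  "measurable_fun L R P u \<longleftrightarrow> (u \<circ> P) \<in> borel_measurable (vol L R)"

text \<open>The square of the \<open>L\<^sup>2\<close> norm over \<open>B \<subseteq> M\<close> of a function \<open>h\<close> of the coordinates.\<close>

definition L2sq ::
  "real \<Rightarrow> (real \<Rightarrow> real) \<Rightarrow> (real \<times> real \<Rightarrow> real^3) \<Rightarrow> (real^3) set \<Rightarrow> (real \<times> real \<Rightarrow> complex) \<Rightarrow> ennreal"
where
  "L2sq L R P B h = (\<integral>\<^sup>+ p\<in>P -` B. ennreal ((norm (h p))\<^sup>2) \<partial>vol L R)"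

definition L2norm ::
  "real \<Rightarrow> (real \<Rightarrow> real) \<Rightarrow> (real \<times> real \<Rightarrow> real^3) \<Rightarrow> (real^3) set \<Rightarrow> (real^3 \<Rightarrow> complex) \<Rightarrow> real"
where
  "L2norm L R P B u = sqrt (enn2real (L2sq L R P B (u \<circ> P)))"

definition D_s :: "(real \<times> real \<Rightarrow> complex) \<Rightarrow> real \<times> real \<Rightarrow> complex" where
  "D_s h p = vector_derivative (\<lambda>\<sigma>. h (\<sigma>, snd p)) (at (fst p))"

definition D_t :: "(real \<times> real \<Rightarrow> complex) \<Rightarrow> real \<times> real \<Rightarrow> complex" where
  "D_t h p = vector_derivative (\<lambda>\<tau>. h (fst p, \<tau>)) (at (snd p))"

text \<open>\<open>|\<nabla>\<^sub>g h|\<^sup>2\<close> for the metric \<open>ds\<^sup>2 + R\<^sup>2 d\<theta>\<^sup>2\<close>.\<close>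

definition grad_sq :: "(real \<Rightarrow> real) \<Rightarrow> (real \<times> real \<Rightarrow> complex) \<Rightarrow> real \<times> real \<Rightarrow> real" where
  "grad_sq R h p = (norm (D_s h p))\<^sup>2 + (norm (D_t h p))\<^sup>2 / (R (fst p))\<^sup>2"

text \<open>\<open>|\<nabla>\<^sub>g\<^sup>2 h|\<^sup>2\<close> for the metric \<open>ds\<^sup>2 + R\<^sup>2 d\<theta>\<^sup>2\<close>, the nonzero Christoffel symbols of which
  are \<open>\<Gamma>\<^sup>s\<^sub>\<theta>\<^sub>\<theta> = - R R'\<close> and \<open>\<Gamma>\<^sup>\<theta>\<^sub>s\<^sub>\<theta> = \<Gamma>\<^sup>\<theta>\<^sub>\<theta>\<^sub>s = R' / R\<close>.\<close>

definition hess_sq :: "(real \<Rightarrow> real) \<Rightarrow> (real \<times> real \<Rightarrow> complex) \<Rightarrow> real \<times> real \<Rightarrow> real" where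
  "hess_sq R h p =
     (let r = R (fst p); r' = deriv R (fst p) in
        (norm (D_s (D_s h) p))\<^sup>2
        + 2 * (norm (D_s (D_t h) p - (r' / r) *\<^sub>R D_t h p))\<^sup>2 / r ^ 2
        + (norm (D_t (D_t h) p + (r * r') *\<^sub>R D_s h p))\<^sup>2 / r ^ 4)"

definition H1sq ::
  "real \<Rightarrow> (real \<Rightarrow> real) \<Rightarrow> (real \<times> real \<Rightarrow> real^3) \<Rightarrow> (real^3) set \<Rightarrow> (real \<times> real \<Rightarrow> complex) \<Rightarrow> ennreal"
where
  "H1sq L R P B h = (\<integral>\<^sup>+ p\<in>P -` B. ennreal ((norm (h p))\<^sup>2 + grad_sq R h p) \<partial>vol L R)"

definition H2sq ::
  "real \<Rightarrow> (real \<Rightarrow> real) \<Rightarrow> (real \<times> real \<Rightarrow> real^3) \<Rightarrow> (real^3) set \<Rightarrow> (real \<times> real \<Rightarrow> complex) \<Rightarrow> ennreal"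
where
  "H2sq L R P B h =
     (\<integral>\<^sup>+ p\<in>P -` B. ennreal ((norm (h p))\<^sup>2 + grad_sq R h p + hess_sq R h p) \<partial>vol L R)"

text \<open>Sobolev spaces are completions, realised inside \<open>L\<^sup>2\<close>: \<open>u\<close> belongs to the space when some
  sequence of smooth functions is Cauchy for the Sobolev norm and converges to \<open>u\<close> in \<open>L\<^sup>2\<close>.
  Here \<open>H\<^sup>1\<^sub>0(M)\<close> is the completion of the smooth functions with support in \<open>M - \<partial>M\<close>.\<close>

definition H10 ::
  "(real^3) set \<Rightarrow> real \<Rightarrow> (real \<Rightarrow> real) \<Rightarrow> (real \<times> real \<Rightarrow> real^3) \<Rightarrow> (real^3 \<Rightarrow> complex) set" where
  "H10 M L R P = {u. measurable_fun L R P u \<and>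
     (\<exists>f :: nat \<Rightarrow> real^3 \<Rightarrow> complex.
        (\<forall>k. smooth_on M (f k) \<and> closure {x\<in>M. f k x \<noteq> 0} \<inter> surface_boundary M = {}) \<and>
        ((\<lambda>(j, k). H1sq L R P M (\<lambda>p. f j (P p) - f k (P p))) \<longlongrightarrow> 0) (sequentially \<times>\<^sub>F sequentially) \<and>
        (\<lambda>k. L2sq L R P M (\<lambda>p. f k (P p) - u (P p))) \<longlonglongrightarrow> 0)}"

text \<open>\<open>f k \<rightarrow> u\<close> in \<open>H\<^sup>2(\<Omega>)\<close> with each \<open>f k\<close> smooth on \<open>\<Omega>\<close> up to its boundary. Operators on
  \<open>H\<^sup>2(\<Omega>)\<close> (traces, differential operators) are the continuous extensions of the classical ones
  along such sequences.\<close>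

definition H2_approx ::
  "real \<Rightarrow> (real \<Rightarrow> real) \<Rightarrow> (real \<times> real \<Rightarrow> real^3) \<Rightarrow> (real^3) set \<Rightarrow>
   (nat \<Rightarrow> real^3 \<Rightarrow> complex) \<Rightarrow> (real^3 \<Rightarrow> complex) \<Rightarrow> bool" where
  "H2_approx L R P \<Omega> f u \<longleftrightarrow>
     (\<forall>k. smooth_on (closure \<Omega>) (f k)) \<and>
     ((\<lambda>(j, k). H2sq L R P \<Omega> (\<lambda>p. f j (P p) - f k (P p))) \<longlongrightarrow> 0) (sequentially \<times>\<^sub>F sequentially) \<and>
     (\<lambda>k. L2sq L R P \<Omega> (\<lambda>p. f k (P p) - u (P p))) \<longlonglongrightarrow> 0"

definition H2 ::
  "real \<Rightarrow> (real \<Rightarrow> real) \<Rightarrow> (real \<times> real \<Rightarrow> real^3) \<Rightarrow> (real^3) set \<Rightarrow> (real^3 \<Rightarrow> complex) set" where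
  "H2 L R P \<Omega> = {u. measurable_fun L R P u \<and> (\<exists>f. H2_approx L R P \<Omega> f u)}"

text \<open>\<open>t\<close>, a function of the angle, is the trace on \<open>S\<close> of \<open>\<partial>\<^sub>\<nu> (u|\<Omega>)\<close>. The unit normal to \<open>S\<close>
  pointing into \<open>\<Omega>\<^sub>+\<close> is \<open>\<partial>\<^sub>s\<close>, and \<open>J\<close> is the range of \<open>s\<close> on the closure of \<open>\<Omega>\<close>, which makes the
  derivative of \<open>f k\<close> at \<open>s0\<close> one-sided.\<close>

definition normal_trace ::
  "real \<Rightarrow> (real \<Rightarrow> real) \<Rightarrow> (real \<times> real \<Rightarrow> real^3) \<Rightarrow> real \<Rightarrow> real set \<Rightarrow> (real^3) set \<Rightarrow>
   (real^3 \<Rightarrow> complex) \<Rightarrow> (real \<Rightarrow> complex) \<Rightarrow> bool" where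
  "normal_trace L R P s0 J \<Omega> u t \<longleftrightarrow>
     t \<in> borel_measurable (lebesgue_on {0..<2 * pi}) \<and>
     (\<exists>f. H2_approx L R P \<Omega> f u \<and>
        (\<lambda>k. \<integral>\<^sup>+ \<theta>. ennreal ((norm (vector_derivative (\<lambda>\<sigma>. f k (P (\<sigma>, \<theta>))) (at s0 within J) - t \<theta>))\<^sup>2 * R s0)
              \<partial>lebesgue_on {0..<2 * pi}) \<longlonglongrightarrow> 0)"

section \<open>The operator\<close>

definition domain_A ::
  "(real^3) set \<Rightarrow> real^3 \<Rightarrow> real \<Rightarrow> (real \<Rightarrow> real) \<Rightarrow> (real^3 \<Rightarrow> real \<times> complex) \<Rightarrow>
   real \<Rightarrow> real \<Rightarrow> real \<Rightarrow> (real^3 \<Rightarrow> complex) set" where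
  "domain_A M N L R \<zeta> s0 cm cp =
     {u \<in> H10 M L R (polar M N \<zeta>).
        u \<in> H2 L R (polar M N \<zeta>) (Omega_minus M N \<zeta> s0) \<and>
        u \<in> H2 L R (polar M N \<zeta>) (Omega_plus M N L \<zeta> s0) \<and>
        (\<exists>tm tp.
           normal_trace L R (polar M N \<zeta>) s0 {0<..s0} (Omega_minus M N \<zeta> s0) u tm \<and>
           normal_trace L R (polar M N \<zeta>) s0 {s0..L} (Omega_plus M N L \<zeta> s0) u tp \<and>
           (AE \<theta> in lebesgue_on {0..<2 * pi}. cm *\<^sub>R tm \<theta> = cp *\<^sub>R tp \<theta>))}"

text \<open>The expression of \<open>\<Delta>\<^sub>c\<close> on functions that are smooth away from \<open>S\<close>.\<close>

definition Delta_c_classical ::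
  "real \<Rightarrow> (real \<Rightarrow> real) \<Rightarrow> real \<Rightarrow> real \<Rightarrow> real \<Rightarrow> (real \<times> real \<Rightarrow> complex) \<Rightarrow> real \<times> real \<Rightarrow> complex"
where
  "Delta_c_classical L R s0 cm cp h p =
     (1 / R (fst p)) *\<^sub>R D_s (\<lambda>q. (coeff_c L s0 cm cp (fst q) * R (fst q)) *\<^sub>R D_s h q) p
     + (coeff_c L s0 cm cp (fst p) / (R (fst p))\<^sup>2) *\<^sub>R D_t (D_t h) p"

definition Delta_c_on ::
  "real \<Rightarrow> (real \<Rightarrow> real) \<Rightarrow> (real \<times> real \<Rightarrow> real^3) \<Rightarrow> real \<Rightarrow> real \<Rightarrow> real \<Rightarrow> (real^3) set \<Rightarrow>
   (real^3 \<Rightarrow> complex) \<Rightarrow> (real^3 \<Rightarrow> complex) \<Rightarrow> bool" where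
  "Delta_c_on L R P s0 cm cp \<Omega> u w \<longleftrightarrow>
     (\<exists>f. H2_approx L R P \<Omega> f u \<and>
        (\<lambda>k. L2sq L R P \<Omega> (\<lambda>p. Delta_c_classical L R s0 cm cp (f k \<circ> P) p - w (P p))) \<longlonglongrightarrow> 0)"

text \<open>\<open>(u, w)\<close> is in the graph of \<open>-\<Delta>\<^sub>c\<close>, i.e. \<open>u\<close> is in the domain and \<open>-\<Delta>\<^sub>c u = w\<close> almost
  everywhere; \<open>S\<close> is negligible.\<close>

definition minus_Delta_c ::
  "(real^3) set \<Rightarrow> real^3 \<Rightarrow> real \<Rightarrow> (real \<Rightarrow> real) \<Rightarrow> (real^3 \<Rightarrow> real \<times> complex) \<Rightarrow>
   real \<Rightarrow> real \<Rightarrow> real \<Rightarrow> (real^3 \<Rightarrow> complex) \<Rightarrow> (real^3 \<Rightarrow> complex) \<Rightarrow> bool" where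
  "minus_Delta_c M N L R \<zeta> s0 cm cp u w \<longleftrightarrow>
     u \<in> domain_A M N L R \<zeta> s0 cm cp \<and> measurable_fun L R (polar M N \<zeta>) w \<and>
     Delta_c_on L R (polar M N \<zeta>) s0 cm cp (Omega_minus M N \<zeta> s0) u (\<lambda>m. - w m) \<and>
     Delta_c_on L R (polar M N \<zeta>) s0 cm cp (Omega_plus M N L \<zeta> s0) u (\<lambda>m. - w m)"

end

theory Submission
  imports Defs
begin

text \<open>Separate variables, \<open>u = f(s) exp(\<i> n \<theta>)\<close>. Write \<open>f = \<psi> V\<close> with \<open>\<psi>\<close> the explicit solution for
  \<open>\<lambda> = 0\<close> in the conformal variable \<open>t = \<integral> ds / R\<close> (\<open>\<psi> = exp(n t)\<close> inside, continued through the
  transmission condition). Then \<open>V\<close> solves a Volterra equation whose Neumann series converges for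
  all \<open>\<lambda>\<close>, and the largest \<open>\<lambda>\<close> for which \<open>V \<ge> 0\<close> on \<open>[0, L]\<close> gives an eigenfunction, positive up to
  the boundary, where it vanishes. Picone's identity bounds \<open>\<lambda>\<close> from above by \<open>n\<^sup>2 (E\<^sub>0 + \<epsilon>) + O(1)\<close>, the energy
  identity gives \<open>\<lambda> \<ge> n\<^sup>2 E\<^sub>0\<close>, and Agmon's weight \<open>exp(2 n \<kappa> |s - s\<^sub>0|)\<close> gives the localisation.

  Since \<open>|R'| \<le> K\<close>, the quotient \<open>exp(n t) / R\<^sup>2\<close> is nondecreasing for \<open>n \<ge> 2 K\<close>; hence for large \<open>n\<close> the
  function \<open>u\<close> is so flat at the pole that it is an \<open>H\<^sup>2\<close> limit of functions vanishing near the pole, and the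
  regularity of \<open>M\<close> at the pole plays no role. The finitely many small \<open>n\<close> reuse one eigenfunction.\<close>

section \<open>Smooth functions\<close>

text \<open>No spectral theorem is invoked: \<lambda> is found by shooting. Factoring out \<psi>
  turns the radial equation into \<open>(c b V')' = - \<lambda> b V\<close> with weight
  \<open>b = R \<psi>\<^sup>2\<close>. The first obstacle is that b degenerates at the pole.
  Monotonicity overcomes it: if b is nondecreasing, the averages of v against b(x) / b(s), x <= s,
  are bounded however fast b vanishes. For large n this monotonicity holds because the growth of
  \<psi>, of rate n / R, beats R'. Positivity is carried along because Picone's identity divides by
  the solution; the resulting upper bound for \<lambda> also guarantees that shooting stops at a
  zero on the boundary. The second obstacle is that Sobolev spaces are completions, so every
  membership, trace and value of the operator needs an explicit smooth sequence. Polynomials times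
  cutoffs, lifted to the surface, are used. Their squared errors are bounded on layers of total
  width O(1/k) and O(1/k) elsewhere: the factor k from a cutoff derivative is paid near the pole by
  R <= K s together with f = O(R^2), and near the boundary by the linear vanishing of the function
  there.\<close>

lemma Ck_on_transfer:
  assumes "open U" "Ck_on k U f" "\<And>x. x \<in> U \<Longrightarrow> f x = g x"
  shows "Ck_on k U g"
  using assms(2,3)
proof (induction k arbitrary: f g)
  case 0
  then show ?case by (simp cong: continuous_on_cong)
next
  case (Suc k)
  have der: "(g has_derivative frechet_derivative f (at x)) (at x)" if "x \<in> U" for x
  proof -
    have "(f has_derivative frechet_derivative f (at x)) (at x)"
      using Suc.prems(1) that by (simp add: frechet_derivative_works)
    then show ?thesis
      by (rule has_derivative_transform_within_open[OF _ \<open>open U\<close> that]) (rule Suc.prems(2))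
  qed
  have "Ck_on k U (\<lambda>x. frechet_derivative g (at x) v)" for v
    using Suc.IH[of "\<lambda>x. frechet_derivative f (at x) v"] Suc.prems(1) frechet_derivative_at[OF der] by simp
  with der show ?case by (auto simp: differentiable_def)
qed

lemma Ck_on_subset: "Ck_on k U f \<Longrightarrow> V \<subseteq> U \<Longrightarrow> Ck_on k V f"
  by (induction k arbitrary: f) (auto intro: continuous_on_subset)

text \<open>Replaces the chosen \<open>frechet_derivative\<close> by any explicit derivative, so
  that smoothness of a concrete function becomes an induction along its differentiation
  rule.\<close>

lemma Ck_on_SucI:
  assumes "open U" and der: "\<And>x. x \<in> U \<Longrightarrow> (f has_derivative f' x) (at x)"
    and "\<And>v. Ck_on k U (\<lambda>x. f' x v)"
  shows "Ck_on (Suc k) U f"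
proof -
  have "Ck_on k U (\<lambda>x. frechet_derivative f (at x) v)" for v
    by (rule Ck_on_transfer[OF assms(1) assms(3)]) (simp add: frechet_derivative_at[OF der])
  with der show ?thesis by (auto simp: differentiable_def)
qed

lemma Ck_on_SucD:
  assumes "Ck_on (Suc k) U f"
  shows "x \<in> U \<Longrightarrow> (f has_derivative frechet_derivative f (at x)) (at x)"
    and "Ck_on k U (\<lambda>x. frechet_derivative f (at x) v)"
  using assms by (auto simp: frechet_derivative_works)

lemma Ck_on_Suc_imp: "Ck_on (Suc k) U f \<Longrightarrow> Ck_on k U f"
proof (induction k arbitrary: f)
  case 0
  then show ?case
    by (auto intro!: continuous_at_imp_continuous_on differentiable_imp_continuous_within)
next
  case (Suc k)
  then show ?case using Ck_on.simps(2) by blast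
qed

lemma Ck_on_imp_continuous_on: "Ck_on k U f \<Longrightarrow> continuous_on U f"
  by (induction k) (use Ck_on_Suc_imp in auto)

lemma Ck_on_const: "open U \<Longrightarrow> Ck_on k U (\<lambda>x. c)"
proof (induction k arbitrary: c)
  case (Suc k)
  then show ?case by (intro Ck_on_SucI[where f' = "\<lambda>x v. 0"]) auto
qed simp

lemma Ck_on_add:
  assumes "open U"
  shows "Ck_on k U f \<Longrightarrow> Ck_on k U g \<Longrightarrow> Ck_on k U (\<lambda>x. f x + g x)"
proof (induction k arbitrary: f g)
  case 0
  then show ?case by (auto intro: continuous_intros)
next
  case (Suc k)
  show ?case
    by (rule Ck_on_SucI[OF assms has_derivative_add[OF Ck_on_SucD(1)[OF Suc.prems(1)] Ck_on_SucD(1)[OF Suc.prems(2)]]])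
      (auto intro!: Suc.IH Ck_on_SucD(2) Suc.prems)
qed

lemma Ck_on_sum:
  assumes "open U"
  shows "(\<And>i. i \<in> I \<Longrightarrow> Ck_on k U (f i)) \<Longrightarrow> Ck_on k U (\<lambda>x. \<Sum>i\<in>I. f i x)"
  by (induction I rule: infinite_finite_induct) (auto intro: Ck_on_const Ck_on_add assms)

text \<open>The product rule pairs the derivative of one factor with the other factor
  undifferentiated, so the induction uses both factors at the lower order too
  (\<open>Ck_on_Suc_imp\<close>).\<close>

lemma Ck_on_bilinear:
  assumes pr: "bounded_bilinear pr" and "open U"
  shows "Ck_on k U f \<Longrightarrow> Ck_on k U g \<Longrightarrow> Ck_on k U (\<lambda>x. pr (f x) (g x))"
proof (induction k arbitrary: f g)
  case 0
  then show ?case by (auto intro: bounded_bilinear.continuous_on[OF pr])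
next
  case (Suc k)
  show ?case
    by (rule Ck_on_SucI[OF assms(2) bounded_bilinear.FDERIV[OF pr Ck_on_SucD(1)[OF Suc.prems(1)] Ck_on_SucD(1)[OF Suc.prems(2)]]])
      (auto intro!: Suc.IH Ck_on_SucD(2)[OF Suc.prems(1)] Ck_on_SucD(2)[OF Suc.prems(2)] Ck_on_add[OF assms(2)]
        Suc.prems[THEN Ck_on_Suc_imp])
qed

lemmas Ck_on_mult = Ck_on_bilinear[OF bounded_bilinear_mult]
lemmas Ck_on_scaleR = Ck_on_bilinear[OF bounded_bilinear_scaleR]

lemma Ck_on_linear:
  assumes "open U" "bounded_linear h"
  shows "Ck_on k U f \<Longrightarrow> Ck_on k U (\<lambda>x. h (f x))"
proof (induction k arbitrary: f)
  case 0
  then show ?case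
    using bounded_linear.continuous_on[OF assms(2)] by simp
next
  case (Suc k)
  show ?case
    by (rule Ck_on_SucI[OF assms(1) bounded_linear.has_derivative[OF assms(2) Ck_on_SucD(1)[OF Suc.prems]]])
      (auto intro!: Suc.IH Ck_on_SucD(2) Suc.prems)
qed

lemma Ck_on_ident: "open U \<Longrightarrow> Ck_on k U (\<lambda>x. x)"
proof (cases k)
  case (Suc j)
  assume "open U"
  then show ?thesis unfolding Suc by (intro Ck_on_SucI[where f' = "\<lambda>x v. v"] Ck_on_const) auto
qed (simp add: continuous_on_id)

lemma Ck_on_power:
  fixes f :: "'a::euclidean_space \<Rightarrow> 'b::real_normed_algebra_1"
  shows "open U \<Longrightarrow> Ck_on k U f \<Longrightarrow> Ck_on k U (\<lambda>x. f x ^ n)"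
  by (induction n) (auto intro: Ck_on_const Ck_on_mult)

lemma Ck_on_compose:
  fixes F :: "'a::euclidean_space \<Rightarrow> 'b::euclidean_space" and g :: "'b \<Rightarrow> 'c::real_normed_vector"
  assumes "open U" "open V" "F ` U \<subseteq> V"
  shows "Ck_on k U F \<Longrightarrow> Ck_on k V g \<Longrightarrow> Ck_on k U (\<lambda>x. g (F x))"
proof (induction k arbitrary: g)
  case 0
  then show ?case using continuous_on_compose2[OF _ _ assms(3)] by auto
next
  case (Suc k)
  \<comment> \<open>The derivative of g applied to the moving vector DF(v) is expanded in the basis:
    this gives a sum of products of directional derivatives in fixed directions, to which the
    induction hypothesis applies.\<close>
  have der: "((\<lambda>x. g (F x)) has_derivative
      (\<lambda>v. \<Sum>b\<in>Basis. (frechet_derivative F (at x) v \<bullet> b) *\<^sub>R frechet_derivative g (at (F x)) b)) (at x)"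
    if "x \<in> U" for x
  proof -
    have g: "(g has_derivative frechet_derivative g (at (F x))) (at (F x))"
      using Ck_on_SucD(1)[OF Suc.prems(2)] that assms(3) by blast
    have d: "((\<lambda>x. g (F x)) has_derivative (\<lambda>v. frechet_derivative g (at (F x)) (frechet_derivative F (at x) v))) (at x)"
      using has_derivative_compose[OF Ck_on_SucD(1)[OF Suc.prems(1) that] g] .
    have "frechet_derivative g (at (F x)) w = (\<Sum>b\<in>Basis. (w \<bullet> b) *\<^sub>R frechet_derivative g (at (F x)) b)" for w
      using linear_sum[of "frechet_derivative g (at (F x))" "\<lambda>b. (w \<bullet> b) *\<^sub>R b" Basis]
        has_derivative_linear[OF g] by (simp add: linear_cmul euclidean_representation)
    from has_derivative_eq_rhs[OF d ext[OF this]] show ?thesis .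
  qed
  have "Ck_on k U (\<lambda>x. (frechet_derivative F (at x) v \<bullet> b) *\<^sub>R frechet_derivative g (at (F x)) b)" for v b
    by (rule Ck_on_scaleR[OF assms(1) Ck_on_linear[OF assms(1) bounded_linear_inner_left Ck_on_SucD(2)[OF Suc.prems(1)]]
          Suc.IH[OF Ck_on_Suc_imp[OF Suc.prems(1)] Ck_on_SucD(2)[OF Suc.prems(2)]]])
  from Ck_on_SucI[OF assms(1) der Ck_on_sum[OF assms(1) this]]
  show ?case .
qed

text \<open>The exponent is general because differentiation lowers it. The exponent -1 later gives
  reciprocals, and 1/2 and -1/2 the modulus of a complex number and its inverse.\<close>

lemma Ck_on_powr: "Ck_on k {0<..} (\<lambda>x::real. x powr a)"
proof (induction k arbitrary: a)
  case 0
  then show ?case by (auto intro!: continuous_intros)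
next
  case (Suc k)
  show ?case
  proof (rule Ck_on_SucI[where f' = "\<lambda>x v. (a * v) * x powr (a - 1)"])
    show "((\<lambda>x. x powr a) has_derivative (\<lambda>v. a * v * x powr (a - 1))) (at x)" if "x \<in> {0<..}" for x
      by (rule has_derivative_eq_rhs[OF has_real_derivative_powr[unfolded has_field_derivative_def]])
        (use that in auto)
    show "Ck_on k {0<..} (\<lambda>x. a * v * x powr (a - 1))" for v
      by (rule Ck_on_mult[OF _ Ck_on_const Suc.IH]) auto
  qed simp
qed

section \<open>Flat functions and a smooth cutoff\<close>

definition flat :: "nat \<Rightarrow> real \<Rightarrow> real" where
  "flat k x = (if x > 0 then (1 / x) ^ k * exp (- 1 / x) else 0)"

lemma flat_limit_0: "((\<lambda>x. (1 / x) ^ k * exp (- 1 / x)) \<longlongrightarrow> 0) (at_right (0::real))"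
proof -
  have "((\<lambda>x. x ^ k / exp x) \<longlongrightarrow> 0) (at_top :: real filter)"
    by (rule tendsto_power_div_exp_0)
  from filterlim_compose[OF this filterlim_inverse_at_top_right]
  show ?thesis by (simp add: inverse_eq_divide exp_minus)
qed

text \<open>The powers of 1/x are carried along so that the family is closed under differentiation;
  smoothness of exp(-1/x) is then a plain induction. At 0 the difference quotient is
  \<open>flat (k + 1)\<close> from the right and 0 from the left.\<close>

lemma flat_has_derivative:
  "(flat k has_real_derivative (flat (k + 2) x - real k * flat (k + 1) x)) (at x)"
proof -
  consider "x > 0" | "x < 0" | "x = 0" by linarith
  then show ?thesis
  proof cases
    case 1
    have "((\<lambda>x. (1 / x) ^ k * exp (- 1 / x)) has_real_derivative (flat (k + 2) x - real k * flat (k + 1) x)) (at x)"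
    proof -
      have i: "((\<lambda>x. 1 / x) has_real_derivative - ((1 / x) ^ 2)) (at x)"
        using 1 by (auto intro!: derivative_eq_intros simp: field_simps power2_eq_square)
      have e: "((\<lambda>x. exp (- 1 / x)) has_real_derivative exp (- 1 / x) * (1 / x) ^ 2) (at x)"
        using DERIV_chain2[OF DERIV_exp DERIV_minus[OF i]] by simp
      have "real k * (1 / x) ^ (k - 1) * (1 / x) ^ 2 = real k * (1 / x) ^ (k + 1)"
        by (cases k) (auto simp: power2_eq_square power_add)
      then show ?thesis
        using DERIV_mult[OF DERIV_power[OF i, of k] e] 1
        by (simp add: flat_def power_add power2_eq_square algebra_simps)
    qed
    then show ?thesis
      by (rule has_field_derivative_transform_within_open[where S = "{0<..}"]) (use 1 in \<open>auto simp: flat_def\<close>)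
  next
    case 2
    have "((\<lambda>x. 0) has_real_derivative (flat (k + 2) x - real k * flat (k + 1) x)) (at x)"
      using 2 by (auto simp: flat_def)
    then show ?thesis
      by (rule has_field_derivative_transform_within_open[where S = "{..<0}"]) (use 2 in \<open>auto simp: flat_def\<close>)
  next
    case 3
    have "((\<lambda>h. flat k h / h) \<longlongrightarrow> 0) (at_right 0)"
      using flat_limit_0[of "Suc k"]
      by (rule Lim_transform_eventually) (auto simp: eventually_at_filter flat_def)
    moreover have "((\<lambda>h. flat k h / h) \<longlongrightarrow> 0) (at_left 0)"
      by (rule Lim_transform_eventually[OF tendsto_const]) (auto simp: eventually_at_filter flat_def)
    ultimately have "((\<lambda>h. flat k h / h) \<longlongrightarrow> 0) (at 0)"
      by (simp add: filterlim_at_split)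
    then show ?thesis using 3 by (simp add: DERIV_def flat_def)
  qed
qed

lemma Ck_on_flat: "Ck_on m UNIV (flat k)"
proof (induction m arbitrary: k)
  case 0
  then show ?case
    by (simp, meson flat_has_derivative DERIV_isCont continuous_at_imp_continuous_on)
next
  case (Suc m)
  have "(flat k has_derivative (\<lambda>v. v * (flat (k + 2) x + (- real k) * flat (k + 1) x))) (at x)" for x
    by (rule has_derivative_eq_rhs[OF flat_has_derivative[unfolded has_field_derivative_def]])
      (auto simp: algebra_simps)
  then show ?case
    by (rule Ck_on_SucI[OF open_UNIV])
      (rule Ck_on_mult Ck_on_add Ck_on_const Suc open_UNIV)+
qed

lemma Ck_on_real_derivative:
  fixes f :: "real \<Rightarrow> real"
  assumes "\<And>k. Ck_on k U f"
  shows "\<And>x. x \<in> U \<Longrightarrow> (f has_real_derivative frechet_derivative f (at x) 1) (at x)"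
    and "\<And>k. Ck_on k U (\<lambda>x. frechet_derivative f (at x) 1)"
proof -
  show "Ck_on k U (\<lambda>x. frechet_derivative f (at x) 1)" for k
    using assms[of "Suc k"] by simp
  fix x assume "x \<in> U"
  then have d: "(f has_derivative frechet_derivative f (at x)) (at x)"
    using Ck_on_SucD(1)[OF assms] by blast
  have "frechet_derivative f (at x) = (*) (frechet_derivative f (at x) 1)"
  proof
    show "frechet_derivative f (at x) v = frechet_derivative f (at x) 1 * v" for v
      using linear_cmul[OF has_derivative_linear[OF d], of v 1] by (simp add: mult.commute)
  qed
  then show "(f has_real_derivative frechet_derivative f (at x) 1) (at x)"
    using d by (simp add: has_field_derivative_def)
qed

text \<open>Rescaling by k multiplies the j-th derivative by k^j; the common bound B for the cutoff
  and two derivatives is the constant from which the approximation estimates start.\<close>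

lemma smooth_cutoff:
  obtains \<eta> \<eta>1 \<eta>2 :: "real \<Rightarrow> real" and B where
    "\<And>k. Ck_on k UNIV \<eta>" "\<And>x. (\<eta> has_real_derivative \<eta>1 x) (at x)"
    "\<And>x. (\<eta>1 has_real_derivative \<eta>2 x) (at x)"
    "\<And>x. x \<le> 1 \<Longrightarrow> \<eta> x = 0" "\<And>x. x \<ge> 2 \<Longrightarrow> \<eta> x = 1"
    "\<And>x. \<bar>\<eta> x\<bar> \<le> B" "\<And>x. \<bar>\<eta>1 x\<bar> \<le> B" "\<And>x. \<bar>\<eta>2 x\<bar> \<le> B"
    "\<And>x. x < 1 \<or> x > 2 \<Longrightarrow> \<eta>1 x = 0" "\<And>x. x < 1 \<or> x > 2 \<Longrightarrow> \<eta>2 x = 0"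
proof -
  \<comment> \<open>The usual quotient of flat functions, with the reciprocal written as a power so
    that \<open>Ck_on_powr\<close> applies. The denominator is positive because x > 1 or x <
    2.\<close>
  define \<eta> where "\<eta> x = flat 0 (x - 1) * (flat 0 (x - 1) + flat 0 (2 - x)) powr (- 1)" for x
  have nn: "flat 0 x \<ge> 0" "x > 0 \<Longrightarrow> flat 0 x > 0" "x \<le> 0 \<Longrightarrow> flat 0 x = 0" for x
    by (auto simp: flat_def)
  have pos: "flat 0 (x - 1) + flat 0 (2 - x) > 0" for x
    using nn(1)[of "x - 1"] nn(1)[of "2 - x"] nn(2)[of "x - 1"] nn(2)[of "2 - x"] by (cases "x > 1") linarith+
  have "Ck_on k UNIV (\<lambda>x::real. x + (- 1))" "Ck_on k UNIV (\<lambda>x::real. 2 + (- 1) * x)" for k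
    by (rule Ck_on_add Ck_on_mult Ck_on_ident Ck_on_const open_UNIV)+
  then have aff: "Ck_on k UNIV (\<lambda>x::real. x - 1)" "Ck_on k UNIV (\<lambda>x::real. 2 - x)" for k
    by simp_all
  have fl: "Ck_on k UNIV (\<lambda>x. flat 0 (x - 1))" "Ck_on k UNIV (\<lambda>x. flat 0 (2 - x))" for k
    using Ck_on_compose[OF open_UNIV open_UNIV _ aff(1) Ck_on_flat]
      Ck_on_compose[OF open_UNIV open_UNIV _ aff(2) Ck_on_flat] by auto
  have "Ck_on k UNIV (\<lambda>x. (flat 0 (x - 1) + flat 0 (2 - x)) powr (- 1))" for k
    using Ck_on_compose[OF open_UNIV open_greaterThan _ Ck_on_add[OF open_UNIV fl] Ck_on_powr[of k "- 1"]] pos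
    by (auto simp del: powr_minus powr_neg_one)
  then have sm: "Ck_on k UNIV \<eta>" for k
    unfolding \<eta>_def by (intro Ck_on_mult fl) auto
  define \<eta>1 where "\<eta>1 x = frechet_derivative \<eta> (at x) 1" for x
  define \<eta>2 where "\<eta>2 x = frechet_derivative \<eta>1 (at x) 1" for x
  have d1: "(\<eta> has_real_derivative \<eta>1 x) (at x)" and sm1: "Ck_on k UNIV \<eta>1" for x k
    unfolding \<eta>1_def using Ck_on_real_derivative[OF sm] by (auto simp: \<eta>1_def)
  have d2: "(\<eta>1 has_real_derivative \<eta>2 x) (at x)" and sm2: "Ck_on k UNIV \<eta>2" for x k
    unfolding \<eta>2_def using Ck_on_real_derivative[OF sm1] by (auto simp: \<eta>2_def)
  have z: "x \<le> 1 \<Longrightarrow> \<eta> x = 0" and o: "x \<ge> 2 \<Longrightarrow> \<eta> x = 1" for x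
    using nn(3)[of "x - 1"] nn(3)[of "2 - x"] nn(2)[of "x - 1"] by (auto simp: \<eta>_def powr_minus)
  \<comment> \<open>A function that is constant on an open set has derivative 0 there; used twice,
    for both derivatives outside [1, 2].\<close>
  have loc: "f1 x = 0" if "\<And>y. (f has_real_derivative f1 y) (at y)" "open U" "x \<in> U" "\<And>y. y \<in> U \<Longrightarrow> f y = c"
    for f f1 :: "real \<Rightarrow> real" and x c U
    using DERIV_unique[OF has_field_derivative_transform_within_open[OF that(1) that(2,3), of "\<lambda>_. c"] DERIV_const]
      that(4) by auto
  have z1: "\<eta>1 x = 0" if "x < 1 \<or> x > 2" for x
    using loc[OF d1, of "{..<1}" x 0] loc[OF d1, of "{2<..}" x 1] that z o by auto
  have z2: "\<eta>2 x = 0" if "x < 1 \<or> x > 2" for x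
    using loc[OF d2, of "{..<1}" x 0] loc[OF d2, of "{2<..}" x 0] that z1 by auto
  have "bounded (f ` {1..2})" if "continuous_on UNIV f" for f :: "real \<Rightarrow> real"
    by (intro compact_imp_bounded compact_continuous_image continuous_on_subset[OF that]) auto
  then have bd: "\<exists>a. \<forall>x\<in>{1..2}. \<bar>f x\<bar> \<le> a" if "\<And>k. Ck_on k UNIV f" for f :: "real \<Rightarrow> real"
    using Ck_on_imp_continuous_on[OF that] by (auto simp: bounded_iff)
  obtain a b c where abc: "\<And>x. x \<in> {1..2} \<Longrightarrow> \<bar>\<eta> x\<bar> \<le> a" "\<And>x. x \<in> {1..2} \<Longrightarrow> \<bar>\<eta>1 x\<bar> \<le> b"
    "\<And>x. x \<in> {1..2} \<Longrightarrow> \<bar>\<eta>2 x\<bar> \<le> c"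
    using bd[OF sm] bd[OF sm1] bd[OF sm2] by metis
  define B where "B = Max {1, a, b, c}"
  have B: "1 \<le> B" "a \<le> B" "b \<le> B" "c \<le> B" by (auto simp: B_def)
  have "\<bar>\<eta> x\<bar> \<le> B" "\<bar>\<eta>1 x\<bar> \<le> B" "\<bar>\<eta>2 x\<bar> \<le> B" for x
    using abc[of x] z1[of x] z2[of x] z[of x] o[of x] B by (cases "x < 1 \<or> x > 2"; auto)+
  with that[of \<eta> \<eta>1 \<eta>2 B] show thesis using sm d1 d2 z o z1 z2 by auto
qed

lemma smooth_on_imp_continuous_on:
  assumes "smooth_on A f"
  shows "continuous_on A f"
  unfolding continuous_on_eq_continuous_within
proof
  fix x assume "x \<in> A"
  then obtain U F where U: "open U" "x \<in> U" "\<And>k. Ck_on k U F" "\<And>y. y \<in> A \<inter> U \<Longrightarrow> F y = f y"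
    using assms unfolding smooth_on_def by metis
  then have "continuous (at x) F"
    using Ck_on_imp_continuous_on continuous_on_eq_continuous_at by blast
  then have "(F \<longlongrightarrow> f x) (at x within A)"
    using U \<open>x \<in> A\<close> by (metis IntI continuous_within continuous_at_imp_continuous_at_within)
  then have "(f \<longlongrightarrow> f x) (at x within A)"
    by (rule Lim_transform_eventually) (use U in \<open>auto simp: eventually_at_topological\<close>)
  then show "continuous (at x within A) f" by (simp add: continuous_within)
qed

section \<open>A Volterra equation\<close>

text \<open>Models \<open>(c b V')' = - \<lambda> b V\<close> with c equal to \<open>cm\<close>
  before s0 and to \<open>cp\<close> after it. The weight may vanish at 0, and its monotonicity
  stands in for a positive lower bound.\<close>

locale volterra =
  fixes b :: "real \<Rightarrow> real" and L s0 cm cp :: real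
  assumes s0: "0 < s0" "s0 < L" and c: "0 < cm" "cm < cp"
    and b_cont: "continuous_on {0..L} b"
    and b_pos: "\<And>s. s \<in> {0<..L} \<Longrightarrow> 0 < b s"
    and b_mono: "\<And>s t. 0 \<le> s \<Longrightarrow> s \<le> t \<Longrightarrow> t \<le> L \<Longrightarrow> b s \<le> b t"
begin

text \<open>One integration of the equation with zero flux at 0: V' is G V times - \<lambda> / c. At
  s = 0 the integral over a point gives the value 0, which is also the limit, even if b 0 =
  0.\<close>

definition G :: "(real \<Rightarrow> real) \<Rightarrow> real \<Rightarrow> real" where
  "G v s = integral {0..s} (\<lambda>x. b x * v x) / b s"

text \<open>The integral of G v / c from 0 to s. The minimum and maximum split it at s0, so that
  each medium contributes with its own coefficient.\<close>

definition W :: "(real \<Rightarrow> real) \<Rightarrow> real \<Rightarrow> real" where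
  "W v s = integral {0..min s s0} (G v) / cm + (integral {0..max s s0} (G v) - integral {0..s0} (G v)) / cp"

lemma b_0: "0 \<le> b 0"
proof -
  have "(b \<longlongrightarrow> b 0) (at 0 within {0..L})"
    using b_cont s0 by (simp add: continuous_on_def)
  then have "(b \<longlongrightarrow> b 0) (at 0 within {0<..L})"
    by (rule tendsto_within_subset) auto
  moreover have "eventually (\<lambda>x. 0 \<le> b x) (at 0 within {0<..L})"
    using b_pos by (auto simp: eventually_at_filter less_imp_le)
  moreover have "at 0 within {0<..L} \<noteq> bot"
    using s0 by (simp add: at_within_eq_bot_iff)
  ultimately show ?thesis by (metis tendsto_lowerbound)
qed

lemma integrable_sub:
  fixes v :: "real \<Rightarrow> real"
  assumes "continuous_on {0..L} v" "0 \<le> s" "t \<le> L"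
  shows "v integrable_on {s..t}"
  using assms by (intro integrable_continuous_real) (auto intro: continuous_on_subset)

lemma bv_cont: "continuous_on {0..L} v \<Longrightarrow> continuous_on {0..L} (\<lambda>x. b x * v x)"
  by (intro continuous_intros b_cont)

text \<open>Monotonicity of b enters here: b x / b s <= 1 for x <= s makes the degenerate division
  harmless. The factor s yields continuity of G v at the pole.\<close>

lemma G_bound:
  assumes "continuous_on {0..L} v" "s \<in> {0..L}" "\<And>x. x \<in> {0..s} \<Longrightarrow> \<bar>v x\<bar> \<le> p"
  shows "\<bar>G v s\<bar> \<le> s * p"
proof (cases "s = 0")
  case False
  then have s: "s \<in> {0<..L}" using assms(2) by auto
  have "\<bar>b x * v x\<bar> \<le> b s * p" if "x \<in> {0..s}" for x
  proof -
    have "0 \<le> b x" using b_0 b_pos[of x] that s by (cases "x = 0") (auto simp: less_imp_le)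
    then show ?thesis
      unfolding abs_mult using b_mono[of x s] assms(3)[OF that] that s by (intro mult_mono) auto
  qed
  then have "norm (integral {0..s} (\<lambda>x. b x * v x)) \<le> (b s * p) * (s - 0)"
    using assms(2) bv_cont[OF assms(1)]
    by (intro integral_bound) (auto intro: continuous_on_subset)
  then show ?thesis
    using b_pos[OF s] by (simp add: G_def abs_div_pos[symmetric] divide_le_eq mult_ac)
qed (simp add: G_def)

lemma bounded_cont:
  assumes "continuous_on {0..L} v"
  obtains p where "0 < p" "\<And>x. x \<in> {0..L} \<Longrightarrow> \<bar>v x :: real\<bar> \<le> p"
  using compact_imp_bounded[OF compact_continuous_image[OF assms compact_Icc]] by (auto simp: bounded_pos)

lemma G_cont:
  assumes v: "continuous_on {0..L} v"
  shows "continuous_on {0..L} (G v)"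
  unfolding continuous_on_def
proof
  fix s assume s: "s \<in> {0..L}"
  show "(G v \<longlongrightarrow> G v s) (at s within {0..L})"
  proof (cases "s = 0")
    case True
    obtain p where p: "0 < p" "\<And>x. x \<in> {0..L} \<Longrightarrow> \<bar>v x\<bar> \<le> p"
      using bounded_cont[OF v] by blast
    have "((\<lambda>x. x * p) \<longlongrightarrow> 0 * p) (at 0 within {0..L})"
      by (intro tendsto_intros)
    moreover have "eventually (\<lambda>x. norm (G v x) \<le> x * p) (at 0 within {0..L})"
      using G_bound[OF v] p by (auto simp: eventually_at_filter)
    ultimately have "(G v \<longlongrightarrow> 0) (at 0 within {0..L})"
      by (auto intro: Lim_null_comparison)
    then show ?thesis using True by (simp add: G_def)
  next
    case False
    have "((\<lambda>s. integral {0..s} (\<lambda>x. b x * v x)) \<longlongrightarrow> integral {0..s} (\<lambda>x. b x * v x)) (at s within {0..L})"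
      using indefinite_integral_continuous_1[OF integrable_sub[OF bv_cont[OF v]], of 0 L] s
      by (auto simp: continuous_on_def)
    then show ?thesis unfolding G_def
      using b_cont s b_pos[of s] False by (intro tendsto_divide) (auto simp: continuous_on_def)
  qed
qed

lemma W_left: "s \<le> s0 \<Longrightarrow> W v s = integral {0..s} (G v) / cm"
  by (simp add: W_def)

lemma W_right: "s0 \<le> s \<Longrightarrow> W v s = W v s0 + (integral {0..s} (G v) - integral {0..s0} (G v)) / cp"
  by (simp add: W_def max_def)

lemma W_cont:
  assumes v: "continuous_on {0..L} v"
  shows "continuous_on {0..L} (W v)"
proof -
  have I: "continuous_on {0..L} (\<lambda>s. integral {0..s} (G v))"
    using indefinite_integral_continuous_1[OF integrable_sub[OF G_cont[OF v]], of 0 L] by simp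
  have "continuous_on {0..L} (\<lambda>s. integral {0..min s s0} (G v))"
    by (rule continuous_on_compose2[OF I]) (use s0 in \<open>auto intro!: continuous_intros\<close>)
  moreover have "continuous_on {0..L} (\<lambda>s. integral {0..max s s0} (G v))"
    by (rule continuous_on_compose2[OF I]) (use s0 in \<open>auto intro!: continuous_intros\<close>)
  ultimately show ?thesis
    unfolding W_def using c by (intro continuous_intros) auto
qed

lemma G_lin:
  assumes "continuous_on {0..L} u" "continuous_on {0..L} v" "s \<in> {0..L}"
  shows "G (\<lambda>x. u x + a * v x) s = G u s + a * G v s"
proof -
  have "integral {0..s} (\<lambda>x. b x * u x + a * (b x * v x)) =
      integral {0..s} (\<lambda>x. b x * u x) + integral {0..s} (\<lambda>x. a * (b x * v x))"
    using assms by (intro integral_add integrable_sub continuous_intros b_cont) auto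
  then show ?thesis by (simp add: G_def algebra_simps add_divide_distrib)
qed

lemma W_lin:
  assumes "continuous_on {0..L} u" "continuous_on {0..L} v" "s \<in> {0..L}"
  shows "W (\<lambda>x. u x + a * v x) s = W u s + a * W v s"
proof -
  have I: "integral {0..t} (G (\<lambda>x. u x + a * v x)) = integral {0..t} (G u) + a * integral {0..t} (G v)"
    if "t \<in> {0..L}" for t
  proof -
    have "integral {0..t} (G (\<lambda>x. u x + a * v x)) = integral {0..t} (\<lambda>x. G u x + a * G v x)"
      using that by (intro integral_cong G_lin assms) auto
    also have "\<dots> = integral {0..t} (G u) + integral {0..t} (\<lambda>x. a * G v x)"
      using that by (intro integral_add integrable_sub continuous_intros G_cont assms) auto
    finally show ?thesis by simp
  qed
  show ?thesis using s0 assms(3) unfolding W_def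
    by (subst I, simp)+ (simp add: algebra_simps add_divide_distrib diff_divide_distrib)
qed

text \<open>In the sup norm with weight exp(\<mu> s) an integration gains 1/\<mu>, so the norm of W
  becomes as small as desired. In the constant, L comes from \<open>G_bound\<close> and 2 from the
  two media, both estimated with the smaller coefficient cm.\<close>

lemma W_bound:
  assumes v: "continuous_on {0..L} v" and "\<mu> > 0" "p \<ge> 0"
    and p: "\<And>x. x \<in> {0..L} \<Longrightarrow> \<bar>v x\<bar> \<le> p * exp (\<mu> * x)" and s: "s \<in> {0..L}"
  shows "\<bar>W v s\<bar> \<le> (2 * L / (cm * \<mu>)) * p * exp (\<mu> * s)"
proof -
  have g: "\<bar>G v x\<bar> \<le> L * p * exp (\<mu> * x)" if "x \<in> {0..L}" for x
  proof -
    have "\<bar>G v x\<bar> \<le> x * (p * exp (\<mu> * x))"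
    proof (rule G_bound[OF v that])
      fix y assume "y \<in> {0..x}"
      then have "p * exp (\<mu> * y) \<le> p * exp (\<mu> * x)" using \<open>\<mu> > 0\<close> \<open>p \<ge> 0\<close> by (intro mult_left_mono) auto
      then show "\<bar>v y\<bar> \<le> p * exp (\<mu> * x)" using p[of y] \<open>y \<in> {0..x}\<close> that by auto
    qed
    also have "\<dots> \<le> L * (p * exp (\<mu> * x))" using that \<open>p \<ge> 0\<close> by (intro mult_right_mono) auto
    finally show ?thesis by simp
  qed
  have I: "\<bar>integral {x..y} (G v)\<bar> \<le> L * p / \<mu> * exp (\<mu> * y)" if "0 \<le> x" "x \<le> y" "y \<le> L" for x y
  proof -
    have hi: "((\<lambda>x. L * p * exp (\<mu> * x)) has_integral (L * p / \<mu> * exp (\<mu> * y) - L * p / \<mu> * exp (\<mu> * x))) {x..y}"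
      using that \<open>\<mu> > 0\<close>
      by (intro fundamental_theorem_of_calculus)
        (auto intro!: derivative_eq_intros simp: has_real_derivative_iff_has_vector_derivative[symmetric])
    have "norm (integral {x..y} (G v)) \<le> integral {x..y} (\<lambda>x. L * p * exp (\<mu> * x))"
      using that g by (intro integral_norm_bound_integral integrable_sub G_cont v has_integral_integrable[OF hi]) auto
    also have "\<dots> \<le> L * p / \<mu> * exp (\<mu> * y)"
      using s0 \<open>\<mu> > 0\<close> \<open>p \<ge> 0\<close> by (subst integral_unique[OF hi]) simp
    finally show ?thesis by simp
  qed
  have e: "L * p / \<mu> * exp (\<mu> * min s s0) \<le> L * p / \<mu> * exp (\<mu> * s)"
    using s0 \<open>\<mu> > 0\<close> \<open>p \<ge> 0\<close> by (intro mult_left_mono) auto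
  define A where "A = L * p / \<mu> * exp (\<mu> * s)"
  have A: "0 \<le> A" using s0 \<open>\<mu> > 0\<close> \<open>p \<ge> 0\<close> by (simp add: A_def)
  have 1: "\<bar>integral {0..min s s0} (G v) / cm\<bar> \<le> A / cm"
  proof -
    have "\<bar>integral {0..min s s0} (G v)\<bar> \<le> A"
      unfolding A_def by (rule order_trans[OF I e]) (use s s0 in auto)
    then show ?thesis using c divide_right_mono[of _ A cm] by (simp add: abs_div_pos[symmetric])
  qed
  have 2: "\<bar>(integral {0..max s s0} (G v) - integral {0..s0} (G v)) / cp\<bar> \<le> A / cm"
  proof -
    have "\<bar>integral {0..max s s0} (G v) - integral {0..s0} (G v)\<bar> \<le> A"
    proof (cases "s \<le> s0")
      case True
      then show ?thesis using A by (simp add: max_def)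
    next
      case False
      then have "integral {0..s} (G v) = integral {0..s0} (G v) + integral {s0..s} (G v)"
        using s s0 by (intro Henstock_Kurzweil_Integration.integral_combine[symmetric] integrable_sub G_cont v) auto
      then show ?thesis using I[of s0 s] False s s0 by (simp add: max_def A_def)
    qed
    then have "\<bar>(integral {0..max s s0} (G v) - integral {0..s0} (G v)) / cp\<bar> \<le> A / cp"
      using c by (auto simp: abs_div_pos[symmetric] intro!: divide_right_mono)
    also have "\<dots> \<le> A / cm" using A c by (intro divide_left_mono) auto
    finally show ?thesis .
  qed
  have "\<bar>W v s\<bar> \<le> A / cm + A / cm"
    unfolding W_def using abs_triangle_ineq 1 2 by (rule order_trans[OF _ add_mono])
  then show ?thesis by (simp add: A_def field_simps)
qed

section \<open>The Neumann series in the spectral parameter\<close>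

primrec a :: "nat \<Rightarrow> real \<Rightarrow> real" where
  "a 0 = (\<lambda>s. 1)"
| "a (Suc k) = W (a k)"

lemma a_cont: "continuous_on {0..L} (a k)"
  by (induction k) (auto intro: W_cont)

lemma a_bound:
  assumes "\<mu> > 0" "s \<in> {0..L}"
  shows "\<bar>a k s\<bar> \<le> (2 * L / (cm * \<mu>)) ^ k * exp (\<mu> * s)"
  using assms(2)
proof (induction k arbitrary: s)
  case 0
  then show ?case using assms by simp
next
  case (Suc k)
  from W_bound[OF a_cont[of k] assms(1) _ Suc.IH Suc.prems] show ?case
    using assms c s0 by (simp add: mult_ac)
qed

text \<open>Each term is one more application of - l W to the constant 1, so the sum should solve V
  = 1 - l W V with value 1 at the pole.\<close>

definition V :: "real \<Rightarrow> real \<Rightarrow> real" where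
  "V l s = (\<Sum>k. (- l) ^ k * a k s)"

context
  fixes \<Lambda> :: real
  assumes \<Lambda>: "0 < \<Lambda>"
begin

text \<open>The rate \<mu> of the weight is adapted to the range of l and makes the series geometric
  with ratio 1/2. This is why the parameter is confined to [0, \<Lambda>].\<close>

lemma ex_rate: "\<exists>\<mu>>0. \<Lambda> * (2 * L / (cm * \<mu>)) \<le> 1 / 2"
proof (intro exI conjI)
  show "0 < 4 * L * \<Lambda> / cm" using \<Lambda> c s0 by simp
  show "\<Lambda> * (2 * L / (cm * (4 * L * \<Lambda> / cm))) \<le> 1 / 2" using \<Lambda> c s0 by simp
qed

text \<open>Uniformity in l and s together gives joint continuity, on which the choice of the
  critical parameter rests.\<close>

lemma V_uniform:
  "uniform_limit ({0..\<Lambda>} \<times> {0..L}) (\<lambda>N p. \<Sum>k<N. (- fst p) ^ k * a k (snd p)) (\<lambda>p. V (fst p) (snd p)) sequentially"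
proof -
  obtain \<mu> where \<mu>: "\<mu> > 0" "\<Lambda> * (2 * L / (cm * \<mu>)) \<le> 1 / 2" using ex_rate by blast
  have "norm ((- fst p) ^ k * a k (snd p)) \<le> exp (\<mu> * L) * (1 / 2) ^ k" if "p \<in> {0..\<Lambda>} \<times> {0..L}" for k p
  proof -
    have "\<bar>fst p\<bar> ^ k * \<bar>a k (snd p)\<bar> \<le> \<Lambda> ^ k * ((2 * L / (cm * \<mu>)) ^ k * exp (\<mu> * snd p))"
      using that \<mu> c s0 \<Lambda> by (intro mult_mono a_bound power_mono) auto
    also have "\<dots> = (\<Lambda> * (2 * L / (cm * \<mu>))) ^ k * exp (\<mu> * snd p)"
      by (simp only: power_mult_distrib mult_ac)
    also have "\<dots> \<le> (1 / 2) ^ k * exp (\<mu> * L)"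
      using \<mu> that \<Lambda> c s0 by (intro mult_mono power_mono) auto
    finally show ?thesis by (simp add: abs_mult power_abs mult.commute)
  qed
  then show ?thesis unfolding V_def
    by (intro Weierstrass_m_test[where M = "\<lambda>k. exp (\<mu> * L) * (1 / 2) ^ k"]) (auto intro!: summable_mult)
qed

lemma V_joint_cont: "continuous_on ({0..\<Lambda>} \<times> {0..L}) (\<lambda>p. V (fst p) (snd p))"
proof (rule uniform_limit_theorem[OF _ V_uniform])
  show "\<forall>\<^sub>F N in sequentially. continuous_on ({0..\<Lambda>} \<times> {0..L}) (\<lambda>p. \<Sum>k<N. (- fst p) ^ k * a k (snd p))"
    by (intro always_eventually allI continuous_intros continuous_on_compose2[OF a_cont]) auto
qed simp

lemma V_cont:
  assumes "l \<in> {0..\<Lambda>}"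
  shows "continuous_on {0..L} (V l)"
proof -
  have "continuous_on {0..L} (\<lambda>s. V (fst (l, s)) (snd (l, s)))"
    by (rule continuous_on_compose2[OF V_joint_cont]) (use assms in \<open>auto intro!: continuous_intros\<close>)
  then show ?thesis by simp
qed

lemma V_fixed:
  assumes l: "l \<in> {0..\<Lambda>}" and s: "s \<in> {0..L}"
  shows "V l s = 1 - l * W (V l) s"
proof -
  define S where "S N s = (\<Sum>k<N. (- l) ^ k * a k s)" for N s
  have Sc: "continuous_on {0..L} (S N)" for N
    unfolding S_def by (intro continuous_intros a_cont)
  have WS: "S (Suc N) s = 1 - l * W (S N) s" for N
  proof (induction N)
    case 0
    have "G (\<lambda>x. 0) = (\<lambda>x. 0)" by (simp add: G_def fun_eq_iff)
    then have "W (\<lambda>x. 0) s = 0" by (simp add: W_def)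
    then show ?case by (simp add: S_def)
  next
    case (Suc N)
    have "S (Suc N) = (\<lambda>x. S N x + (- l) ^ N * a N x)" by (simp add: S_def fun_eq_iff)
    then have "W (S (Suc N)) s = W (S N) s + (- l) ^ N * a (Suc N) s"
      using W_lin[OF Sc a_cont s] by simp
    moreover have "S (Suc (Suc N)) s = S (Suc N) s + (- l) ^ Suc N * a (Suc N) s" by (simp add: S_def)
    ultimately show ?case using Suc by (simp add: algebra_simps)
  qed
  have lim: "(\<lambda>N. S N s) \<longlonglongrightarrow> V l s" if "s \<in> {0..L}" for s
    using tendsto_uniform_limitI[OF V_uniform, of "(l, s)"] that l by (simp add: S_def)
  have "(\<lambda>N. W (S N) s) \<longlonglongrightarrow> W (V l) s"
  proof (rule LIMSEQ_I)
    fix r :: real assume "r > 0"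
    \<comment> \<open>The constant of \<open>W_bound\<close> for \<mu> = 1: only continuity of W
      under uniform convergence is at stake, so one fixed rate does.\<close>
    define q where "q = 2 * L / (cm * 1) * exp (1 * s)"
    have q: "q > 0" using c s0 by (simp add: q_def)
    have "r / (2 * q) > 0" using q \<open>r > 0\<close> by simp
    from uniform_limitD[OF V_uniform this]
    obtain N0 where N0: "\<And>N p. N \<ge> N0 \<Longrightarrow> p \<in> {0..\<Lambda>} \<times> {0..L} \<Longrightarrow>
        dist (\<Sum>k<N. (- fst p) ^ k * a k (snd p)) (V (fst p) (snd p)) < r / (2 * q)"
      unfolding eventually_sequentially by blast
    have "norm (W (S N) s - W (V l) s) < r" if "N \<ge> N0" for N
    proof -
      have d: "\<bar>S N x + (- 1) * V l x\<bar> \<le> r / (2 * q) * exp (1 * x)" if "x \<in> {0..L}" for x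
      proof -
        have "\<bar>S N x - V l x\<bar> < r / (2 * q)"
          using N0[OF \<open>N \<ge> N0\<close>, of "(l, x)"] that l by (simp add: S_def dist_real_def)
        also have "\<dots> \<le> r / (2 * q) * exp (1 * x)"
          using mult_left_mono[of 1 "exp (1 * x)" "r / (2 * q)"] that q \<open>r > 0\<close> by simp
        finally show ?thesis by simp
      qed
      have cd: "continuous_on {0..L} (\<lambda>x. S N x + (- 1) * V l x)"
        by (intro continuous_intros Sc V_cont l)
      have "\<bar>W (\<lambda>x. S N x + (- 1) * V l x) s\<bar> \<le> 2 * L / (cm * 1) * (r / (2 * q)) * exp (1 * s)"
        using q \<open>r > 0\<close> by (intro W_bound[OF cd _ _ d s]) auto
      also have "\<dots> = q * (r / (2 * q))" by (simp add: q_def)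
      also have "\<dots> = r / 2" using q by simp
      finally show ?thesis using W_lin[OF Sc V_cont[OF l] s, of N "- 1"] \<open>r > 0\<close> by simp
    qed
    then show "\<exists>no. \<forall>N\<ge>no. norm (W (S N) s - W (V l) s) < r" by blast
  qed
  then have "(\<lambda>N. 1 - l * W (S N) s) \<longlonglongrightarrow> 1 - l * W (V l) s"
    by (intro tendsto_intros)
  moreover have "(\<lambda>N. S (Suc N) s) \<longlonglongrightarrow> V l s"
    by (rule LIMSEQ_Suc[OF lim[OF s]])
  ultimately show ?thesis using WS LIMSEQ_unique by simp
qed

section \<open>Positivity and the critical parameter\<close>

lemma V_at_0: "l \<in> {0..\<Lambda>} \<Longrightarrow> V l 0 = 1"
  using V_fixed[of l 0] s0 by (simp add: W_def max_def)

lemma GV_nonneg: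
  assumes l: "l \<in> {0..\<Lambda>}" and "\<And>x. x \<in> {0..L} \<Longrightarrow> V l x \<ge> 0" and s: "s \<in> {0..L}"
  shows "G (V l) s \<ge> 0"
proof -
  have b: "b x \<ge> 0" if "x \<in> {0..L}" for x
    using b_0 b_pos[of x] that by (cases "x = 0") (auto simp: less_imp_le)
  then have "integral {0..s} (\<lambda>x. b x * V l x) \<ge> 0"
    using assms(2) s by (intro integral_nonneg integrable_sub bv_cont V_cont l) auto
  then show ?thesis using b[OF s] by (simp add: G_def)
qed

text \<open>A strong maximum principle. Since V >= 0, V is nonincreasing, so a zero at s < L forces
  V = 0 on an interval after s. Hence G V s = 0, the integral of b V over [0, s] vanishes, and V = 0
  on (0, s], against V = 1 at 0.\<close>

lemma V_pos:
  assumes l: "l \<in> {0..\<Lambda>}" and nn: "\<And>x. x \<in> {0..L} \<Longrightarrow> V l x \<ge> 0" and s: "s \<in> {0..<L}"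
  shows "V l s > 0"
proof (rule ccontr)
  assume "\<not> V l s > 0"
  with nn[of s] s have Vs: "V l s = 0" by auto
  have s_pos: "s > 0" using V_at_0[OF l] Vs s by (cases "s = 0") auto
  have l_pos: "l > 0" using V_fixed[OF l, of s] Vs s l by (cases "l = 0") auto
  have gc: "continuous_on {0..L} (G (V l))" by (intro G_cont V_cont l)
  \<comment> \<open>t is the end of the medium that begins or contains s, so that a single
    coefficient occurs on [s, t].\<close>
  have "\<exists>t c. s < t \<and> t \<le> L \<and> c > 0 \<and> V l t = V l s - l * (integral {s..t} (G (V l)) / c)"
  proof (cases "s < s0")
    case True
    have "integral {0..s0} (G (V l)) = integral {0..s} (G (V l)) + integral {s..s0} (G (V l))"
      using s s0 True
      by (intro Henstock_Kurzweil_Integration.integral_combine[symmetric] integrable_sub gc) auto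
    then have "V l s0 = V l s - l * (integral {s..s0} (G (V l)) / cm)"
      using V_fixed[OF l, of s0] V_fixed[OF l, of s] True s0 s W_left[of s "V l"] W_left[of s0 "V l"]
      by (simp add: add_divide_distrib algebra_simps)
    with True s0 c show ?thesis by (intro exI[of _ s0] exI[of _ cm]) auto
  next
    case False
    have "integral {0..L} (G (V l)) = integral {0..s} (G (V l)) + integral {s..L} (G (V l))"
      using s s0 by (intro Henstock_Kurzweil_Integration.integral_combine[symmetric] integrable_sub gc) auto
    then have "V l L = V l s - l * (integral {s..L} (G (V l)) / cp)"
      using V_fixed[OF l, of L] V_fixed[OF l, of s] False s0 s W_right[of s "V l"] W_right[of L "V l"]
      by (simp add: add_divide_distrib diff_divide_distrib algebra_simps)
    with s c show ?thesis by (intro exI[of _ L] exI[of _ cp]) auto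
  qed
  then obtain t c' where t: "s < t" "t \<le> L" "c' > 0" "V l t = V l s - l * (integral {s..t} (G (V l)) / c')"
    by blast
  have "integral {s..t} (G (V l)) \<ge> 0"
    using GV_nonneg[OF l nn] s t by (intro integral_nonneg integrable_sub gc) auto
  then have "integral {s..t} (G (V l)) = 0"
    using t nn[of t] Vs l_pos s by (auto simp: mult_le_0_iff divide_le_0_iff)
  then have "G (V l) s = 0"
  proof -
    have "continuous_on {s..t} (G (V l))" by (rule continuous_on_subset[OF gc]) (use s t in auto)
    moreover have "G (V l) x \<ge> 0" if "x \<in> {s..t}" for x by (rule GV_nonneg[OF l nn]) (use that s t in auto)
    ultimately have "\<forall>x\<in>{s..t}. G (V l) x = 0"
      using integral_eq_0_iff[of s t "G (V l)"] t \<open>integral {s..t} (G (V l)) = 0\<close> by blast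
    then show ?thesis using t by simp
  qed
  then have "integral {0..s} (\<lambda>x. b x * V l x) = 0"
    using b_pos[of s] s s_pos by (simp add: G_def)
  moreover have "0 \<le> b x * V l x" if "x \<in> {0..s}" for x
    using that s nn[of x] b_0 b_pos[of x] by (cases "x = 0") (auto simp: less_imp_le)
  ultimately have z: "b x * V l x = 0" if "x \<in> {0..s}" for x
    using integral_eq_0_iff[of 0 s "\<lambda>x. b x * V l x"] continuous_on_subset[OF bv_cont[OF V_cont[OF l]]] s s_pos that
    by auto
  have "V l x = 0" if "x \<in> {0<..s}" for x
    using z[of x] b_pos[of x] that s by auto
  then have "eventually (\<lambda>x. V l x = 0) (at 0 within {0<..s})"
    by (auto simp: eventually_at_filter)
  moreover have "(V l \<longlongrightarrow> V l 0) (at 0 within {0<..s})"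
  proof (rule tendsto_within_subset)
    show "(V l \<longlongrightarrow> V l 0) (at 0 within {0..L})"
      using V_cont[OF l] s0 by (simp add: continuous_on_def)
  qed (use s in auto)
  moreover have "at 0 within {0<..s} \<noteq> bot" using s_pos by (simp add: at_within_eq_bot_iff)
  ultimately have "V l 0 = 0"
    using tendsto_unique[of "at 0 within {0<..s}" "V l" "V l 0" 0] tendsto_eventually by blast
  then show False using V_at_0[OF l] by simp
qed

text \<open>Shooting: l is the largest parameter for which V stays nonnegative on [0, L], the
  maximum of a compact set that contains 0. If V l L > 0 and l < \<Lambda>, then V l has a positive
  minimum and uniform continuity admits a larger parameter. The alternative l = \<Lambda> is
  excluded later by Picone's bound.\<close>

lemma ex_first_zero:
  "\<exists>l\<in>{0..\<Lambda>}. (\<forall>s\<in>{0..<L}. V l s > 0) \<and> (V l L = 0 \<or> l = \<Lambda>)"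
proof -
  define A where "A = {l\<in>{0..\<Lambda>}. \<forall>s\<in>{0..L}. V l s \<ge> 0}"
  have "A = {0..\<Lambda>} \<inter> (\<Inter>s\<in>{0..L}. {l\<in>{0..\<Lambda>}. 0 \<le> V l s})" by (auto simp: A_def)
  moreover have "closed {l\<in>{0..\<Lambda>}. 0 \<le> V l s}" if "s \<in> {0..L}" for s
  proof -
    have "continuous_on {0..\<Lambda>} (\<lambda>l. V (fst (l, s)) (snd (l, s)))"
      by (rule continuous_on_compose2[OF V_joint_cont]) (use that in \<open>auto intro!: continuous_intros\<close>)
    then have "continuous_on {0..\<Lambda>} (\<lambda>l. V l s)" by simp
    from continuous_closed_preimage[OF this closed_atLeastAtMost closed_atLeast[of 0]]
    show ?thesis by (simp add: vimage_def Int_def conj_commute)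
  qed
  ultimately have "closed A" by (metis (no_types, lifting) closed_INT closed_Int closed_atLeastAtMost)
  moreover have "bounded A" by (rule bounded_subset[of "{0..\<Lambda>}"]) (auto simp: A_def)
  ultimately have "compact A" by (simp add: compact_eq_bounded_closed)
  moreover have "V 0 s = 1" if "s \<in> {0..L}" for s using V_fixed[of 0 s] \<Lambda> that by simp
  then have "0 \<in> A" using \<Lambda> by (auto simp: A_def)
  ultimately obtain l where l: "l \<in> A" and max: "\<And>l'. l' \<in> A \<Longrightarrow> l' \<le> l"
    using compact_attains_sup[of A] by auto
  have l': "l \<in> {0..\<Lambda>}" and nn: "\<And>x. x \<in> {0..L} \<Longrightarrow> V l x \<ge> 0" using l by (auto simp: A_def)
  have "V l L = 0 \<or> l = \<Lambda>"
  proof (rule ccontr)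
    assume "\<not> ?thesis"
    then have VL: "V l L > 0" and "l < \<Lambda>" using nn[of L] s0 l' by auto
    have pos: "V l s > 0" if "s \<in> {0..L}" for s
      using V_pos[OF l' nn, of s] that VL by (cases "s = L") auto
    have "\<exists>x\<in>{0..L}. \<forall>y\<in>{0..L}. V l x \<le> V l y"
      using s0 by (intro continuous_attains_inf V_cont l') auto
    then obtain m where m: "m > 0" "\<And>s. s \<in> {0..L} \<Longrightarrow> m \<le> V l s" using pos by blast
    have "uniformly_continuous_on ({0..\<Lambda>} \<times> {0..L}) (\<lambda>p. V (fst p) (snd p))"
      by (intro compact_uniformly_continuous V_joint_cont compact_Times compact_Icc)
    then obtain d where d: "d > 0" "\<And>p q. p \<in> {0..\<Lambda>} \<times> {0..L} \<Longrightarrow> q \<in> {0..\<Lambda>} \<times> {0..L} \<Longrightarrow> dist q p < d \<Longrightarrow>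
        dist (V (fst q) (snd q)) (V (fst p) (snd p)) < m"
      using m(1) unfolding uniformly_continuous_on_def by metis
    define l2 where "l2 = min \<Lambda> (l + d / 2)"
    have l2: "l2 \<in> {0..\<Lambda>}" "l < l2" "l2 - l < d" using l' \<open>l < \<Lambda>\<close> d by (auto simp: l2_def)
    have "V l2 s \<ge> 0" if "s \<in> {0..L}" for s
    proof -
      have "dist (l2, s) (l, s) < d" using l2 by (simp add: dist_Pair_Pair dist_real_def)
      from d(2)[OF _ _ this] have "\<bar>V l2 s - V l s\<bar> < m" using that l' l2 by (simp add: dist_real_def)
      then show ?thesis using m(2)[OF that] by simp
    qed
    then have "l2 \<in> A" using l2 by (auto simp: A_def)
    from max[OF this] l2 show False by simp
  qed
  then show ?thesis using V_pos[OF l' nn] l' by blast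
qed

end

end

section \<open>The radial equation\<close>

text \<open>Derivatives are taken within J, hence one-sided at the interface and the boundary; these
  are the values that the transmission condition compares. The number n is a real parameter here,
  and integrality enters only with exp(i n \<theta>).\<close>

definition side_solution ::
  "(real \<Rightarrow> real) \<Rightarrow> (real \<Rightarrow> real) \<Rightarrow> real \<Rightarrow> real \<Rightarrow> real \<Rightarrow> real set \<Rightarrow>
    (real \<Rightarrow> real) \<Rightarrow> (real \<Rightarrow> real) \<Rightarrow> (real \<Rightarrow> real) \<Rightarrow> bool" where
  "side_solution R R1 n c l J f f1 f2 \<longleftrightarrow>
     (\<forall>s\<in>J. (f has_real_derivative f1 s) (at s within J) \<and>
             (f1 has_real_derivative f2 s) (at s within J) \<and>
             c * (f2 s + R1 s / R s * f1 s - n\<^sup>2 / (R s)\<^sup>2 * f s) = - l * f s) \<and>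
     continuous_on J f2"

text \<open>Reduction of order: \<psi> solves the equation for l = 0, and f = \<psi> V turns the
  full equation into a first-order system for V and g, in which the coefficient of g is minus the
  logarithmic derivative of \<open>R \<psi>\<^sup>2\<close>.\<close>

lemma side_solutionI:
  assumes c: "c > 0" and R: "\<And>s. s \<in> J \<Longrightarrow> R s > 0" "continuous_on J R" "continuous_on J R1"
    and \<psi>: "\<And>s. s \<in> J \<Longrightarrow> \<psi> s \<noteq> 0"
    and d\<psi>: "\<And>s. s \<in> J \<Longrightarrow> (\<psi> has_real_derivative \<psi>1 s) (at s within J)"
    and d\<psi>1: "\<And>s. s \<in> J \<Longrightarrow> (\<psi>1 has_real_derivative (n\<^sup>2 / (R s)\<^sup>2 * \<psi> s - R1 s / R s * \<psi>1 s)) (at s within J)"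
    and dV: "\<And>s. s \<in> J \<Longrightarrow> (V has_real_derivative - (l / c) * g s) (at s within J)"
    and dg: "\<And>s. s \<in> J \<Longrightarrow> (g has_real_derivative V s - (R1 s / R s + 2 * \<psi>1 s / \<psi> s) * g s) (at s within J)"
  shows "side_solution R R1 n c l J (\<lambda>s. \<psi> s * V s) (\<lambda>s. \<psi>1 s * V s - (l / c) * (\<psi> s * g s))
     (\<lambda>s. (n\<^sup>2 / (R s)\<^sup>2 * \<psi> s - R1 s / R s * \<psi>1 s) * V s - (l / c) * (\<psi> s * V s - \<psi> s * (R1 s / R s) * g s))"
  unfolding side_solution_def
proof (intro conjI ballI)
  fix s assume s: "s \<in> J"
  show "((\<lambda>s. \<psi> s * V s) has_real_derivative \<psi>1 s * V s - (l / c) * (\<psi> s * g s)) (at s within J)"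
    by (rule DERIV_cong[OF DERIV_mult[OF d\<psi>[OF s] dV[OF s]]]) (simp add: algebra_simps)
  \<comment> \<open>Clears the quotient in g'. The terms in \<psi>1 g of the two product rules then
    cancel.\<close>
  have e: "(V s - (r + 2 * \<psi>1 s / \<psi> s) * g s) * \<psi> s = \<psi> s * V s - \<psi> s * r * g s - 2 * (\<psi>1 s * g s)" for r
    using \<psi>[OF s] by (simp add: field_simps)
  show "((\<lambda>s. \<psi>1 s * V s - (l / c) * (\<psi> s * g s)) has_real_derivative
      (n\<^sup>2 / (R s)\<^sup>2 * \<psi> s - R1 s / R s * \<psi>1 s) * V s - (l / c) * (\<psi> s * V s - \<psi> s * (R1 s / R s) * g s)) (at s within J)"
    by (rule DERIV_cong[OF DERIV_diff[OF DERIV_mult[OF d\<psi>1[OF s] dV[OF s]]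
        DERIV_cmult[OF DERIV_mult[OF d\<psi>[OF s] dg[OF s]]]]], unfold e) (simp add: algebra_simps)
  define a where "a = n\<^sup>2 / (R s)\<^sup>2"
  define r where "r = R1 s / R s"
  have "c * ((a * \<psi> s - r * \<psi>1 s) * V s - (l / c) * (\<psi> s * V s - \<psi> s * r * g s) + r * (\<psi>1 s * V s - (l / c) * (\<psi> s * g s)) - a * (\<psi> s * V s))
      = - l * (\<psi> s * V s)"
    using c by (simp add: field_simps)
  then show "c * ((n\<^sup>2 / (R s)\<^sup>2 * \<psi> s - R1 s / R s * \<psi>1 s) * V s - (l / c) * (\<psi> s * V s - \<psi> s * (R1 s / R s) * g s)
      + R1 s / R s * (\<psi>1 s * V s - (l / c) * (\<psi> s * g s)) - n\<^sup>2 / (R s)\<^sup>2 * (\<psi> s * V s)) = - l * (\<psi> s * V s)"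
    by (simp add: a_def r_def)
next
  have "continuous_on J \<psi>" "continuous_on J \<psi>1" "continuous_on J V" "continuous_on J g"
    using DERIV_continuous_on[OF d\<psi>] DERIV_continuous_on[OF d\<psi>1] DERIV_continuous_on[OF dV]
      DERIV_continuous_on[OF dg] by blast+
  moreover have "\<And>s. s \<in> J \<Longrightarrow> R s \<noteq> 0" using R(1) by force
  ultimately show "continuous_on J (\<lambda>s. (n\<^sup>2 / (R s)\<^sup>2 * \<psi> s - R1 s / R s * \<psi>1 s) * V s - (l / c) * (\<psi> s * V s - \<psi> s * (R1 s / R s) * g s))"
    by (intro continuous_intros R) auto
qed

section \<open>The conformal variable and the zero-energy solution\<close>

locale profile =
  fixes R R1 :: "real \<Rightarrow> real" and L s0 cm cp K :: real
  assumes s0: "0 < s0" "s0 < L" and c: "0 < cm" "cm < cp"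
    and R_0: "R 0 = 0" and R_pos: "\<And>s. s \<in> {0<..L} \<Longrightarrow> 0 < R s"
    and dR: "\<And>s. s \<in> {0..L} \<Longrightarrow> (R has_real_derivative R1 s) (at s within {0..L})"
    and R1_cont: "continuous_on {0..L} R1"
    and K: "\<And>s. s \<in> {0..L} \<Longrightarrow> \<bar>R1 s\<bar> \<le> K"
begin

lemma R_cont: "continuous_on {0..L} R"
  using dR by (rule DERIV_continuous_on)

lemma dR_at: "s \<in> {0<..<L} \<Longrightarrow> (R has_real_derivative R1 s) (at s)"
  using dR[of s] at_within_Icc_at[of 0 s L] by auto

text \<open>In the variable t the operator R d/ds is d/dt, so exp(n t) and exp(- n t) solve the
  equation for l = 0. The base point is s0 because 1/R is not integrable at the pole, R being at
  most K s.\<close>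

lemma ex_time:
  "\<exists>t. t s0 = 0 \<and> (\<forall>s\<in>{0<..L}. (t has_real_derivative 1 / R s) (at s within {0<..L}))"
proof -
  \<comment> \<open>The signed integral from s0 to s: one of the two intervals is empty or a single
    point.\<close>
  define t where "t s = integral {s0..s} (\<lambda>x. 1 / R x) - integral {s..s0} (\<lambda>x. 1 / R x)" for s
  have "(t has_real_derivative 1 / R s) (at s within {0<..L})" if s: "s \<in> {0<..L}" for s
  proof -
    \<comment> \<open>Any base point in (0, min s s0) gives a primitive that differs from t by a
      constant near s.\<close>
    define a where "a = min s s0 / 2"
    have a: "0 < a" "a < s" "a < s0" using s s0 by (auto simp: a_def)
    have "R x \<noteq> 0" if "x \<in> {a..L}" for x using R_pos[of x] a that by auto
    then have ct: "continuous_on {a..L} (\<lambda>x. 1 / R x)"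
      using a by (intro continuous_intros continuous_on_subset[OF R_cont]) auto
    have int: "(\<lambda>x. 1 / R x) integrable_on {x..y}" if "a \<le> x" "y \<le> L" for x y
      using that by (intro integrable_continuous_real continuous_on_subset[OF ct]) auto
    have "((\<lambda>x. integral {a..x} (\<lambda>x. 1 / R x) - integral {a..s0} (\<lambda>x. 1 / R x)) has_real_derivative 1 / R s) (at s within {a..L})"
      by (rule DERIV_cong[OF DERIV_diff[OF integral_has_real_derivative[OF ct] DERIV_const]]) (use a s in auto)
    then have "(t has_real_derivative 1 / R s) (at s within {a..L})"
    proof (rule has_field_derivative_transform_within[OF _ zero_less_one])
      show "s \<in> {a..L}" using a s by auto
      fix x assume x: "x \<in> {a..L}"
      show "integral {a..x} (\<lambda>x. 1 / R x) - integral {a..s0} (\<lambda>x. 1 / R x) = t x"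
      proof (cases "x \<le> s0")
        case True
        then have "integral {a..x} (\<lambda>x. 1 / R x) + integral {x..s0} (\<lambda>x. 1 / R x) = integral {a..s0} (\<lambda>x. 1 / R x)"
          using x a s0 by (intro Henstock_Kurzweil_Integration.integral_combine int) auto
        then show ?thesis using True by (cases "x = s0") (auto simp: t_def)
      next
        case False
        then have "integral {a..s0} (\<lambda>x. 1 / R x) + integral {s0..x} (\<lambda>x. 1 / R x) = integral {a..x} (\<lambda>x. 1 / R x)"
          using x a s0 by (intro Henstock_Kurzweil_Integration.integral_combine int) auto
        then show ?thesis using False by (auto simp: t_def)
      qed
    qed
    moreover have "at s within {a..L} = at s within {0<..L}"
      by (rule at_within_nhd[of _ "{a<..}"]) (use a s in auto)
    ultimately show ?thesis by simp
  qed
  moreover have "t s0 = 0" by (simp add: t_def)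
  ultimately show ?thesis by blast
qed

lemma mono_from_derivative:
  assumes "\<And>x. x \<in> {0<..L} \<Longrightarrow> (f has_real_derivative f' x) (at x within {0<..L})"
    "\<And>x. x \<in> {0<..L} \<Longrightarrow> f' x \<ge> 0" "0 < x" "x \<le> y" "y \<le> L"
  shows "f x \<le> (f y :: real)"
proof (rule DERIV_nonneg_imp_increasing_open[OF assms(4)])
  fix z assume "x < z" "z < y"
  then have "at z within {0<..L} = at z" using assms by (intro at_within_interior) auto
  then show "\<exists>w. (f has_real_derivative w) (at z) \<and> 0 \<le> w"
    using assms(1,2)[of z] \<open>x < z\<close> \<open>z < y\<close> assms(3,5) by auto
next
  show "continuous_on {x..y} f"
    by (rule continuous_on_subset[OF DERIV_continuous_on[OF assms(1)]]) (use assms in auto)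
qed

text \<open>Origin of the conditions on n: \<open>2 * K \<le> n\<close> makes exp(n t) / R^2
  nondecreasing, hence the flatness at the pole; \<open>K \<le> 2 * n * (cm / cp)\<close> makes the
  weight b nondecreasing beyond s0, where the slope of \<psi> has dropped by the factor cm /
  cp.\<close>

lemma ex_radial:
  assumes n: "n > 0" "2 * K \<le> n" "K \<le> 2 * n * (cm / cp)" and \<Lambda>: "\<Lambda> > 0"
  obtains l f f1 f2 h h1 h2 C where "l \<in> {0..\<Lambda>}"
    "side_solution R R1 n cm l {0<..s0} f f1 f2" "side_solution R R1 n cp l {s0..L} h h1 h2"
    "f s0 = h s0" "cm * f1 s0 = cp * h1 s0"
    "\<And>s. s \<in> {0<..s0} \<Longrightarrow> f s > 0" "\<And>s. s \<in> {s0..<L} \<Longrightarrow> h s > 0" "h L = 0 \<or> l = \<Lambda>"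
    "\<And>s. s \<in> {0<..s0} \<Longrightarrow> \<bar>f s\<bar> \<le> C * (R s)\<^sup>2 \<and> \<bar>f1 s\<bar> \<le> C * R s \<and> \<bar>f2 s\<bar> \<le> C"
proof -
  obtain t where t0: "t s0 = 0" and t: "\<And>s. s \<in> {0<..L} \<Longrightarrow> (t has_real_derivative 1 / R s) (at s within {0<..L})"
    using ex_time by blast
  define \<phi> where "\<phi> s = exp (n * t s)" for s
  have \<phi>_pos: "\<phi> s > 0" for s by (simp add: \<phi>_def)
  have \<phi>s0: "\<phi> s0 = 1" by (simp add: \<phi>_def t0)
  have d\<phi>: "(\<phi> has_real_derivative n * \<phi> s / R s) (at s within {0<..L})" if "s \<in> {0<..L}" for s
    unfolding \<phi>_def by (rule DERIV_cong[OF DERIV_chain2[OF DERIV_exp DERIV_cmult[OF t[OF that]]]]) simp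
  have dR': "(R has_real_derivative R1 s) (at s within {0<..L})" if "s \<in> {0<..L}" for s
    by (rule has_field_derivative_subset[OF dR]) (use that in auto)
  have \<phi>_mono: "\<phi> x \<le> \<phi> y" if "0 < x" "x \<le> y" "y \<le> L" for x y
    by (rule mono_from_derivative[OF d\<phi>]) (use that n(1) R_pos \<phi>_pos in \<open>auto intro!: divide_nonneg_nonneg simp: less_imp_le\<close>)
  \<comment> \<open>The derivative of \<phi> / R^2 has the sign of n - 2 R'; the bound is the
    comparison with s0, where \<phi> = 1.\<close>
  have \<phi>R2: "\<phi> s \<le> (R s)\<^sup>2 / (R s0)\<^sup>2" if s: "s \<in> {0<..s0}" for s
  proof -
    have "\<phi> s / (R s)\<^sup>2 \<le> \<phi> s0 / (R s0)\<^sup>2"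
    proof (rule mono_from_derivative[where f = "\<lambda>x. \<phi> x / (R x)\<^sup>2" and f' = "\<lambda>x. \<phi> x * (n - 2 * R1 x) / (R x) ^ 3"])
      fix x assume x: "x \<in> {0<..L}"
      have "R x > 0" using R_pos[OF x] .
      then show "((\<lambda>x. \<phi> x / (R x)\<^sup>2) has_real_derivative \<phi> x * (n - 2 * R1 x) / (R x) ^ 3) (at x within {0<..L})"
        by (intro DERIV_cong[OF DERIV_divide[OF d\<phi>[OF x] DERIV_power[OF dR'[OF x], of 2]]])
          (auto simp: field_simps power2_eq_square power3_eq_cube)
      show "0 \<le> \<phi> x * (n - 2 * R1 x) / (R x) ^ 3"
        using \<open>R x > 0\<close> n(2) K[of x] x \<phi>_pos[of x] by (intro divide_nonneg_nonneg mult_nonneg_nonneg) auto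
    qed (use s s0 in auto)
    then show ?thesis using R_pos[of s] R_pos[of s0] s s0 by (simp add: \<phi>s0 field_simps)
  qed
  \<comment> \<open>Continuing \<phi> through the transmission condition prescribes value 1 and
    slope n \<rho> / R s0 at s0; \<alpha> and \<beta> solve \<alpha> + \<beta> = 1 and \<alpha> -
    \<beta> = \<rho>.\<close>
  define \<rho> where "\<rho> = cm / cp"
  have \<rho>: "0 < \<rho>" "\<rho> < 1" using c by (auto simp: \<rho>_def)
  define \<alpha> where "\<alpha> = (1 + \<rho>) / 2"
  define \<beta> where "\<beta> = (1 - \<rho>) / 2"
  have \<alpha>\<beta>: "\<alpha> > 0" "\<beta> > 0" "\<alpha> + \<beta> = 1" "\<alpha> - \<beta> = \<rho>" using \<rho> by (auto simp: \<alpha>_def \<beta>_def field_simps)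
  define \<psi> where "\<psi> s = \<alpha> * \<phi> s + \<beta> / \<phi> s" for s
  define \<psi>1 where "\<psi>1 s = n * (\<alpha> * \<phi> s - \<beta> / \<phi> s) / R s" for s
  have \<psi>_pos: "\<psi> s > 0" for s using \<alpha>\<beta> \<phi>_pos[of s] by (auto simp: \<psi>_def intro: add_pos_pos)
  have \<psi>s0: "\<psi> s0 = 1" "\<psi>1 s0 = n * \<rho> / R s0" using \<alpha>\<beta> by (auto simp: \<psi>_def \<psi>1_def \<phi>s0)
  have d\<psi>: "(\<psi> has_real_derivative \<psi>1 s) (at s within {0<..L})" if "s \<in> {0<..L}" for s
    unfolding \<psi>_def
    by (rule DERIV_cong[OF DERIV_add[OF DERIV_cmult[OF d\<phi>[OF that]] DERIV_divide[OF DERIV_const d\<phi>[OF that]]]])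
      (use R_pos[OF that] \<phi>_pos[of s] in \<open>auto simp: \<psi>1_def field_simps\<close>)
  have d\<psi>1: "(\<psi>1 has_real_derivative n\<^sup>2 / (R s)\<^sup>2 * \<psi> s - R1 s / R s * \<psi>1 s) (at s within {0<..L})"
    if "s \<in> {0<..L}" for s
    unfolding \<psi>1_def
    by (rule DERIV_cong[OF DERIV_divide[OF DERIV_cmult[OF DERIV_diff[OF DERIV_cmult[OF d\<phi>[OF that]]
        DERIV_divide[OF DERIV_const d\<phi>[OF that]]]] dR'[OF that]]])
      (use R_pos[OF that] \<phi>_pos[of s] in \<open>auto simp: \<psi>_def field_simps power2_eq_square\<close>)
  define d\<phi>1 where "d\<phi>1 s = n * \<phi> s / R s" for s
  have dd\<phi>: "(d\<phi>1 has_real_derivative n\<^sup>2 / (R s)\<^sup>2 * \<phi> s - R1 s / R s * d\<phi>1 s) (at s within {0<..L})"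
    if "s \<in> {0<..L}" for s
    unfolding d\<phi>1_def
    by (rule DERIV_cong[OF DERIV_divide[OF DERIV_cmult[OF d\<phi>[OF that]] dR'[OF that]]])
      (use R_pos[OF that] \<phi>_pos[of s] in \<open>auto simp: field_simps power2_eq_square\<close>)
  \<comment> \<open>The weight of the factored equation, with \<phi> in the role of \<psi> on the
    inner side. Both equal 1 at s0, so b is continuous.\<close>
  define b where "b s = R s * (if s \<le> s0 then \<phi> s else \<psi> s)\<^sup>2" for s
  have b_left: "b s = R s * (\<phi> s)\<^sup>2" if "s \<le> s0" for s using that by (simp add: b_def)
  have b_right: "b s = R s * (\<psi> s)\<^sup>2" if "s0 \<le> s" for s using that \<psi>s0 \<phi>s0 by (cases "s = s0") (auto simp: b_def)
  have b_pos: "0 < b s" if "s \<in> {0<..L}" for s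
    using R_pos[OF that] \<phi>_pos[of s] \<psi>_pos[of s] by (auto simp: b_def)
  have b0: "b 0 = 0" by (simp add: b_def R_0)
  have n2K: "K \<le> 2 * n" using n c
    by (smt (verit) divide_less_eq_1_pos mult_less_cancel_left2)
  have mono_l: "b x \<le> b y" if "0 < x" "x \<le> y" "y \<le> s0" for x y
  proof -
    have "R x * (\<phi> x)\<^sup>2 \<le> R y * (\<phi> y)\<^sup>2"
    proof (rule mono_from_derivative[where f = "\<lambda>s. R s * (\<phi> s)\<^sup>2" and f' = "\<lambda>s. (\<phi> s)\<^sup>2 * (R1 s + 2 * n)"])
      fix s assume s: "s \<in> {0<..L}"
      show "((\<lambda>s. R s * (\<phi> s)\<^sup>2) has_real_derivative (\<phi> s)\<^sup>2 * (R1 s + 2 * n)) (at s within {0<..L})"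
        by (rule DERIV_cong[OF DERIV_mult[OF dR'[OF s] DERIV_power[OF d\<phi>[OF s]]]])
          (use R_pos[OF s] in \<open>auto simp: field_simps power2_eq_square\<close>)
      show "0 \<le> (\<phi> s)\<^sup>2 * (R1 s + 2 * n)" using K[of s] n2K s by auto
    qed (use that s0 in auto)
    then show ?thesis using that b_left by simp
  qed
  have mono_r: "b x \<le> b y" if "s0 \<le> x" "x \<le> y" "y \<le> L" for x y
  proof (cases "x = y")
    case False
    have "R x * (\<psi> x)\<^sup>2 \<le> R y * (\<psi> y)\<^sup>2"
    proof (rule DERIV_nonneg_imp_increasing_open[OF \<open>x \<le> y\<close>, of "\<lambda>s. R s * (\<psi> s)\<^sup>2"])
      fix s assume s: "x < s" "s < y"
      then have sL: "s \<in> {0<..L}" "s \<in> interior {0<..L}" using that s0 by (auto simp: interior_eq)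
      define w where "w = R1 s * (\<psi> s)\<^sup>2 + 2 * R s * \<psi> s * \<psi>1 s"
      have "((\<lambda>s. R s * (\<psi> s)\<^sup>2) has_real_derivative w) (at s within {0<..L})"
        by (rule DERIV_cong[OF DERIV_mult[OF dR'[OF sL(1)] DERIV_power[OF d\<psi>[OF sL(1)]]]])
          (auto simp: w_def power2_eq_square)
      then have "((\<lambda>s. R s * (\<psi> s)\<^sup>2) has_real_derivative w) (at s)"
        using at_within_interior[OF sL(2)] by simp
      moreover have "0 \<le> w"
      proof -
        \<comment> \<open>In the variable t the logarithmic derivative of \<psi> is n \<rho> at s0
          and does not fall below this value afterwards. Therefore w >= (R1 s + 2 n \<rho>)
          \<psi>^2.\<close>
        have "1 \<le> \<phi> s" using \<phi>_mono[of s0 s] s that s0 \<phi>s0 by simp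
        then have "1 / \<phi> s \<le> \<phi> s" using \<phi>_pos[of s] mult_mono[of 1 "\<phi> s" 1 "\<phi> s"] by (simp add: divide_le_eq)
        have "\<alpha> * \<phi> s - \<beta> / \<phi> s - \<rho> * \<psi> s = (1 - \<rho>\<^sup>2) / 2 * (\<phi> s - 1 / \<phi> s)"
          unfolding \<psi>_def \<alpha>_def \<beta>_def using \<phi>_pos[of s] by (simp add: field_simps power2_eq_square)
        moreover have "\<dots> \<ge> 0" using \<open>1 / \<phi> s \<le> \<phi> s\<close> \<rho> by (intro mult_nonneg_nonneg) (auto simp: power_le_one)
        ultimately have "\<rho> * \<psi> s \<le> \<alpha> * \<phi> s - \<beta> / \<phi> s" by linarith
        then have "n * (\<alpha> * \<phi> s - \<beta> / \<phi> s) \<ge> n * (\<rho> * \<psi> s)" using n(1) by (intro mult_left_mono) auto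
        then have "R s * \<psi>1 s \<ge> n * \<rho> * \<psi> s" using R_pos[OF sL(1)] by (simp add: \<psi>1_def)
        then have "2 * \<psi> s * (R s * \<psi>1 s) \<ge> 2 * \<psi> s * (n * \<rho> * \<psi> s)" using \<psi>_pos[of s] by (intro mult_left_mono) auto
        moreover have "w = R1 s * (\<psi> s)\<^sup>2 + 2 * \<psi> s * (R s * \<psi>1 s)" by (simp add: w_def)
        ultimately have "w \<ge> (R1 s + 2 * n * \<rho>) * (\<psi> s)\<^sup>2" by (simp add: power2_eq_square algebra_simps)
        moreover have "R1 s + 2 * n * \<rho> \<ge> 0" using K[of s] sL n(3) by (auto simp: \<rho>_def)
        ultimately show ?thesis by (smt (verit) mult_nonneg_nonneg zero_le_power2)
      qed
      ultimately show "\<exists>w. ((\<lambda>s. R s * (\<psi> s)\<^sup>2) has_real_derivative w) (at s) \<and> 0 \<le> w" by blast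
    next
      have "continuous_on {0<..L} \<psi>" by (rule DERIV_continuous_on[OF d\<psi>])
      then show "continuous_on {x..y} (\<lambda>s. R s * (\<psi> s)\<^sup>2)"
        using that s0 by (intro continuous_intros continuous_on_subset[OF R_cont] continuous_on_subset[OF \<open>continuous_on {0<..L} \<psi>\<close>]) auto
    qed
    then show ?thesis using that b_right by simp
  qed simp
  have b_mono: "b x \<le> b y" if "0 \<le> x" "x \<le> y" "y \<le> L" for x y
  proof (cases "x = 0")
    case True
    then show ?thesis using b0 b_pos[of y] that by (cases "y = 0") auto
  next
    case False
    then have x: "0 < x" using that by simp
    show ?thesis
    proof (cases "x \<le> s0 \<and> s0 \<le> y")
      case True
      then show ?thesis using mono_l[of x s0] mono_r[of s0 y] x that by auto
    next
      case False
      then show ?thesis using mono_l[of x y] mono_r[of x y] x that by (cases "y \<le> s0") auto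
    qed
  qed
  have \<phi>c: "continuous_on {0<..L} \<phi>" and \<psi>c: "continuous_on {0<..L} \<psi>"
    by (rule DERIV_continuous_on, erule d\<phi>, rule DERIV_continuous_on, erule d\<psi>)
  have b_cont: "continuous_on {0..L} b"
    unfolding continuous_on_def
  proof
    fix s assume s: "s \<in> {0..L}"
    show "(b \<longlongrightarrow> b s) (at s within {0..L})"
    proof (cases "s = 0")
      case True
      have "(R \<longlongrightarrow> 0) (at 0 within {0..L})" using R_cont R_0 s0 by (auto simp: continuous_on_def dest!: bspec[of _ _ 0])
      \<comment> \<open>On the inner side \<phi> <= 1, so b is squeezed between 0 and R.\<close>
      moreover have "eventually (\<lambda>x. norm (b x) \<le> R x) (at 0 within {0..L})"
      proof -
        have "norm (b x) \<le> R x" if "x \<in> {0..L}" "x < s0" for x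
        proof (cases "x = 0")
          case False
          have "R x * (\<phi> x)\<^sup>2 \<le> R x * 1"
            using that False R_pos[of x] \<phi>_mono[of x s0] s0 \<phi>_pos[of x] \<phi>s0 by (intro mult_left_mono power_le_one) (auto simp: less_imp_le)
          then show ?thesis using that False b_pos[of x] b_left[of x] by simp
        qed (simp add: b0 R_0)
        then show ?thesis using s0 unfolding eventually_at by (intro exI[of _ s0]) (auto simp: dist_real_def)
      qed
      ultimately show ?thesis using True b0 by (simp add: Lim_null_comparison)
    next
      case False
      have "continuous_on {0<..L} (\<lambda>s. if s \<le> s0 then \<phi> s else \<psi> s)"
        by (rule continuous_on_cases_le)
          (auto intro: continuous_on_subset[OF \<phi>c] continuous_on_subset[OF \<psi>c] continuous_on_id simp: \<phi>s0 \<psi>s0)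
      moreover have "continuous_on {0<..L} R" by (rule continuous_on_subset[OF R_cont]) auto
      ultimately have "continuous_on {0<..L} b" unfolding b_def by (intro continuous_intros)
      then have "(b \<longlongrightarrow> b s) (at s within {0<..L})" using s False by (auto simp: continuous_on_def)
      moreover have "at s within {0<..L} = at s within {0..L}"
        by (rule at_within_nhd[of _ "{0<..}"]) (use s False in auto)
      ultimately show ?thesis by simp
    qed
  qed
  interpret volterra b L s0 cm cp
    by unfold_locales (use s0 c b_cont b_pos b_mono in auto)
  obtain l where l: "l \<in> {0..\<Lambda>}" and V_pos: "\<And>s. s \<in> {0..<L} \<Longrightarrow> V l s > 0" and VL: "V l L = 0 \<or> l = \<Lambda>"
    using ex_first_zero[OF \<Lambda>] by blast
  define v where "v = V l"
  define g where "g = G v"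
  have vc: "continuous_on {0..L} v" unfolding v_def by (rule V_cont[OF \<Lambda> l])
  have gc: "continuous_on {0..L} g" unfolding g_def by (rule G_cont[OF vc])
  have dI: "((\<lambda>s. integral {0..s} (\<lambda>x. b x * v x)) has_real_derivative b s * v s) (at s within {0..L})" if "s \<in> {0..L}" for s
    by (rule integral_has_real_derivative[OF bv_cont[OF vc] that])
  have dJ: "((\<lambda>s. integral {0..s} g) has_real_derivative g s) (at s within {0..L})" if "s \<in> {0..L}" for s
    by (rule integral_has_real_derivative[OF gc that])
  \<comment> \<open>Stated for a general factor \<xi>, so that one computation serves \<phi> on the
    inner and \<psi> on the outer side.\<close>
  have dg: "(g has_real_derivative v s - (R1 s / R s + 2 * \<xi>1 s / \<xi> s) * g s) (at s within J)"
    if J: "J \<subseteq> {0<..L}" "s \<in> J" and b: "\<And>s. s \<in> J \<Longrightarrow> b s = R s * (\<xi> s)\<^sup>2" and "\<xi> s > 0"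
      and \<xi>: "(\<xi> has_real_derivative \<xi>1 s) (at s within J)" for J \<xi> \<xi>1 s
  proof -
    have R: "R s > 0" using R_pos J by auto
    have sub: "at s within J \<le> at s within {0..L}" using J(1) by (intro at_le) auto
    have 1: "((\<lambda>s. integral {0..s} (\<lambda>x. b x * v x)) has_real_derivative b s * v s) (at s within J)"
      by (rule has_field_derivative_subset[OF dI]) (use J in auto)
    have 2: "((\<lambda>s. R s * (\<xi> s)\<^sup>2) has_real_derivative (R1 s * (\<xi> s)\<^sup>2 + 2 * R s * \<xi> s * \<xi>1 s)) (at s within J)"
      by (rule DERIV_cong[OF DERIV_mult[OF has_field_derivative_subset[OF dR'] DERIV_power[OF \<xi>]]])
        (use J in \<open>auto simp: power2_eq_square\<close>)
    define I where "I = integral {0..s} (\<lambda>x. b x * v x)"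
    have gI: "g s = I / (R s * (\<xi> s)\<^sup>2)" by (simp add: g_def G_def I_def b[OF J(2)])
    have "((\<lambda>s. integral {0..s} (\<lambda>x. b x * v x) / (R s * (\<xi> s)\<^sup>2)) has_real_derivative
        v s - (R1 s / R s + 2 * \<xi>1 s / \<xi> s) * g s) (at s within J)"
      by (rule DERIV_cong[OF DERIV_divide[OF 1 2]])
        (use R \<open>\<xi> s > 0\<close> in \<open>auto simp: gI I_def[symmetric] b[OF J(2)] field_simps power2_eq_square\<close>)
    then show ?thesis
      by (rule has_field_derivative_transform_within[OF _ zero_less_one J(2)]) (auto simp: g_def G_def b)
  qed
  have subl: "{0<..s0} \<subseteq> {0<..L}" and subr: "{s0..L} \<subseteq> {0<..L}" using s0 by auto
  have dVl: "(v has_real_derivative - (l / cm) * g s) (at s within {0<..s0})" if s: "s \<in> {0<..s0}" for s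
  proof -
    have "((\<lambda>s. 1 - l * (integral {0..s} g / cm)) has_real_derivative 0 - l * (g s / cm)) (at s within {0<..s0})"
      using s s0 by (intro DERIV_diff DERIV_const DERIV_cmult DERIV_cdivide has_field_derivative_subset[OF dJ]) auto
    then show ?thesis
    proof (rule has_field_derivative_transform_within[OF DERIV_cong zero_less_one s])
      show "1 - l * (integral {0..x} g / cm) = v x" if "x \<in> {0<..s0}" for x
        using V_fixed[OF \<Lambda> l, of x] W_left[of x v] that s0 by (simp add: v_def g_def)
    qed simp
  qed
  have dVr: "(v has_real_derivative - (l / cp) * g s) (at s within {s0..L})" if s: "s \<in> {s0..L}" for s
  proof -
    have "((\<lambda>s. 1 - l * (W v s0 + (integral {0..s} g - integral {0..s0} g) / cp)) has_real_derivative
        0 - l * (0 + (g s - 0) / cp)) (at s within {s0..L})"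
      using s s0 by (intro DERIV_diff DERIV_add DERIV_const DERIV_cmult DERIV_cdivide has_field_derivative_subset[OF dJ]) auto
    then show ?thesis
    proof (rule has_field_derivative_transform_within[OF DERIV_cong zero_less_one s])
      show "1 - l * (W v s0 + (integral {0..x} g - integral {0..s0} g) / cp) = v x" if x: "x \<in> {s0..L}" for x
      proof -
        have "v x = 1 - l * W v x" using V_fixed[OF \<Lambda> l, of x] x s0 by (simp add: v_def)
        also have "W v x = W v s0 + (integral {0..x} g - integral {0..s0} g) / cp"
          unfolding g_def by (rule W_right) (use x in auto)
        finally show ?thesis by simp
      qed
    qed simp
  qed
  have Rc: "continuous_on J R" "continuous_on J R1" if "J \<subseteq> {0<..L}" for J
    using that by (auto intro!: continuous_on_subset[OF R_cont] continuous_on_subset[OF R1_cont])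
  have left: "side_solution R R1 n cm l {0<..s0} (\<lambda>s. \<phi> s * v s) (\<lambda>s. d\<phi>1 s * v s - (l / cm) * (\<phi> s * g s))
     (\<lambda>s. (n\<^sup>2 / (R s)\<^sup>2 * \<phi> s - R1 s / R s * d\<phi>1 s) * v s - (l / cm) * (\<phi> s * v s - \<phi> s * (R1 s / R s) * g s))"
  proof (rule side_solutionI[OF c(1) _ Rc[OF subl] _ _ _ dVl])
    fix s assume s: "s \<in> {0<..s0}"
    then have sL: "s \<in> {0<..L}" using s0 by auto
    show "R s > 0" by (rule R_pos[OF sL])
    show "\<phi> s \<noteq> 0" using \<phi>_pos[of s] by simp
    show *: "(\<phi> has_real_derivative d\<phi>1 s) (at s within {0<..s0})"
      unfolding d\<phi>1_def by (rule has_field_derivative_subset[OF d\<phi>[OF sL] subl])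
    show "(d\<phi>1 has_real_derivative n\<^sup>2 / (R s)\<^sup>2 * \<phi> s - R1 s / R s * d\<phi>1 s) (at s within {0<..s0})"
      by (rule has_field_derivative_subset[OF dd\<phi>[OF sL] subl])
    show "(g has_real_derivative v s - (R1 s / R s + 2 * d\<phi>1 s / \<phi> s) * g s) (at s within {0<..s0})"
      by (rule dg[where \<xi> = \<phi> and ?\<xi>1.0 = d\<phi>1, OF subl s _ \<phi>_pos *]) (simp add: b_left)
  qed
  have right: "side_solution R R1 n cp l {s0..L} (\<lambda>s. \<psi> s * v s) (\<lambda>s. \<psi>1 s * v s - (l / cp) * (\<psi> s * g s))
     (\<lambda>s. (n\<^sup>2 / (R s)\<^sup>2 * \<psi> s - R1 s / R s * \<psi>1 s) * v s - (l / cp) * (\<psi> s * v s - \<psi> s * (R1 s / R s) * g s))"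
  proof (rule side_solutionI[OF _ _ Rc[OF subr] _ _ _ dVr])
    show "cp > 0" using c by simp
    fix s assume s: "s \<in> {s0..L}"
    then have sL: "s \<in> {0<..L}" using s0 by auto
    show "R s > 0" by (rule R_pos[OF sL])
    show "\<psi> s \<noteq> 0" using \<psi>_pos[of s] by simp
    show *: "(\<psi> has_real_derivative \<psi>1 s) (at s within {s0..L})"
      by (rule has_field_derivative_subset[OF d\<psi>[OF sL] subr])
    show "(\<psi>1 has_real_derivative n\<^sup>2 / (R s)\<^sup>2 * \<psi> s - R1 s / R s * \<psi>1 s) (at s within {s0..L})"
      by (rule has_field_derivative_subset[OF d\<psi>1[OF sL] subr])
    show "(g has_real_derivative v s - (R1 s / R s + 2 * \<psi>1 s / \<psi> s) * g s) (at s within {s0..L})"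
      by (rule dg[where \<xi> = \<psi> and ?\<xi>1.0 = \<psi>1, OF subr s _ \<psi>_pos *]) (simp add: b_right)
  qed
  obtain B where B: "B > 0" "\<And>s. s \<in> {0..L} \<Longrightarrow> \<bar>v s\<bar> \<le> B" using bounded_cont[OF vc] by blast
  obtain Rm where Rm: "Rm > 0" "\<And>s. s \<in> {0..L} \<Longrightarrow> \<bar>R s\<bar> \<le> Rm" using bounded_cont[OF R_cont] by blast
  have gb: "\<bar>g s\<bar> \<le> L * B" if "s \<in> {0..L}" for s
  proof -
    have "\<bar>g s\<bar> \<le> s * B" unfolding g_def by (rule G_bound[OF vc that]) (use B that in auto)
    also have "\<dots> \<le> L * B" using that B(1) by (intro mult_right_mono) auto
    finally show ?thesis .
  qed
  have K0: "K \<ge> 0" using K[of 0] s0 by auto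
  \<comment> \<open>C0 bounds \<phi> / R^2 on the inner side. From it, C1, C2 and C3 bound f / R^2,
    f' / R and f''.\<close>
  define C0 where "C0 = 1 / (R s0)\<^sup>2"
  have C0: "C0 \<ge> 0" by (simp add: C0_def)
  define a where "a = l / cm"
  have a: "a \<ge> 0" using l c by (simp add: a_def)
  define C1 where "C1 = C0 * B"
  define C2 where "C2 = n * C0 * B + a * (C0 * Rm * (L * B))"
  define C3 where "C3 = (n\<^sup>2 * C0 + K * n * C0) * B + a * (C0 * Rm\<^sup>2 * B + C0 * Rm * K * (L * B))"
  define C where "C = max C1 (max C2 C3)"
  have bounds: "\<bar>\<phi> s * v s\<bar> \<le> C * (R s)\<^sup>2 \<and> \<bar>d\<phi>1 s * v s - a * (\<phi> s * g s)\<bar> \<le> C * R s \<and>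
      \<bar>(n\<^sup>2 / (R s)\<^sup>2 * \<phi> s - R1 s / R s * d\<phi>1 s) * v s - a * (\<phi> s * v s - \<phi> s * (R1 s / R s) * g s)\<bar> \<le> C"
    if s: "s \<in> {0<..s0}" for s
  proof -
    have sL: "s \<in> {0<..L}" "s \<in> {0..L}" using s s0 by auto
    have R: "R s > 0" by (rule R_pos[OF sL(1)])
    define y where "y = \<phi> s / (R s)\<^sup>2"
    have y: "0 \<le> y" "y \<le> C0" using \<phi>R2[OF s] R \<phi>_pos[of s] by (auto simp: y_def C0_def field_simps)
    have \<phi>y: "\<phi> s = y * (R s)\<^sup>2" using R by (simp add: y_def)
    note v = B(2)[OF sL(2)] and g = gb[OF sL(2)] and k = K[OF sL(2)]
    have RRm: "R s \<le> Rm" "R s ^ 2 \<le> Rm ^ 2" using Rm(2)[OF sL(2)] R by (auto intro: power_mono)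
    have yv: "\<bar>y * v s\<bar> \<le> C0 * B" unfolding abs_mult using y v by (intro mult_mono) auto
    have yg: "\<bar>y * g s\<bar> \<le> C0 * (L * B)" unfolding abs_mult using y g by (intro mult_mono) auto
    have C0B: "0 \<le> C0 * B" "0 \<le> C0 * (L * B)" using yv yg by linarith+
    have e1: "\<bar>\<phi> s * v s\<bar> \<le> C1 * (R s)\<^sup>2"
    proof -
      have "\<bar>\<phi> s * v s\<bar> = \<bar>y * v s\<bar> * (R s)\<^sup>2" by (simp add: \<phi>y abs_mult)
      then show ?thesis unfolding C1_def using mult_right_mono[OF yv, of "(R s)\<^sup>2"] by simp
    qed
    have e2: "\<bar>d\<phi>1 s * v s - a * (\<phi> s * g s)\<bar> \<le> C2 * R s"
    proof -
      have "d\<phi>1 s * v s - a * (\<phi> s * g s) = (n * (y * v s) - a * ((y * g s) * R s)) * R s"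
        using R by (simp add: d\<phi>1_def \<phi>y power2_eq_square field_simps)
      moreover have "\<bar>n * (y * v s) - a * ((y * g s) * R s)\<bar> \<le> C2"
      proof -
        have "\<bar>n * (y * v s)\<bar> \<le> n * (C0 * B)" unfolding abs_mult[of n] using yv n(1) by (intro mult_mono) auto
        moreover have "\<bar>a * ((y * g s) * R s)\<bar> \<le> a * (C0 * (L * B) * Rm)"
          unfolding abs_mult[of a] abs_mult[of "y * g s"] using yg a R RRm C0B by (intro mult_mono) auto
        ultimately show ?thesis unfolding C2_def
          using abs_triangle_ineq4[of "n * (y * v s)" "a * ((y * g s) * R s)"] by (simp add: mult_ac)
      qed
      ultimately show ?thesis using R by (simp add: abs_mult)
    qed
    have e3: "\<bar>(n\<^sup>2 / (R s)\<^sup>2 * \<phi> s - R1 s / R s * d\<phi>1 s) * v s - a * (\<phi> s * v s - \<phi> s * (R1 s / R s) * g s)\<bar> \<le> C3"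
    proof -
      have "(n\<^sup>2 / (R s)\<^sup>2 * \<phi> s - R1 s / R s * d\<phi>1 s) * v s - a * (\<phi> s * v s - \<phi> s * (R1 s / R s) * g s)
        = n\<^sup>2 * (y * v s) - (R1 s * n) * (y * v s) - a * ((y * v s) * (R s)\<^sup>2 - (y * g s) * (R s * R1 s))"
        using R by (simp add: d\<phi>1_def \<phi>y power2_eq_square field_simps)
      moreover have "\<bar>n\<^sup>2 * (y * v s)\<bar> \<le> n\<^sup>2 * (C0 * B)" unfolding abs_mult[of "n\<^sup>2"] using yv by (intro mult_mono) auto
      moreover have "\<bar>(R1 s * n) * (y * v s)\<bar> \<le> (K * n) * (C0 * B)"
        unfolding abs_mult[of "R1 s * n"] abs_mult[of "R1 s"] using yv k n(1) K0 by (intro mult_mono) auto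
      moreover have "\<bar>a * ((y * v s) * (R s)\<^sup>2 - (y * g s) * (R s * R1 s))\<bar> \<le> a * (C0 * B * Rm\<^sup>2 + C0 * (L * B) * (Rm * K))"
      proof -
        have "\<bar>(y * v s) * (R s)\<^sup>2\<bar> \<le> C0 * B * Rm\<^sup>2" unfolding abs_mult[of "y * v s"]
          using yv RRm C0B by (intro mult_mono) auto
        moreover have "\<bar>(y * g s) * (R s * R1 s)\<bar> \<le> C0 * (L * B) * (Rm * K)"
          unfolding abs_mult[of "y * g s"] abs_mult[of "R s"] using yg RRm k C0B R K0 Rm by (intro mult_mono) auto
        ultimately have "\<bar>(y * v s) * (R s)\<^sup>2 - (y * g s) * (R s * R1 s)\<bar> \<le> C0 * B * Rm\<^sup>2 + C0 * (L * B) * (Rm * K)"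
          by linarith
        then show ?thesis unfolding abs_mult[of a] using a by (intro mult_mono) auto
      qed
      moreover have "C3 = n\<^sup>2 * (C0 * B) + (K * n) * (C0 * B) + a * (C0 * B * Rm\<^sup>2 + C0 * (L * B) * (Rm * K))"
        by (simp add: C3_def algebra_simps)
      ultimately show ?thesis by linarith
    qed
    have "C1 \<le> C" "C2 \<le> C" "C3 \<le> C" by (auto simp: C_def)
    then show ?thesis using e1 e2 e3 R
      by (meson mult_right_mono order_trans zero_le_power2 less_imp_le)
  qed
  show thesis
  proof (rule that[OF l left right])
    show "\<phi> s0 * v s0 = \<psi> s0 * v s0" by (simp add: \<phi>s0 \<psi>s0)
    \<comment> \<open>In the terms with g the coefficient c cancels against l / c, so they agree on
      both sides; what remains is the choice of \<rho>.\<close>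
    show "cm * (d\<phi>1 s0 * v s0 - l / cm * (\<phi> s0 * g s0)) = cp * (\<psi>1 s0 * v s0 - l / cp * (\<psi> s0 * g s0))"
      using c by (simp add: \<phi>s0 \<psi>s0 d\<phi>1_def \<rho>_def algebra_simps)
    show "\<phi> s * v s > 0" if "s \<in> {0<..s0}" for s using V_pos[of s] that s0 \<phi>_pos[of s] by (auto simp: v_def)
    show "\<psi> s * v s > 0" if "s \<in> {s0..<L}" for s using V_pos[of s] that s0 \<psi>_pos[of s] by (auto simp: v_def)
    show "\<psi> L * v L = 0 \<or> l = \<Lambda>" using VL by (auto simp: v_def)
  qed (use bounds a_def in auto)
qed

end

section \<open>Eigenvalue bounds and exponential decay\<close>

lemma side_solution_at:
  assumes "side_solution R R1 n c l J f f1 f2" "s \<in> interior J"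
  shows "(f has_real_derivative f1 s) (at s)" "(f1 has_real_derivative f2 s) (at s)"
    "c * (f2 s + R1 s / R s * f1 s - n\<^sup>2 / (R s)\<^sup>2 * f s) = - l * f s"
proof -
  have "s \<in> J" using assms(2) interior_subset by blast
  then show "(f has_real_derivative f1 s) (at s)" "(f1 has_real_derivative f2 s) (at s)"
    "c * (f2 s + R1 s / R s * f1 s - n\<^sup>2 / (R s)\<^sup>2 * f s) = - l * f s"
    using assms(1) at_within_interior[OF assms(2)] unfolding side_solution_def by metis+
qed

lemma side_solution_cont:
  assumes "side_solution R R1 n c l J f f1 f2"
  shows "continuous_on J f" "continuous_on J f1" "continuous_on J f2"
  using assms DERIV_continuous_on[of J f f1] DERIV_continuous_on[of J f1 f2] unfolding side_solution_def by auto

text \<open>Positivity is recorded on the inner side, where Picone's identity divides by f. The last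
  clause is the flatness at the pole: boundedness of f / R^2, f' / R and f'' is what the Hessian in
  polar coordinates asks for.\<close>

definition (in profile) radial_mode :: "real \<Rightarrow> real \<Rightarrow> (real \<Rightarrow> real) \<Rightarrow> (real \<Rightarrow> real) \<Rightarrow> (real \<Rightarrow> real) \<Rightarrow>
    (real \<Rightarrow> real) \<Rightarrow> (real \<Rightarrow> real) \<Rightarrow> (real \<Rightarrow> real) \<Rightarrow> bool" where
  "radial_mode n l f f1 f2 h h1 h2 \<longleftrightarrow>
     side_solution R R1 n cm l {0<..s0} f f1 f2 \<and> side_solution R R1 n cp l {s0..L} h h1 h2 \<and>
     f s0 = h s0 \<and> cm * f1 s0 = cp * h1 s0 \<and> (\<forall>s\<in>{0<..s0}. f s > 0) \<and> h L = 0 \<and>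
     (\<exists>C. \<forall>s\<in>{0<..s0}. \<bar>f s\<bar> \<le> C * (R s)\<^sup>2 \<and> \<bar>f1 s\<bar> \<le> C * R s \<and> \<bar>f2 s\<bar> \<le> C)"

locale trapping_profile = profile +
  assumes R_less: "\<And>s. s \<in> {0<..<s0} \<Longrightarrow> R s < R s0"
    and gap: "\<exists>\<epsilon>>0. \<forall>s\<in>{s0..L}. cm / (R s0)\<^sup>2 + \<epsilon> \<le> cp / (R s)\<^sup>2"
begin

section \<open>The potential well and bounds for the eigenvalue\<close>

definition E0 :: real where "E0 = cm / (R s0)\<^sup>2"

lemma R_nonneg: "s \<in> {0..L} \<Longrightarrow> R s \<ge> 0"
  using R_pos[of s] R_0 by (cases "s = 0") auto

lemma Rs0: "R s0 > 0" using R_pos s0 by auto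

lemma E0_pos: "E0 > 0" using Rs0 c by (simp add: E0_def)

lemma V_left_ge: "s \<in> {0<..s0} \<Longrightarrow> cm / (R s)\<^sup>2 \<ge> E0"
  using R_less[of s] R_pos[of s] s0 c Rs0 unfolding E0_def
  by (cases "s = s0") (auto intro!: divide_left_mono power_mono simp: less_imp_le)

lemma left_gap:
  assumes "\<delta> > 0"
  shows "\<exists>\<epsilon>>0. \<forall>s\<in>{0<..s0 - \<delta>}. E0 + \<epsilon> \<le> cm / (R s)\<^sup>2"
proof (cases "\<delta> < s0")
  case True
  have "\<exists>x\<in>{0..s0 - \<delta>}. \<forall>y\<in>{0..s0 - \<delta>}. R y \<le> R x"
    using True s0 assms by (intro continuous_attains_sup continuous_on_subset[OF R_cont]) auto
  then obtain x where x: "x \<in> {0..s0 - \<delta>}" "\<And>y. y \<in> {0..s0 - \<delta>} \<Longrightarrow> R y \<le> R x" by blast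
  have "R x < R s0" using x(1) R_less[of x] R_0 Rs0 assms by (cases "x = 0") auto
  \<comment> \<open>The second entry makes m positive without locating the maximum point x.\<close>
  define m where "m = max (R x) (R s0 / 2)"
  have m: "0 < m" "m < R s0" using \<open>R x < R s0\<close> Rs0 by (auto simp: m_def)
  have "E0 + (cm / m\<^sup>2 - E0) \<le> cm / (R s)\<^sup>2" if s: "s \<in> {0<..s0 - \<delta>}" for s
  proof -
    have "R s > 0" using R_pos[of s] s s0 assms by auto
    moreover have "R s \<le> m" using x(2)[of s] s by (auto simp: m_def)
    ultimately show ?thesis using c by (auto intro!: divide_left_mono power_mono)
  qed
  moreover have "cm / m\<^sup>2 - E0 > 0"
    using m c unfolding E0_def by (auto intro!: divide_strict_left_mono power_strict_mono)
  ultimately show ?thesis by blast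
next
  case False
  then show ?thesis by (intro exI[of _ 1]) auto
qed

lemma near_s0:
  assumes "\<epsilon> > 0"
  shows "\<exists>p. 0 < p \<and> p < s0 \<and> (\<forall>s\<in>{p..s0}. cm / (R s)\<^sup>2 \<le> E0 + \<epsilon>)"
proof -
  have "((\<lambda>s. cm / (R s)\<^sup>2) \<longlongrightarrow> E0) (at s0)"
    unfolding E0_def using DERIV_isCont[OF dR_at, of s0] s0 Rs0
    by (intro tendsto_intros) (auto simp: isCont_def)
  then have "eventually (\<lambda>s. cm / (R s)\<^sup>2 < E0 + \<epsilon>) (at s0)"
    using assms by (intro order_tendstoD(2)) auto
  then obtain d where d: "d > 0" "\<And>s. s \<noteq> s0 \<Longrightarrow> dist s s0 < d \<Longrightarrow> cm / (R s)\<^sup>2 < E0 + \<epsilon>"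
    unfolding eventually_at by auto
  define p where "p = max (s0 / 2) (s0 - d / 2)"
  have "cm / (R s)\<^sup>2 \<le> E0 + \<epsilon>" if "s \<in> {p..s0}" for s
    using d(2)[of s] that d(1) assms by (cases "s = s0") (auto simp: p_def dist_real_def E0_def less_imp_le)
  moreover have "0 < p" "p < s0" using d(1) s0 by (auto simp: p_def)
  ultimately show ?thesis by blast
qed

text \<open>The divergence form of the radial equation; both Picone's identity and the energy
  identity differentiate an expression in the flux k R f'.\<close>

lemma flux_derivative:
  assumes f: "(f has_real_derivative f1 s) (at s)" "(f1 has_real_derivative f2 s) (at s)"
    "k * (f2 s + R1 s / R s * f1 s - n\<^sup>2 / (R s)\<^sup>2 * f s) = - l * f s" and s: "s \<in> {0<..<L}"
  shows "((\<lambda>s. k * (R s * f1 s)) has_real_derivative R s * (k * n\<^sup>2 / (R s)\<^sup>2 - l) * f s) (at s)"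
proof -
  have R: "R s > 0" using R_pos[of s] s by auto
  have "k * (R1 s * f1 s + f2 s * R s) = R s * (k * (f2 s + R1 s / R s * f1 s - n\<^sup>2 / (R s)\<^sup>2 * f s) + k * (n\<^sup>2 / (R s)\<^sup>2 * f s))"
    using R by (simp add: field_simps)
  also have "\<dots> = R s * (k * n\<^sup>2 / (R s)\<^sup>2 - l) * f s"
    unfolding f(3) by (simp add: algebra_simps)
  finally show ?thesis
    by (intro DERIV_cong[OF DERIV_cmult[OF DERIV_mult[OF dR_at[OF s] f(2)]]]) 
qed

text \<open>Picone's identity with the test function \<open>(s - p) (s0 - s)\<close>.\<close>

lemma eigenvalue_upper_bound:
  assumes "\<epsilon> > 0"
  shows "\<exists>A. \<forall>n l f f1 f2. side_solution R R1 n cm l {0<..s0} f f1 f2 \<longrightarrow> (\<forall>s\<in>{0<..s0}. f s > 0) \<longrightarrow>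
      l \<le> n\<^sup>2 * (E0 + \<epsilon>) + A"
proof -
  obtain p where p: "0 < p" "p < s0" "\<And>s. s \<in> {p..s0} \<Longrightarrow> cm / (R s)\<^sup>2 \<le> E0 + \<epsilon>"
    using near_s0[OF assms] by blast
  define v where "v s = (s - p) * (s0 - s)" for s
  define v' where "v' s = s0 + p - 2 * s" for s
  have dv: "(v has_real_derivative v' s) (at s)" for s
    unfolding v_def v'_def by (auto intro!: derivative_eq_intros)
  have Rc: "continuous_on {p..s0} R" by (rule continuous_on_subset[OF R_cont]) (use p s0 in auto)
  have Rp: "R s > 0" if "s \<in> {p..s0}" for s using R_pos[of s] that p s0 by auto
  then have Rn: "\<forall>s\<in>{p..s0}. R s \<noteq> 0" by (metis less_irrefl)
  \<comment> \<open>A / D is the Rayleigh quotient of the test function without its potential term.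
    It depends on neither n, l nor f and becomes the O(1) term of the bound.\<close>
  define D where "D = integral {p..s0} (\<lambda>s. R s * (v s)\<^sup>2)"
  define A where "A = integral {p..s0} (\<lambda>s. cm * R s * (v' s)\<^sup>2)"
  have vc: "continuous_on {p..s0} v" "continuous_on {p..s0} v'" by (auto simp: v_def v'_def intro!: continuous_intros)
  have iD: "(\<lambda>s. R s * (v s)\<^sup>2) integrable_on {p..s0}" and iA: "(\<lambda>s. cm * R s * (v' s)\<^sup>2) integrable_on {p..s0}"
    by (intro integrable_continuous_real continuous_intros Rc vc)+
  have D: "D > 0"
  proof -
    have "D \<ge> 0" unfolding D_def using Rp by (intro integral_nonneg iD) (auto simp: less_imp_le)
    moreover have "D \<noteq> 0"
    proof
      assume "D = 0"
      moreover have "continuous_on {p..s0} (\<lambda>s. R s * (v s)\<^sup>2)" by (intro continuous_intros Rc vc)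
      moreover have "0 \<le> R s * (v s)\<^sup>2" if "s \<in> {p..s0}" for s using Rp[OF that] by auto
      ultimately have "\<forall>s\<in>{p..s0}. R s * (v s)\<^sup>2 = 0"
        unfolding D_def using integral_eq_0_iff[of p s0 "\<lambda>s. R s * (v s)\<^sup>2"] p by blast
      from bspec[OF this, of "(p + s0) / 2"] show False
        using p Rp[of "(p + s0) / 2"] by (auto simp: v_def)
    qed
    ultimately show ?thesis by simp
  qed
  have "l \<le> n\<^sup>2 * (E0 + \<epsilon>) + A / D"
    if side: "side_solution R R1 n cm l {0<..s0} f f1 f2" and pos: "\<And>s. s \<in> {0<..s0} \<Longrightarrow> f s > 0" for n l f f1 f2
  proof -
    \<comment> \<open>Picone's field. It vanishes at p and s0 because v does, so no boundary values
      of f survive the integration.\<close>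
    define F where "F s = (v s)\<^sup>2 * (cm * (R s * f1 s)) / f s" for s
    define q where "q s = (cm * R s * (v' s)\<^sup>2 + (n\<^sup>2 * (E0 + \<epsilon>)) * (R s * (v s)\<^sup>2)) - l * (R s * (v s)\<^sup>2)" for s
    have fc: "continuous_on {p..s0} f" "continuous_on {p..s0} f1"
      by (rule continuous_on_subset[OF side_solution_cont(1)[OF side]], use p in auto)
        (rule continuous_on_subset[OF side_solution_cont(2)[OF side]], use p in auto)
    have fpos: "f s > 0" if "s \<in> {p..s0}" for s using pos[of s] that p by auto
    have "continuous_on {p..s0} F" unfolding F_def
      using fpos by (intro continuous_intros Rc vc fc) force
    have dF: "(F has_real_derivative
        2 * v s * v' s * (cm * (R s * f1 s)) / f s + (v s)\<^sup>2 * (R s * (cm * n\<^sup>2 / (R s)\<^sup>2 - l)) - (v s)\<^sup>2 * (cm * R s * (f1 s)\<^sup>2) / (f s)\<^sup>2) (at s)"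
      if s: "s \<in> {p<..<s0}" for s
    proof -
      have si: "s \<in> interior {0<..s0}" using s p s0 by simp
      have fs: "f s > 0" using fpos s by auto
      have sL: "s \<in> {0<..<L}" using s p s0 by auto
      show ?thesis unfolding F_def
        by (rule DERIV_cong[OF DERIV_divide[OF DERIV_mult[OF DERIV_power[OF dv, of 2] flux_derivative[where f = f and ?f1.0 = f1 and ?f2.0 = f2, OF side_solution_at[OF side si] sL]] side_solution_at(1)[OF side si]]])
         (use fs in \<open>auto simp: field_simps power2_eq_square\<close>)
    qed
    have Fint: "((\<lambda>s. 2 * v s * v' s * (cm * (R s * f1 s)) / f s + (v s)\<^sup>2 * (R s * (cm * n\<^sup>2 / (R s)\<^sup>2 - l)) - (v s)\<^sup>2 * (cm * R s * (f1 s)\<^sup>2) / (f s)\<^sup>2) has_integral F s0 - F p) {p..s0}"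
      using p \<open>continuous_on {p..s0} F\<close> dF
      by (intro fundamental_theorem_of_calculus_interior) (auto simp: has_real_derivative_iff_has_vector_derivative[symmetric])
    have qint: "(q has_integral (A + (n\<^sup>2 * (E0 + \<epsilon>)) * D) - l * D) {p..s0}"
      unfolding q_def A_def D_def
      by (intro has_integral_diff has_integral_add has_integral_mult_right integrable_integral iA iD)
    have "F s0 - F p \<le> (A + (n\<^sup>2 * (E0 + \<epsilon>)) * D) - l * D"
    proof (rule has_integral_le[OF Fint qint])
      fix s assume s: "s \<in> {p..s0}"
      have fs: "f s > 0" and Rs: "R s > 0" using fpos[OF s] Rp[OF s] .
      \<comment> \<open>Completing the square: 2 v v' w - (v w)^2 <= v'^2 for w = f' / f.\<close>
      define w where "w = f1 s / f s"
      have "2 * v s * v' s * (cm * (R s * f1 s)) / f s - (v s)\<^sup>2 * (cm * R s * (f1 s)\<^sup>2) / (f s)\<^sup>2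
          = cm * R s * (2 * v s * v' s * w - (v s * w)\<^sup>2)"
        using fs by (simp add: w_def field_simps power2_eq_square)
      also have "\<dots> \<le> cm * R s * (v' s)\<^sup>2"
        using c Rs sum_squares_ge_zero[of "v' s - v s * w" 0]
        by (intro mult_left_mono) (auto simp: power2_eq_square algebra_simps)
      finally have 1: "2 * v s * v' s * (cm * (R s * f1 s)) / f s - (v s)\<^sup>2 * (cm * R s * (f1 s)\<^sup>2) / (f s)\<^sup>2 \<le> cm * R s * (v' s)\<^sup>2" .
      have "n\<^sup>2 * (cm / (R s)\<^sup>2) \<le> n\<^sup>2 * (E0 + \<epsilon>)" using p(3)[OF s] by (intro mult_left_mono) auto
      then have "n\<^sup>2 * (cm / (R s)\<^sup>2) * (R s * (v s)\<^sup>2) \<le> n\<^sup>2 * (E0 + \<epsilon>) * (R s * (v s)\<^sup>2)"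
        using Rs by (intro mult_right_mono) auto
      moreover have "(v s)\<^sup>2 * (R s * (cm * n\<^sup>2 / (R s)\<^sup>2 - l)) = n\<^sup>2 * (cm / (R s)\<^sup>2) * (R s * (v s)\<^sup>2) - l * (R s * (v s)\<^sup>2)"
        by (simp add: algebra_simps)
      ultimately show "2 * v s * v' s * (cm * (R s * f1 s)) / f s + (v s)\<^sup>2 * (R s * (cm * n\<^sup>2 / (R s)\<^sup>2 - l)) - (v s)\<^sup>2 * (cm * R s * (f1 s)\<^sup>2) / (f s)\<^sup>2 \<le> q s"
        using 1 unfolding q_def by linarith
    qed
    then have "l * D \<le> A + (n\<^sup>2 * (E0 + \<epsilon>)) * D" by (simp add: F_def v_def)
    also have "\<dots> = (n\<^sup>2 * (E0 + \<epsilon>) + A / D) * D" using D by (simp add: field_simps)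
    finally show ?thesis using D by simp
  qed
  then show ?thesis by blast
qed

text \<open>\<Lambda> is placed above Picone's bound with \<epsilon> = 1. This excludes the
  alternative l = \<Lambda> of the shooting argument and leaves the Dirichlet condition at
  L.\<close>

lemma ex_radial_mode:
  "\<exists>n0. \<forall>n\<ge>n0. \<exists>l f f1 f2 h h1 h2. radial_mode n l f f1 f2 h h1 h2"
proof -
  obtain A where A: "\<And>n l f f1 f2. side_solution R R1 n cm l {0<..s0} f f1 f2 \<Longrightarrow> (\<forall>s\<in>{0<..s0}. f s > 0) \<Longrightarrow>
      l \<le> n\<^sup>2 * (E0 + 1) + A" using eigenvalue_upper_bound[OF zero_less_one] by metis
  define n0 where "n0 = max 1 (max (2 * K) (K * cp / cm))"
  have "\<exists>l f f1 f2 h h1 h2. radial_mode n l f f1 f2 h h1 h2" if "n \<ge> n0" for n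
  proof -
    have n: "n > 0" "2 * K \<le> n" "K * cp / cm \<le> n" using that by (auto simp: n0_def)
    define x where "x = n * (cm / cp)"
    have "K \<le> x" using n(3) c by (simp add: x_def field_simps)
    moreover have "x \<ge> 0" using n(1) c by (simp add: x_def)
    ultimately have "K \<le> 2 * x" by linarith
    then have n3: "K \<le> 2 * n * (cm / cp)" by (simp add: x_def)
    define \<Lambda> where "\<Lambda> = n\<^sup>2 * (E0 + 1) + \<bar>A\<bar> + 1"
    have \<Lambda>: "\<Lambda> > 0" using E0_pos by (auto simp: \<Lambda>_def intro!: add_nonneg_pos mult_nonneg_nonneg)
    from ex_radial[OF n(1,2) n3 \<Lambda>]
    obtain l f f1 f2 h h1 h2 C where m: "side_solution R R1 n cm l {0<..s0} f f1 f2" "side_solution R R1 n cp l {s0..L} h h1 h2"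
      "f s0 = h s0" "cm * f1 s0 = cp * h1 s0" "\<And>s. s \<in> {0<..s0} \<Longrightarrow> f s > 0" "h L = 0 \<or> l = \<Lambda>"
      "\<And>s. s \<in> {0<..s0} \<Longrightarrow> \<bar>f s\<bar> \<le> C * (R s)\<^sup>2 \<and> \<bar>f1 s\<bar> \<le> C * R s \<and> \<bar>f2 s\<bar> \<le> C"
      by metis
    have "l < \<Lambda>" using A[OF m(1)] m(5) by (force simp: \<Lambda>_def)
    with m have "radial_mode n l f f1 f2 h h1 h2" unfolding radial_mode_def by blast
    then show ?thesis by blast
  qed
  then show ?thesis by blast
qed

text \<open>Multiply the equation by f and by the exponential weight and integrate; the term
  discarded is the weight times k R (f' + n \<mu> f)^2. The sign of \<mu> is free, so the weight can
  be made to grow away from s0 on either side.\<close>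

lemma energy:
  assumes xy: "0 \<le> x" "x \<le> y" "y \<le> L" and k: "k > 0"
    and f: "\<And>s. s \<in> {x<..<y} \<Longrightarrow> (f has_real_derivative f1 s) (at s)"
      "\<And>s. s \<in> {x<..<y} \<Longrightarrow> (f1 has_real_derivative f2 s) (at s)"
      "\<And>s. s \<in> {x<..<y} \<Longrightarrow> k * (f2 s + R1 s / R s * f1 s - n\<^sup>2 / (R s)\<^sup>2 * f s) = - l * f s"
    and cont: "continuous_on {x..y} (\<lambda>s. R s * f1 s * f s)" 
    and cq: "continuous_on {x..y} (\<lambda>s. (f s)\<^sup>2 * R s * (k * n\<^sup>2 / (R s)\<^sup>2 - l - k * n\<^sup>2 * \<mu>\<^sup>2))"
  shows "integral {x..y} (\<lambda>s. exp (2 * n * \<mu> * (s - s0)) * ((f s)\<^sup>2 * R s * (k * n\<^sup>2 / (R s)\<^sup>2 - l - k * n\<^sup>2 * \<mu>\<^sup>2)))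
    \<le> k * (R y * f1 y * f y) * exp (2 * n * \<mu> * (y - s0)) - k * (R x * f1 x * f x) * exp (2 * n * \<mu> * (x - s0))"
proof -
  define w where "w s = exp (2 * n * \<mu> * (s - s0))" for s
  define F where "F s = k * (R s * f1 s * f s) * w s" for s
  define F' where "F' s = w s * (R s * (k * n\<^sup>2 / (R s)\<^sup>2 - l) * (f s)\<^sup>2 + k * R s * (f1 s)\<^sup>2 + 2 * n * \<mu> * (k * R s * f1 s * f s))" for s
  have dw: "(w has_real_derivative 2 * n * \<mu> * w s) (at s)" for s
    unfolding w_def by (auto intro!: derivative_eq_intros)
  have wc: "continuous_on {x..y} w" unfolding w_def by (intro continuous_intros)
  have dF: "(F has_real_derivative F' s) (at s)" if s: "s \<in> {x<..<y}" for s
  proof -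
    have "((\<lambda>s. (k * (R s * f1 s)) * f s * w s) has_real_derivative F' s) (at s)"
      by (rule DERIV_cong[OF DERIV_mult[OF DERIV_mult[OF flux_derivative[where f = f and ?f1.0 = f1 and ?f2.0 = f2, OF f(1)[OF s] f(2)[OF s] f(3)[OF s]] f(1)[OF s]] dw]])
        (use s xy in \<open>auto simp: F'_def power2_eq_square algebra_simps\<close>)
    moreover have "F = (\<lambda>s. (k * (R s * f1 s)) * f s * w s)" by (auto simp: F_def)
    ultimately show ?thesis by simp
  qed
  have i1: "(F' has_integral F y - F x) {x..y}"
  proof (rule fundamental_theorem_of_calculus_interior[OF xy(2)])
    show "continuous_on {x..y} F" unfolding F_def by (intro continuous_intros cont wc)
  qed (use dF in \<open>auto simp: has_real_derivative_iff_has_vector_derivative[symmetric]\<close>)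
  have i2: "((\<lambda>s. w s * ((f s)\<^sup>2 * R s * (k * n\<^sup>2 / (R s)\<^sup>2 - l - k * n\<^sup>2 * \<mu>\<^sup>2))) has_integral
      integral {x..y} (\<lambda>s. w s * ((f s)\<^sup>2 * R s * (k * n\<^sup>2 / (R s)\<^sup>2 - l - k * n\<^sup>2 * \<mu>\<^sup>2)))) {x..y}"
    by (intro integrable_integral integrable_continuous_real continuous_intros wc cq)
  have "integral {x..y} (\<lambda>s. w s * ((f s)\<^sup>2 * R s * (k * n\<^sup>2 / (R s)\<^sup>2 - l - k * n\<^sup>2 * \<mu>\<^sup>2))) \<le> F y - F x"
  proof (rule has_integral_le[OF i2 i1])
    fix s assume s: "s \<in> {x..y}"
    have "0 \<le> k * R s * (f1 s + n * \<mu> * f s)\<^sup>2" using k R_nonneg[of s] s xy by (intro mult_nonneg_nonneg) auto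
    then have "(f s)\<^sup>2 * R s * (k * n\<^sup>2 / (R s)\<^sup>2 - l - k * n\<^sup>2 * \<mu>\<^sup>2) \<le>
        R s * (k * n\<^sup>2 / (R s)\<^sup>2 - l) * (f s)\<^sup>2 + k * R s * (f1 s)\<^sup>2 + 2 * n * \<mu> * (k * R s * f1 s * f s)"
      by (simp add: power2_eq_square algebra_simps)
    then show "w s * ((f s)\<^sup>2 * R s * (k * n\<^sup>2 / (R s)\<^sup>2 - l - k * n\<^sup>2 * \<mu>\<^sup>2)) \<le> F' s"
      unfolding F'_def by (intro mult_left_mono) (auto simp: w_def)
  qed
  then show ?thesis by (simp add: F_def w_def)
qed

text \<open>A bound by a multiple of R extends continuity to the pole, where R vanishes; a mode
  itself is controlled on (0, s0] only.\<close>

lemma continuous_on_zero_endI: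
  fixes g :: "real \<Rightarrow> real"
  assumes "continuous_on {0<..s0} g" "g 0 = 0" "\<And>s. s \<in> {0<..s0} \<Longrightarrow> \<bar>g s\<bar> \<le> C * R s"
  shows "continuous_on {0..s0} g"
  unfolding continuous_on_def
proof
  fix s assume s: "s \<in> {0..s0}"
  show "(g \<longlongrightarrow> g s) (at s within {0..s0})"
  proof (cases "s = 0")
    case True
    have "continuous_on {0..s0} R" by (rule continuous_on_subset[OF R_cont]) (use s0 in auto)
    then have "((\<lambda>s. C * R s) \<longlongrightarrow> C * 0) (at 0 within {0..s0})"
      using R_0 s0 by (intro tendsto_mult tendsto_const) (auto simp: continuous_on_def dest!: bspec[of _ _ 0])
    moreover have "eventually (\<lambda>x. norm (g x) \<le> C * R x) (at 0 within {0..s0})"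
      using assms(3) by (auto simp: eventually_at_filter)
    ultimately show ?thesis using True assms(2) by (simp add: Lim_null_comparison)
  next
    case False
    have "(g \<longlongrightarrow> g s) (at s within {0<..s0})" using assms(1) s False by (auto simp: continuous_on_def)
    moreover have "at s within {0<..s0} = at s within {0..s0}"
      by (rule at_within_nhd[of _ "{0<..}"]) (use s False in auto)
    ultimately show ?thesis by simp
  qed
qed

section \<open>Energy estimates for a radial mode\<close>

context
  fixes n l :: real and f f1 f2 h h1 h2 :: "real \<Rightarrow> real"
  assumes n: "n > 0" and mode: "radial_mode n l f f1 f2 h h1 h2"
begin

text \<open>Every integrand carries the factor R and so has the value 0 at the pole, whatever f 0
  is. The bound f = O(R^2) absorbs the singular n^2 / R^2 of the potential.\<close>

lemma mode_cont_left:
  "continuous_on {0..s0} (\<lambda>s. (f s)\<^sup>2 * R s)"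
  "continuous_on {0..s0} (\<lambda>s. R s * f1 s * f s)"
  "continuous_on {0..s0} (\<lambda>s. (f s)\<^sup>2 * R s * (cm * n\<^sup>2 / (R s)\<^sup>2 - l - k))"
proof -
  from mode obtain C where side: "side_solution R R1 n cm l {0<..s0} f f1 f2"
    and C: "\<And>s. s \<in> {0<..s0} \<Longrightarrow> \<bar>f s\<bar> \<le> C * (R s)\<^sup>2 \<and> \<bar>f1 s\<bar> \<le> C * R s"
    unfolding radial_mode_def by blast
  obtain B where B: "B > 0" "\<And>s. s \<in> {0..L} \<Longrightarrow> \<bar>R s\<bar> \<le> B"
    using compact_imp_bounded[OF compact_continuous_image[OF R_cont compact_Icc]] by (auto simp: bounded_pos)
  have Rc: "continuous_on {0<..s0} R" by (rule continuous_on_subset[OF R_cont]) (use s0 in auto)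
  have Rp: "R s > 0" "R s \<le> B" if "s \<in> {0<..s0}" for s using R_pos[of s] B(2)[of s] that s0 by auto
  then have Rn: "\<forall>s\<in>{0<..s0}. R s \<noteq> 0" by (metis less_irrefl)
  have C0: "C \<ge> 0"
  proof -
    have "0 \<le> C * R s0" using C[of s0] s0 by (smt (verit) greaterThanAtMost_iff)
    then show ?thesis using Rs0 by (simp add: zero_le_mult_iff)
  qed
  have bf: "\<bar>f s\<bar> \<le> C * B\<^sup>2" "\<bar>f1 s\<bar> \<le> C * B" if "s \<in> {0<..s0}" for s
  proof -
    have "C * (R s)\<^sup>2 \<le> C * B\<^sup>2" "C * R s \<le> C * B" using C0 Rp[OF that] by (auto intro!: mult_left_mono power_mono)
    then show "\<bar>f s\<bar> \<le> C * B\<^sup>2" "\<bar>f1 s\<bar> \<le> C * B" using C[OF that] by linarith+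
  qed
  have f2R: "(f s)\<^sup>2 \<le> (C * B\<^sup>2)\<^sup>2" if "s \<in> {0<..s0}" for s
    using power_mono[OF bf(1)[OF that], of 2] by simp
  have e1: "\<bar>(f s)\<^sup>2 * R s\<bar> \<le> (C * B\<^sup>2)\<^sup>2 * R s" if "s \<in> {0<..s0}" for s
    using f2R[OF that] Rp[OF that] by (simp add: abs_mult)
  show 1: "continuous_on {0..s0} (\<lambda>s. (f s)\<^sup>2 * R s)"
    by (rule continuous_on_zero_endI[where C = "(C * B\<^sup>2)\<^sup>2"], intro continuous_intros side_solution_cont(1)[OF side] Rc)
      (use R_0 e1 in auto)
  show "continuous_on {0..s0} (\<lambda>s. R s * f1 s * f s)"
  proof (rule continuous_on_zero_endI[where C = "(C * B) * (C * B\<^sup>2)"])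
    show "\<bar>R s * f1 s * f s\<bar> \<le> (C * B) * (C * B\<^sup>2) * R s" if "s \<in> {0<..s0}" for s
    proof -
      have "\<bar>f1 s\<bar> * \<bar>f s\<bar> \<le> (C * B) * (C * B\<^sup>2)" using bf[OF that] B C0 by (intro mult_mono) auto
      from mult_left_mono[OF this, of "R s"] show ?thesis using Rp[OF that] by (simp add: abs_mult mult_ac)
    qed
  qed (use R_0 side_solution_cont[OF side] Rc in \<open>auto intro!: continuous_intros\<close>)
  have "continuous_on {0..s0} (\<lambda>s. cm * n\<^sup>2 * ((f s)\<^sup>2 * R s / (R s)\<^sup>2) - (l + k) * ((f s)\<^sup>2 * R s))"
  proof (rule continuous_on_diff[OF continuous_on_mult[OF continuous_on_const] continuous_on_mult[OF continuous_on_const 1]])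
    show "continuous_on {0..s0} (\<lambda>s. (f s)\<^sup>2 * R s / (R s)\<^sup>2)"
    proof (rule continuous_on_zero_endI[where C = "C\<^sup>2 * B\<^sup>2"])
      show "\<bar>(f s)\<^sup>2 * R s / (R s)\<^sup>2\<bar> \<le> C\<^sup>2 * B\<^sup>2 * R s" if s: "s \<in> {0<..s0}" for s
      proof -
        have "(f s)\<^sup>2 \<le> (C * (R s)\<^sup>2)\<^sup>2" using power_mono[OF conjunct1[OF C[OF s]], of 2] by simp
        also have "\<dots> = C\<^sup>2 * (R s)\<^sup>2 * (R s)\<^sup>2" by (simp add: power2_eq_square)
        also have "\<dots> \<le> C\<^sup>2 * B\<^sup>2 * (R s)\<^sup>2" using Rp[OF s] by (intro mult_right_mono mult_left_mono power_mono) auto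
        finally have "(f s)\<^sup>2 / (R s)\<^sup>2 \<le> C\<^sup>2 * B\<^sup>2" using Rp[OF s] by (simp add: divide_le_eq)
        from mult_right_mono[OF this, of "R s"] show ?thesis using Rp[OF s] by (simp add: abs_mult)
      qed
    qed (use R_0 Rn side_solution_cont[OF side] Rc in \<open>auto intro!: continuous_intros\<close>)
  qed
  then show "continuous_on {0..s0} (\<lambda>s. (f s)\<^sup>2 * R s * (cm * n\<^sup>2 / (R s)\<^sup>2 - l - k))"
    by (simp add: algebra_simps)
qed

lemma mode_cont_right:
  "continuous_on {s0..L} (\<lambda>s. (h s)\<^sup>2 * R s)"
  "continuous_on {s0..L} (\<lambda>s. R s * h1 s * h s)"
  "continuous_on {s0..L} (\<lambda>s. (h s)\<^sup>2 * R s * (cp * n\<^sup>2 / (R s)\<^sup>2 - l - k))"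
proof -
  from mode have side: "side_solution R R1 n cp l {s0..L} h h1 h2"
    unfolding radial_mode_def by blast
  have Rc: "continuous_on {s0..L} R" by (rule continuous_on_subset[OF R_cont]) (use s0 in auto)
  have Rn: "R s \<noteq> 0" if "s \<in> {s0..L}" for s using R_pos[of s] that s0 by auto
  note [continuous_intros] = side_solution_cont[OF side] Rc
  show "continuous_on {s0..L} (\<lambda>s. (h s)\<^sup>2 * R s)" "continuous_on {s0..L} (\<lambda>s. R s * h1 s * h s)"
    by (intro continuous_intros)+
  show "continuous_on {s0..L} (\<lambda>s. (h s)\<^sup>2 * R s * (cp * n\<^sup>2 / (R s)\<^sup>2 - l - k))"
    using Rn by (intro continuous_intros) auto
qed

text \<open>The rates - \<kappa> inside and \<kappa> outside are added. The fluxes at s0 cancel by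
  the transmission condition, both weights being 1 there; the term at the pole vanishes with R, and
  the one at L with h.\<close>

lemma mode_energy:
  "integral {0..s0} (\<lambda>s. exp (2 * n * \<kappa> * (s0 - s)) * ((f s)\<^sup>2 * R s * (cm * n\<^sup>2 / (R s)\<^sup>2 - l - cm * n\<^sup>2 * \<kappa>\<^sup>2))) +
   integral {s0..L} (\<lambda>s. exp (2 * n * \<kappa> * (s - s0)) * ((h s)\<^sup>2 * R s * (cp * n\<^sup>2 / (R s)\<^sup>2 - l - cp * n\<^sup>2 * \<kappa>\<^sup>2))) \<le> 0"
proof -
  from mode have sf: "side_solution R R1 n cm l {0<..s0} f f1 f2" and sh: "side_solution R R1 n cp l {s0..L} h h1 h2"
    and m: "f s0 = h s0" "cm * f1 s0 = cp * h1 s0" "h L = 0" unfolding radial_mode_def by auto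
  have i: "s \<in> interior {0<..s0}" if "s \<in> {0<..<s0}" for s using that by simp
  have i': "s \<in> interior {s0..L}" if "s \<in> {s0<..<L}" for s using that by simp
  have ew: "exp (2 * n * (- \<kappa>) * (s - s0)) = exp (2 * n * \<kappa> * (s0 - s))" for s by (simp add: algebra_simps)
  have "integral {0..s0} (\<lambda>s. exp (2 * n * (- \<kappa>) * (s - s0)) * ((f s)\<^sup>2 * R s * (cm * n\<^sup>2 / (R s)\<^sup>2 - l - cm * n\<^sup>2 * (- \<kappa>)\<^sup>2)))
     \<le> cm * (R s0 * f1 s0 * f s0) * exp (2 * n * (- \<kappa>) * (s0 - s0)) - cm * (R 0 * f1 0 * f 0) * exp (2 * n * (- \<kappa>) * (0 - s0))"
    by (rule energy[where ?f1.0 = f1 and ?f2.0 = f2])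
      (use s0 c side_solution_at[OF sf i] mode_cont_left(2) mode_cont_left(3)[of "cm * n\<^sup>2 * (- \<kappa>)\<^sup>2"] in auto)
  moreover have "integral {s0..L} (\<lambda>s. exp (2 * n * \<kappa> * (s - s0)) * ((h s)\<^sup>2 * R s * (cp * n\<^sup>2 / (R s)\<^sup>2 - l - cp * n\<^sup>2 * \<kappa>\<^sup>2)))
     \<le> cp * (R L * h1 L * h L) * exp (2 * n * \<kappa> * (L - s0)) - cp * (R s0 * h1 s0 * h s0) * exp (2 * n * \<kappa> * (s0 - s0))"
    by (rule energy[where ?f1.0 = h1 and ?f2.0 = h2])
      (use s0 c side_solution_at[OF sh i'] mode_cont_right(2) mode_cont_right(3)[of "cp * n\<^sup>2 * \<kappa>\<^sup>2"] in auto)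
  moreover have "cm * (R s0 * f1 s0 * f s0) = cp * (R s0 * h1 s0 * h s0)"
    using m(1,2) by (metis mult.assoc mult.left_commute)
  ultimately show ?thesis unfolding ew power2_minus using m(3) R_0 by simp
qed

lemma mode_mass_pos: "integral {0..s0} (\<lambda>s. (f s)\<^sup>2 * R s) > 0"
proof -
  have nn: "0 \<le> (f s)\<^sup>2 * R s" if "s \<in> {0..s0}" for s using R_nonneg[of s] that s0 by auto
  have "integral {0..s0} (\<lambda>s. (f s)\<^sup>2 * R s) \<ge> 0"
    by (intro integral_nonneg integrable_continuous_real mode_cont_left) (use nn in auto)
  moreover have "integral {0..s0} (\<lambda>s. (f s)\<^sup>2 * R s) \<noteq> 0"
  proof
    assume "integral {0..s0} (\<lambda>s. (f s)\<^sup>2 * R s) = 0"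
    then have "\<forall>s\<in>{0..s0}. (f s)\<^sup>2 * R s = 0"
      using integral_eq_0_iff[OF mode_cont_left(1)] s0 nn by blast
    from bspec[OF this, of s0] have "f s0 = 0" using Rs0 s0 by auto
    moreover have "\<forall>s\<in>{0<..s0}. f s > 0" using mode unfolding radial_mode_def by blast
    then have "f s0 > 0" using s0 by simp
    ultimately show False by simp
  qed
  ultimately show ?thesis by simp
qed

lemma mode_mass_nonneg:
  "0 \<le> x \<Longrightarrow> y \<le> s0 \<Longrightarrow> integral {x..y} (\<lambda>s. (f s)\<^sup>2 * R s) \<ge> 0"
  "s0 \<le> x \<Longrightarrow> y \<le> L \<Longrightarrow> integral {x..y} (\<lambda>s. (h s)\<^sup>2 * R s) \<ge> 0"
  by (intro integral_nonneg integrable_continuous_real continuous_on_subset[OF mode_cont_left(1)] continuous_on_subset[OF mode_cont_right(1)],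
      use R_nonneg s0 in auto)+

text \<open>For \<kappa> = 0 the energy inequality says that the potential minus l has nonpositive
  integral against the density of the mode. For l < n^2 E0 it would be positive, since the mode has
  mass inside.\<close>

lemma eigenvalue_lower_bound: "n\<^sup>2 * E0 \<le> l"
proof (rule ccontr)
  assume "\<not> n\<^sup>2 * E0 \<le> l"
  then have d: "n\<^sup>2 * E0 - l > 0" by simp
  have "(n\<^sup>2 * E0 - l) * integral {0..s0} (\<lambda>s. (f s)\<^sup>2 * R s) = integral {0..s0} (\<lambda>s. (n\<^sup>2 * E0 - l) * ((f s)\<^sup>2 * R s))"
    by simp
  also have "\<dots> \<le> integral {0..s0} (\<lambda>s. (f s)\<^sup>2 * R s * (cm * n\<^sup>2 / (R s)\<^sup>2 - l - 0))"
  proof (rule integral_le)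
    show "(\<lambda>s. (n\<^sup>2 * E0 - l) * ((f s)\<^sup>2 * R s)) integrable_on {0..s0}"
      "(\<lambda>s. (f s)\<^sup>2 * R s * (cm * n\<^sup>2 / (R s)\<^sup>2 - l - 0)) integrable_on {0..s0}"
      by (rule integrable_continuous_real continuous_on_mult[OF continuous_on_const] mode_cont_left)+
    fix s assume s: "s \<in> {0..s0}"
    show "(n\<^sup>2 * E0 - l) * ((f s)\<^sup>2 * R s) \<le> (f s)\<^sup>2 * R s * (cm * n\<^sup>2 / (R s)\<^sup>2 - l - 0)"
    proof (cases "s = 0")
      case False
      then have "n\<^sup>2 * E0 \<le> n\<^sup>2 * (cm / (R s)\<^sup>2)" using V_left_ge[of s] s by (intro mult_left_mono) auto
      then have "(f s)\<^sup>2 * R s * (n\<^sup>2 * E0 - l) \<le> (f s)\<^sup>2 * R s * (cm * n\<^sup>2 / (R s)\<^sup>2 - l - 0)"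
        using R_nonneg[of s] s s0 by (intro mult_left_mono) (auto simp: mult_ac)
      then show ?thesis by (simp add: mult_ac)
    qed (simp add: R_0)
  qed
  finally have "0 < integral {0..s0} (\<lambda>s. (f s)\<^sup>2 * R s * (cm * n\<^sup>2 / (R s)\<^sup>2 - l - 0))"
    using mult_pos_pos[OF d mode_mass_pos] by linarith
  moreover have "0 \<le> integral {s0..L} (\<lambda>s. (h s)\<^sup>2 * R s * (cp * n\<^sup>2 / (R s)\<^sup>2 - l - 0))"
  proof (rule integral_nonneg[OF integrable_continuous_real[OF mode_cont_right(3)]])
    fix s assume s: "s \<in> {s0..L}"
    have "E0 \<le> cp / (R s)\<^sup>2" using gap s unfolding E0_def by force
    then have "n\<^sup>2 * E0 \<le> n\<^sup>2 * (cp / (R s)\<^sup>2)" by (intro mult_left_mono) auto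
    then have "0 \<le> cp * n\<^sup>2 / (R s)\<^sup>2 - l - 0" using d by (simp add: mult_ac)
    then show "0 \<le> (h s)\<^sup>2 * R s * (cp * n\<^sup>2 / (R s)\<^sup>2 - l - 0)"
      using R_nonneg[of s] s s0 by (intro mult_nonneg_nonneg) auto
  qed
  ultimately show False using mode_energy[of 0] by simp
qed

text \<open>Agmon's estimate with the weight \<open>exp (2 n \<kappa> |s - s0|)\<close>.\<close>

lemma mode_decay:
  assumes \<delta>: "\<delta> > 0" and \<epsilon>: "\<epsilon> > 0" and \<kappa>: "\<kappa> > 0" "cp * \<kappa>\<^sup>2 \<le> \<epsilon>"
    and left: "\<And>s. s \<in> {0<..s0 - \<delta> / 2} \<Longrightarrow> E0 + 4 * \<epsilon> \<le> cm / (R s)\<^sup>2"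
    and right: "\<And>s. s \<in> {s0..L} \<Longrightarrow> E0 + 4 * \<epsilon> \<le> cp / (R s)\<^sup>2"
    and l: "l \<le> n\<^sup>2 * (E0 + \<epsilon>)"
  shows "integral {0..s0 - \<delta>} (\<lambda>s. (f s)\<^sup>2 * R s) + integral {s0 + \<delta>..L} (\<lambda>s. (h s)\<^sup>2 * R s)
    \<le> 2 * exp (- n * \<kappa> * \<delta>) * integral {0..s0} (\<lambda>s. (f s)\<^sup>2 * R s)"
proof -
  define e where "e = n\<^sup>2 * \<epsilon>"
  have e: "e > 0" using n \<epsilon> by (simp add: e_def)
  \<comment> \<open>X is the weight at distance \<delta> from s0 and Y the weight at distance
    \<delta> / 2; the gain is the quotient X / Y = exp(n \<kappa> \<delta>).\<close>
  define X where "X = exp (2 * n * \<kappa> * \<delta>)"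
  define Y where "Y = exp (n * \<kappa> * \<delta>)"
  have XY: "X > 0" "Y > 0" by (auto simp: X_def Y_def)
  define qf where "qf s = cm * n\<^sup>2 / (R s)\<^sup>2 - l - cm * n\<^sup>2 * \<kappa>\<^sup>2" for s
  define qh where "qh s = cp * n\<^sup>2 / (R s)\<^sup>2 - l - cp * n\<^sup>2 * \<kappa>\<^sup>2" for s
  have kk: "cm * n\<^sup>2 * \<kappa>\<^sup>2 \<le> e" "cp * n\<^sup>2 * \<kappa>\<^sup>2 \<le> e"
  proof -
    have "n\<^sup>2 * (cp * \<kappa>\<^sup>2) \<le> e" unfolding e_def using \<kappa> by (intro mult_left_mono) auto
    then show "cp * n\<^sup>2 * \<kappa>\<^sup>2 \<le> e" by (simp add: mult_ac)
    moreover have "cm * (n\<^sup>2 * \<kappa>\<^sup>2) \<le> cp * (n\<^sup>2 * \<kappa>\<^sup>2)" using c by (intro mult_right_mono) auto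
    ultimately show "cm * n\<^sup>2 * \<kappa>\<^sup>2 \<le> e" by (simp add: mult_ac)
  qed
  have l': "l \<le> n\<^sup>2 * E0 + e" using l by (simp add: e_def algebra_simps)
  \<comment> \<open>Of the gap 4 \<epsilon>, one \<epsilon> pays for l and one for the weight.
    Within \<delta> / 2 of s0 on the inner side there is no gap, and the coefficient is only bounded
    below by -2 e.\<close>
  have qf1: "qf s \<ge> e" if "s \<in> {0<..s0 - \<delta> / 2}" for s
  proof -
    have "n\<^sup>2 * (E0 + 4 * \<epsilon>) \<le> n\<^sup>2 * (cm / (R s)\<^sup>2)" using left[OF that] by (intro mult_left_mono) auto
    then show ?thesis unfolding qf_def using kk l' e by (simp add: e_def algebra_simps)
  qed
  have qf2: "qf s \<ge> - 2 * e" if "s \<in> {0<..s0}" for s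
  proof -
    have "n\<^sup>2 * E0 \<le> n\<^sup>2 * (cm / (R s)\<^sup>2)" using V_left_ge[OF that] by (intro mult_left_mono) auto
    then show ?thesis unfolding qf_def using kk l' e by (simp add: algebra_simps)
  qed
  have qh1: "qh s \<ge> e" if "s \<in> {s0..L}" for s
  proof -
    have "n\<^sup>2 * (E0 + 4 * \<epsilon>) \<le> n\<^sup>2 * (cp / (R s)\<^sup>2)" using right[OF that] by (intro mult_left_mono) auto
    then show ?thesis unfolding qh_def using kk l' e by (simp add: e_def algebra_simps)
  qed
  let ?F = "\<lambda>s. (f s)\<^sup>2 * R s" and ?H = "\<lambda>s. (h s)\<^sup>2 * R s"
  let ?wl = "\<lambda>s. exp (2 * n * \<kappa> * (s0 - s))" and ?wr = "\<lambda>s. exp (2 * n * \<kappa> * (s - s0))"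
  have Fnn: "0 \<le> ?F s" if "s \<in> {0..s0}" for s using R_nonneg[of s] that s0 by auto
  have Hnn: "0 \<le> ?H s" if "s \<in> {s0..L}" for s using R_nonneg[of s] that s0 by auto
  have cl: "continuous_on {0..s0} (\<lambda>s. ?wl s * (?F s * qf s))" unfolding qf_def
    by (intro continuous_intros mode_cont_left)
  have cr: "continuous_on {s0..L} (\<lambda>s. ?wr s * (?H s * qh s))" unfolding qh_def
    by (intro continuous_intros mode_cont_right)
  have expl: "?wl s \<ge> X" if "s \<le> s0 - \<delta>" for s
    using that n \<kappa> by (auto simp: X_def intro!: mult_left_mono)
  have expr: "?wr s \<ge> X" if "s \<ge> s0 + \<delta>" for s
    using that n \<kappa> by (auto simp: X_def intro!: mult_left_mono)
  have expy: "?wl s \<le> Y" if "s \<ge> s0 - \<delta> / 2" for s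
  proof -
    have "2 * n * \<kappa> * (s0 - s) \<le> 2 * n * \<kappa> * (\<delta> / 2)" using that n \<kappa> by (intro mult_left_mono) auto
    then show ?thesis by (simp add: Y_def)
  qed
  \<comment> \<open>A negative contribution can only arise within \<delta> / 2 of s0 on the inner
    side, where the weight is at most Y.\<close>
  have near: "?wl s * (?F s * qf s) \<ge> - (2 * e * Y) * ?F s" if s: "s \<in> {0..s0}" for s
  proof (cases "s = 0")
    case False
    show ?thesis
    proof (cases "s \<le> s0 - \<delta> / 2")
      case True
      have "0 \<le> ?wl s * (?F s * qf s)"
        using qf1[of s] True False s e Fnn[OF s] by (intro mult_nonneg_nonneg[of "?wl s"] mult_nonneg_nonneg[of "?F s"]) auto
      moreover have "0 \<le> (2 * e * Y) * ?F s" using Fnn[OF s] e XY by (intro mult_nonneg_nonneg[of "2 * e * Y"]) auto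
      then have "- (2 * e * Y) * ?F s \<le> 0" by simp
      ultimately show ?thesis by (rule order_trans[rotated])
    next
      case nle: False
      have "?wl s * (?F s * qf s) \<ge> ?wl s * (?F s * (- 2 * e))"
        using qf2[of s] False s Fnn[OF s] by (intro mult_left_mono) auto
      moreover have "?wl s * (?F s * (2 * e)) \<le> Y * (?F s * (2 * e))"
        using expy[of s] nle Fnn[OF s] e by (intro mult_right_mono) auto
      ultimately show ?thesis by (simp add: mult_ac)
    qed
  qed (simp add: R_0)
  have L: "integral {0..s0} (\<lambda>s. ?wl s * (?F s * qf s)) \<ge> e * X * integral {0..s0 - \<delta>} ?F - (2 * e * Y) * integral {0..s0} ?F"
  proof (cases "\<delta> < s0")
    case True
    have "integral {0..s0} (\<lambda>s. ?wl s * (?F s * qf s)) =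
        integral {0..s0 - \<delta>} (\<lambda>s. ?wl s * (?F s * qf s)) + integral {s0 - \<delta>..s0} (\<lambda>s. ?wl s * (?F s * qf s))"
      using True \<delta> by (intro Henstock_Kurzweil_Integration.integral_combine[symmetric] integrable_continuous_real cl) auto
    moreover have "integral {0..s0 - \<delta>} (\<lambda>s. ?wl s * (?F s * qf s)) \<ge> integral {0..s0 - \<delta>} (\<lambda>s. (e * X) * ?F s)"
    proof (rule integral_le)
      have "{0..s0 - \<delta>} \<subseteq> {0..s0}" using \<delta> by auto
      then show "(\<lambda>s. (e * X) * ?F s) integrable_on {0..s0 - \<delta>}" "(\<lambda>s. ?wl s * (?F s * qf s)) integrable_on {0..s0 - \<delta>}"
        by (auto intro!: integrable_continuous_real continuous_on_mult[OF continuous_on_const[of _ "e * X"]]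
            intro: continuous_on_subset[OF cl] continuous_on_subset[OF mode_cont_left(1)])
      fix s assume s: "s \<in> {0..s0 - \<delta>}"
      show "(e * X) * ?F s \<le> ?wl s * (?F s * qf s)"
      proof (cases "s = 0")
        case False
        have F: "0 \<le> ?F s" using Fnn[of s] s \<delta> by auto
        have "?F s * e \<le> ?F s * qf s" using qf1[of s] s False \<delta> F by (intro mult_left_mono) auto
        moreover have "0 \<le> ?F s * e" using F e by (intro mult_nonneg_nonneg[of "?F s"]) auto
        ultimately have "X * (?F s * e) \<le> ?wl s * (?F s * qf s)"
          using expl[of s] s XY by (intro mult_mono[of X]) auto
        then show ?thesis by (simp add: mult_ac)
      qed (simp add: R_0)
    qed
    moreover have "integral {s0 - \<delta>..s0} (\<lambda>s. ?wl s * (?F s * qf s)) \<ge> integral {s0 - \<delta>..s0} (\<lambda>s. - (2 * e * Y) * ?F s)"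
      by (intro integral_le integrable_continuous_real continuous_on_mult[OF continuous_on_const[of _ "- (2 * e * Y)"]]
          continuous_on_subset[OF cl] continuous_on_subset[OF mode_cont_left(1)])
        (use near True \<delta> in auto)
    moreover have "integral {0..s0} ?F = integral {0..s0 - \<delta>} ?F + integral {s0 - \<delta>..s0} ?F"
      using True \<delta> by (intro Henstock_Kurzweil_Integration.integral_combine[symmetric] integrable_continuous_real mode_cont_left(1)) auto
    moreover have "0 \<le> (2 * e * Y) * integral {0..s0 - \<delta>} ?F"
      using mode_mass_nonneg(1)[of 0 "s0 - \<delta>"] \<delta> e XY by (intro mult_nonneg_nonneg) auto
    moreover have "integral {0..s0 - \<delta>} (\<lambda>s. (e * X) * ?F s) = (e * X) * integral {0..s0 - \<delta>} ?F"
      "integral {s0 - \<delta>..s0} (\<lambda>s. - (2 * e * Y) * ?F s) = - (2 * e * Y) * integral {s0 - \<delta>..s0} ?F"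
      by (rule integral_mult_right)+
    moreover have aux: "I \<ge> x * a - y * J"
      if "I = i + j" "i' \<le> i" "j' \<le> j" "J = a + b" "0 \<le> y * a" "i' = x * a" "j' = - y * b" for I i j i' j' J a b x y :: real
    proof -
      have "y * J = y * a + y * b" unfolding that(4) by (rule distrib_left)
      with that show ?thesis by simp
    qed
    ultimately show ?thesis by blast
  next
    case False
    \<comment> \<open>For \<delta> >= s0 no positive s lies that far inside: the interval is empty
      or a single point.\<close>
    have z: "integral {0..s0 - \<delta>} ?F = 0"
      using False R_0 by (cases "s0 = \<delta>") (auto simp: not_less)
    have "integral {0..s0} (\<lambda>s. ?wl s * (?F s * qf s)) \<ge> integral {0..s0} (\<lambda>s. - (2 * e * Y) * ?F s)"
      by (intro integral_le integrable_continuous_real continuous_on_mult[OF continuous_on_const[of _ "- (2 * e * Y)"]] cl mode_cont_left(1))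
        (use near in auto)
    then show ?thesis using z by simp
  qed
  have rnn: "0 \<le> ?wr s * (?H s * qh s)" if s: "s \<in> {s0..L}" for s
    using qh1[OF s] e Hnn[OF s] by (intro mult_nonneg_nonneg[of "?wr s"] mult_nonneg_nonneg[of "?H s"]) auto
  have Rr: "integral {s0..L} (\<lambda>s. ?wr s * (?H s * qh s)) \<ge> e * X * integral {s0 + \<delta>..L} ?H"
  proof (cases "s0 + \<delta> < L")
    case True
    have "integral {s0..L} (\<lambda>s. ?wr s * (?H s * qh s)) =
        integral {s0..s0 + \<delta>} (\<lambda>s. ?wr s * (?H s * qh s)) + integral {s0 + \<delta>..L} (\<lambda>s. ?wr s * (?H s * qh s))"
      using True \<delta> by (intro Henstock_Kurzweil_Integration.integral_combine[symmetric] integrable_continuous_real cr) auto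
    moreover have "integral {s0..s0 + \<delta>} (\<lambda>s. ?wr s * (?H s * qh s)) \<ge> 0"
      by (intro integral_nonneg integrable_continuous_real continuous_on_subset[OF cr]) (use rnn True in auto)
    moreover have "integral {s0 + \<delta>..L} (\<lambda>s. ?wr s * (?H s * qh s)) \<ge> integral {s0 + \<delta>..L} (\<lambda>s. (e * X) * ?H s)"
    proof (rule integral_le)
      have "{s0 + \<delta>..L} \<subseteq> {s0..L}" using \<delta> by auto
      then show "(\<lambda>s. (e * X) * ?H s) integrable_on {s0 + \<delta>..L}" "(\<lambda>s. ?wr s * (?H s * qh s)) integrable_on {s0 + \<delta>..L}"
        by (auto intro!: integrable_continuous_real continuous_on_mult[OF continuous_on_const[of _ "e * X"]]
            intro: continuous_on_subset[OF cr] continuous_on_subset[OF mode_cont_right(1)])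
      fix s assume s: "s \<in> {s0 + \<delta>..L}"
      have H: "0 \<le> ?H s" using Hnn[of s] s \<delta> by auto
      have "?H s * e \<le> ?H s * qh s" using qh1[of s] s \<delta> H by (intro mult_left_mono) auto
      moreover have "0 \<le> ?H s * e" using H e by (intro mult_nonneg_nonneg[of "?H s"]) auto
      ultimately have "X * (?H s * e) \<le> ?wr s * (?H s * qh s)"
        using expr[of s] s XY by (intro mult_mono[of X]) auto
      then show "(e * X) * ?H s \<le> ?wr s * (?H s * qh s)" by (simp add: mult_ac)
    qed
    ultimately show ?thesis by simp
  next
    case False
    have "integral {s0 + \<delta>..L} ?H = 0"
      using False mode by (cases "s0 + \<delta> = L") (auto simp: not_less)
    moreover have "integral {s0..L} (\<lambda>s. ?wr s * (?H s * qh s)) \<ge> 0"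
      by (intro integral_nonneg integrable_continuous_real cr) (use rnn in auto)
    ultimately show ?thesis by simp
  qed
  have "integral {0..s0} (\<lambda>s. ?wl s * (?F s * qf s)) + integral {s0..L} (\<lambda>s. ?wr s * (?H s * qh s)) \<le> 0"
    using mode_energy[of \<kappa>] unfolding qf_def qh_def .
  with L Rr have "e * X * (integral {0..s0 - \<delta>} ?F + integral {s0 + \<delta>..L} ?H) \<le> e * (2 * Y * integral {0..s0} ?F)"
    by (simp add: algebra_simps)
  then have "X * (integral {0..s0 - \<delta>} ?F + integral {s0 + \<delta>..L} ?H) \<le> 2 * Y * integral {0..s0} ?F"
    using e by (simp add: mult.assoc)
  \<comment> \<open>Y = X exp(- n \<kappa> \<delta>) turns the comparison of weights into the decay
    factor.\<close>
  moreover have "2 * Y * integral {0..s0} ?F = X * (2 * exp (- n * \<kappa> * \<delta>) * integral {0..s0} ?F)"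
    by (simp add: X_def Y_def exp_add[symmetric] algebra_simps)
  ultimately show ?thesis using XY by simp
qed

end

text \<open>One \<kappa> and one N serve all modes. \<epsilon> is a quarter of the smaller gap;
  Picone's bound with \<epsilon> / 2 leaves room for its O(1) term once n^2 >= 2 |A| / \<epsilon>;
  the inner rate satisfies cp \<kappa>^2 <= \<epsilon>. The factor \<delta> is absorbed into the
  rate returned.\<close>

lemma decay_rate:
  assumes \<delta>: "\<delta> > 0"
  shows "\<exists>\<kappa>>0. \<exists>N. \<forall>n\<ge>N. \<forall>l f f1 f2 h h1 h2. radial_mode n l f f1 f2 h h1 h2 \<longrightarrow>
     integral {0..s0 - \<delta>} (\<lambda>s. (f s)\<^sup>2 * R s) + integral {s0 + \<delta>..L} (\<lambda>s. (h s)\<^sup>2 * R s)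
       \<le> 2 * exp (- n * \<kappa>) * integral {0..s0} (\<lambda>s. (f s)\<^sup>2 * R s)"
proof -
  obtain \<epsilon>1 where \<epsilon>1: "\<epsilon>1 > 0" "\<And>s. s \<in> {0<..s0 - \<delta> / 2} \<Longrightarrow> E0 + \<epsilon>1 \<le> cm / (R s)\<^sup>2"
    using left_gap[of "\<delta> / 2"] \<delta> by auto
  obtain \<epsilon>2 where \<epsilon>2: "\<epsilon>2 > 0" "\<And>s. s \<in> {s0..L} \<Longrightarrow> E0 + \<epsilon>2 \<le> cp / (R s)\<^sup>2"
    using gap unfolding E0_def by auto
  define \<epsilon> where "\<epsilon> = min \<epsilon>1 \<epsilon>2 / 4"
  have \<epsilon>: "\<epsilon> > 0" "4 * \<epsilon> \<le> \<epsilon>1" "4 * \<epsilon> \<le> \<epsilon>2" using \<epsilon>1 \<epsilon>2 by (auto simp: \<epsilon>_def)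
  obtain A where A: "\<And>n l f f1 f2. side_solution R R1 n cm l {0<..s0} f f1 f2 \<Longrightarrow> (\<forall>s\<in>{0<..s0}. f s > 0) \<Longrightarrow>
      l \<le> n\<^sup>2 * (E0 + \<epsilon> / 2) + A" using eigenvalue_upper_bound[of "\<epsilon> / 2"] \<epsilon>(1) by (metis half_gt_zero)
  define \<kappa> where "\<kappa> = sqrt (\<epsilon> / cp)"
  have cp: "cp > 0" using c by simp
  have \<kappa>: "\<kappa> > 0" "cp * \<kappa>\<^sup>2 \<le> \<epsilon>" using \<epsilon> cp by (auto simp: \<kappa>_def)
  define N where "N = max 1 (2 * \<bar>A\<bar> / \<epsilon>)"
  have "integral {0..s0 - \<delta>} (\<lambda>s. (f s)\<^sup>2 * R s) + integral {s0 + \<delta>..L} (\<lambda>s. (h s)\<^sup>2 * R s)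
       \<le> 2 * exp (- n * (\<kappa> * \<delta>)) * integral {0..s0} (\<lambda>s. (f s)\<^sup>2 * R s)"
    if n: "n \<ge> N" and m: "radial_mode n l f f1 f2 h h1 h2" for n l f f1 f2 h h1 h2
  proof -
    have n1: "n \<ge> 1" "2 * \<bar>A\<bar> / \<epsilon> \<le> n" using n by (auto simp: N_def)
    have "2 * \<bar>A\<bar> / \<epsilon> \<le> n\<^sup>2" using n1 self_le_power[of n 2] by linarith
    then have "A \<le> n\<^sup>2 * (\<epsilon> / 2)" using \<epsilon>(1) by (simp add: field_simps)
    moreover have "l \<le> n\<^sup>2 * (E0 + \<epsilon> / 2) + A" using A m unfolding radial_mode_def by blast
    ultimately have l: "l \<le> n\<^sup>2 * (E0 + \<epsilon>)" by (simp add: algebra_simps)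
    have "E0 + 4 * \<epsilon> \<le> cm / (R s)\<^sup>2" if "s \<in> {0<..s0 - \<delta> / 2}" for s using \<epsilon>1(2)[OF that] \<epsilon> by linarith
    moreover have "E0 + 4 * \<epsilon> \<le> cp / (R s)\<^sup>2" if "s \<in> {s0..L}" for s using \<epsilon>2(2)[OF that] \<epsilon> by linarith
    ultimately show ?thesis
      using mode_decay[OF _ m \<delta> \<epsilon>(1) \<kappa> _ _ l] n1 by (simp add: mult_ac)
  qed
  moreover have "\<kappa> * \<delta> > 0" using \<kappa> \<delta> by simp
  ultimately show ?thesis by blast
qed

end

section \<open>Geometry of the surface\<close>

lemma smooth_on_subset:
  assumes B: "smooth_on B f" and "A \<subseteq> B"
  shows "smooth_on A f"
  unfolding smooth_on_def
proof
  fix x assume "x \<in> A"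
  then obtain U F where "open U" "x \<in> U" "\<And>k. Ck_on k U F" "\<And>y. y \<in> B \<inter> U \<Longrightarrow> F y = f y"
    using B \<open>A \<subseteq> B\<close> unfolding smooth_on_def by (metis subsetD)
  with \<open>A \<subseteq> B\<close> show "\<exists>U F. open U \<and> x \<in> U \<and> (\<forall>k. Ck_on k U F) \<and> (\<forall>y\<in>A \<inter> U. F y = f y)"
    by (intro exI[of _ U] exI[of _ F]) auto
qed

lemma Ck_on_Pair:
  fixes f :: "'a::euclidean_space \<Rightarrow> 'b::real_normed_vector" and g :: "'a \<Rightarrow> 'c::real_normed_vector"
  assumes "open U" "Ck_on k U f" "Ck_on k U g"
  shows "Ck_on k U (\<lambda>x. (f x, g x))"
proof -
  have "bounded_linear (\<lambda>x::'b. (x, 0::'c))" "bounded_linear (\<lambda>x::'c. (0::'b, x))"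
    by (auto intro!: bounded_linear_Pair bounded_linear_ident bounded_linear_zero)
  from Ck_on_add[OF assms(1) Ck_on_linear[OF assms(1) this(1) assms(2)] Ck_on_linear[OF assms(1) this(2) assms(3)]]
  show ?thesis by simp
qed

text \<open>The local extensions have to be merged into one derivative, continuous up to the ends.
  This works because a derivative within a nondegenerate interval is unique, so
  \<open>vector_derivative\<close> agrees with each of them.\<close>

lemma smooth_on_real_derivative:
  fixes f :: "real \<Rightarrow> real"
  assumes f: "smooth_on {a..b} f" and ab: "a < b"
  obtains f1 where "\<And>s. s \<in> {a..b} \<Longrightarrow> (f has_real_derivative f1 s) (at s within {a..b})"
    "continuous_on {a..b} f1"
proof -
  define f1 where "f1 s = vector_derivative f (at s within {a..b})" for s
  have loc: "\<exists>U D. open U \<and> x \<in> U \<and> continuous_on U D \<and>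
      (\<forall>y\<in>{a..b} \<inter> U. (f has_real_derivative D y) (at y within {a..b}) \<and> f1 y = D y)" if x: "x \<in> {a..b}" for x
  proof -
    obtain U F where U: "open U" "x \<in> U" "\<And>k. Ck_on k U F" "\<And>y. y \<in> {a..b} \<inter> U \<Longrightarrow> F y = f y"
      using f x unfolding smooth_on_def by metis
    define D where "D y = frechet_derivative F (at y) 1" for y
    have D: "continuous_on U D"
      unfolding D_def by (rule Ck_on_imp_continuous_on[OF Ck_on_real_derivative(2)[OF U(3)]])
    have d: "(f has_real_derivative D y) (at y within {a..b})" if y: "y \<in> {a..b} \<inter> U" for y
    proof -
      have "(F has_real_derivative D y) (at y within {a..b})"
        unfolding D_def using Ck_on_real_derivative(1)[OF U(3)] y by (blast intro: has_field_derivative_at_within)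
      moreover obtain e where "e > 0" "ball y e \<subseteq> U" using U(1) y by (meson IntD2 openE)
      moreover from this have "F z = f z" if "z \<in> {a..b}" "dist z y < e" for z
        using U(4)[of z] that by (auto simp: dist_commute subset_iff)
      ultimately show ?thesis
        by (intro has_field_derivative_transform_within[of F "D y" y "{a..b}" e f]) (use y in auto)
    qed
    moreover have "f1 y = D y" if y: "y \<in> {a..b} \<inter> U" for y
      unfolding f1_def using d[OF y] y ab vector_derivative_within_cbox[of a b y f "D y"]
      by (auto simp: has_real_derivative_iff_has_vector_derivative)
    ultimately show ?thesis using U(1,2) D by blast
  qed
  show thesis
  proof (rule that[of f1])
    show "(f has_real_derivative f1 s) (at s within {a..b})" if "s \<in> {a..b}" for s
      using loc[OF that] that by force
    show "continuous_on {a..b} f1"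
      unfolding continuous_on_def
    proof
      fix x assume x: "x \<in> {a..b}"
      then obtain U D where U: "open U" "x \<in> U" "continuous_on U D" "\<And>y. y \<in> {a..b} \<inter> U \<Longrightarrow> f1 y = D y"
        using loc by metis
      have "(D \<longlongrightarrow> D x) (at x)" using U(1-3) continuous_on_eq_continuous_at isCont_def by blast
      then have "(D \<longlongrightarrow> f1 x) (at x within {a..b})" using U(2,4) x by (simp add: Lim_at_imp_Lim_at_within)
      then show "(f1 \<longlongrightarrow> f1 x) (at x within {a..b})"
        by (rule Lim_transform_eventually) (use U in \<open>auto simp: eventually_at_topological\<close>)
    qed
  qed
qed

section \<open>Polar coordinates and lifted functions\<close>

locale revolution =
  fixes M :: "(real^3) set" and a e N :: "real^3" and L :: real and R :: "real \<Rightarrow> real"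
    and \<zeta> :: "real^3 \<Rightarrow> real \<times> complex"
  assumes surf: "surface_of_revolution M a e N L R \<zeta>"
begin

abbreviation P :: "real \<times> real \<Rightarrow> real^3" where "P \<equiv> polar M N \<zeta>"

definition \<xi> :: "real \<times> complex \<Rightarrow> real^3" where "\<xi> = inv_into (M - {N}) \<zeta>"

lemma L_pos: "0 < L" and N_mem: "N \<in> M" and M_compact: "compact M" and R_0: "R 0 = 0"
  and R_pos: "s \<in> {0<..L} \<Longrightarrow> 0 < R s" and R_smooth: "smooth_on {0..L} R"
  using surf by (auto simp: surface_of_revolution_def)

lemma diffeo_\<zeta>: "diffeo (M - {N}) ({0<..L} \<times> sphere 0 1) \<zeta>"
  using surf by (simp add: surface_of_revolution_def)

lemma bij_\<zeta>: "bij_betw \<zeta> (M - {N}) ({0<..L} \<times> sphere 0 1)"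
  and smooth_\<zeta>: "smooth_on (M - {N}) \<zeta>"
  and smooth_\<xi>: "smooth_on ({0<..L} \<times> sphere 0 1) \<xi>"
  using diffeo_\<zeta> by (auto simp: diffeo_def \<xi>_def)

lemma \<xi>_mem: "p \<in> {0<..L} \<times> sphere 0 1 \<Longrightarrow> \<xi> p \<in> M - {N}"
  and \<zeta>_\<xi>: "p \<in> {0<..L} \<times> sphere 0 1 \<Longrightarrow> \<zeta> (\<xi> p) = p"
  and \<xi>_\<zeta>: "m \<in> M - {N} \<Longrightarrow> \<xi> (\<zeta> m) = m"
  and \<zeta>_mem: "m \<in> M - {N} \<Longrightarrow> \<zeta> m \<in> {0<..L} \<times> sphere 0 1"
  unfolding \<xi>_def using bij_\<zeta> bij_betw_inv_into[OF bij_\<zeta>]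
    bij_betw_inv_into_right[OF bij_\<zeta>] bij_betw_inv_into_left[OF bij_\<zeta>]
  by (auto dest: bij_betwE)

lemma P_eq: "P (s, t) = \<xi> (s, cis t)"
  by (simp add: polar_def \<xi>_def)

lemma \<zeta>_P: "s \<in> {0<..L} \<Longrightarrow> \<zeta> (P (s, t)) = (s, cis t)"
  and P_mem: "s \<in> {0<..L} \<Longrightarrow> P (s, t) \<in> M - {N}"
  using \<zeta>_\<xi>[of "(s, cis t)"] \<xi>_mem[of "(s, cis t)"] by (auto simp: P_eq)

lemma cont_\<xi>: "continuous_on ({0<..L} \<times> sphere 0 1) \<xi>"
  and cont_\<zeta>: "continuous_on (M - {N}) \<zeta>"
  using smooth_\<xi> smooth_\<zeta> smooth_on_imp_continuous_on by blast+

lemma compact_annulus: "0 < x \<Longrightarrow> y \<le> L \<Longrightarrow> compact (\<xi> ` ({x..y} \<times> sphere 0 1))"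
  by (intro compact_continuous_image continuous_on_subset[OF cont_\<xi>] compact_Times) auto

lemma P_vimage_Omega:
  assumes s: "s \<in> {0<..L}" and s0: "s0 \<in> {0<..<L}"
  shows "P (s, t) \<in> Omega_minus M N \<zeta> s0 \<longleftrightarrow> s < s0" "P (s, t) \<in> Omega_plus M N L \<zeta> s0 \<longleftrightarrow> s0 < s"
proof -
  have eq: "P (s, t) \<in> \<xi> ` (J \<times> sphere 0 1) \<longleftrightarrow> s \<in> J" if "J \<subseteq> {0<..L}" for J
  proof
    assume "P (s, t) \<in> \<xi> ` (J \<times> sphere 0 1)"
    then obtain p where p: "p \<in> J \<times> sphere 0 1" "P (s, t) = \<xi> p" by blast
    then have "\<zeta> (P (s, t)) = p" using \<zeta>_\<xi>[of p] that by auto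
    then show "s \<in> J" using \<zeta>_P[OF s, of t] p by auto
  next
    assume "s \<in> J"
    then show "P (s, t) \<in> \<xi> ` (J \<times> sphere 0 1)" by (auto simp: P_eq)
  qed
  show "P (s, t) \<in> Omega_minus M N \<zeta> s0 \<longleftrightarrow> s < s0"
  proof -
    have "{0<..<s0} \<subseteq> {0<..L}" using s0 by auto
    from eq[OF this] show ?thesis using P_mem[OF s, of t] s by (simp add: Omega_minus_def \<xi>_def[symmetric])
  qed
  show "P (s, t) \<in> Omega_plus M N L \<zeta> s0 \<longleftrightarrow> s0 < s"
  proof -
    have "{s0<..L} \<subseteq> {0<..L}" using s0 by auto
    from eq[OF this] show ?thesis using s by (simp add: Omega_plus_def \<xi>_def[symmetric])
  qed
qed

lemma closure_Omega:
  assumes "0 < s0" "s0 < L"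
  shows "closure (Omega_minus M N \<zeta> s0) \<subseteq> M" "closure (Omega_plus M N L \<zeta> s0) \<subseteq> M"
proof -
  have "\<xi> ` ({0<..<s0} \<times> sphere 0 1) \<subseteq> M" "\<xi> ` ({s0<..L} \<times> sphere 0 1) \<subseteq> M"
    using \<xi>_mem assms by fastforce+
  then have "Omega_minus M N \<zeta> s0 \<subseteq> M" "Omega_plus M N L \<zeta> s0 \<subseteq> M"
    using N_mem by (auto simp: Omega_minus_def Omega_plus_def \<xi>_def)
  then show "closure (Omega_minus M N \<zeta> s0) \<subseteq> M" "closure (Omega_plus M N L \<zeta> s0) \<subseteq> M"
    using compact_imp_closed[OF M_compact] by (auto simp: closure_minimal)
qed

text \<open>This is g(s) exp(i n \<theta>): the power of the circle coordinate needs no choice of an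
  angle. The pole receives the value 0, in accordance with the flatness of the modes.\<close>

definition lift :: "nat \<Rightarrow> (real \<Rightarrow> real) \<Rightarrow> real^3 \<Rightarrow> complex" where
  "lift n g m = (if m \<in> M - {N} then of_real (g (fst (\<zeta> m))) * snd (\<zeta> m) ^ n else 0)"

lemma lift_P: "s \<in> {0<..L} \<Longrightarrow> lift n g (P (s, t)) = of_real (g s) * cis (real n * t)"
  using \<zeta>_P[of s t] P_mem[of s t] Complex.DeMoivre[of t n] by (simp add: lift_def)

lemma lift_support:
  assumes "0 < d" "\<And>s. s \<in> {0<..L} \<Longrightarrow> s < d \<or> s > d' \<Longrightarrow> g s = 0" "d' \<le> L" "m \<in> M" "lift n g m \<noteq> 0"
  shows "m \<in> \<xi> ` ({d..d'} \<times> sphere 0 1)"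
proof -
  have m: "m \<in> M - {N}" "g (fst (\<zeta> m)) \<noteq> 0" using assms(5) by (auto simp: lift_def split: if_splits)
  then have "fst (\<zeta> m) \<in> {d..d'}" using assms(2)[of "fst (\<zeta> m)"] \<zeta>_mem[OF m(1)] by (force simp: not_less)
  then have "\<zeta> m \<in> {d..d'} \<times> sphere 0 1" using \<zeta>_mem[OF m(1)] by (auto simp: mem_Times_iff)
  then show ?thesis using \<xi>_\<zeta>[OF m(1)] by (metis image_eqI)
qed

text \<open>As g vanishes for s < d, the lift is 0 on M outside a compact annulus that avoids N, so
  the zero function extends it near the pole. Elsewhere the local extensions of \<zeta> are composed
  with g.\<close>

lemma smooth_on_lift:
  assumes g: "\<And>k. Ck_on k UNIV g" and d: "0 < d" "\<And>s. s < d \<Longrightarrow> g s = 0"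
  shows "smooth_on M (lift n g)"
  unfolding smooth_on_def
proof
  fix x assume x: "x \<in> M"
  show "\<exists>U F. open U \<and> x \<in> U \<and> (\<forall>k. Ck_on k U F) \<and> (\<forall>y\<in>M \<inter> U. F y = lift n g y)"
  proof (cases "x = N")
    case True
    let ?K = "\<xi> ` ({d..L} \<times> sphere 0 1)"
    have "open (- ?K)" using compact_annulus[OF d(1) order_refl] compact_imp_closed by auto
    moreover have "\<xi> q \<noteq> N" if "q \<in> {d..L} \<times> sphere 0 1" for q using \<xi>_mem[of q] that d(1) by auto
    then have "x \<in> - ?K" using True by blast
    moreover have "\<forall>k. Ck_on k (- ?K) (\<lambda>x. 0 :: complex)" using \<open>open (- ?K)\<close> Ck_on_const by blast
    moreover have "\<forall>y\<in>M \<inter> - ?K. 0 = lift n g y"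
      using lift_support[of d L g _ n] d by fastforce
    ultimately show ?thesis by blast
  next
    case False
    then obtain U Z where U: "open U" "x \<in> U" "\<And>k. Ck_on k U Z" "\<And>y. y \<in> (M - {N}) \<inter> U \<Longrightarrow> Z y = \<zeta> y"
      using smooth_\<zeta> x unfolding smooth_on_def by (metis Diff_iff singletonD)
    let ?U = "U - {N}"
    have o: "open ?U" using U(1) by auto
    have Z: "Ck_on k ?U Z" for k using Ck_on_subset[OF U(3)] by blast
    have "Ck_on k ?U (\<lambda>y. of_real (g (fst (Z y))) * snd (Z y) ^ n :: complex)" for k
    proof (intro Ck_on_mult Ck_on_power o)
      have "Ck_on k ?U (\<lambda>y. g (fst (Z y)))"
        by (rule Ck_on_compose[OF o open_UNIV _ Ck_on_linear[OF o bounded_linear_fst Z] g]) auto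
      then show "Ck_on k ?U (\<lambda>y. of_real (g (fst (Z y))) :: complex)"
        by (rule Ck_on_linear[OF o bounded_linear_of_real])
      show "Ck_on k ?U (\<lambda>y. snd (Z y))" by (rule Ck_on_linear[OF o bounded_linear_snd Z])
    qed
    moreover have "\<forall>y\<in>M \<inter> ?U. of_real (g (fst (Z y))) * snd (Z y) ^ n = lift n g y"
      using U(4) by (auto simp: lift_def)
    ultimately show ?thesis using o U(2) False by blast
  qed
qed

text \<open>An explicit interior chart: (s, z) goes to s z, which maps the part of M - {N} with s <
  L onto the punctured open disk of radius L.\<close>

lemma interior_not_boundary:
  assumes x: "x \<in> M - {N}" "fst (\<zeta> x) < L"
  shows "x \<notin> surface_boundary M"
proof -
  \<comment> \<open>Charts take values in \<open>real^2\<close>, whereas the circle lies in the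
    complex plane; the two linear maps identify them.\<close>
  define v2c where "v2c w = of_real (w $ 1) + \<i> * of_real (w $ 2)" for w :: "real^2"
  define c2v :: "complex \<Rightarrow> real^2" where "c2v z = Re z *\<^sub>R axis 1 1 + Im z *\<^sub>R axis 2 1" for z
  have bl: "bounded_linear v2c" "bounded_linear c2v"
    unfolding v2c_def c2v_def
    by (intro bounded_linear_add bounded_linear_mult_right[THEN bounded_linear_compose] bounded_linear_of_real[THEN bounded_linear_compose]
        bounded_linear_vec_nth bounded_linear_scaleR_left[THEN bounded_linear_compose] bounded_linear_Re bounded_linear_Im)+
  have vc: "v2c (c2v z) = z" for z
    by (simp add: v2c_def c2v_def axis_def complex_eq_iff)
  have cv: "c2v (v2c w) = w" for w
    by (simp add: v2c_def c2v_def vec_eq_iff forall_2 axis_def)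
  define V where "V = {w. 0 < cmod (v2c w) \<and> cmod (v2c w) < L}"
  have cont: "continuous_on UNIV v2c" using bl(1) by (simp add: linear_continuous_on)
  have oV: "open V" unfolding V_def
    by (intro open_Collect_conj open_Collect_less continuous_intros cont)
  have "openin (top_of_set (M - {N})) ((M - {N}) \<inter> \<zeta> -` (fst -` {..<L}))"
    by (rule continuous_openin_preimage_gen[OF cont_\<zeta>]) (auto intro!: open_vimage continuous_intros)
  then obtain T where T: "open T" "(M - {N}) \<inter> \<zeta> -` (fst -` {..<L}) = (M - {N}) \<inter> T"
    unfolding openin_open by blast
  define W where "W = T - {N}"
  have W: "open W" "x \<in> W" using T x by (auto simp: W_def)
  have MW: "y \<in> M \<inter> W \<longleftrightarrow> y \<in> M - {N} \<and> fst (\<zeta> y) < L" for y using T(2) by (auto simp: W_def)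
  have MWe: "M \<inter> W = {y \<in> M - {N}. fst (\<zeta> y) < L}" using MW by auto
  define f where "f y = c2v (of_real (fst (\<zeta> y)) * snd (\<zeta> y))" for y
  define p where "p w = (cmod (v2c w), v2c w / of_real (cmod (v2c w)))" for w
  have p: "p w \<in> {0<..L} \<times> sphere 0 1" "fst (p w) < L" if "w \<in> V" for w
    using that by (auto simp: p_def V_def norm_divide)
  have fy: "f y \<in> V \<and> p (f y) = \<zeta> y" if y: "y \<in> M \<inter> W" for y
  proof -
    obtain s z where sz: "\<zeta> y = (s, z)" by force
    have "0 < s" "cmod z = 1" "s < L" using \<zeta>_mem[of y] y MW[of y] sz by auto
    moreover from this have "z \<noteq> 0" by auto
    ultimately show ?thesis by (simp add: f_def p_def V_def vc sz norm_mult)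
  qed
  have \<xi>p: "\<xi> (p w) \<in> M \<inter> W" "f (\<xi> (p w)) = w" if w: "w \<in> V" for w
  proof -
    show "\<xi> (p w) \<in> M \<inter> W" unfolding MWe using \<xi>_mem[OF p(1)[OF w]] \<zeta>_\<xi>[OF p(1)[OF w]] p(2)[OF w] by simp
    have "v2c w \<noteq> 0" using w by (auto simp: V_def)
    then show "f (\<xi> (p w)) = w" using \<zeta>_\<xi>[OF p(1)[OF w]] by (simp add: f_def p_def cv)
  qed
  have bij: "bij_betw f (M \<inter> W) V"
    by (rule bij_betw_byWitness[where f' = "\<lambda>w. \<xi> (p w)"]) (use fy \<xi>p \<xi>_\<zeta> in \<open>auto simp: MWe\<close>)
  have inv: "inv_into (M \<inter> W) f w = \<xi> (p w)" if "w \<in> V" for w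
    by (rule inv_into_f_eq) (use bij \<xi>p[OF that] in \<open>auto simp: bij_betw_def\<close>)
  have "smooth_on (M \<inter> W) f"
    unfolding smooth_on_def
  proof
    fix y assume y: "y \<in> M \<inter> W"
    then have "y \<in> M - {N}" using MW by auto
    then obtain U Z where U: "open U" "y \<in> U" "\<And>k. Ck_on k U Z" "\<And>y. y \<in> (M - {N}) \<inter> U \<Longrightarrow> Z y = \<zeta> y"
      using smooth_\<zeta> unfolding smooth_on_def by metis
    have "Ck_on k U (\<lambda>y. c2v (of_real (fst (Z y)) * snd (Z y)))" for k
      by (intro Ck_on_linear[OF U(1) bl(2)] Ck_on_mult U(1) Ck_on_linear[OF U(1) bounded_linear_of_real]
          Ck_on_linear[OF U(1) bounded_linear_fst] Ck_on_linear[OF U(1) bounded_linear_snd] U(3))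
    moreover have "\<forall>y\<in>(M \<inter> W) \<inter> U. c2v (of_real (fst (Z y)) * snd (Z y)) = f y"
      using U(4) MW by (auto simp: f_def)
    ultimately show "\<exists>U F. open U \<and> y \<in> U \<and> (\<forall>k. Ck_on k U F) \<and> (\<forall>y\<in>(M \<inter> W) \<inter> U. F y = f y)"
      using U(1,2) by blast
  qed
  moreover have "smooth_on V (inv_into (M \<inter> W) f)"
    unfolding smooth_on_def
  proof
    fix w assume w: "w \<in> V"
    obtain U G where U: "open U" "p w \<in> U" "\<And>k. Ck_on k U G" "\<And>q. q \<in> ({0<..L} \<times> sphere 0 1) \<inter> U \<Longrightarrow> G q = \<xi> q"
      using smooth_\<xi> p(1)[OF w] unfolding smooth_on_def by metis
    have sq: "Ck_on k V (\<lambda>w. (Re (v2c w))\<^sup>2 + (Im (v2c w))\<^sup>2)" for k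
      unfolding power2_eq_square
      by (intro Ck_on_add Ck_on_mult oV Ck_on_linear[OF oV bounded_linear_Re] Ck_on_linear[OF oV bounded_linear_Im]
          Ck_on_linear[OF oV bl(1)] Ck_on_ident)
    have sqp: "(\<lambda>w. (Re (v2c w))\<^sup>2 + (Im (v2c w))\<^sup>2) ` V \<subseteq> {0<..}"
      by (auto simp: V_def cmod_power2[symmetric])
    have pw: "Ck_on k V (\<lambda>w. ((Re (v2c w))\<^sup>2 + (Im (v2c w))\<^sup>2) powr b)" for k b
      by (rule Ck_on_compose[OF oV open_greaterThan sqp sq Ck_on_powr])
    \<comment> \<open>Modulus and inverse modulus are powers of Re^2 + Im^2, which is positive on V,
      so their smoothness follows from that of \<open>powr\<close>.\<close>
    have e: "((Re z)\<^sup>2 + (Im z)\<^sup>2) powr (1 / 2) = cmod z" "((Re z)\<^sup>2 + (Im z)\<^sup>2) powr (- (1 / 2)) = inverse (cmod z)" for z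
      by (simp_all add: powr_minus powr_half_sqrt cmod_def)
    have p_eq: "p w = (((Re (v2c w))\<^sup>2 + (Im (v2c w))\<^sup>2) powr (1 / 2),
        of_real (((Re (v2c w))\<^sup>2 + (Im (v2c w))\<^sup>2) powr (- (1 / 2))) * v2c w)" for w
      unfolding e p_def by (simp add: divide_inverse mult.commute)
    have pV: "Ck_on k V p" for k
      unfolding p_eq[abs_def]
      by (intro Ck_on_Pair oV pw Ck_on_mult Ck_on_linear[OF oV bounded_linear_of_real] Ck_on_linear[OF oV bl(1)] Ck_on_ident)
    have "continuous_on V p" by (rule Ck_on_imp_continuous_on[OF pV])
    then have oU: "open (V \<inter> p -` U)" using continuous_open_preimage oV U(1) by blast
    have "Ck_on k (V \<inter> p -` U) (\<lambda>w. G (p w))" for k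
      by (rule Ck_on_compose[OF oU U(1) _ Ck_on_subset[OF pV] U(3)]) auto
    moreover have "\<forall>y\<in>V \<inter> (V \<inter> p -` U). G (p y) = inv_into (M \<inter> W) f y"
      using U(4) p(1) inv by auto
    ultimately show "\<exists>U F. open U \<and> w \<in> U \<and> (\<forall>k. Ck_on k U F) \<and> (\<forall>y\<in>V \<inter> U. F y = inv_into (M \<inter> W) f y)"
      using oU w U(2) by blast
  qed
  ultimately have "diffeomorphic (M \<inter> W) V"
    unfolding diffeomorphic_def diffeo_def using bij by blast
  then show ?thesis using W oV unfolding surface_boundary_def by blast
qed

text \<open>Vanishing near both ends confines the closed support to a compact annulus with s < L,
  whose points are interior.\<close>

lemma lift_support_boundary:
  assumes d: "0 < d" "\<And>s. s < d \<Longrightarrow> g s = 0" "\<And>s. s > L - d \<Longrightarrow> g s = 0"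
  shows "closure {x\<in>M. lift n g x \<noteq> 0} \<inter> surface_boundary M = {}"
proof -
  let ?K = "\<xi> ` ({d..L - d} \<times> sphere 0 1)"
  have "{x\<in>M. lift n g x \<noteq> 0} \<subseteq> ?K" using lift_support[of d "L - d" g _ n] d by auto
  moreover have "closed ?K" using compact_annulus[OF d(1), of "L - d"] d(1) compact_imp_closed by auto
  ultimately have "closure {x\<in>M. lift n g x \<noteq> 0} \<subseteq> ?K" by (rule closure_minimal)
  moreover have "y \<notin> surface_boundary M" if y: "y \<in> ?K" for y
  proof -
    obtain q where q: "q \<in> {d..L - d} \<times> sphere 0 1" "y = \<xi> q" using y by blast
    then have "q \<in> {0<..L} \<times> sphere 0 1" using d(1) by auto
    then have "y \<in> M - {N}" "\<zeta> y = q" using \<xi>_mem \<zeta>_\<xi> q(2) by auto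
    moreover have "fst q < L" using q(1) d(1) by (auto simp: mem_Times_iff)
    ultimately show ?thesis by (metis interior_not_boundary)
  qed
  ultimately show ?thesis by blast
qed

section \<open>Meridians and the distance to the interface\<close>

lemma meridian_derivative:
  obtains X where "\<And>s. s \<in> {0<..<L} \<Longrightarrow> ((\<lambda>s. P (s, t)) has_vector_derivative X s) (at s)"
    "continuous_on {0<..<L} X" "\<And>s. s \<in> {0<..<L} \<Longrightarrow> norm (X s) = 1"
proof -
  define X where "X s = vector_derivative (\<lambda>s. P (s, t)) (at s)" for s
  have loc: "\<exists>U D. open U \<and> s \<in> U \<and> continuous_on U D \<and> (\<forall>y\<in>U. ((\<lambda>s. P (s, t)) has_vector_derivative D y) (at y))"
    if s: "s \<in> {0<..<L}" for s
  proof -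
    obtain U G where U: "open U" "(s, cis t) \<in> U" "\<And>k. Ck_on k U G" "\<And>q. q \<in> ({0<..L} \<times> sphere 0 1) \<inter> U \<Longrightarrow> G q = \<xi> q"
      using smooth_\<xi> s unfolding smooth_on_def by (metis (no_types, lifting) SigmaI greaterThanAtMost_iff greaterThanLessThan_iff less_imp_le mem_sphere_0 norm_cis)
    define U' where "U' = {0<..<L} \<inter> (\<lambda>s. (s, cis t)) -` U"
    have oU: "open U'" unfolding U'_def by (intro open_Int open_vimage U(1) continuous_intros open_greaterThanLessThan)
    have lin: "Ck_on k U' (\<lambda>s. (s, cis t))" for k
      by (intro Ck_on_Pair oU Ck_on_ident Ck_on_const)
    have C: "Ck_on k U' (\<lambda>s. G (s, cis t))" for k
      by (rule Ck_on_compose[OF oU U(1) _ lin U(3)]) (auto simp: U'_def)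
    define D where "D y = frechet_derivative (\<lambda>s. G (s, cis t)) (at y) 1" for y
    have "continuous_on U' D"
      unfolding D_def using C[of 1] by simp
    moreover have "((\<lambda>s. P (s, t)) has_vector_derivative D y) (at y)" if y: "y \<in> U'" for y
    proof -
      have d: "((\<lambda>s. G (s, cis t)) has_derivative frechet_derivative (\<lambda>s. G (s, cis t)) (at y)) (at y)"
        using Ck_on_SucD(1)[OF C y] .
      have "frechet_derivative (\<lambda>s. G (s, cis t)) (at y) = (\<lambda>h. h *\<^sub>R D y)"
      proof
        show "frechet_derivative (\<lambda>s. G (s, cis t)) (at y) h = h *\<^sub>R D y" for h
          using linear_cmul[OF has_derivative_linear[OF d], of h 1] by (simp add: D_def)
      qed
      with d have "((\<lambda>s. G (s, cis t)) has_vector_derivative D y) (at y)"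
        by (simp add: has_vector_derivative_def)
      then show ?thesis
        by (rule has_vector_derivative_transform_within_open[OF _ oU y]) (use U(4) in \<open>auto simp: U'_def P_eq\<close>)
    qed
    ultimately show ?thesis using oU s U(2) by (intro exI[of _ U'] exI[of _ D]) (auto simp: U'_def)
  qed
  have XD: "((\<lambda>s. P (s, t)) has_vector_derivative X s) (at s)" if "s \<in> {0<..<L}" for s
    using loc[OF that] unfolding X_def by (metis vector_derivative_at)
  show thesis
  proof (rule that[OF XD])
    show "continuous_on {0<..<L} X"
      unfolding continuous_on_eq_continuous_at[OF open_greaterThanLessThan]
    proof
      fix s assume "s \<in> {0<..<L}"
      from loc[OF this] obtain U D where U: "open U" "s \<in> U" "continuous_on U D" "\<And>y. y \<in> U \<Longrightarrow> X y = D y"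
        unfolding X_def by (metis vector_derivative_at)
      then have "continuous_on U X" by (simp cong: continuous_on_cong)
      then show "isCont X s" using U(1,2) continuous_on_eq_continuous_at by blast
    qed
    show "norm (X s) = 1" if s: "s \<in> {0<..<L}" for s
    proof -
      have "at s within {0<..L} = at s" using s by (intro at_within_interior) auto
      moreover have "vector_derivative (\<lambda>\<sigma>. P (\<sigma>, t)) (at s within {0<..L}) \<bullet> vector_derivative (\<lambda>\<sigma>. P (\<sigma>, t)) (at s within {0<..L}) = 1"
        using surf s unfolding surface_of_revolution_def Let_def by auto
      ultimately have "X s \<bullet> X s = 1" by (simp add: X_def)
      then show ?thesis by (simp add: norm_eq_sqrt_inner)
    qed
  qed
qed

text \<open>The meridian from s to s0 is an admissible curve, and since
  \<open>\<partial>/\<partial>s\<close> has unit length its length is |s0 - s|.\<close>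

lemma dist_meridian:
  assumes s: "s \<in> {0<..L}" and s0: "s0 \<in> {0<..<L}"
  shows "dist_g M (P (s, t)) (P (s0, t)) \<le> ennreal \<bar>s0 - s\<bar>"
proof -
  obtain X where X: "\<And>s. s \<in> {0<..<L} \<Longrightarrow> ((\<lambda>s. P (s, t)) has_vector_derivative X s) (at s)"
    "continuous_on {0<..<L} X" "\<And>s. s \<in> {0<..<L} \<Longrightarrow> norm (X s) = 1"
    using meridian_derivative[of t] by blast
  define \<sigma> where "\<sigma> \<tau> = s + \<tau> * (s0 - s)" for \<tau>
  define \<gamma> where "\<gamma> \<tau> = P (\<sigma> \<tau>, t)" for \<tau>
  have conv: "\<sigma> \<tau> = (1 - \<tau>) * s + \<tau> * s0" for \<tau> by (simp add: \<sigma>_def algebra_simps)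
  have \<sigma>1: "\<sigma> \<tau> \<in> {0<..L}" if "\<tau> \<in> {0..1}" for \<tau>
    unfolding conv using convexD_alt[of "{0<..L}" s s0 \<tau>] s s0 that by (auto simp: convex_real_interval)
  have \<sigma>2: "\<sigma> \<tau> \<in> {0<..<L}" if "\<tau> \<in> {0<..<1}" for \<tau>
  proof -
    have "\<tau> * s0 < \<tau> * L" "(1 - \<tau>) * s \<le> (1 - \<tau>) * L" using that s s0 by (auto intro!: mult_left_mono)
    then have "\<sigma> \<tau> < L" unfolding conv by (simp add: algebra_simps)
    then show ?thesis using \<sigma>1[of \<tau>] that by auto
  qed
  have d\<gamma>: "(\<gamma> has_vector_derivative (s0 - s) *\<^sub>R X (\<sigma> \<tau>)) (at \<tau>)" if "\<tau> \<in> {0<..<1}" for \<tau>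
  proof -
    have "(\<sigma> has_vector_derivative (s0 - s)) (at \<tau>)"
      unfolding \<sigma>_def has_real_derivative_iff_has_vector_derivative[symmetric] by (auto intro!: derivative_eq_intros)
    from vector_diff_chain_at[OF this X(1)[OF \<sigma>2[OF that]]] show ?thesis
      by (simp add: o_def \<gamma>_def[abs_def])
  qed
  have c\<gamma>: "continuous_on {0..1} \<gamma>"
    unfolding \<gamma>_def P_eq
    by (rule continuous_on_compose2[OF cont_\<xi>]) (use \<sigma>1 in \<open>auto simp: \<sigma>_def intro!: continuous_intros\<close>)
  \<comment> \<open>For s = L the coordinates stop at the starting point of the curve, so two-sided
    derivatives are available at interior parameters only; both ends go into the exceptional
    set.\<close>
  have c1: "\<gamma> C1_differentiable_on ({0..1} - {0, 1})"
    unfolding C1_differentiable_on_def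
  proof (intro exI conjI ballI)
    show "(\<gamma> has_vector_derivative (s0 - s) *\<^sub>R X (\<sigma> \<tau>)) (at \<tau>)" if "\<tau> \<in> {0..1} - {0, 1}" for \<tau>
      using d\<gamma>[of \<tau>] that by force
    show "continuous_on ({0..1} - {0, 1}) (\<lambda>\<tau>. (s0 - s) *\<^sub>R X (\<sigma> \<tau>))"
    proof (intro continuous_on_scaleR continuous_on_const continuous_on_compose2[OF X(2)])
      show "continuous_on ({0..1} - {0, 1}) \<sigma>" unfolding \<sigma>_def by (intro continuous_intros)
      show "\<sigma> ` ({0..1} - {0, 1}) \<subseteq> {0<..<L}" by (intro image_subsetI \<sigma>2) auto
    qed
  qed
  have pc: "\<gamma> piecewise_C1_differentiable_on {0..1}"
    unfolding piecewise_C1_differentiable_on_def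
    by (rule conjI[OF c\<gamma>], rule exI[of _ "{0, 1}"], rule conjI[OF _ c1]) simp
  have "curve_length \<gamma> \<le> (\<integral>\<^sup>+ \<tau>\<in>{0..1::real}. ennreal \<bar>s0 - s\<bar> \<partial>lborel)"
    unfolding curve_length_def
  proof (rule nn_integral_mono_AE)
    have "AE \<tau> in lborel. \<tau> \<noteq> 0 \<and> \<tau> \<noteq> (1::real)"
      using AE_lborel_singleton[of 0] AE_lborel_singleton[of "1::real"] by eventually_elim auto
    then show "AE \<tau> in lborel. ennreal (norm (vector_derivative \<gamma> (at \<tau>))) * indicator {0..1} \<tau> \<le> ennreal \<bar>s0 - s\<bar> * indicator {0..1} \<tau>"
    proof eventually_elim
      case (elim \<tau>)
      show ?case
      proof (cases "\<tau> \<in> {0<..<1}")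
        case True
        then show ?thesis using vector_derivative_at[OF d\<gamma>[OF True]] X(3)[OF \<sigma>2[OF True]] by simp
      next
        case False
        then have "\<tau> \<notin> {0..1}" using elim by auto
        then show ?thesis by simp
      qed
    qed
  qed
  also have "\<dots> = ennreal \<bar>s0 - s\<bar>" by (simp add: nn_integral_cmult_indicator)
  finally have le: "curve_length \<gamma> \<le> ennreal \<bar>s0 - s\<bar>" .
  have "dist_g M (P (s, t)) (P (s0, t)) \<le> curve_length \<gamma>"
    unfolding dist_g_def
  proof (rule Inf_lower, intro CollectI exI conjI)
    show "\<gamma> ` {0..1} \<subseteq> M" using P_mem \<sigma>1 by (auto simp: \<gamma>_def)
  qed (use pc in \<open>auto simp: \<gamma>_def \<sigma>_def\<close>)
  with le show ?thesis by (rule order_trans[rotated])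
qed

text \<open>Every point of \<omega> is joined to the interface by its own meridian, so a positive
  distance keeps s away from s0. A finite \<delta> below the distance is chosen because the distance
  may be infinite.\<close>

lemma away_from_interface:
  assumes s0: "s0 \<in> {0<..<L}" and pos: "setdist_g M (closure \<omega>) (interface M N \<zeta> s0) > 0"
  obtains \<delta> where "\<delta> > 0" "\<And>s t. s \<in> {0<..L} \<Longrightarrow> P (s, t) \<in> \<omega> \<Longrightarrow> \<delta> \<le> \<bar>s - s0\<bar>"
proof -
  obtain q where q: "0 < q" "q < setdist_g M (closure \<omega>) (interface M N \<zeta> s0)" using dense[OF pos] by blast
  then have "q \<noteq> top" by auto
  then obtain \<delta> where \<delta>: "q = ennreal \<delta>" "\<delta> \<ge> 0" by (cases q) auto
  show thesis
  proof (rule that[of \<delta>])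
    show "\<delta> > 0" using q \<delta> by (cases "\<delta> = 0") auto
    fix s t assume s: "s \<in> {0<..L}" and "P (s, t) \<in> \<omega>"
    then have "P (s, t) \<in> closure \<omega>" using closure_subset by blast
    moreover have "P (s0, t) \<in> interface M N \<zeta> s0" by (auto simp: interface_def polar_def)
    ultimately have "setdist_g M (closure \<omega>) (interface M N \<zeta> s0) \<le> dist_g M (P (s, t)) (P (s0, t))"
      unfolding setdist_g_def by (meson INF_lower2 order_refl)
    also have "\<dots> \<le> ennreal \<bar>s0 - s\<bar>" by (rule dist_meridian[OF s s0])
    finally have "ennreal \<delta> < ennreal \<bar>s0 - s\<bar>" using q \<delta> by simp
    then show "\<delta> \<le> \<bar>s - s0\<bar>" using \<delta>(2) by (simp add: ennreal_less_iff abs_minus_commute)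
  qed
qed

end

section \<open>Smooth approximation on the interval\<close>

lemma Ck_on_real_polynomial:
  fixes p :: "real \<Rightarrow> real"
  shows "real_polynomial_function p \<Longrightarrow> Ck_on k UNIV p"
proof (induction rule: real_polynomial_function.induct)
  case (linear f)
  then show ?case using Ck_on_linear[OF open_UNIV linear Ck_on_ident[OF open_UNIV]] by simp
qed (auto intro: Ck_on_const Ck_on_add Ck_on_mult)

lemma real_polynomial_antiderivative:
  fixes q :: "real \<Rightarrow> real"
  assumes "real_polynomial_function q"
  shows "\<exists>Q. real_polynomial_function Q \<and> Q x0 = y0 \<and> (\<forall>x. (Q has_real_derivative q x) (at x))"
proof -
  obtain a n where q: "q = (\<lambda>x. \<Sum>i\<le>n. a i * x ^ i)"
    using assms unfolding real_polynomial_function_iff_sum by blast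
  define Q where "Q x = (\<Sum>i\<le>n. (a i / real (Suc i)) * (x ^ i * x))" for x
  have "((\<lambda>x. (a i / real (Suc i)) * (x ^ i * x)) has_real_derivative a i * x ^ i) (at x)" for i x
  proof -
    have "((\<lambda>x. (a i / real (Suc i)) * x ^ Suc i) has_real_derivative a i * x ^ i) (at x)"
      by (rule DERIV_cong[OF DERIV_cmult[OF DERIV_pow[of "Suc i"]]]) (simp del: of_nat_Suc)
    then show ?thesis by (simp only: power_Suc2)
  qed
  then have dQ: "(Q has_real_derivative q x) (at x)" for x
    unfolding Q_def q by (intro DERIV_sum) auto
  have "real_polynomial_function Q"
    unfolding Q_def
    by (intro real_polynomial_function_sum real_polynomial_function.intros(4) real_polynomial_function_power
        real_polynomial_function.intros(2) real_polynomial_function.intros(1) bounded_linear_ident) auto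
  then have "real_polynomial_function (\<lambda>x. Q x + (y0 - Q x0))"
    by (intro real_polynomial_function.intros(3) real_polynomial_function.intros(2))
  moreover have "((\<lambda>x. Q x + (y0 - Q x0)) has_real_derivative q x) (at x)" for x
    using DERIV_add[OF dQ DERIV_const] by simp
  ultimately show ?thesis by (intro exI[of _ "\<lambda>x. Q x + (y0 - Q x0)"]) auto
qed

lemma derivative_bound:
  fixes f g :: "real \<Rightarrow> real"
  assumes "\<And>x. x \<in> {a..b} \<Longrightarrow> (f has_real_derivative f1 x) (at x within {a..b})"
    and "\<And>x. x \<in> {a..b} \<Longrightarrow> (g has_real_derivative g1 x) (at x within {a..b})"
    and "\<And>x. x \<in> {a..b} \<Longrightarrow> \<bar>f1 x - g1 x\<bar> \<le> B" "x \<in> {a..b}" "y \<in> {a..b}"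
  shows "\<bar>f x - g x\<bar> \<le> \<bar>f y - g y\<bar> + B * \<bar>x - y\<bar>"
proof -
  have "norm ((f x - g x) - (f y - g y)) \<le> B * norm (x - y)"
    by (rule field_differentiable_bound[where S = "{a..b}" and f = "\<lambda>x. f x - g x" and f' = "\<lambda>x. f1 x - g1 x"])
      (use assms in \<open>auto intro!: DERIV_diff\<close>)
  then show ?thesis by (simp add: abs_minus_commute)
qed

text \<open>Approximate f'' by a polynomial and integrate twice from the data of f at a; each
  integration multiplies the error by at most the length of the interval.\<close>

lemma polynomial_C2_approx:
  fixes f f1 f2 :: "real \<Rightarrow> real"
  assumes ab: "a \<le> b" and \<epsilon>: "\<epsilon> > 0"
    and f: "\<And>x. x \<in> {a..b} \<Longrightarrow> (f has_real_derivative f1 x) (at x within {a..b})"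
    and f1: "\<And>x. x \<in> {a..b} \<Longrightarrow> (f1 has_real_derivative f2 x) (at x within {a..b})"
    and f2: "continuous_on {a..b} f2"
  obtains p p1 p2 where "\<And>k. Ck_on k UNIV p" "\<And>x. (p has_real_derivative p1 x) (at x)"
    "\<And>x. (p1 has_real_derivative p2 x) (at x)"
    "\<And>x. x \<in> {a..b} \<Longrightarrow> \<bar>p x - f x\<bar> \<le> \<epsilon> \<and> \<bar>p1 x - f1 x\<bar> \<le> \<epsilon> \<and> \<bar>p2 x - f2 x\<bar> \<le> \<epsilon>"
proof -
  \<comment> \<open>l is at least 1 and at least the length, so an error \<epsilon> / l^2 in f''
    survives two integrations.\<close>
  define l where "l = 1 + (b - a)"
  have l: "l \<ge> 1" using ab by (simp add: l_def)
  define e where "e = \<epsilon> / l\<^sup>2"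
  have e: "e > 0" "e * l * l = \<epsilon>" using \<epsilon> l by (auto simp: e_def power2_eq_square)
  obtain p2 where p2: "real_polynomial_function p2" "\<And>x. x \<in> {a..b} \<Longrightarrow> \<bar>f2 x - p2 x\<bar> < e"
    using Stone_Weierstrass_real_polynomial_function[OF compact_Icc f2 e(1)] by blast
  obtain p1 where p1: "real_polynomial_function p1" "p1 a = f1 a" "\<And>x. (p1 has_real_derivative p2 x) (at x)"
    using real_polynomial_antiderivative[OF p2(1)] by blast
  obtain p where p: "real_polynomial_function p" "p a = f a" "\<And>x. (p has_real_derivative p1 x) (at x)"
    using real_polynomial_antiderivative[OF p1(1)] by blast
  have le: "e \<le> e * l" "e * l \<le> e * l * l" using mult_left_mono[of 1 l e] mult_left_mono[of 1 l "e * l"] e(1) l by auto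
  have b1: "\<bar>p1 x - f1 x\<bar> \<le> e * l" if "x \<in> {a..b}" for x
  proof -
    have "\<bar>p1 x - f1 x\<bar> \<le> \<bar>p1 a - f1 a\<bar> + e * \<bar>x - a\<bar>"
      by (rule derivative_bound[OF has_field_derivative_at_within[OF p1(3)] f1])
        (use p2(2) that ab in \<open>auto simp: abs_minus_commute less_imp_le\<close>)
    also have "\<dots> \<le> e * l" using p1(2) that e(1) by (auto simp: l_def intro!: mult_left_mono)
    finally show ?thesis .
  qed
  have b0: "\<bar>p x - f x\<bar> \<le> e * l * l" if "x \<in> {a..b}" for x
  proof -
    have "\<bar>p x - f x\<bar> \<le> \<bar>p a - f a\<bar> + (e * l) * \<bar>x - a\<bar>"
      by (rule derivative_bound[OF has_field_derivative_at_within[OF p(3)] f b1])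
        (use that ab in auto)
    also have "\<dots> \<le> e * l * l" using p(2) that e(1) l by (auto simp: l_def intro!: mult_left_mono)
    finally show ?thesis .
  qed
  show thesis
  proof (rule that[of p p1 p2])
    show "\<bar>p x - f x\<bar> \<le> \<epsilon> \<and> \<bar>p1 x - f1 x\<bar> \<le> \<epsilon> \<and> \<bar>p2 x - f2 x\<bar> \<le> \<epsilon>" if "x \<in> {a..b}" for x
      using b0[OF that] b1[OF that] p2(2)[OF that] e(2) le by linarith
  qed (use Ck_on_real_polynomial[OF p(1)] p(3) p1(3) in auto)
qed

lemma Ck_on_affine: "Ck_on k UNIV (\<lambda>s::real. a * s + b)"
  by (intro Ck_on_add Ck_on_mult Ck_on_const Ck_on_ident open_UNIV)

section \<open>Cutoffs at the pole, the interface and the boundary\<close>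

context profile
begin

text \<open>The layers in which a cutoff or a ramp of width 1/k may be active.\<close>

definition bad :: "nat \<Rightarrow> real set" where
  "bad k = {0..2 / real k} \<union> {s0..s0 + 1 / real k} \<union> {L - 2 / real k..L}"

text \<open>One dominating function for all squared errors: bounded on the thin layers and O(1/k)
  off them, so that its integral is O(1/k).\<close>

definition majorant :: "real \<Rightarrow> nat \<Rightarrow> real \<Rightarrow> real" where
  "majorant C k s = C * indicator (bad k) s + C / real k"

lemma majorant_bad: "C \<ge> 0 \<Longrightarrow> s \<in> bad k \<Longrightarrow> x \<le> C \<Longrightarrow> x \<le> majorant C k s"
  by (simp add: majorant_def add_increasing2)

lemma majorant_good: "C \<ge> 0 \<Longrightarrow> x \<le> C / real k \<Longrightarrow> x \<le> majorant C k s"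
  by (auto simp: majorant_def indicator_def)

lemma R_upper: obtains Rm where "Rm > 0" "\<And>s. s \<in> {0..L} \<Longrightarrow> R s \<le> Rm"
proof -
  obtain B where B: "B > 0" "\<And>s. s \<in> {0..L} \<Longrightarrow> \<bar>R s\<bar> \<le> B"
    using compact_imp_bounded[OF compact_continuous_image[OF R_cont compact_Icc]] by (auto simp: bounded_pos)
  show thesis by (rule that[OF B(1)]) (use B(2) in fastforce)
qed

lemma R_lower:
  assumes "0 < a" "a \<le> L"
  obtains r where "r > 0" "\<And>s. s \<in> {a..L} \<Longrightarrow> r \<le> R s"
proof -
  have "\<exists>x\<in>{a..L}. \<forall>y\<in>{a..L}. R x \<le> R y"
    using assms by (intro continuous_attains_inf continuous_on_subset[OF R_cont]) auto
  then obtain x where "x \<in> {a..L}" "\<And>y. y \<in> {a..L} \<Longrightarrow> R x \<le> R y" by blast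
  with assms R_pos[of x] that[of "R x"] show thesis by auto
qed

lemma R_le_linear: "s \<in> {0..L} \<Longrightarrow> R s \<le> K * s"
proof -
  assume s: "s \<in> {0..L}"
  have "\<bar>R s - 0\<bar> \<le> \<bar>R 0 - 0\<bar> + K * \<bar>s - 0\<bar>"
    by (rule derivative_bound[where g = "\<lambda>_. 0" and ?g1.0 = "\<lambda>_. 0", OF dR]) (use s s0 K in auto)
  then show ?thesis using R_0 s by simp
qed

lemma K_pos: "K > 0"
proof (rule ccontr)
  assume "\<not> K > 0"
  then have "R s0 \<le> 0" using R_le_linear[of s0] s0 by (smt (verit) atLeastAtMost_iff mult_nonneg_nonneg mult_nonpos_nonneg)
  then show False using R_pos[of s0] s0 by auto
qed

text \<open>g is a cutoff at the pole times a polynomial. On the transition layer s <= 2/k each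
  derivative of the cutoff costs a factor k, but k R <= 2 K, so it is paid by one factor R of |f| <=
  C R^2 and |f'| <= C R. The errors, weighted as in the polar Hessian, stay bounded there.\<close>

lemma H2_approximation:
  assumes J: "J = {0<..\<beta>} \<or> (\<exists>\<alpha>>0. \<alpha> < \<beta> \<and> J = {\<alpha>..\<beta>})" and \<beta>: "0 < \<beta>" "\<beta> \<le> L"
    and f: "\<And>s. s \<in> J \<Longrightarrow> (f has_real_derivative f1 s) (at s within J)"
    and f1: "\<And>s. s \<in> J \<Longrightarrow> (f1 has_real_derivative f2 s) (at s within J)"
    and f2: "continuous_on J f2"
    and C: "C \<ge> 0" "\<And>s. s \<in> J \<Longrightarrow> \<bar>f s\<bar> \<le> C * (R s)\<^sup>2 \<and> \<bar>f1 s\<bar> \<le> C * R s \<and> \<bar>f2 s\<bar> \<le> C"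
  obtains C' k0 where "C' \<ge> 0" "k0 \<ge> 1" "\<And>k. k \<ge> k0 \<Longrightarrow> \<exists>g g1 g2. (\<forall>m. Ck_on m UNIV g) \<and>
      (\<forall>x. (g has_real_derivative g1 x) (at x) \<and> (g1 has_real_derivative g2 x) (at x)) \<and>
      (\<forall>s. s < 1 / real k \<longrightarrow> g s = 0) \<and>
      (\<forall>s\<in>J. (g2 s - f2 s)\<^sup>2 + ((g1 s - f1 s) / R s)\<^sup>2 + ((g s - f s) / (R s)\<^sup>2)\<^sup>2
         \<le> C' * indicator {0..2 / real k} s + C' / real k)"
proof -
  obtain \<eta> \<eta>1 \<eta>2 B where \<eta>: "\<And>k. Ck_on k UNIV \<eta>" "\<And>x. (\<eta> has_real_derivative \<eta>1 x) (at x)"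
    "\<And>x. (\<eta>1 has_real_derivative \<eta>2 x) (at x)"
    "\<And>x. x \<le> 1 \<Longrightarrow> \<eta> x = 0" "\<And>x. x \<ge> 2 \<Longrightarrow> \<eta> x = 1"
    "\<And>x. \<bar>\<eta> x\<bar> \<le> B" "\<And>x. \<bar>\<eta>1 x\<bar> \<le> B" "\<And>x. \<bar>\<eta>2 x\<bar> \<le> B"
    "\<And>x. x < 1 \<or> x > 2 \<Longrightarrow> \<eta>1 x = 0" "\<And>x. x < 1 \<or> x > 2 \<Longrightarrow> \<eta>2 x = 0"
    using smooth_cutoff by blast
  have B0: "B \<ge> 0" using \<eta>(6)[of 0] by simp
  define D where "D = C + 1"
  define b2 where "b2 = 4 * K\<^sup>2 * B * D + 4 * K * B * D + B * D + C"
  define b1 where "b1 = 2 * K * B * D + B * D + C"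
  define b0 where "b0 = B * D + C"
  define C' where "C' = 3 + b2\<^sup>2 + b1\<^sup>2 + b0\<^sup>2"
  obtain k0 :: nat where k0: "1 / \<beta> < real k0" using reals_Archimedean2 by blast
  have "k0 \<ge> 1" using k0 \<beta>(1) by (cases k0) (auto simp: field_simps not_less[symmetric])
  have JL: "J \<subseteq> {0<..L}" using J \<beta> by auto
  show thesis
  proof (rule that[of C' k0])
    show "C' \<ge> 0" by (simp add: C'_def)
    show "k0 \<ge> 1" by fact
    fix k :: nat assume k: "k \<ge> k0"
    define \<kappa> where "\<kappa> = real k"
    have \<kappa>: "\<kappa> \<ge> 1" "1 / \<kappa> < \<beta>" "\<kappa> > 0"
      using k k0 \<open>k0 \<ge> 1\<close> \<beta>(1) by (auto simp: \<kappa>_def field_simps intro: less_le_trans[of 1 "\<beta> * real k0"])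
    obtain r where r: "r > 0" "\<And>s. s \<in> {1 / \<kappa>..L} \<Longrightarrow> r \<le> R s"
      using R_lower[of "1 / \<kappa>"] \<kappa> \<beta> by auto
    \<comment> \<open>Accuracy relative to r, a lower bound of R beyond 1/k: the polynomial errors
      remain O(1/k) after division by R or R^2.\<close>
    define \<epsilon> where "\<epsilon> = min 1 (min r (r\<^sup>2)) / \<kappa>"
    have \<epsilon>: "\<epsilon> > 0" "\<epsilon> \<le> 1 / \<kappa>" "\<epsilon> \<le> r / \<kappa>" "\<epsilon> \<le> r\<^sup>2 / \<kappa>"
      using r(1) \<kappa> by (auto simp: \<epsilon>_def intro!: divide_right_mono)
    \<comment> \<open>The polynomial approximates f on a compact interval inside J; closer to the
      pole g vanishes because of the cutoff.\<close>
    obtain x0 where x0: "x0 \<le> \<beta>" "{x0..\<beta>} \<subseteq> J" "\<And>s. s \<in> J \<Longrightarrow> 1 / \<kappa> \<le> s \<Longrightarrow> s \<in> {x0..\<beta>}"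
    proof (cases "J = {0<..\<beta>}")
      case True
      moreover have "0 < 1 / \<kappa>" using \<kappa> by simp
      then have "x \<in> {0<..\<beta>}" if "x \<in> {1 / \<kappa>..\<beta>}" for x
        using that less_le_trans[of 0 "1 / \<kappa>" x] unfolding atLeastAtMost_iff greaterThanAtMost_iff by blast
      then have "{1 / \<kappa>..\<beta>} \<subseteq> {0<..\<beta>}" by blast
      ultimately show thesis using that[of "1 / \<kappa>"] \<kappa> by auto
    next
      case False
      then obtain \<alpha> where "\<alpha> > 0" "\<alpha> < \<beta>" "J = {\<alpha>..\<beta>}" using J by auto
      then show thesis using that[of \<alpha>] by auto
    qed
    obtain p p1 p2 where p: "\<And>k. Ck_on k UNIV p" "\<And>x. (p has_real_derivative p1 x) (at x)"
      "\<And>x. (p1 has_real_derivative p2 x) (at x)"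
      "\<And>x. x \<in> {x0..\<beta>} \<Longrightarrow> \<bar>p x - f x\<bar> \<le> \<epsilon> \<and> \<bar>p1 x - f1 x\<bar> \<le> \<epsilon> \<and> \<bar>p2 x - f2 x\<bar> \<le> \<epsilon>"
    proof (rule polynomial_C2_approx[OF x0(1) \<epsilon>(1)])
      show "(f has_real_derivative f1 x) (at x within {x0..\<beta>})" if "x \<in> {x0..\<beta>}" for x
        using has_field_derivative_subset[OF f x0(2)] that x0(2) by blast
      show "(f1 has_real_derivative f2 x) (at x within {x0..\<beta>})" if "x \<in> {x0..\<beta>}" for x
        using has_field_derivative_subset[OF f1 x0(2)] that x0(2) by blast
      show "continuous_on {x0..\<beta>} f2" by (rule continuous_on_subset[OF f2 x0(2)])
    qed blast
    define g where "g s = \<eta> (\<kappa> * s + 0) * p s" for s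
    define g1 where "g1 s = \<kappa> * \<eta>1 (\<kappa> * s) * p s + \<eta> (\<kappa> * s) * p1 s" for s
    define g2 where "g2 s = \<kappa>\<^sup>2 * \<eta>2 (\<kappa> * s) * p s + 2 * \<kappa> * \<eta>1 (\<kappa> * s) * p1 s + \<eta> (\<kappa> * s) * p2 s" for s
    have de: "((\<lambda>s. \<eta> (\<kappa> * s)) has_real_derivative \<kappa> * \<eta>1 (\<kappa> * s)) (at s)"
      "((\<lambda>s. \<eta>1 (\<kappa> * s)) has_real_derivative \<kappa> * \<eta>2 (\<kappa> * s)) (at s)" for s
      by (rule DERIV_cong[OF DERIV_chain2[OF \<eta>(2) DERIV_cmult_Id]], simp,
          rule DERIV_cong[OF DERIV_chain2[OF \<eta>(3) DERIV_cmult_Id]], simp)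
    have "Ck_on m UNIV g" for m
      unfolding g_def by (intro Ck_on_mult open_UNIV p Ck_on_compose[OF open_UNIV open_UNIV _ Ck_on_affine \<eta>(1)]) auto
    moreover have "(g has_real_derivative g1 s) (at s)" for s
      unfolding g_def g1_def add_0_right by (rule DERIV_cong[OF DERIV_mult[OF de(1) p(2)]]) (simp add: algebra_simps)
    moreover have "(g1 has_real_derivative g2 s) (at s)" for s
      unfolding g1_def g2_def
      by (rule DERIV_cong[OF DERIV_add[OF DERIV_mult[OF DERIV_cmult[OF de(2)] p(2)] DERIV_mult[OF de(1) p(3)]]])
        (simp add: algebra_simps power2_eq_square)
    moreover have "g s = 0" if "s < 1 / real k" for s
      using \<eta>(4)[of "\<kappa> * s"] that \<kappa> by (simp add: g_def \<kappa>_def field_simps)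
    moreover have "(g2 s - f2 s)\<^sup>2 + ((g1 s - f1 s) / R s)\<^sup>2 + ((g s - f s) / (R s)\<^sup>2)\<^sup>2
         \<le> C' * indicator {0..2 / real k} s + C' / real k" if s: "s \<in> J" for s
    proof -
      have sL: "s \<in> {0<..L}" using JL s by auto
      have Rs: "R s > 0" by (rule R_pos[OF sL])
      note Cs = C(2)[OF s]
      consider "\<kappa> * s < 1" | "1 \<le> \<kappa> * s" "\<kappa> * s \<le> 2" | "2 < \<kappa> * s" by linarith
      \<comment> \<open>Either s is in the pole layer and the weighted errors are bounded, or they
        are at most 1/k. The three cases are g = 0, the transition, and g = p.\<close>
      then have dj: "(\<kappa> * s \<le> 2 \<and> \<bar>g2 s - f2 s\<bar> \<le> b2 \<and> \<bar>g1 s - f1 s\<bar> \<le> b1 * R s \<and> \<bar>g s - f s\<bar> \<le> b0 * (R s)\<^sup>2) \<or>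
        (\<bar>g2 s - f2 s\<bar> \<le> 1 / \<kappa> \<and> \<bar>g1 s - f1 s\<bar> \<le> 1 / \<kappa> * R s \<and> \<bar>g s - f s\<bar> \<le> 1 / \<kappa> * (R s)\<^sup>2)"
      proof cases
        case 1
        then have "g s = 0" "g1 s = 0" "g2 s = 0" using \<eta>(4,9,10)[of "\<kappa> * s"] by (auto simp: g_def g1_def g2_def)
        moreover have "C \<le> b0" "C \<le> b1" "C \<le> b2" using B0 C(1) K_pos by (auto simp: b0_def b1_def b2_def D_def)
        then have "C * R s \<le> b1 * R s" "C * (R s)\<^sup>2 \<le> b0 * (R s)\<^sup>2" using Rs by (auto intro!: mult_right_mono)
        ultimately show ?thesis using Cs 1 \<open>C \<le> b2\<close> by auto
      next
        case 2
        have s1: "1 / \<kappa> \<le> s" using 2 \<kappa> by (simp add: field_simps)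
        have rR: "r \<le> R s" using r(2)[of s] s1 sL by auto
        note ps = p(4)[OF x0(3)[OF s s1]]
        have "r / \<kappa> \<le> R s" using rR \<kappa> r(1) by (simp add: divide_le_eq) (smt (verit) mult_le_cancel_left1)
        moreover have "r\<^sup>2 / \<kappa> \<le> (R s)\<^sup>2"
        proof -
          have "r\<^sup>2 / \<kappa> \<le> r\<^sup>2" using \<kappa> by (simp add: divide_le_eq mult_le_cancel_left1)
          also have "\<dots> \<le> (R s)\<^sup>2" using rR r(1) by (intro power_mono) auto
          finally show ?thesis .
        qed
        moreover have "1 / \<kappa> \<le> 1" using \<kappa> by simp
        ultimately have e: "\<epsilon> \<le> R s" "\<epsilon> \<le> (R s)\<^sup>2" "\<epsilon> \<le> 1" using \<epsilon> by linarith+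
        have P: "\<bar>p s\<bar> \<le> D * (R s)\<^sup>2" "\<bar>p1 s\<bar> \<le> D * R s" "\<bar>p2 s\<bar> \<le> D"
          using ps Cs e unfolding D_def distrib_right by linarith+
        have D0: "D \<ge> 0" using C(1) by (simp add: D_def)
        have kR: "\<kappa> * R s \<le> 2 * K"
        proof -
          have "\<kappa> * R s \<le> \<kappa> * (K * s)" using R_le_linear[of s] sL \<kappa> by (intro mult_left_mono) auto
          also have "\<dots> = K * (\<kappa> * s)" by simp
          also have "\<dots> \<le> K * 2" using 2 K_pos by (intro mult_left_mono) auto
          finally show ?thesis by simp
        qed
        have kp: "\<kappa> * \<bar>p s\<bar> \<le> 2 * K * D * R s"
        proof -
          have "\<kappa> * \<bar>p s\<bar> \<le> \<kappa> * (D * (R s)\<^sup>2)" using P \<kappa> by (intro mult_left_mono) auto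
          also have "\<dots> = (\<kappa> * R s) * (D * R s)" by (simp add: power2_eq_square)
          also have "\<dots> \<le> (2 * K) * (D * R s)" using kR D0 Rs by (intro mult_right_mono) auto
          finally show ?thesis by simp
        qed
        have kkp: "\<kappa>\<^sup>2 * \<bar>p s\<bar> \<le> 4 * K\<^sup>2 * D"
        proof -
          have "\<kappa>\<^sup>2 * \<bar>p s\<bar> = \<kappa> * (\<kappa> * \<bar>p s\<bar>)" by (simp add: power2_eq_square)
          also have "\<dots> \<le> \<kappa> * (2 * K * D * R s)" using kp \<kappa> by (intro mult_left_mono) auto
          also have "\<dots> = (\<kappa> * R s) * (2 * K * D)" by simp
          also have "\<dots> \<le> (2 * K) * (2 * K * D)" using kR D0 K_pos by (intro mult_right_mono) auto
          finally show ?thesis by (simp add: power2_eq_square)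
        qed
        have kp1: "\<kappa> * \<bar>p1 s\<bar> \<le> 2 * K * D"
        proof -
          have "\<kappa> * \<bar>p1 s\<bar> \<le> \<kappa> * (D * R s)" using P \<kappa> by (intro mult_left_mono) auto
          also have "\<dots> = (\<kappa> * R s) * D" by simp
          also have "\<dots> \<le> (2 * K) * D" using kR D0 by (intro mult_right_mono) auto
          finally show ?thesis .
        qed
        have m: "\<bar>x * y\<bar> \<le> B * z" if "\<bar>x\<bar> \<le> B" "\<bar>y\<bar> \<le> z" for x y z :: real
          unfolding abs_mult using that B0 by (intro mult_mono) auto
        have "\<bar>\<eta> (\<kappa> * s) * p s\<bar> \<le> B * (D * (R s)\<^sup>2)" by (rule m[OF \<eta>(6) P(1)])
        moreover have "g s = \<eta> (\<kappa> * s) * p s" by (simp add: g_def)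
        moreover have "b0 * (R s)\<^sup>2 = B * (D * (R s)\<^sup>2) + C * (R s)\<^sup>2" by (simp add: b0_def algebra_simps)
        ultimately have 0: "\<bar>g s - f s\<bar> \<le> b0 * (R s)\<^sup>2" using Cs by linarith
        have "\<bar>\<eta>1 (\<kappa> * s) * (\<kappa> * p s)\<bar> \<le> B * (2 * K * D * R s)" using kp \<kappa> by (intro m[OF \<eta>(7)]) (simp add: abs_mult)
        moreover have "\<bar>\<eta> (\<kappa> * s) * p1 s\<bar> \<le> B * (D * R s)" by (rule m[OF \<eta>(6) P(2)])
        moreover have "g1 s = \<eta>1 (\<kappa> * s) * (\<kappa> * p s) + \<eta> (\<kappa> * s) * p1 s" by (simp add: g1_def)
        moreover have "b1 * R s = B * (2 * K * D * R s) + B * (D * R s) + C * R s" by (simp add: b1_def algebra_simps)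
        ultimately have 1: "\<bar>g1 s - f1 s\<bar> \<le> b1 * R s" using Cs by linarith
        have "\<bar>\<eta>2 (\<kappa> * s) * (\<kappa>\<^sup>2 * p s)\<bar> \<le> B * (4 * K\<^sup>2 * D)" using kkp by (intro m[OF \<eta>(8)]) (simp add: abs_mult)
        moreover have "\<bar>\<eta>1 (\<kappa> * s) * (\<kappa> * p1 s)\<bar> \<le> B * (2 * K * D)" using kp1 \<kappa> by (intro m[OF \<eta>(7)]) (simp add: abs_mult)
        moreover have "\<bar>\<eta> (\<kappa> * s) * p2 s\<bar> \<le> B * D" by (rule m[OF \<eta>(6) P(3)])
        moreover have "g2 s = \<eta>2 (\<kappa> * s) * (\<kappa>\<^sup>2 * p s) + 2 * (\<eta>1 (\<kappa> * s) * (\<kappa> * p1 s)) + \<eta> (\<kappa> * s) * p2 s" by (simp add: g2_def)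
        moreover have "b2 = B * (4 * K\<^sup>2 * D) + 2 * (B * (2 * K * D)) + B * D + C" by (simp add: b2_def algebra_simps)
        ultimately have "\<bar>g2 s - f2 s\<bar> \<le> b2" using Cs by linarith
        with 0 1 2 show ?thesis by blast
      next
        case 3
        then have s1: "1 / \<kappa> \<le> s" using \<kappa> by (simp add: field_simps)
        have rR: "r \<le> R s" using r(2)[of s] s1 sL by auto
        note ps = p(4)[OF x0(3)[OF s s1]]
        have "g s = p s" "g1 s = p1 s" "g2 s = p2 s" using 3 \<eta>(5,9,10)[of "\<kappa> * s"] by (auto simp: g_def g1_def g2_def)
        moreover have "r / \<kappa> \<le> 1 / \<kappa> * R s" using rR \<kappa> by (simp add: divide_right_mono)
        moreover have "r\<^sup>2 / \<kappa> \<le> 1 / \<kappa> * (R s)\<^sup>2" using power_mono[OF rR, of 2] r(1) \<kappa> by (simp add: divide_right_mono)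
        ultimately show ?thesis using ps \<epsilon> by auto
      qed
      have sq: "x\<^sup>2 + (y / R s)\<^sup>2 + (z / (R s)\<^sup>2)\<^sup>2 \<le> a2\<^sup>2 + a1\<^sup>2 + a0\<^sup>2"
        if "\<bar>x\<bar> \<le> a2 \<and> \<bar>y\<bar> \<le> a1 * R s \<and> \<bar>z\<bar> \<le> a0 * (R s)\<^sup>2" for x y z a2 a1 a0
      proof -
        have "\<bar>y / R s\<bar> \<le> a1" "\<bar>z / (R s)\<^sup>2\<bar> \<le> a0" "\<bar>x\<bar> \<le> a2" using that Rs by (auto simp: abs_div_pos[symmetric] divide_le_eq)
        then show ?thesis by (intro add_mono) (metis abs_ge_zero power2_abs power_mono)+
      qed
      from dj show ?thesis
      proof
          assume *: "\<kappa> * s \<le> 2 \<and> \<bar>g2 s - f2 s\<bar> \<le> b2 \<and> \<bar>g1 s - f1 s\<bar> \<le> b1 * R s \<and> \<bar>g s - f s\<bar> \<le> b0 * (R s)\<^sup>2"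
          then have "s \<in> {0..2 / real k}" using \<kappa> sL by (auto simp: \<kappa>_def field_simps)
          moreover have "b2\<^sup>2 + b1\<^sup>2 + b0\<^sup>2 \<le> C'" by (simp add: C'_def)
          moreover have "0 \<le> C' / real k" by (simp add: C'_def)
          ultimately show ?thesis using sq[of "g2 s - f2 s" b2 "g1 s - f1 s" b1 "g s - f s" b0] * by simp
      next
          assume *: "\<bar>g2 s - f2 s\<bar> \<le> 1 / \<kappa> \<and> \<bar>g1 s - f1 s\<bar> \<le> 1 / \<kappa> * R s \<and> \<bar>g s - f s\<bar> \<le> 1 / \<kappa> * (R s)\<^sup>2"
          have "(1 / \<kappa>)\<^sup>2 \<le> 1 / \<kappa>" using \<kappa> by (simp add: power2_eq_square divide_le_eq)
          moreover have "3 * (1 / \<kappa>) \<le> C' / real k" unfolding \<kappa>_def[symmetric] using \<kappa> by (simp add: C'_def divide_right_mono)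
          moreover have "0 \<le> C' * indicator {0..2 / real k} s" by (simp add: C'_def)
          ultimately show ?thesis using sq[OF *] by linarith
      qed
    qed
    ultimately show "\<exists>g g1 g2. (\<forall>m. Ck_on m UNIV g) \<and>
      (\<forall>x. (g has_real_derivative g1 x) (at x) \<and> (g1 has_real_derivative g2 x) (at x)) \<and>
      (\<forall>s. s < 1 / real k \<longrightarrow> g s = 0) \<and>
      (\<forall>s\<in>J. (g2 s - f2 s)\<^sup>2 + ((g1 s - f1 s) / R s)\<^sup>2 + ((g s - f s) / (R s)\<^sup>2)\<^sup>2
         \<le> C' * indicator {0..2 / real k} s + C' / real k)" by blast
  qed
qed

text \<open>The glued function is continuous at s0, but its derivative jumps. The jump is spread
  over a ramp of width 1/k, the result approximated by a polynomial and integrated: the function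
  then errs by O(1/k), the derivative by a bounded amount on the ramp. Cutoffs at both ends multiply
  k by functions that are O(1/k) there.\<close>

lemma H1_approximation:
  assumes f: "\<And>s. s \<in> {0<..s0} \<Longrightarrow> (f has_real_derivative f1 s) (at s within {0<..s0})" "continuous_on {0<..s0} f1"
    and h: "\<And>s. s \<in> {s0..L} \<Longrightarrow> (h has_real_derivative h1 s) (at s within {s0..L})" "continuous_on {s0..L} h1"
    and glue: "f s0 = h s0" "h L = 0"
    and C: "C \<ge> 0" "\<And>s. s \<in> {0<..s0} \<Longrightarrow> \<bar>f s\<bar> \<le> C * (R s)\<^sup>2 \<and> \<bar>f1 s\<bar> \<le> C * R s"
  obtains C' k0 where "C' \<ge> 0" "k0 \<ge> 1" "\<And>k. k \<ge> k0 \<Longrightarrow> \<exists>g g1. (\<forall>m. Ck_on m UNIV g) \<and>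
      (\<forall>x. (g has_real_derivative g1 x) (at x)) \<and> (\<forall>s. s < 1 / real k \<or> s > L - 1 / real k \<longrightarrow> g s = 0) \<and>
      (\<forall>s\<in>{0<..<s0}. ((g s - f s) / R s)\<^sup>2 + (g1 s - f1 s)\<^sup>2 \<le> majorant C' k s) \<and>
      (\<forall>s\<in>{s0<..<L}. ((g s - h s) / R s)\<^sup>2 + (g1 s - h1 s)\<^sup>2 \<le> majorant C' k s)"
proof -
  obtain \<eta> \<eta>1 \<eta>2 B where \<eta>: "\<And>k. Ck_on k UNIV \<eta>" "\<And>x. (\<eta> has_real_derivative \<eta>1 x) (at x)"
    "\<And>x. (\<eta>1 has_real_derivative \<eta>2 x) (at x)"
    "\<And>x. x \<le> 1 \<Longrightarrow> \<eta> x = 0" "\<And>x. x \<ge> 2 \<Longrightarrow> \<eta> x = 1"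
    "\<And>x. \<bar>\<eta> x\<bar> \<le> B" "\<And>x. \<bar>\<eta>1 x\<bar> \<le> B" "\<And>x. \<bar>\<eta>2 x\<bar> \<le> B"
    "\<And>x. x < 1 \<or> x > 2 \<Longrightarrow> \<eta>1 x = 0" "\<And>x. x < 1 \<or> x > 2 \<Longrightarrow> \<eta>2 x = 0"
    using smooth_cutoff by blast
  have B1: "B \<ge> 1" using \<eta>(6)[of 2] \<eta>(5)[of 2] by simp
  obtain Rm where Rm: "Rm > 0" "\<And>s. s \<in> {0..L} \<Longrightarrow> R s \<le> Rm" using R_upper by blast
  obtain r0 where r0: "r0 > 0" "\<And>s. s \<in> {s0..L} \<Longrightarrow> r0 \<le> R s" using R_lower[of s0] s0 by auto
  obtain H where H: "H > 0" "\<And>s. s \<in> {s0..L} \<Longrightarrow> \<bar>h1 s\<bar> \<le> H"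
    using compact_imp_bounded[OF compact_continuous_image[OF h(2) compact_Icc]] by (auto simp: bounded_pos)
  \<comment> \<open>The linear vanishing of h at L pays for the factor k of the outer
    cutoff.\<close>
  have hH: "\<bar>h s\<bar> \<le> H * (L - s)" if "s \<in> {s0..L}" for s
  proof -
    have "\<bar>h s - 0\<bar> \<le> \<bar>h L - 0\<bar> + H * \<bar>s - L\<bar>"
      by (rule derivative_bound[where g = "\<lambda>_. 0" and ?g1.0 = "\<lambda>_. 0", OF h(1)]) (use that s0 H in auto)
    then show ?thesis using glue(2) that by simp
  qed
  \<comment> \<open>j is the jump of the derivative. c2 / k will bound the distance between the
    integrated polynomial and h: multiples of L come from the approximation error, 1 + |j| from
    crossing the ramp.\<close>
  define j where "j = h1 s0 - f1 s0"
  define c2 where "c2 = 2 * L + 2 * L + 1 + \<bar>j\<bar>"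
  have c2: "c2 > 0" using s0 by (simp add: c2_def add_pos_nonneg)
  text \<open>Bounds for \<open>|p| / R\<close>, \<open>k |p|\<close> and \<open>|p'|\<close> in the two end layers.\<close>
  define d0 where "d0 = C * Rm + 1 + (2 * H + c2) / r0"
  define dk where "dk = 2 * K * (C * Rm + 1) + 2 * H + c2"
  define d1 where "d1 = C * Rm + H + 1"
  \<comment> \<open>e0 and e1 bound the errors of g / R and g' in the end layers, m1 and m2 those in
    the ramp layer. The summand 2 of C' covers the good part of the inner side, where the error is
    at most 2 / k^2.\<close>
  define e0 where "e0 = B * B * d0 + C * Rm + H * L / r0"
  define e1 where "e1 = 2 * (B * B * dk) + B * B * d1 + C * Rm + H"
  define m1 where "m1 = c2 / r0"
  define m2 where "m2 = 1 + \<bar>j\<bar>"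
  define C' where "C' = e0\<^sup>2 + e1\<^sup>2 + m1\<^sup>2 + m2\<^sup>2 + 2"
  \<comment> \<open>With 4 / k < \<mu> the layers at the pole, the interface and the boundary are
    disjoint.\<close>
  define \<mu> where "\<mu> = min s0 (L - s0)"
  have \<mu>: "\<mu> > 0" "\<mu> \<le> s0" "\<mu> \<le> L - s0" using s0 by (auto simp: \<mu>_def)
  obtain k0 :: nat where k0: "4 / \<mu> < real k0" using reals_Archimedean2 by blast
  have "k0 \<ge> 1" using k0 \<mu>(1) by (cases k0) (auto simp: field_simps not_less[symmetric])
  show thesis
  proof (rule that[of C' k0])
    show "C' \<ge> 0" by (simp add: C'_def)
    show "k0 \<ge> 1" by fact
    fix k :: nat assume k: "k \<ge> k0"
    define \<kappa> where "\<kappa> = real k"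
    have \<kappa>1: "\<kappa> \<ge> 1" using k \<open>k0 \<ge> 1\<close> by (simp add: \<kappa>_def)
    have "4 / \<mu> < \<kappa>" using k k0 by (simp add: \<kappa>_def)
    then have k4: "4 / \<kappa> < \<mu>" using \<mu>(1) \<kappa>1 by (simp add: field_simps)
    define \<delta> where "\<delta> = 1 / \<kappa>"
    have \<delta>: "\<delta> > 0" "\<delta> \<le> 1" "4 * \<delta> < \<mu>" "\<kappa> * \<delta> = 1" using \<kappa>1 k4 by (auto simp: \<delta>_def)
    obtain r where r: "r > 0" "\<And>s. s \<in> {\<delta>..L} \<Longrightarrow> r \<le> R s"
      using R_lower[of \<delta>] \<delta> \<mu> s0 by (auto simp: )
    \<comment> \<open>The integrated error \<epsilon> L has to stay below r / k, where r bounds R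
      from below beyond 1/k; on the inner side the error is then at most R / k.\<close>
    define \<epsilon> where "\<epsilon> = min 1 (r / L) * \<delta>"
    have \<epsilon>: "\<epsilon> > 0" "\<epsilon> \<le> \<delta>" "\<epsilon> * L \<le> r * \<delta>"
    proof -
      show "\<epsilon> > 0" using r(1) s0 \<delta> by (simp add: \<epsilon>_def)
      show "\<epsilon> \<le> \<delta>" using \<delta> by (simp add: \<epsilon>_def mult_le_cancel_right1)
      have "min 1 (r / L) * L \<le> r / L * L" using s0 by (intro mult_right_mono) auto
      then have "min 1 (r / L) * L * \<delta> \<le> r * \<delta>" using s0 \<delta> by (intro mult_right_mono) auto
      then show "\<epsilon> * L \<le> r * \<delta>" by (simp add: \<epsilon>_def mult_ac)
    qed
    \<comment> \<open>The ramp: w is f1 up to s0 and h1 from s0 + 1/k on. Subtracting the whole jump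
      at s0 makes it continuous there.\<close>
    define w where "w s = (if s \<le> s0 then f1 s else h1 s - j * max 0 (1 - \<kappa> * (s - s0)))" for s
    have wc: "continuous_on {\<delta>..L} w"
      unfolding w_def
    proof (rule continuous_on_cases_le)
      show "continuous_on {s \<in> {\<delta>..L}. s \<le> s0} f1" by (rule continuous_on_subset[OF f(2)]) (use \<delta> in auto)
      show "continuous_on {s \<in> {\<delta>..L}. s0 \<le> s} (\<lambda>s. h1 s - j * max 0 (1 - \<kappa> * (s - s0)))"
        by (intro continuous_intros continuous_on_subset[OF h(2)]) auto
    qed (auto simp: j_def intro: continuous_intros)
    obtain q where q: "real_polynomial_function q" "\<And>s. s \<in> {\<delta>..L} \<Longrightarrow> \<bar>w s - q s\<bar> < \<epsilon>"
      using Stone_Weierstrass_real_polynomial_function[OF compact_Icc wc \<epsilon>(1)] by blast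
    obtain p where p: "real_polynomial_function p" "p \<delta> = f \<delta>" "\<And>x. (p has_real_derivative q x) (at x)"
      using real_polynomial_antiderivative[OF q(1)] by blast
    have qf: "\<bar>q s - f1 s\<bar> \<le> \<epsilon>" if "s \<in> {\<delta>..s0}" for s using q(2)[of s] that s0 by (auto simp: w_def)
    have qh: "\<bar>q s - h1 s\<bar> \<le> \<epsilon> + \<bar>j\<bar>" if "s \<in> {s0..L}" for s
    proof (cases "s = s0")
      case True
      then show ?thesis using q(2)[of s] that s0 \<delta> \<mu> by (auto simp: w_def j_def)
    next
      case False
      have "0 \<le> \<kappa> * (s - s0)" using that \<kappa>1 by simp
      then have "\<bar>j * max 0 (1 - \<kappa> * (s - s0))\<bar> \<le> \<bar>j\<bar> * 1" unfolding abs_mult by (intro mult_left_mono) auto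
      then show ?thesis using q(2)[of s] that s0 \<delta> \<mu> False by (auto simp: w_def)
    qed
    have qh2: "\<bar>q s - h1 s\<bar> \<le> \<epsilon>" if "s \<in> {s0 + \<delta>..L}" for s
    proof -
      have "1 \<le> \<kappa> * (s - s0)" using that \<kappa>1 \<delta> mult_left_mono[of \<delta> "s - s0" \<kappa>] by auto
      then show ?thesis using q(2)[of s] that s0 \<delta> \<mu> by (auto simp: w_def)
    qed
    have pf: "\<bar>p s - f s\<bar> \<le> r * \<delta>" if s: "s \<in> {\<delta>..s0}" for s
    proof -
      have "\<bar>p s - f s\<bar> \<le> \<bar>p \<delta> - f \<delta>\<bar> + \<epsilon> * \<bar>s - \<delta>\<bar>"
      proof (rule derivative_bound[OF has_field_derivative_at_within[OF p(3)] _ qf s])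
        show "(f has_real_derivative f1 x) (at x within {\<delta>..s0})" if "x \<in> {\<delta>..s0}" for x
          by (rule has_field_derivative_subset[OF f(1)]) (use that \<delta> in auto)
      qed (use s in auto)
      also have "\<dots> \<le> \<epsilon> * L" using p(2) s s0 \<delta> \<epsilon> by (auto intro!: mult_left_mono)
      finally show ?thesis using \<epsilon>(3) by linarith
    qed
    have hsub: "(h has_real_derivative h1 x) (at x within {a..b})" if "x \<in> {a..b}" "s0 \<le> a" "b \<le> L" for x a b
      by (rule has_field_derivative_subset[OF h(1)]) (use that in auto)
    have r\<delta>: "r * \<delta> \<le> c2 * \<delta>" if "r \<le> c2" using that \<delta> by simp
    have p0: "\<bar>p s0 - h s0\<bar> \<le> \<epsilon> * L"
    proof -
      have "\<bar>p s0 - f s0\<bar> \<le> \<bar>p \<delta> - f \<delta>\<bar> + \<epsilon> * \<bar>s0 - \<delta>\<bar>"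
      proof (rule derivative_bound[OF has_field_derivative_at_within[OF p(3)] _ qf])
        show "(f has_real_derivative f1 x) (at x within {\<delta>..s0})" if "x \<in> {\<delta>..s0}" for x
          by (rule has_field_derivative_subset[OF f(1)]) (use that \<delta> in auto)
      qed (use \<delta> \<mu> in auto)
      also have "\<dots> \<le> \<epsilon> * L" using p(2) s0 \<delta> \<epsilon> \<mu> by (auto intro!: mult_left_mono)
      finally show ?thesis using glue by simp
    qed
    have ph1: "\<bar>p s - h s\<bar> \<le> \<epsilon> * L + (\<epsilon> + \<bar>j\<bar>) * \<delta>" if s: "s \<in> {s0..s0 + \<delta>}" for s
    proof -
      have "\<bar>p s - h s\<bar> \<le> \<bar>p s0 - h s0\<bar> + (\<epsilon> + \<bar>j\<bar>) * \<bar>s - s0\<bar>"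
        by (rule derivative_bound[OF has_field_derivative_at_within[OF p(3)] hsub qh s]) (use \<delta> \<mu> in auto)
      also have "(\<epsilon> + \<bar>j\<bar>) * \<bar>s - s0\<bar> \<le> (\<epsilon> + \<bar>j\<bar>) * \<delta>" using s \<epsilon> by (intro mult_left_mono) auto
      finally show ?thesis using p0 by linarith
    qed
    have ph2: "\<bar>p s - h s\<bar> \<le> \<epsilon> * L + (\<epsilon> + \<bar>j\<bar>) * \<delta> + \<epsilon> * L" if s: "s \<in> {s0 + \<delta>..L}" for s
    proof -
      have "\<bar>p s - h s\<bar> \<le> \<bar>p (s0 + \<delta>) - h (s0 + \<delta>)\<bar> + \<epsilon> * \<bar>s - (s0 + \<delta>)\<bar>"
        by (rule derivative_bound[OF has_field_derivative_at_within[OF p(3)] hsub qh2 s]) (use \<delta> \<mu> s in auto)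
      also have "\<epsilon> * \<bar>s - (s0 + \<delta>)\<bar> \<le> \<epsilon> * L" using s \<epsilon> s0 \<delta> by (intro mult_left_mono) auto
      finally have "\<bar>p s - h s\<bar> \<le> \<bar>p (s0 + \<delta>) - h (s0 + \<delta>)\<bar> + \<epsilon> * L" by simp
      moreover have "\<bar>p (s0 + \<delta>) - h (s0 + \<delta>)\<bar> \<le> \<epsilon> * L + (\<epsilon> + \<bar>j\<bar>) * \<delta>" by (rule ph1) (use \<delta> in auto)
      ultimately show ?thesis by linarith
    qed
    have ph: "\<bar>p s - h s\<bar> \<le> c2 * \<delta>" if s: "s \<in> {s0..L}" for s
    proof -
      have "\<epsilon> * L \<le> \<delta> * L" "(\<epsilon> + \<bar>j\<bar>) * \<delta> \<le> (1 + \<bar>j\<bar>) * \<delta>" "0 \<le> \<epsilon> * L" "0 \<le> \<delta> * L"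
        using \<epsilon> \<delta> s0 by (auto intro!: mult_right_mono)
      moreover have "c2 * \<delta> = 4 * (\<delta> * L) + (1 + \<bar>j\<bar>) * \<delta>" by (simp add: c2_def algebra_simps)
      moreover have "\<bar>p s - h s\<bar> \<le> \<epsilon> * L + (\<epsilon> + \<bar>j\<bar>) * \<delta> + \<epsilon> * L"
      proof (cases "s \<le> s0 + \<delta>")
        case True
        then have "\<bar>p s - h s\<bar> \<le> \<epsilon> * L + (\<epsilon> + \<bar>j\<bar>) * \<delta>" by (intro ph1) (use s in auto)
        then show ?thesis using \<open>0 \<le> \<epsilon> * L\<close> by linarith
      qed (use ph2[of s] s in auto)
      ultimately show ?thesis by linarith
    qed
    define g where "g s = \<eta> (\<kappa> * s + 0) * \<eta> ((- \<kappa>) * s + \<kappa> * L) * p s" for s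
    define X where "X s = \<eta> (\<kappa> * s)" for s
    define Y where "Y s = \<eta> (\<kappa> * (L - s))" for s
    define X1 where "X1 s = \<eta>1 (\<kappa> * s)" for s
    define Y1 where "Y1 s = \<eta>1 (\<kappa> * (L - s))" for s
    define g1 where "g1 s = \<kappa> * X1 s * Y s * p s - \<kappa> * X s * Y1 s * p s + X s * Y s * q s" for s
    have gXY: "g s = X s * Y s * p s" for s by (simp add: g_def X_def Y_def algebra_simps)
    have dX: "(X has_real_derivative \<kappa> * X1 s) (at s)" for s
      unfolding X_def X1_def using DERIV_chain2[OF \<eta>(2) DERIV_cmult_Id, of \<kappa> s UNIV] by (simp add: mult.commute)
    have dY: "(Y has_real_derivative - \<kappa> * Y1 s) (at s)" for s
    proof -
      have "((\<lambda>s. \<kappa> * (L - s)) has_real_derivative - \<kappa>) (at s)" by (auto intro!: derivative_eq_intros)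
      from DERIV_chain2[OF \<eta>(2) this] show ?thesis by (simp add: Y_def[abs_def] Y1_def mult.commute)
    qed
    have "Ck_on m UNIV g" for m
      unfolding g_def
      by (intro Ck_on_mult open_UNIV Ck_on_real_polynomial[OF p(1)] Ck_on_compose[OF open_UNIV open_UNIV _ Ck_on_affine \<eta>(1)]) auto
    moreover have "(g has_real_derivative g1 s) (at s)" for s
      unfolding gXY[abs_def] g1_def
      by (rule DERIV_cong[OF DERIV_mult[OF DERIV_mult[OF dX dY] p(3)]]) (simp add: algebra_simps)
    moreover have gz: "g s = 0" if "s < \<delta> \<or> s > L - \<delta>" for s
    proof -
      have "\<kappa> * s \<le> 1 \<or> \<kappa> * (L - s) \<le> 1"
        using that \<kappa>1 \<delta>(4) mult_left_mono[of s \<delta> \<kappa>] mult_left_mono[of "L - s" \<delta> \<kappa>] by auto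
      then show ?thesis using \<eta>(4) by (auto simp: gXY X_def Y_def)
    qed
    moreover have g1z: "g1 s = 0" if "s < \<delta> \<or> s > L - \<delta>" for s
    proof -
      have "\<kappa> * s < \<kappa> * \<delta> \<or> \<kappa> * (L - s) < \<kappa> * \<delta>" using that \<kappa>1 by auto
      then show ?thesis using \<eta>(4,9) \<delta>(4) by (auto simp: g1_def X_def Y_def X1_def Y1_def)
    qed
    have mid: "g s = p s \<and> g1 s = q s" if "2 * \<delta> < s" "s < L - 2 * \<delta>" for s
    proof -
      have "\<kappa> * (2 * \<delta>) < \<kappa> * s" "\<kappa> * (2 * \<delta>) < \<kappa> * (L - s)" using that \<kappa>1 by auto
      then have "\<kappa> * s > 2" "\<kappa> * (L - s) > 2" using \<delta>(4) by (auto simp: mult.left_commute)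
      then show ?thesis using \<eta>(5,9) by (auto simp: gXY g1_def X_def Y_def X1_def Y1_def)
    qed
    \<comment> \<open>The factor 2 counts the two cutoffs, the derivative of each contributing a
      term in \<kappa> p.\<close>
    have ends: "\<bar>g s\<bar> \<le> B * B * d0 * R s" "\<bar>g1 s\<bar> \<le> 2 * (B * B * dk) + B * B * d1"
      if "\<bar>p s\<bar> \<le> d0 * R s" "\<kappa> * \<bar>p s\<bar> \<le> dk" "\<bar>q s\<bar> \<le> d1" for s
    proof -
      have m: "\<bar>x * y * z\<bar> \<le> B * B * v" if "\<bar>x\<bar> \<le> B" "\<bar>y\<bar> \<le> B" "\<bar>z\<bar> \<le> v" for x y z v :: real
        unfolding abs_mult using that B1 by (intro mult_mono) auto
      have XB: "\<bar>X s\<bar> \<le> B" "\<bar>Y s\<bar> \<le> B" "\<bar>X1 s\<bar> \<le> B" "\<bar>Y1 s\<bar> \<le> B" using \<eta> by (auto simp: X_def Y_def X1_def Y1_def)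
      show "\<bar>g s\<bar> \<le> B * B * d0 * R s" using m[OF XB(1,2) that(1)] by (simp add: gXY mult.assoc)
      have kp: "\<bar>\<kappa> * p s\<bar> \<le> dk" using that(2) \<kappa>1 by (simp add: abs_mult)
      have "g1 s = X1 s * Y s * (\<kappa> * p s) - X s * Y1 s * (\<kappa> * p s) + X s * Y s * q s" by (simp add: g1_def)
      then show "\<bar>g1 s\<bar> \<le> 2 * (B * B * dk) + B * B * d1"
        using m[OF XB(3,2) kp] m[OF XB(1,4) kp] m[OF XB(1,2) that(3)] by linarith
    qed
    have e01: "e0 \<ge> 0" "e1 \<ge> 0" "d0 \<ge> 0" "dk \<ge> 0" "d1 \<ge> 0"
      using B1 C(1) Rm(1) H(1) c2 r0(1) K_pos s0
      by (auto simp: e0_def e1_def d0_def dk_def d1_def intro!: add_nonneg_nonneg mult_nonneg_nonneg divide_nonneg_nonneg)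
    have sq: "(x / R s)\<^sup>2 + y\<^sup>2 \<le> a\<^sup>2 + b\<^sup>2" if "s \<in> {0<..L}" "\<bar>x\<bar> \<le> a * R s" "\<bar>y\<bar> \<le> b" for x y a b s
    proof -
      have "\<bar>x / R s\<bar> \<le> a" using that R_pos[OF that(1)] by (auto simp: abs_div_pos[symmetric] divide_le_eq)
      then show ?thesis using that(3) by (intro add_mono) (metis abs_ge_zero power2_abs power_mono)+
    qed
    have \<delta>k: "2 / real k = 2 * \<delta>" "1 / real k = \<delta>" by (auto simp: \<delta>_def \<kappa>_def)
    have bad1: "s \<in> bad k" if "s \<in> {0..2 * \<delta>} \<or> s \<in> {s0..s0 + \<delta>} \<or> s \<in> {L - 2 * \<delta>..L}" for s
      unfolding bad_def \<delta>k using that by auto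
    have Cp: "C' \<ge> 0" "e0\<^sup>2 + e1\<^sup>2 \<le> C'" "m1\<^sup>2 + m2\<^sup>2 \<le> C'" "\<And>a. a \<le> 2 * \<delta> \<Longrightarrow> a \<le> C' / real k"
      "(m1\<^sup>2 + 1) * \<delta> \<le> C' / real k"
    proof -
      have "C' / real k = C' * \<delta>" by (simp add: \<delta>_def \<kappa>_def)
      moreover have "2 * \<delta> \<le> C' * \<delta>" "(m1\<^sup>2 + 1) * \<delta> \<le> C' * \<delta>" using \<delta>(1) by (auto simp: C'_def intro!: mult_right_mono)
      ultimately show "\<And>a. a \<le> 2 * \<delta> \<Longrightarrow> a \<le> C' / real k" "(m1\<^sup>2 + 1) * \<delta> \<le> C' / real k" by auto
    qed (auto simp: C'_def)
    have \<delta>2: "\<delta>\<^sup>2 \<le> \<delta>" using \<delta> by (simp add: power2_eq_square mult_le_cancel_left1)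
    have left: "((g s - f s) / R s)\<^sup>2 + (g1 s - f1 s)\<^sup>2 \<le> majorant C' k s" if s: "s \<in> {0<..<s0}" for s
    proof -
      have sL: "s \<in> {0<..L}" "s \<in> {0..L}" "s \<in> {0<..s0}" using s s0 by auto
      have Rs: "R s > 0" "R s \<le> Rm" using R_pos[OF sL(1)] Rm(2)[OF sL(2)] by auto
      have fb: "\<bar>f s\<bar> \<le> C * Rm * R s" "\<bar>f1 s\<bar> \<le> C * Rm"
      proof -
        have CR: "C * R s \<le> C * Rm" using C(1) Rs by (intro mult_left_mono) auto
        then have "C * (R s)\<^sup>2 \<le> C * Rm * R s"
          using mult_right_mono[OF CR, of "R s"] Rs by (simp add: power2_eq_square)
        with CR show "\<bar>f s\<bar> \<le> C * Rm * R s" "\<bar>f1 s\<bar> \<le> C * Rm" using C(2)[OF sL(3)] by linarith+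
      qed
      consider "s < \<delta>" | "\<delta> \<le> s" "s \<le> 2 * \<delta>" | "2 * \<delta> < s" by linarith
      then show ?thesis
      proof cases
        case 3
        have "g s = p s" "g1 s = q s" using mid[of s] 3 s \<delta> \<mu> by auto
        moreover have "\<bar>p s - f s\<bar> \<le> \<delta> * R s"
        proof -
          have "\<delta> * r \<le> \<delta> * R s" using r(2)[of s] 3 s s0 \<delta> by (intro mult_left_mono) auto
          moreover have "\<bar>p s - f s\<bar> \<le> r * \<delta>" by (rule pf) (use 3 s \<delta> in auto)
          ultimately show ?thesis by (simp add: mult.commute)
        qed
        moreover have "\<bar>q s - f1 s\<bar> \<le> \<delta>" using qf[of s] 3 s \<delta> \<epsilon> by auto
        ultimately have "((g s - f s) / R s)\<^sup>2 + (g1 s - f1 s)\<^sup>2 \<le> \<delta>\<^sup>2 + \<delta>\<^sup>2" using sq[OF sL(1), of "g s - f s" \<delta> "g1 s - f1 s" \<delta>] by simp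
        then show ?thesis using \<delta>2 by (intro majorant_good Cp) auto
      next
        case 1
        then have "\<bar>g s - f s\<bar> \<le> e0 * R s" "\<bar>g1 s - f1 s\<bar> \<le> e1"
        proof -
          have "C * Rm \<le> e0" "C * Rm \<le> e1" unfolding e0_def e1_def
            using B1 e01 H s0 r0 by (auto intro!: add_nonneg_nonneg mult_nonneg_nonneg divide_nonneg_nonneg)
          then have "C * Rm * R s \<le> e0 * R s" "C * Rm \<le> e1" using Rs by (auto intro!: mult_right_mono)
          then show "\<bar>g s - f s\<bar> \<le> e0 * R s" "\<bar>g1 s - f1 s\<bar> \<le> e1" using fb gz[of s] g1z[of s] 1 by auto
        qed
        from sq[OF sL(1) this] show ?thesis using Cp(2) s 1 \<delta> by (intro majorant_bad Cp bad1) auto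
      next
        case 2
        have P: "\<bar>p s\<bar> \<le> (C * Rm + 1) * R s"
        proof -
          have "r * \<delta> \<le> R s * 1" using r(2)[of s] 2 sL r(1) \<delta> by (intro mult_mono) auto
          then show ?thesis using pf[of s] fb s 2 by (auto simp: distrib_right)
        qed
        have "(C * Rm + 1) * R s \<le> d0 * R s" using Rs H c2 r0 by (auto simp: d0_def intro!: mult_right_mono divide_nonneg_nonneg)
        then have 1: "\<bar>p s\<bar> \<le> d0 * R s" using P by linarith
        have kpk: "\<kappa> * \<bar>p s\<bar> \<le> dk"
        proof -
          have "\<kappa> * R s \<le> \<kappa> * (K * s)" using R_le_linear[OF sL(2)] \<kappa>1 by (intro mult_left_mono) auto
          also have "\<dots> \<le> \<kappa> * (K * (2 * \<delta>))" using 2 K_pos \<kappa>1 by (intro mult_left_mono) auto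
          also have "\<dots> = 2 * K * (\<kappa> * \<delta>)" by simp
          finally have kR: "\<kappa> * R s \<le> 2 * K" using \<delta>(4) by simp
          have "\<kappa> * \<bar>p s\<bar> \<le> \<kappa> * ((C * Rm + 1) * R s)" using P \<kappa>1 by (intro mult_left_mono) auto
          also have "\<dots> = (\<kappa> * R s) * (C * Rm + 1)" by simp
          also have "\<dots> \<le> 2 * K * (C * Rm + 1)" using kR C(1) Rm(1) by (intro mult_right_mono) auto
          finally show ?thesis using H c2 by (simp add: dk_def)
        qed
        have 3: "\<bar>q s\<bar> \<le> d1" using qf[of s] 2 s fb \<epsilon> \<delta> H by (auto simp: d1_def)
        have "\<bar>g s - f s\<bar> \<le> B * B * d0 * R s + C * Rm * R s" using ends(1)[OF 1 kpk 3] fb by linarith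
        also have "\<dots> \<le> e0 * R s"
          unfolding e0_def distrib_right using H s0 r0 Rs by (auto intro!: mult_nonneg_nonneg divide_nonneg_nonneg)
        finally have "\<bar>g s - f s\<bar> \<le> e0 * R s" .
        moreover have "\<bar>g1 s - f1 s\<bar> \<le> e1" using ends(2)[OF 1 kpk 3] fb H unfolding e1_def by linarith
        ultimately show ?thesis using sq[OF sL(1), of "g s - f s" e0 "g1 s - f1 s" e1] Cp(2) s 2
          by (intro majorant_bad Cp bad1) auto
      qed
    qed
    have right: "((g s - h s) / R s)\<^sup>2 + (g1 s - h1 s)\<^sup>2 \<le> majorant C' k s" if s: "s \<in> {s0<..<L}" for s
    proof -
      have sL: "s \<in> {0<..L}" "s \<in> {s0..L}" using s s0 by auto
      have Rs: "R s > 0" "r0 \<le> R s" using R_pos[OF sL(1)] r0(2)[OF sL(2)] by auto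
      have R1: "x \<le> x / r0 * R s" if "x \<ge> 0" for x
        using mult_left_mono[OF Rs(2) that] r0(1) by (simp add: field_simps)
      have hb: "\<bar>h s\<bar> \<le> H * L / r0 * R s" "\<bar>h1 s\<bar> \<le> H"
      proof -
        have "\<bar>h s\<bar> \<le> H * L" using hH[OF sL(2)] H s s0 by (smt (verit) greaterThanLessThan_iff mult_left_mono)
        then show "\<bar>h s\<bar> \<le> H * L / r0 * R s" using R1[of "H * L"] H s0 by simp
      qed (use H(2)[OF sL(2)] in auto)
      have s2: "2 * \<delta> < s" using s \<delta> \<mu> by auto
      consider "s > L - \<delta>" | "L - 2 * \<delta> \<le> s" "s \<le> L - \<delta>" | "s < L - 2 * \<delta>" "s \<le> s0 + \<delta>" | "s < L - 2 * \<delta>" "s0 + \<delta> < s" by linarith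
      then show ?thesis
      proof cases
        case 1
        have "H * L / r0 \<le> e0" "H \<le> e1" unfolding e0_def e1_def
          using B1 e01 C(1) Rm by (auto intro!: add_nonneg_nonneg mult_nonneg_nonneg)
        then have "H * L / r0 * R s \<le> e0 * R s" "H \<le> e1"
          using mult_right_mono[of "H * L / r0" e0 "R s"] Rs by auto
        then have "\<bar>g s - h s\<bar> \<le> e0 * R s" "\<bar>g1 s - h1 s\<bar> \<le> e1" using hb gz[of s] g1z[of s] 1 by auto
        from sq[OF sL(1) this] show ?thesis using Cp(2) s 1 \<delta> by (intro majorant_bad Cp bad1) auto
      next
        case 2
        have P: "\<bar>p s\<bar> \<le> (2 * H + c2) * \<delta>"
        proof -
          have "H * (L - s) \<le> H * (2 * \<delta>)" using 2 H by (intro mult_left_mono) auto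
          then show ?thesis using ph[OF sL(2)] hH[OF sL(2)] by (auto simp: algebra_simps)
        qed
        have 1: "\<bar>p s\<bar> \<le> d0 * R s"
        proof -
          have "(2 * H + c2) * \<delta> \<le> (2 * H + c2) * 1" using H c2 \<delta> by (intro mult_left_mono) auto
          also have "\<dots> \<le> (2 * H + c2) / r0 * R s" using R1[of "2 * H + c2"] H c2 by simp
          also have "\<dots> \<le> d0 * R s"
          proof (rule mult_right_mono)
            show "(2 * H + c2) / r0 \<le> d0"
              using mult_nonneg_nonneg[OF C(1) less_imp_le[OF Rm(1)]] unfolding d0_def by linarith
          qed (use Rs in auto)
          finally show ?thesis using P by linarith
        qed
        have kpk: "\<kappa> * \<bar>p s\<bar> \<le> dk"
        proof -
          have "\<kappa> * \<bar>p s\<bar> \<le> \<kappa> * ((2 * H + c2) * \<delta>)" using P \<kappa>1 by (intro mult_left_mono) auto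
          also have "\<dots> = (2 * H + c2) * (\<kappa> * \<delta>)" by simp
          also have "\<dots> = 2 * H + c2" using \<delta>(4) by simp
          moreover have "0 \<le> 2 * K * (C * Rm + 1)"
            using K_pos C(1) Rm(1) by (intro mult_nonneg_nonneg add_nonneg_nonneg) auto
          ultimately show ?thesis unfolding dk_def by linarith
        qed
        have "\<bar>q s - h1 s\<bar> \<le> \<epsilon>" by (rule qh2) (use 2 \<delta> \<mu> s in auto)
        then have 3: "\<bar>q s\<bar> \<le> d1"
          using hb(2) \<epsilon>(2) \<delta>(2) mult_nonneg_nonneg[OF C(1) less_imp_le[OF Rm(1)]] unfolding d1_def by linarith
        have "\<bar>g s - h s\<bar> \<le> B * B * d0 * R s + H * L / r0 * R s" using ends(1)[OF 1 kpk 3] hb by linarith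
        also have "\<dots> \<le> e0 * R s" unfolding e0_def distrib_right using C(1) Rm Rs by auto
        finally have "\<bar>g s - h s\<bar> \<le> e0 * R s" .
        moreover have "\<bar>g1 s - h1 s\<bar> \<le> e1"
          using ends(2)[OF 1 kpk 3] hb mult_nonneg_nonneg[OF C(1) less_imp_le[OF Rm(1)]] unfolding e1_def by linarith
        ultimately show ?thesis using sq[OF sL(1), of "g s - h s" e0 "g1 s - h1 s" e1] Cp(2) s 2
          by (intro majorant_bad Cp bad1) auto
      next
        case 3
        have "g s = p s" "g1 s = q s" using mid[of s] 3 s2 by auto
        moreover have "\<bar>p s - h s\<bar> \<le> m1 * R s"
        proof -
          have "c2 * \<delta> \<le> c2 * 1" using c2 \<delta> by (intro mult_left_mono) auto
          moreover have "c2 \<le> c2 / r0 * R s" using R1[of c2] c2 by simp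
          ultimately show ?thesis using ph[OF sL(2)] unfolding m1_def by linarith
        qed
        moreover have "\<bar>q s - h1 s\<bar> \<le> m2" using qh[OF sL(2)] \<epsilon> \<delta> by (simp add: m2_def)
        ultimately have "((g s - h s) / R s)\<^sup>2 + (g1 s - h1 s)\<^sup>2 \<le> m1\<^sup>2 + m2\<^sup>2" using sq[OF sL(1), of "g s - h s" m1 "g1 s - h1 s" m2] by simp
        then show ?thesis using Cp(3) s 3 by (intro majorant_bad Cp bad1) auto
      next
        case 4
        have "g s = p s" "g1 s = q s" using mid[of s] 4 s2 by auto
        moreover have "\<bar>p s - h s\<bar> \<le> (m1 * \<delta>) * R s"
          using ph[OF sL(2)] R1[of "c2 * \<delta>"] c2 \<delta> by (simp add: m1_def)
        moreover have "\<bar>q s - h1 s\<bar> \<le> \<delta>" using qh2[of s] 4 s \<epsilon> by auto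
        ultimately have "((g s - h s) / R s)\<^sup>2 + (g1 s - h1 s)\<^sup>2 \<le> (m1 * \<delta>)\<^sup>2 + \<delta>\<^sup>2"
          using sq[OF sL(1), of "g s - h s" "m1 * \<delta>" "g1 s - h1 s" \<delta>] by simp
        also have "\<dots> = (m1\<^sup>2 + 1) * \<delta>\<^sup>2" by (simp add: power_mult_distrib distrib_right)
        also have "\<dots> \<le> (m1\<^sup>2 + 1) * \<delta>" using \<delta>2 by (intro mult_left_mono) auto
        also have "\<dots> \<le> C' / real k" by (rule Cp(5))
        finally show ?thesis by (rule majorant_good[OF Cp(1)])
      qed
    qed
    ultimately show "\<exists>g g1. (\<forall>m. Ck_on m UNIV g) \<and>
      (\<forall>x. (g has_real_derivative g1 x) (at x)) \<and> (\<forall>s. s < 1 / real k \<or> s > L - 1 / real k \<longrightarrow> g s = 0) \<and>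
      (\<forall>s\<in>{0<..<s0}. ((g s - f s) / R s)\<^sup>2 + (g1 s - f1 s)\<^sup>2 \<le> majorant C' k s) \<and>
      (\<forall>s\<in>{s0<..<L}. ((g s - h s) / R s)\<^sup>2 + (g1 s - h1 s)\<^sup>2 \<le> majorant C' k s)"
      using left right unfolding \<delta>k by blast
  qed
qed

end

section \<open>Integration and derivatives in polar coordinates\<close>

lemma vector_derivative_separated:
  assumes G: "(G has_real_derivative g1) (at s)" and I: "open I" "s \<in> I"
    and h: "\<And>\<sigma>. \<sigma> \<in> I \<Longrightarrow> h \<sigma> = of_real (G \<sigma>) * (z :: complex)"
  shows "(h has_vector_derivative of_real g1 * z) (at s)"
proof -
  have "((\<lambda>\<sigma>. of_real (G \<sigma>)) has_vector_derivative of_real g1) (at s)"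
    using G by (intro has_vector_derivative_of_real) (simp add: has_real_derivative_iff_has_vector_derivative)
  then have "((\<lambda>\<sigma>. of_real (G \<sigma>) * z) has_vector_derivative of_real g1 * z) (at s)"
    by (rule has_vector_derivative_mult_left)
  then show ?thesis
    by (rule has_vector_derivative_transform_within_open[OF _ I]) (simp add: h)
qed

lemma D_s_separated:
  assumes "(G has_real_derivative g1) (at s)" "open I" "s \<in> I"
    and "\<And>\<sigma>. \<sigma> \<in> I \<Longrightarrow> h (\<sigma>, t) = of_real (G \<sigma>) * (z * cis (real n * t))"
  shows "D_s h (s, t) = of_real g1 * (z * cis (real n * t))"
  unfolding D_s_def using vector_derivative_at[OF vector_derivative_separated[OF assms]] by simp

lemma D_t_separated:
  assumes "\<And>\<tau>. h (s, \<tau>) = of_real c * (z * cis (real n * \<tau>))"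
  shows "D_t h (s, t) = of_real c * ((z * (\<i> * of_nat n)) * cis (real n * t))"
proof -
  have "((\<lambda>\<tau>. of_real c * (z * exp (\<i> * of_real (real n * \<tau>)))) has_vector_derivative
      of_real c * ((z * (\<i> * of_nat n)) * exp (\<i> * of_real (real n * t)))) (at t)"
    by (auto intro!: derivative_eq_intros has_vector_derivative_real_field simp: mult_ac)
  then have "((\<lambda>\<tau>. h (s, \<tau>)) has_vector_derivative of_real c * ((z * (\<i> * of_nat n)) * cis (real n * t))) (at t)"
    unfolding assms cis_conv_exp .
  then show ?thesis unfolding D_t_def by (simp add: vector_derivative_at)
qed

locale setting = revolution M a e N L R \<zeta> + trapping_profile R R1 L s0 cm cp K
  for M :: "(real^3) set" and a e N :: "real^3" and L :: real and R :: "real \<Rightarrow> real"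
    and \<zeta> :: "real^3 \<Rightarrow> real \<times> complex" and R1 s0 cm cp K
begin

lemma deriv_R: "s \<in> {0<..<L} \<Longrightarrow> deriv R s = R1 s"
  by (rule DERIV_imp_deriv[OF dR_at])

section \<open>Integrals of functions of the radius\<close>

definition rect :: "(real \<times> real) set" where "rect = {0<..L} \<times> {0..<2 * pi}"

lemma rect_borel: "rect \<in> sets borel"
proof -
  have "{0<..L} \<times> {0..<2 * pi} \<in> sets (borel \<Otimes>\<^sub>M borel :: (real \<times> real) measure)"
    by (intro pair_measureI) auto
  then show ?thesis unfolding borel_prod rect_def .
qed

lemma space_vol: "space (vol L R) = rect"
  by (simp add: vol_def rect_def space_restrict_space)

lemma borel_measurable_vol:
  assumes "f \<in> borel_measurable borel" "\<And>p. p \<in> rect \<Longrightarrow> g p = f p"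
  shows "g \<in> borel_measurable (lebesgue_on rect)" "g \<in> borel_measurable (vol L R)"
proof -
  have "f \<in> borel_measurable (lebesgue_on rect)"
    by (intro measurable_restrict_space1 measurable_completion) (use assms(1) in simp)
  then show 1: "g \<in> borel_measurable (lebesgue_on rect)"
    by (rule measurable_cong[THEN iffD1, rotated]) (use assms(2) in \<open>auto simp: space_restrict_space\<close>)
  then show "g \<in> borel_measurable (vol L R)" by (simp add: vol_def rect_def)
qed

text \<open>R is controlled on [0, L] only; set to 0 elsewhere it becomes a Borel function on the
  line, fit for Fubini's theorem.\<close>

definition \<rho> :: "real \<Rightarrow> real" where "\<rho> s = indicator {0<..L} s * R s"

lemma \<rho>_borel: "\<rho> \<in> borel_measurable borel"
proof -
  have "(\<lambda>s. indicator {0<..L} s *\<^sub>R R s) \<in> borel_measurable borel"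
    by (intro borel_measurable_continuous_on_indicator continuous_on_subset[OF R_cont]) auto
  then show ?thesis by (simp add: \<rho>_def[abs_def])
qed

lemma \<rho>_fst_borel: "(\<lambda>p. \<rho> (fst p)) \<in> borel_measurable (borel :: (real \<times> real) measure)"
  by (rule measurable_compose[OF _ \<rho>_borel]) (intro borel_measurable_continuous_onI continuous_intros)

text \<open>Passes from the completed measure to the Borel product, where the angle integrates to 2
  pi.\<close>

lemma nn_integral_vol:
  assumes v: "v \<in> borel_measurable borel"
  shows "(\<integral>\<^sup>+ p. v (fst p) \<partial>vol L R) = ennreal (2 * pi) * (\<integral>\<^sup>+ s. v s * ennreal (\<rho> s) \<partial>lborel)"
proof -
  have fst_m: "fst \<in> borel_measurable (borel :: (real \<times> real) measure)"
    by (intro borel_measurable_continuous_onI continuous_intros)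
  have ef: "(\<lambda>p. v (fst p)) \<in> borel_measurable (borel :: (real \<times> real) measure)"
    by (rule measurable_compose[OF fst_m v])
  have R_m: "(\<lambda>p. ennreal (R (fst p))) \<in> borel_measurable (lebesgue_on rect)"
    by (rule borel_measurable_vol(1)[of "\<lambda>p. ennreal (\<rho> (fst p))"])
      (use \<rho>_fst_borel in \<open>auto simp: \<rho>_def rect_def\<close>)
  have "(\<integral>\<^sup>+ p. v (fst p) \<partial>vol L R) = (\<integral>\<^sup>+ p. ennreal (R (fst p)) * v (fst p) \<partial>lebesgue_on rect)"
    unfolding vol_def rect_def[symmetric]
    by (intro nn_integral_density R_m borel_measurable_vol(1)[OF ef]) auto
  also have "\<dots> = (\<integral>\<^sup>+ p. ennreal (R (fst p)) * v (fst p) * indicator rect p \<partial>lebesgue)"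
    using rect_borel by (intro nn_integral_restrict_space) auto
  also have "\<dots> = (\<integral>\<^sup>+ p. v (fst p) * ennreal (\<rho> (fst p)) * indicator {0..<2 * pi} (snd p) \<partial>lborel)"
    unfolding nn_integral_completion
    by (intro nn_integral_cong) (auto simp: rect_def \<rho>_def indicator_def mult.commute)
  also have "\<dots> = (\<integral>\<^sup>+ p. v (fst p) * ennreal (\<rho> (fst p)) * indicator {0..<2 * pi} (snd p) \<partial>(lborel \<Otimes>\<^sub>M lborel))"
    by (simp add: lborel_prod)
  also have "\<dots> = (\<integral>\<^sup>+ s. \<integral>\<^sup>+ t. v s * ennreal (\<rho> s) * indicator {0..<2 * pi} t \<partial>lborel \<partial>lborel)"
  proof -
    have [measurable]: "v \<in> borel_measurable lborel" "\<rho> \<in> borel_measurable lborel" using v \<rho>_borel by auto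
    have "(\<lambda>p. v (fst p) * ennreal (\<rho> (fst p)) * indicator {0..<2 * pi} (snd p)) \<in> borel_measurable (lborel \<Otimes>\<^sub>M lborel)"
      by measurable
    from lborel.nn_integral_fst[OF this] show ?thesis by simp
  qed
  also have "\<dots> = (\<integral>\<^sup>+ s. (v s * ennreal (\<rho> s)) * ennreal (2 * pi) \<partial>lborel)"
    by (intro nn_integral_cong) (simp add: nn_integral_cmult_indicator)
  also have "\<dots> = (\<integral>\<^sup>+ s. v s * ennreal (\<rho> s) \<partial>lborel) * ennreal (2 * pi)"
    by (rule nn_integral_multc) (use v \<rho>_borel in auto)
  finally show ?thesis by (simp add: mult.commute)
qed

text \<open>Monotonicity of the integral holds for arbitrary h, so integrands built from pointwise
  derivatives are estimated directly, away from the radii s0 and L.\<close>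

lemma nn_integral_vol_le:
  assumes v: "v \<in> borel_measurable borel"
    and h: "\<And>s t. s \<in> {0<..<L} \<Longrightarrow> s \<noteq> s0 \<Longrightarrow> h (s, t) \<le> ennreal (v s)"
  shows "(\<integral>\<^sup>+ p. h p \<partial>vol L R) \<le> ennreal (2 * pi) * (\<integral>\<^sup>+ s. ennreal (v s) * ennreal (\<rho> s) \<partial>lborel)"
proof -
  \<comment> \<open>The value \<open>top\<close> at the two exceptional radii makes the pointwise
    comparison hold everywhere at no cost, as they are null sets.\<close>
  define E where "E s = (if s \<in> {s0, L} then top else ennreal (v s))" for s
  have E: "E \<in> borel_measurable borel" unfolding E_def using v by (intro measurable_If) auto
  have "(\<integral>\<^sup>+ p. h p \<partial>vol L R) \<le> (\<integral>\<^sup>+ p. E (fst p) \<partial>vol L R)"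
  proof (rule nn_integral_mono)
    fix p assume "p \<in> space (vol L R)"
    then obtain s t where "p = (s, t)" "s \<in> {0<..L}" by (auto simp: space_vol rect_def)
    then show "h p \<le> E (fst p)" using h[of s t] by (auto simp: E_def)
  qed
  also have "\<dots> = ennreal (2 * pi) * (\<integral>\<^sup>+ s. E s * ennreal (\<rho> s) \<partial>lborel)" by (rule nn_integral_vol[OF E])
  also have "(\<integral>\<^sup>+ s. E s * ennreal (\<rho> s) \<partial>lborel) = (\<integral>\<^sup>+ s. ennreal (v s) * ennreal (\<rho> s) \<partial>lborel)"
  proof (rule nn_integral_cong_AE)
    show "AE s in lborel. E s * ennreal (\<rho> s) = ennreal (v s) * ennreal (\<rho> s)"
      using AE_lborel_singleton[of s0] AE_lborel_singleton[of L] by eventually_elim (auto simp: E_def)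
  qed
  finally show ?thesis .
qed

lemma bad_borel: "bad k \<in> sets borel"
  by (simp add: bad_def)

lemma majorant_integral:
  obtains c where "c > 0" "\<And>C j k. C \<ge> 0 \<Longrightarrow> j \<ge> 1 \<Longrightarrow> k \<ge> 1 \<Longrightarrow>
    ennreal (2 * pi) * (\<integral>\<^sup>+ s. ennreal (majorant C j s + majorant C k s) * ennreal (\<rho> s) \<partial>lborel)
      \<le> ennreal (c * C * (1 / real j + 1 / real k))"
proof -
  obtain Rm where Rm: "Rm > 0" "\<And>s. s \<in> {0..L} \<Longrightarrow> R s \<le> Rm" using R_upper by blast
  have L0: "L > 0" using s0 by simp
  \<comment> \<open>5 = 2 + 1 + 2, the widths of the three layers in units of 1/k.\<close>
  have em: "emeasure lborel (bad k) \<le> ennreal (5 * (1 / real k))" for k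
  proof -
    have "emeasure lborel (bad k) \<le> emeasure lborel ({0..2 / real k} \<union> {s0..s0 + 1 / real k}) + emeasure lborel {L - 2 / real k..L}"
      unfolding bad_def by (intro emeasure_subadditive) auto
    also have "\<dots> \<le> (emeasure lborel {0..2 / real k} + emeasure lborel {s0..s0 + 1 / real k}) + emeasure lborel {L - 2 / real k..L}"
      by (intro add_right_mono emeasure_subadditive) auto
    also have "\<dots> = ennreal (5 * (1 / real k))"
      by (simp add: ennreal_plus[symmetric] del: ennreal_plus)
    finally show ?thesis .
  qed
  note [measurable] = bad_borel
  have one: "(\<integral>\<^sup>+ s. ennreal (majorant C k s) * indicator {0..L} s \<partial>lborel) \<le> ennreal (C * (5 + L) * (1 / real k))"
    if C: "C \<ge> 0" for C k
  proof -
    have "(\<integral>\<^sup>+ s. ennreal (majorant C k s) * indicator {0..L} s \<partial>lborel)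
        \<le> (\<integral>\<^sup>+ s. ennreal C * indicator (bad k) s + ennreal (C / real k) * indicator {0..L} s \<partial>lborel)"
      by (intro nn_integral_mono) (use C in \<open>auto simp: majorant_def indicator_def ennreal_plus[symmetric] simp del: ennreal_plus\<close>)
    also have "\<dots> = ennreal C * emeasure lborel (bad k) + ennreal (C / real k) * emeasure lborel {0..L}"
      by (subst nn_integral_add) (auto simp: nn_integral_cmult_indicator bad_borel)
    also have "\<dots> \<le> ennreal C * ennreal (5 * (1 / real k)) + ennreal (C / real k) * ennreal L"
      using L0 by (intro add_mono mult_left_mono em) auto
    also have "\<dots> = ennreal (C * (5 + L) * (1 / real k))"
      using C L0 by (simp add: ennreal_mult[symmetric] ennreal_plus[symmetric] algebra_simps add_divide_distrib del: ennreal_plus)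
    finally show ?thesis .
  qed
  have m: "majorant C k \<in> borel_measurable borel" for C k
    unfolding majorant_def[abs_def] using bad_borel by simp
  show thesis
  proof (rule that[of "2 * pi * Rm * (5 + L)"])
    show "0 < 2 * pi * Rm * (5 + L)" using Rm L0 by simp
    fix C :: real and j k :: nat assume C: "C \<ge> 0" "j \<ge> 1" "k \<ge> 1"
    have nn: "majorant C k s \<ge> 0" for k s using C by (simp add: majorant_def)
    have "(\<integral>\<^sup>+ s. ennreal (majorant C j s + majorant C k s) * ennreal (\<rho> s) \<partial>lborel)
        \<le> (\<integral>\<^sup>+ s. ennreal Rm * (ennreal (majorant C j s) * indicator {0..L} s + ennreal (majorant C k s) * indicator {0..L} s) \<partial>lborel)"
    proof (rule nn_integral_mono)
      fix s
      show "ennreal (majorant C j s + majorant C k s) * ennreal (\<rho> s)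
        \<le> ennreal Rm * (ennreal (majorant C j s) * indicator {0..L} s + ennreal (majorant C k s) * indicator {0..L} s)"
      proof (cases "s \<in> {0<..L}")
        case True
        then have "ennreal (majorant C j s + majorant C k s) * ennreal (\<rho> s) \<le> ennreal (majorant C j s + majorant C k s) * ennreal Rm"
          using Rm by (intro mult_left_mono ennreal_leI) (auto simp: \<rho>_def)
        also have "\<dots> = ennreal Rm * (ennreal (majorant C j s) * indicator {0..L} s + ennreal (majorant C k s) * indicator {0..L} s)"
          using True nn by (simp add: mult.commute)
        finally show ?thesis .
      qed (simp add: \<rho>_def)
    qed
    also have "\<dots> = ennreal Rm * ((\<integral>\<^sup>+ s. ennreal (majorant C j s) * indicator {0..L} s \<partial>lborel) + (\<integral>\<^sup>+ s. ennreal (majorant C k s) * indicator {0..L} s \<partial>lborel))"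
      using m by (subst nn_integral_cmult) (auto simp: nn_integral_add)
    also have "\<dots> \<le> ennreal Rm * (ennreal (C * (5 + L) * (1 / real j)) + ennreal (C * (5 + L) * (1 / real k)))"
      by (intro mult_left_mono add_mono one C) auto
    finally have "ennreal (2 * pi) * (\<integral>\<^sup>+ s. ennreal (majorant C j s + majorant C k s) * ennreal (\<rho> s) \<partial>lborel)
        \<le> ennreal (2 * pi) * (ennreal Rm * (ennreal (C * (5 + L) * (1 / real j)) + ennreal (C * (5 + L) * (1 / real k))))"
      by (intro mult_left_mono) auto
    also have "\<dots> = ennreal (2 * pi * Rm * (5 + L) * C * (1 / real j + 1 / real k))"
      using C Rm(1) L0
      by (simp add: ennreal_mult[symmetric] ennreal_plus[symmetric] algebra_simps del: ennreal_plus)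
    finally show "ennreal (2 * pi) * (\<integral>\<^sup>+ s. ennreal (majorant C j s + majorant C k s) * ennreal (\<rho> s) \<partial>lborel)
        \<le> ennreal (2 * pi * Rm * (5 + L) * C * (1 / real j + 1 / real k))" .
  qed
qed

lemma majorant_borel: "majorant C k \<in> borel_measurable borel"
  unfolding majorant_def[abs_def] using bad_borel by simp

lemma majorant_nonneg: "C \<ge> 0 \<Longrightarrow> 0 \<le> majorant C k s"
  by (simp add: majorant_def)

lemma majorant_scale: "A * majorant C k s = majorant (A * C) k s"
  by (simp add: majorant_def distrib_left)

text \<open>Turns a pointwise majorant into the Cauchy condition of a Sobolev norm. The shift by k0
  skips the indices for which no approximant is constructed.\<close>

lemma tendsto_majorant_double:
  assumes C: "C \<ge> 0" and k0: "k0 \<ge> 1"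
    and h: "\<And>j k s t. s \<in> {0<..<L} \<Longrightarrow> s \<noteq> s0 \<Longrightarrow>
      h j k (s, t) \<le> ennreal (majorant C (k0 + j) s + majorant C (k0 + k) s)"
  shows "((\<lambda>(j, k). \<integral>\<^sup>+ p. h j k p \<partial>vol L R) \<longlongrightarrow> 0) (sequentially \<times>\<^sub>F sequentially)"
proof -
  obtain c where c: "c > 0" "\<And>C j k. C \<ge> 0 \<Longrightarrow> j \<ge> 1 \<Longrightarrow> k \<ge> 1 \<Longrightarrow>
    ennreal (2 * pi) * (\<integral>\<^sup>+ s. ennreal (majorant C j s + majorant C k s) * ennreal (\<rho> s) \<partial>lborel)
      \<le> ennreal (c * C * (1 / real j + 1 / real k))"
    using majorant_integral by blast
  have b: "(\<integral>\<^sup>+ p. h j k p \<partial>vol L R) \<le> ennreal (c * C * (1 / real (k0 + j) + 1 / real (k0 + k)))" for j k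
  proof -
    have "(\<integral>\<^sup>+ p. h j k p \<partial>vol L R) \<le> ennreal (2 * pi) * (\<integral>\<^sup>+ s. ennreal (majorant C (k0 + j) s + majorant C (k0 + k) s) * ennreal (\<rho> s) \<partial>lborel)"
      by (intro nn_integral_vol_le borel_measurable_add majorant_borel h)
    also have "\<dots> \<le> ennreal (c * C * (1 / real (k0 + j) + 1 / real (k0 + k)))" using C k0 by (intro c) auto
    finally show ?thesis .
  qed
  have l: "(\<lambda>k. 1 / real (k0 + k)) \<longlonglongrightarrow> 0"
    using LIMSEQ_ignore_initial_segment[OF lim_1_over_n, of k0] by (simp add: add.commute)
  have "((\<lambda>p. ennreal (c * C * (1 / real (k0 + fst p) + 1 / real (k0 + snd p)))) \<longlongrightarrow> ennreal (c * C * (0 + 0))) (sequentially \<times>\<^sub>F sequentially)"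
    by (intro tendsto_intros filterlim_compose[OF l filterlim_fst] filterlim_compose[OF l filterlim_snd])
  then have lim: "((\<lambda>p. ennreal (c * C * (1 / real (k0 + fst p) + 1 / real (k0 + snd p)))) \<longlongrightarrow> 0) (sequentially \<times>\<^sub>F sequentially)"
    by simp
  show ?thesis
    by (rule tendsto_sandwich[OF _ _ tendsto_const lim]) (insert b, auto intro!: always_eventually simp: case_prod_beta)
qed

lemma tendsto_majorant:
  assumes C: "C \<ge> 0" and k0: "k0 \<ge> 1"
    and h: "\<And>k s t. s \<in> {0<..<L} \<Longrightarrow> s \<noteq> s0 \<Longrightarrow> h k (s, t) \<le> ennreal (majorant C (k0 + k) s)"
  shows "(\<lambda>k. \<integral>\<^sup>+ p. h k p \<partial>vol L R) \<longlonglongrightarrow> 0"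
proof -
  have "((\<lambda>(j, k). \<integral>\<^sup>+ p. h k p \<partial>vol L R) \<longlongrightarrow> 0) (sequentially \<times>\<^sub>F sequentially)"
  proof (rule tendsto_majorant_double[OF C k0])
    fix j k s t assume "s \<in> {0<..<L}" "s \<noteq> s0"
    from h[OF this] have "h k (s, t) \<le> ennreal (majorant C (k0 + k) s)" .
    also have "\<dots> \<le> ennreal (majorant C (k0 + j) s + majorant C (k0 + k) s)"
      using majorant_nonneg[OF C] by (intro ennreal_leI) simp
    finally show "h k (s, t) \<le> ennreal (majorant C (k0 + j) s + majorant C (k0 + k) s)" .
  qed
  moreover have "filterlim (\<lambda>k. (k, k)) (sequentially \<times>\<^sub>F sequentially) sequentially"
    by (intro filterlim_Pair filterlim_ident)
  ultimately have "((\<lambda>k. (\<lambda>(j, k). \<integral>\<^sup>+ p. h k p \<partial>vol L R) (k, k)) \<longlongrightarrow> 0) sequentially"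
    by (rule filterlim_compose)
  then show ?thesis by simp
qed

text \<open>\<open>Q\<close> controls the \<open>H\<^sup>2\<close> integrand and \<open>\<Delta>\<^sub>c\<close> of \<open>G(s) exp(\<i> n \<theta>)\<close>, where \<open>x = G''\<close>, \<open>y = G'\<close> and \<open>w = G\<close>.\<close>

definition Q :: "real \<Rightarrow> real \<Rightarrow> real \<Rightarrow> real \<Rightarrow> real" where
  "Q s x y w = x\<^sup>2 + (y / R s)\<^sup>2 + (w / (R s)\<^sup>2)\<^sup>2"

lemma sum_sq_le: "(x - y)\<^sup>2 \<le> 2 * (x - z)\<^sup>2 + 2 * (y - z)\<^sup>2" for x y z :: real
  using sum_squares_ge_zero[of "(x - z) + (y - z)" 0] by (simp add: power2_eq_square algebra_simps)

text \<open>The triangle inequality through the limit, for the difference of two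
  approximants.\<close>

lemma Q_diff: "Q s (x - x') (y - y') (w - w') \<le> 2 * Q s (x - x0) (y - y0) (w - w0) + 2 * Q s (x' - x0) (y' - y0) (w' - w0)"
  using sum_sq_le[of x x' x0] sum_sq_le[of "y / R s" "y' / R s" "y0 / R s"]
    sum_sq_le[of "w / (R s)\<^sup>2" "w' / (R s)\<^sup>2" "w0 / (R s)\<^sup>2"]
  unfolding Q_def by (simp add: diff_divide_distrib)

lemma norm_separated: "norm (of_real x * (z * cis y)) = \<bar>x\<bar> * norm z"
  by (simp add: norm_mult)

section \<open>Differential expressions of separated functions\<close>

context
  fixes h :: "real \<times> real \<Rightarrow> complex" and G G1 G2 :: "real \<Rightarrow> real" and n :: nat and I :: "real set"
  assumes I: "open I" "I \<subseteq> {0<..<L}"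
    and h: "\<And>s t. s \<in> I \<Longrightarrow> h (s, t) = of_real (G s) * cis (real n * t)"
    and dG: "\<And>s. s \<in> I \<Longrightarrow> (G has_real_derivative G1 s) (at s)"
begin

lemma sep_D_s: "s \<in> I \<Longrightarrow> D_s h (s, t) = of_real (G1 s) * cis (real n * t)"
  using D_s_separated[OF dG I(1), where h = h and t = t and z = 1 and n = n] h by simp

lemma sep_D_t: "s \<in> I \<Longrightarrow> D_t h (s, t) = of_real (G s) * ((\<i> * of_nat n) * cis (real n * t))"
  using D_t_separated[of h s "G s" 1 n t] h by simp

lemma sep_D_tt: "s \<in> I \<Longrightarrow> D_t (D_t h) (s, t) = of_real (- (real n)\<^sup>2 * G s) * cis (real n * t)"
proof -
  assume s: "s \<in> I"
  have "\<i> * of_nat n * (\<i> * of_nat n) = (of_real (- (real n)\<^sup>2) :: complex)"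
    by (simp add: complex_eq_iff power2_eq_square)
  with D_t_separated[of "D_t h" s "G s" "\<i> * of_nat n" n t] sep_D_t[OF s] show ?thesis by simp
qed

lemma sep_grad: "s \<in> I \<Longrightarrow> grad_sq R h (s, t) = (G1 s)\<^sup>2 + (real n)\<^sup>2 * (G s)\<^sup>2 / (R s)\<^sup>2"
  unfolding grad_sq_def by (simp add: sep_D_s sep_D_t norm_mult power_mult_distrib mult.commute)

context
  assumes dG1: "\<And>s. s \<in> I \<Longrightarrow> (G1 has_real_derivative G2 s) (at s)"
begin

lemma sep_D_ss: "s \<in> I \<Longrightarrow> D_s (D_s h) (s, t) = of_real (G2 s) * cis (real n * t)"
  using D_s_separated[OF dG1 I(1), where h = "D_s h" and t = t and z = 1 and n = n] sep_D_s by simp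

lemma sep_D_st: "s \<in> I \<Longrightarrow> D_s (D_t h) (s, t) = of_real (G1 s) * ((\<i> * of_nat n) * cis (real n * t))"
  using D_s_separated[OF dG I(1), where h = "D_t h" and t = t and z = "\<i> * of_nat n" and n = n] sep_D_t by simp

lemma sep_hess:
  assumes s: "s \<in> I"
  shows "hess_sq R h (s, t) = (G2 s)\<^sup>2 + 2 * ((real n)\<^sup>2 * (G1 s - R1 s / R s * G s)\<^sup>2) / (R s)\<^sup>2
     + (- (real n)\<^sup>2 * G s + R s * R1 s * G1 s)\<^sup>2 / (R s) ^ 4"
proof -
  have sL: "s \<in> {0<..<L}" using s I by auto
  have 1: "D_s (D_t h) (s, t) - (R1 s / R s) *\<^sub>R D_t h (s, t) = of_real (G1 s - R1 s / R s * G s) * ((\<i> * of_nat n) * cis (real n * t))"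
    unfolding sep_D_st[OF s] sep_D_t[OF s] by (simp add: scaleR_conv_of_real algebra_simps)
  have 2: "D_t (D_t h) (s, t) + (R s * R1 s) *\<^sub>R D_s h (s, t) = of_real (- (real n)\<^sup>2 * G s + R s * R1 s * G1 s) * (1 * cis (real n * t))"
    unfolding sep_D_tt[OF s] sep_D_s[OF s] by (simp add: scaleR_conv_of_real algebra_simps)
  have 3: "D_s (D_s h) (s, t) = of_real (G2 s) * (1 * cis (real n * t))" unfolding sep_D_ss[OF s] by simp
  show ?thesis
    unfolding hess_sq_def Let_def fst_conv deriv_R[OF sL] 1 2 3 norm_separated
    by (simp add: power_mult_distrib norm_mult mult.commute)
qed

lemma sep_Delta:
  assumes s: "s \<in> I" and c: "\<And>\<sigma>. \<sigma> \<in> I \<Longrightarrow> coeff_c L s0 cm cp \<sigma> = c"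
  shows "Delta_c_classical L R s0 cm cp h (s, t) =
     of_real (c * (G2 s + R1 s / R s * G1 s - (real n)\<^sup>2 / (R s)\<^sup>2 * G s)) * cis (real n * t)"
proof -
  have sL: "s \<in> {0<..<L}" using s I by auto
  have Rs: "R s > 0" using R_pos sL by auto
  have "((\<lambda>\<sigma>. c * R \<sigma> * G1 \<sigma>) has_real_derivative c * (R1 s * G1 s + R s * G2 s)) (at s)"
    by (rule DERIV_cong[OF DERIV_mult[OF DERIV_cmult[OF dR_at[OF sL]] dG1[OF s]]]) (simp add: algebra_simps)
  from D_s_separated[OF this I(1) s, where h = "\<lambda>q. (coeff_c L s0 cm cp (fst q) * R (fst q)) *\<^sub>R D_s h q" and t = t and z = 1 and n = n]
  have 1: "D_s (\<lambda>q. (coeff_c L s0 cm cp (fst q) * R (fst q)) *\<^sub>R D_s h q) (s, t) =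
      of_real (c * (R1 s * G1 s + R s * G2 s)) * cis (real n * t)"
    using sep_D_s c by (simp add: scaleR_conv_of_real)
  have 2: "(1 / R s) * (c * (R1 s * G1 s + R s * G2 s)) + (c / (R s)\<^sup>2) * (- (real n)\<^sup>2 * G s) =
      c * (G2 s + R1 s / R s * G1 s - (real n)\<^sup>2 / (R s)\<^sup>2 * G s)"
    using Rs by (simp add: field_simps)
  show ?thesis
    unfolding Delta_c_classical_def fst_conv 1 sep_D_tt[OF s] c[OF s] 2[symmetric] of_real_add of_real_mult[of "1 / R s"]
      of_real_mult[of "c / (R s)\<^sup>2"]
    by (simp add: scaleR_conv_of_real algebra_simps)
qed

end

end

text \<open>The weights of Q match the singularities at the pole: after the substitution y = y' R, w
  = w' R^2 no negative power of R remains, so a single constant depending on n serves all s.\<close>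

lemma H2_constant:
  obtains Cn where "Cn \<ge> 0" "\<And>s x y w. s \<in> {0<..<L} \<Longrightarrow>
      w\<^sup>2 + (y\<^sup>2 + (real n)\<^sup>2 * w\<^sup>2 / (R s)\<^sup>2) +
      (x\<^sup>2 + 2 * ((real n)\<^sup>2 * (y - R1 s / R s * w)\<^sup>2) / (R s)\<^sup>2 + (- (real n)\<^sup>2 * w + R s * R1 s * y)\<^sup>2 / (R s) ^ 4)
       \<le> Cn * Q s x y w"
    "\<And>s x y w. s \<in> {0<..<L} \<Longrightarrow> w\<^sup>2 \<le> Cn * Q s x y w"
    "\<And>s x y w. s \<in> {0<..<L} \<Longrightarrow> (cm * (x + R1 s / R s * y - (real n)\<^sup>2 / (R s)\<^sup>2 * w))\<^sup>2 \<le> Cn * Q s x y w"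
    "\<And>s x y w. s \<in> {0<..<L} \<Longrightarrow> (cp * (x + R1 s / R s * y - (real n)\<^sup>2 / (R s)\<^sup>2 * w))\<^sup>2 \<le> Cn * Q s x y w"
proof -
  obtain Rm where Rm: "Rm > 0" "\<And>s. s \<in> {0..L} \<Longrightarrow> R s \<le> Rm" using R_upper by blast
  define m where "m = (real n)\<^sup>2"
  have m: "m \<ge> 0" by (simp add: m_def)
  define A where "A = 1 + Rm\<^sup>2 + Rm ^ 4 + m * Rm\<^sup>2 + 4 * m * (1 + K\<^sup>2) + 2 * (K\<^sup>2 + m\<^sup>2)"
  define D where "D = 3 * cp\<^sup>2 * (1 + K\<^sup>2 + m\<^sup>2)"
  have A: "A \<ge> 0" "D \<ge> 0" using m by (auto simp: A_def D_def)
  have Qnn: "Q s x y w \<ge> 0" for s x y w by (simp add: Q_def)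
  {
    fix s x y w assume s: "s \<in> {0<..<L}"
    have R: "R s > 0" "R s \<le> Rm" using R_pos Rm(2) s by auto
    \<comment> \<open>In these variables Q is a plain sum of squares, and the coefficients involve
      only R, R' and n.\<close>
    define y' where "y' = y / R s"
    define w' where "w' = w / (R s)\<^sup>2"
    have y: "y = y' * R s" and w: "w = w' * (R s)\<^sup>2" using R by (auto simp: y'_def w'_def)
    have R2: "(R s)\<^sup>2 \<le> Rm\<^sup>2" "(R s) ^ 4 \<le> Rm ^ 4" using R by (auto intro!: power_mono)
    have K2: "(R1 s)\<^sup>2 \<le> K\<^sup>2" using power_mono[OF K[of s], of 2] s by simp
    have Q: "Q s x y w = x\<^sup>2 + y'\<^sup>2 + w'\<^sup>2" by (simp add: Q_def y'_def w'_def)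
    have a1: "w\<^sup>2 \<le> Rm ^ 4 * w'\<^sup>2"
    proof -
      have "w\<^sup>2 = (R s) ^ 4 * w'\<^sup>2" by (simp add: w power2_eq_square power4_eq_xxxx)
      then show ?thesis using R2 by (auto intro!: mult_right_mono)
    qed
    have a2: "y\<^sup>2 \<le> Rm\<^sup>2 * y'\<^sup>2" unfolding y power_mult_distrib mult.commute[of "y'\<^sup>2"] using R2 by (intro mult_right_mono) auto
    have a3: "m * w\<^sup>2 / (R s)\<^sup>2 \<le> m * Rm\<^sup>2 * w'\<^sup>2"
    proof -
      have "m * w\<^sup>2 / (R s)\<^sup>2 = m * ((R s)\<^sup>2 * w'\<^sup>2)" using R by (simp add: w power2_eq_square)
      also have "\<dots> \<le> m * (Rm\<^sup>2 * w'\<^sup>2)" using R2 m by (intro mult_left_mono mult_right_mono) auto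
      finally show ?thesis by simp
    qed
    have kw: "(R1 s * w')\<^sup>2 \<le> K\<^sup>2 * w'\<^sup>2" "(R1 s * y')\<^sup>2 \<le> K\<^sup>2 * y'\<^sup>2"
      unfolding power_mult_distrib using K2 by (auto intro!: mult_right_mono)
    have sqd: "(u - v)\<^sup>2 \<le> 2 * u\<^sup>2 + 2 * v\<^sup>2" for u v :: real using sum_sq_le[of u v 0] by simp
    have a4: "2 * (m * (y - R1 s / R s * w)\<^sup>2) / (R s)\<^sup>2 \<le> 4 * m * y'\<^sup>2 + 4 * m * K\<^sup>2 * w'\<^sup>2"
    proof -
      have "y - R1 s / R s * w = (y' - R1 s * w') * R s" using R by (simp add: y w power2_eq_square algebra_simps)
      then have "2 * (m * (y - R1 s / R s * w)\<^sup>2) / (R s)\<^sup>2 = 2 * m * (y' - R1 s * w')\<^sup>2" using R by (simp add: power_mult_distrib)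
      also have "\<dots> \<le> 2 * m * (2 * y'\<^sup>2 + 2 * (K\<^sup>2 * w'\<^sup>2))" using sqd[of y' "R1 s * w'"] kw m by (intro mult_left_mono) auto
      finally show ?thesis by (simp add: algebra_simps)
    qed
    have a5: "(- m * w + R s * R1 s * y)\<^sup>2 / (R s) ^ 4 \<le> 2 * K\<^sup>2 * y'\<^sup>2 + 2 * m\<^sup>2 * w'\<^sup>2"
    proof -
      have "- m * w + R s * R1 s * y = (R1 s * y' - m * w') * (R s)\<^sup>2" by (simp add: y w power2_eq_square algebra_simps)
      then have "(- m * w + R s * R1 s * y)\<^sup>2 / (R s) ^ 4 = (R1 s * y' - m * w')\<^sup>2"
        using R by (simp add: power_mult_distrib power_even_eq[symmetric] power2_eq_square power4_eq_xxxx)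
      also have "\<dots> \<le> 2 * (K\<^sup>2 * y'\<^sup>2) + 2 * (m * w')\<^sup>2" using sqd[of "R1 s * y'" "m * w'"] kw by linarith
      finally show ?thesis by (simp add: power_mult_distrib)
    qed
    have nn: "0 \<le> x\<^sup>2" "0 \<le> y'\<^sup>2" "0 \<le> w'\<^sup>2" "0 \<le> K\<^sup>2" "0 \<le> Rm\<^sup>2" "0 \<le> Rm ^ 4" "0 \<le> m\<^sup>2" by auto
    define cx where "cx = (1 :: real)"
    define cy where "cy = Rm\<^sup>2 + 4 * m + 2 * K\<^sup>2"
    define cw where "cw = Rm ^ 4 + m * Rm\<^sup>2 + 4 * m * K\<^sup>2 + 2 * m\<^sup>2"
    have cc: "cx \<le> A" "cy \<le> A" "cw \<le> A" using m by (auto simp: A_def cx_def cy_def cw_def algebra_simps)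
    have "w\<^sup>2 + (y\<^sup>2 + m * w\<^sup>2 / (R s)\<^sup>2) + (x\<^sup>2 + 2 * (m * (y - R1 s / R s * w)\<^sup>2) / (R s)\<^sup>2 + (- m * w + R s * R1 s * y)\<^sup>2 / (R s) ^ 4)
        \<le> cx * x\<^sup>2 + cy * y'\<^sup>2 + cw * w'\<^sup>2"
      using a1 a2 a3 a4 a5 unfolding cx_def cy_def cw_def distrib_right by linarith
    also have "\<dots> \<le> A * x\<^sup>2 + A * y'\<^sup>2 + A * w'\<^sup>2" using cc by (intro add_mono mult_right_mono) auto
    also have "\<dots> = A * Q s x y w" by (simp add: Q distrib_left)
    finally have 1: "w\<^sup>2 + (y\<^sup>2 + m * w\<^sup>2 / (R s)\<^sup>2) + (x\<^sup>2 + 2 * (m * (y - R1 s / R s * w)\<^sup>2) / (R s)\<^sup>2 + (- m * w + R s * R1 s * y)\<^sup>2 / (R s) ^ 4)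
        \<le> A * Q s x y w" .
    moreover have "0 \<le> y\<^sup>2 + m * w\<^sup>2 / (R s)\<^sup>2" "0 \<le> x\<^sup>2 + 2 * (m * (y - R1 s / R s * w)\<^sup>2) / (R s)\<^sup>2 + (- m * w + R s * R1 s * y)\<^sup>2 / (R s) ^ 4"
      using m by auto
    ultimately have 2: "w\<^sup>2 \<le> A * Q s x y w" by linarith
    have 3: "(c * (x + R1 s / R s * y - m / (R s)\<^sup>2 * w))\<^sup>2 \<le> D * Q s x y w" if "0 < c" "c \<le> cp" for c
    proof -
      have e: "x + R1 s / R s * y - m / (R s)\<^sup>2 * w = x + R1 s * y' - m * w'" using R by (simp add: y w)
      have "(x + R1 s * y' - m * w')\<^sup>2 \<le> 3 * (x\<^sup>2 + (R1 s * y')\<^sup>2 + (m * w')\<^sup>2)"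
        using sum_squares_ge_zero[of "x - R1 s * y'" "x + m * w'"] zero_le_power2[of "R1 s * y' + m * w'"]
        by (simp add: power2_eq_square algebra_simps)
      also have "\<dots> \<le> 3 * (x\<^sup>2 + K\<^sup>2 * y'\<^sup>2 + m\<^sup>2 * w'\<^sup>2)" using kw by (simp add: power_mult_distrib)
      also have "\<dots> \<le> 3 * ((1 + K\<^sup>2 + m\<^sup>2) * x\<^sup>2 + (1 + K\<^sup>2 + m\<^sup>2) * y'\<^sup>2 + (1 + K\<^sup>2 + m\<^sup>2) * w'\<^sup>2)"
        using nn by (simp add: distrib_right)
      also have "\<dots> = 3 * (1 + K\<^sup>2 + m\<^sup>2) * Q s x y w" by (simp add: Q algebra_simps)
      finally have i: "(x + R1 s * y' - m * w')\<^sup>2 \<le> 3 * (1 + K\<^sup>2 + m\<^sup>2) * Q s x y w" .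
      have "c\<^sup>2 \<le> cp\<^sup>2" using that by (intro power_mono) auto
      then have "c\<^sup>2 * (x + R1 s * y' - m * w')\<^sup>2 \<le> cp\<^sup>2 * (3 * (1 + K\<^sup>2 + m\<^sup>2) * Q s x y w)"
        using i by (intro mult_mono) auto
      moreover have "D * Q s x y w = cp\<^sup>2 * (3 * (1 + K\<^sup>2 + m\<^sup>2) * Q s x y w)" by (simp add: D_def)
      ultimately show ?thesis by (simp only: e power_mult_distrib)
    qed
    have AD: "A * Q s x y w \<le> (A + D) * Q s x y w" "D * Q s x y w \<le> (A + D) * Q s x y w"
      using A Qnn by (auto intro!: mult_right_mono)
    note order_trans[OF 1 AD(1)] order_trans[OF 2 AD(1)] order_trans[OF 3[of cm] AD(2)] order_trans[OF 3[of cp] AD(2)]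
  }
  note b = this
  show thesis
    by (rule that[of "A + D"]) (use A b c in \<open>auto simp: m_def\<close>)
qed

end

section \<open>Membership in the domain\<close>

context setting
begin

section \<open>Lifted approximations on one side of the interface\<close>

context
  fixes n :: nat and I :: "real set" and \<Omega> :: "(real^3) set" and g g1 g2 :: "nat \<Rightarrow> real \<Rightarrow> real"
    and f f1 f2 :: "real \<Rightarrow> real" and u :: "real^3 \<Rightarrow> complex" and C :: real and k0 :: nat
  assumes I: "open I" "I \<subseteq> {0<..<L}"
    and \<Omega>: "\<And>s t. s \<in> {0<..<L} \<Longrightarrow> s \<noteq> s0 \<Longrightarrow> P (s, t) \<in> \<Omega> \<longleftrightarrow> s \<in> I" "closure \<Omega> \<subseteq> M"
    and g: "\<And>k m. Ck_on m UNIV (g k)" "\<And>k x. (g k has_real_derivative g1 k x) (at x)"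
      "\<And>k x. (g1 k has_real_derivative g2 k x) (at x)"
      "\<And>k s. s < 1 / real (k0 + k) \<Longrightarrow> g k s = 0"
    and C: "C \<ge> 0" and k0: "k0 \<ge> 1"
    and Q: "\<And>k s. s \<in> I \<Longrightarrow> Q s (g2 k s - f2 s) (g1 k s - f1 s) (g k s - f s) \<le> majorant C (k0 + k) s"
    and u: "\<And>s t. s \<in> I \<Longrightarrow> u (P (s, t)) = of_real (f s) * cis (real n * t)"
begin

lemma approx_lift_P: "s \<in> I \<Longrightarrow> lift n (g k) (P (s, t)) = of_real (g k s) * cis (real n * t)"
  using I by (intro lift_P) auto

text \<open>The squared errors are at most a constant times Q of the radial errors, hence under the
  majorant. Each approximant is smooth on all of M because its radial part vanishes near the
  pole.\<close>

lemma H2_approx_lift: "H2_approx L R P \<Omega> (\<lambda>k. lift n (g k)) u"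
  unfolding H2_approx_def
proof (intro conjI allI)
  obtain Cn where Cn: "Cn \<ge> 0" "\<And>s x y w. s \<in> {0<..<L} \<Longrightarrow>
      w\<^sup>2 + (y\<^sup>2 + (real n)\<^sup>2 * w\<^sup>2 / (R s)\<^sup>2) +
      (x\<^sup>2 + 2 * ((real n)\<^sup>2 * (y - R1 s / R s * w)\<^sup>2) / (R s)\<^sup>2 + (- (real n)\<^sup>2 * w + R s * R1 s * y)\<^sup>2 / (R s) ^ 4)
       \<le> Cn * Q s x y w"
    "\<And>s x y w. s \<in> {0<..<L} \<Longrightarrow> w\<^sup>2 \<le> Cn * Q s x y w"
    using H2_constant[of n] by metis
  show "smooth_on (closure \<Omega>) (lift n (g k))" for k
    by (rule smooth_on_subset[OF smooth_on_lift[OF g(1) _ g(4)] \<Omega>(2)]) (use k0 in auto)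
  define C' where "C' = 2 * Cn * C"
  have C': "C' \<ge> 0" using Cn C by (simp add: C'_def)
  show "((\<lambda>(j, k). H2sq L R P \<Omega> (\<lambda>p. lift n (g j) (P p) - lift n (g k) (P p))) \<longlongrightarrow> 0) (sequentially \<times>\<^sub>F sequentially)"
    unfolding H2sq_def
  proof (rule tendsto_majorant_double[OF C' k0])
    fix j k s t assume s: "s \<in> {0<..<L}" "s \<noteq> s0"
    define h where "h p = lift n (g j) (P p) - lift n (g k) (P p)" for p
    define G where "G s = g j s - g k s" for s
    define G1 where "G1 s = g1 j s - g1 k s" for s
    define G2 where "G2 s = g2 j s - g2 k s" for s
    have dG: "(G has_real_derivative G1 s) (at s)" "(G1 has_real_derivative G2 s) (at s)" for s
      unfolding G_def[abs_def] G1_def[abs_def] G2_def by (intro DERIV_diff g)+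
    have hs: "h (s, t) = of_real (G s) * cis (real n * t)" if "s \<in> I" for s t
      using that by (simp add: h_def G_def approx_lift_P algebra_simps)
    show "ennreal ((norm (h (s, t)))\<^sup>2 + grad_sq R h (s, t) + hess_sq R h (s, t)) * indicator (P -` \<Omega>) (s, t)
      \<le> ennreal (majorant C' (k0 + j) s + majorant C' (k0 + k) s)"
    proof (cases "s \<in> I")
      case True
      have "(norm (h (s, t)))\<^sup>2 + grad_sq R h (s, t) + hess_sq R h (s, t) =
        (G s)\<^sup>2 + ((G1 s)\<^sup>2 + (real n)\<^sup>2 * (G s)\<^sup>2 / (R s)\<^sup>2) +
        ((G2 s)\<^sup>2 + 2 * ((real n)\<^sup>2 * (G1 s - R1 s / R s * G s)\<^sup>2) / (R s)\<^sup>2 + (- (real n)\<^sup>2 * G s + R s * R1 s * G1 s)\<^sup>2 / (R s) ^ 4)"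
      proof -
        have gr: "grad_sq R h (s, t) = (G1 s)\<^sup>2 + (real n)\<^sup>2 * (G s)\<^sup>2 / (R s)\<^sup>2"
          by (rule sep_grad[OF I hs dG(1) True])
        have he: "hess_sq R h (s, t) = (G2 s)\<^sup>2 + 2 * ((real n)\<^sup>2 * (G1 s - R1 s / R s * G s)\<^sup>2) / (R s)\<^sup>2 + (- (real n)\<^sup>2 * G s + R s * R1 s * G1 s)\<^sup>2 / (R s) ^ 4"
          by (rule sep_hess[OF I hs dG True])
        show ?thesis unfolding gr he hs[OF True] by (simp add: norm_mult)
      qed
      also have "\<dots> \<le> Cn * Q s (G2 s) (G1 s) (G s)" by (rule Cn(2)[OF s(1)])
      also have "\<dots> \<le> Cn * (2 * majorant C (k0 + j) s + 2 * majorant C (k0 + k) s)"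
        using Q_diff[of s "g2 j s" "g2 k s" "g1 j s" "g1 k s" "g j s" "g k s" "f2 s" "f1 s" "f s"] Q[OF True, of j] Q[OF True, of k] Cn(1)
        unfolding G_def G1_def G2_def by (intro mult_left_mono) auto
      also have "\<dots> = majorant C' (k0 + j) s + majorant C' (k0 + k) s"
        by (simp add: C'_def majorant_scale[symmetric] distrib_left)
      finally show ?thesis using True \<Omega>(1)[OF s] by (simp add: ennreal_leI)
    next
      case False
      then show ?thesis using \<Omega>(1)[OF s] by simp
    qed
  qed
  have "Cn * C \<ge> 0" using Cn C by simp
  then show "(\<lambda>k. L2sq L R P \<Omega> (\<lambda>p. lift n (g k) (P p) - u (P p))) \<longlonglongrightarrow> 0"
    unfolding L2sq_def
  proof (rule tendsto_majorant[OF _ k0])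
    fix k s t assume s: "s \<in> {0<..<L}" "s \<noteq> s0"
    show "ennreal ((norm (lift n (g k) (P (s, t)) - u (P (s, t))))\<^sup>2) * indicator (P -` \<Omega>) (s, t)
      \<le> ennreal (majorant (Cn * C) (k0 + k) s)"
    proof (cases "s \<in> I")
      case True
      have "lift n (g k) (P (s, t)) - u (P (s, t)) = of_real (g k s - f s) * cis (real n * t)"
        using True by (simp add: approx_lift_P u algebra_simps)
      then have "(norm (lift n (g k) (P (s, t)) - u (P (s, t))))\<^sup>2 = (g k s - f s)\<^sup>2" by (simp add: norm_mult del: of_real_diff)
      also have "\<dots> \<le> Cn * Q s (g2 k s - f2 s) (g1 k s - f1 s) (g k s - f s)" by (rule Cn(3)[OF s(1)])
      also have "\<dots> \<le> Cn * majorant C (k0 + k) s" using Q[OF True] Cn(1) by (intro mult_left_mono) auto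
      finally show ?thesis using True \<Omega>(1)[OF s] by (simp add: ennreal_leI majorant_scale)
    next
      case False
      then show ?thesis using \<Omega>(1)[OF s] by simp
    qed
  qed
qed

text \<open>On a separated function the operator is a linear expression in (g'', g', g). Subtracting
  the equation of f leaves the same expression in the errors, which Q controls.\<close>

lemma Delta_c_on_lift:
  assumes c: "c = cm \<or> c = cp" "\<And>\<sigma>. \<sigma> \<in> I \<Longrightarrow> coeff_c L s0 cm cp \<sigma> = c"
    and ode: "\<And>s. s \<in> I \<Longrightarrow> c * (f2 s + R1 s / R s * f1 s - (real n)\<^sup>2 / (R s)\<^sup>2 * f s) = - l * f s"
  shows "Delta_c_on L R P s0 cm cp \<Omega> u (\<lambda>m. - (of_real l * u m))"
  unfolding Delta_c_on_def
proof (intro exI conjI)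
  show "H2_approx L R P \<Omega> (\<lambda>k. lift n (g k)) u" by (rule H2_approx_lift)
  obtain Cn where Cn: "Cn \<ge> 0"
    "\<And>s x y w. s \<in> {0<..<L} \<Longrightarrow> (c * (x + R1 s / R s * y - (real n)\<^sup>2 / (R s)\<^sup>2 * w))\<^sup>2 \<le> Cn * Q s x y w"
    using H2_constant[of n] c(1) by metis
  have "Cn * C \<ge> 0" using Cn C by simp
  then show "(\<lambda>k. L2sq L R P \<Omega> (\<lambda>p. Delta_c_classical L R s0 cm cp (lift n (g k) \<circ> P) p - - (of_real l * u (P p)))) \<longlonglongrightarrow> 0"
    unfolding L2sq_def
  proof (rule tendsto_majorant[OF _ k0])
    fix k s t assume s: "s \<in> {0<..<L}" "s \<noteq> s0"
    show "ennreal ((norm (Delta_c_classical L R s0 cm cp (lift n (g k) \<circ> P) (s, t) - - (of_real l * u (P (s, t)))))\<^sup>2) * indicator (P -` \<Omega>) (s, t)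
      \<le> ennreal (majorant (Cn * C) (k0 + k) s)"
    proof (cases "s \<in> I")
      case True
      have hs: "(lift n (g k) \<circ> P) (s, t) = of_real (g k s) * cis (real n * t)" if "s \<in> I" for s t
        using that by (simp add: approx_lift_P)
      define r where "r = R1 s / R s"
      define q where "q = (real n)\<^sup>2 / (R s)\<^sup>2"
      have D: "Delta_c_classical L R s0 cm cp (lift n (g k) \<circ> P) (s, t) =
          of_real (c * (g2 k s + r * g1 k s - q * g k s)) * cis (real n * t)"
        unfolding r_def q_def by (rule sep_Delta[OF I hs g(2) g(3) True c(2)])
      have o: "c * (f2 s + r * f1 s - q * f s) = - l * f s" using ode[OF True] by (simp add: r_def q_def)
      have e: "c * (g2 k s + r * g1 k s - q * g k s) + l * f s =
          c * ((g2 k s - f2 s) + r * (g1 k s - f1 s) - q * (g k s - f s))"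
        using o by (simp add: algebra_simps)
      have "Delta_c_classical L R s0 cm cp (lift n (g k) \<circ> P) (s, t) - - (of_real l * u (P (s, t))) =
          of_real (c * (g2 k s + r * g1 k s - q * g k s) + l * f s) * cis (real n * t)"
        unfolding D u[OF True] by (simp add: algebra_simps)
      then have "(norm (Delta_c_classical L R s0 cm cp (lift n (g k) \<circ> P) (s, t) - - (of_real l * u (P (s, t)))))\<^sup>2 =
          (c * ((g2 k s - f2 s) + r * (g1 k s - f1 s) - q * (g k s - f s)))\<^sup>2"
        unfolding e by (simp only: norm_mult norm_of_real norm_cis mult_1_right power2_abs)
      also have "\<dots> \<le> Cn * Q s (g2 k s - f2 s) (g1 k s - f1 s) (g k s - f s)"
        unfolding r_def q_def by (rule Cn(2)[OF s(1)])
      also have "\<dots> \<le> Cn * majorant C (k0 + k) s" using Q[OF True] Cn(1) by (intro mult_left_mono) auto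
      finally show ?thesis using True \<Omega>(1)[OF s] by (simp add: ennreal_leI majorant_scale)
    next
      case False
      then show ?thesis using \<Omega>(1)[OF s] by simp
    qed
  qed
qed

text \<open>The approximants are smooth across s0, so their one-sided derivatives there are the
  ordinary ones. As |exp(i n \<theta>)| = 1, convergence of the traces reduces to that of a single
  number.\<close>

lemma normal_trace_lift:
  assumes J: "s0 \<in> J" "J \<subseteq> {0<..L}" "at s0 within J \<noteq> bot"
    and lim: "(\<lambda>k. (g1 k s0 - f1 s0)\<^sup>2) \<longlonglongrightarrow> 0"
  shows "normal_trace L R P s0 J \<Omega> u (\<lambda>\<theta>. of_real (f1 s0) * cis (real n * \<theta>))"
  unfolding normal_trace_def
proof (intro conjI exI)
  have "(\<lambda>\<theta>. of_real (f1 s0) * cis (real n * \<theta>)) \<in> borel_measurable borel"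
    by (intro borel_measurable_continuous_onI continuous_intros)
  then show "(\<lambda>\<theta>. of_real (f1 s0) * cis (real n * \<theta>)) \<in> borel_measurable (lebesgue_on {0..<2 * pi})"
    by (intro measurable_restrict_space1 measurable_completion) simp
  show "H2_approx L R P \<Omega> (\<lambda>k. lift n (g k)) u" by (rule H2_approx_lift)
  have vd: "vector_derivative (\<lambda>\<sigma>. lift n (g k) (P (\<sigma>, \<theta>))) (at s0 within J) = of_real (g1 k s0) * cis (real n * \<theta>)" for k \<theta>
  proof (rule vector_derivative_within[OF J(3)])
    have "((\<lambda>\<sigma>. of_real (g k \<sigma>) * cis (real n * \<theta>)) has_vector_derivative of_real (g1 k s0) * cis (real n * \<theta>)) (at s0)"
      by (rule vector_derivative_separated[OF g(2) open_UNIV]) auto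
    then have "((\<lambda>\<sigma>. of_real (g k \<sigma>) * cis (real n * \<theta>)) has_vector_derivative of_real (g1 k s0) * cis (real n * \<theta>)) (at s0 within J)"
      by (rule has_vector_derivative_at_within)
    then show "((\<lambda>\<sigma>. lift n (g k) (P (\<sigma>, \<theta>))) has_vector_derivative of_real (g1 k s0) * cis (real n * \<theta>)) (at s0 within J)"
      by (rule has_vector_derivative_transform[rotated 2]) (use J lift_P in auto)
  qed
  have nq: "(norm (vector_derivative (\<lambda>\<sigma>. lift n (g k) (P (\<sigma>, \<theta>))) (at s0 within J) - of_real (f1 s0) * cis (real n * \<theta>)))\<^sup>2 * R s0
      = (g1 k s0 - f1 s0)\<^sup>2 * R s0" for k \<theta>
    unfolding vd left_diff_distrib[symmetric] of_real_diff[symmetric] by (simp only: norm_mult norm_of_real norm_cis mult_1_right power2_abs)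
  have eq: "(\<integral>\<^sup>+ \<theta>. ennreal ((norm (vector_derivative (\<lambda>\<sigma>. lift n (g k) (P (\<sigma>, \<theta>))) (at s0 within J) - of_real (f1 s0) * cis (real n * \<theta>)))\<^sup>2 * R s0)
      \<partial>lebesgue_on {0..<2 * pi}) = ennreal ((g1 k s0 - f1 s0)\<^sup>2 * R s0) * ennreal (2 * pi)" for k
    unfolding nq by (simp add: emeasure_restrict_space)
  have "(\<lambda>k. ennreal ((g1 k s0 - f1 s0)\<^sup>2 * R s0 * (2 * pi))) \<longlonglongrightarrow> ennreal (0 * R s0 * (2 * pi))"
    by (intro tendsto_intros lim)
  then show "(\<lambda>k. \<integral>\<^sup>+ \<theta>. ennreal ((norm (vector_derivative (\<lambda>\<sigma>. lift n (g k) (P (\<sigma>, \<theta>))) (at s0 within J) - of_real (f1 s0) * cis (real n * \<theta>)))\<^sup>2 * R s0)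
      \<partial>lebesgue_on {0..<2 * pi}) \<longlonglongrightarrow> 0"
    unfolding eq using Rs0 by (simp add: ennreal_mult[symmetric])
qed

end

lemma measurable_lift:
  assumes "continuous_on {0<..L} F"
  shows "measurable_fun L R P (lift n F)"
  unfolding measurable_fun_def
proof (rule borel_measurable_vol(2))
  show "(\<lambda>p. indicator rect p *\<^sub>R (of_real (F (fst p)) * cis (real n * snd p))) \<in> borel_measurable borel"
    by (intro borel_measurable_continuous_on_indicator rect_borel continuous_intros continuous_on_compose2[OF assms])
      (auto simp: rect_def)
  show "(lift n F \<circ> P) p = indicator rect p *\<^sub>R (of_real (F (fst p)) * cis (real n * snd p))" if "p \<in> rect" for p
    using that lift_P[of "fst p" n F "snd p"] by (auto simp: rect_def)
qed

lemma H10_lift: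
  assumes g: "\<And>k m. Ck_on m UNIV (g k)" "\<And>k x. (g k has_real_derivative g1 k x) (at x)"
      "\<And>k s. s < 1 / real (k0 + k) \<or> s > L - 1 / real (k0 + k) \<Longrightarrow> g k s = 0"
    and C: "C \<ge> 0" and k0: "k0 \<ge> 1"
    and F: "continuous_on {0<..L} F"
    and b: "\<And>k s. s \<in> {0<..<L} \<Longrightarrow> s \<noteq> s0 \<Longrightarrow> ((g k s - F s) / R s)\<^sup>2 + (g1 k s - F1 s)\<^sup>2 \<le> majorant C (k0 + k) s"
  shows "lift n F \<in> H10 M L R P"
  unfolding H10_def
proof (intro CollectI conjI exI allI)
  show "measurable_fun L R P (lift n F)" by (rule measurable_lift[OF F])
  have kpos: "0 < 1 / real (k0 + k)" for k using k0 by simp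
  show "smooth_on M (lift n (g k))" for k
    by (rule smooth_on_lift[OF g(1) kpos g(3)]) auto
  show "closure {x\<in>M. lift n (g k) x \<noteq> 0} \<inter> surface_boundary M = {}" for k
    by (rule lift_support_boundary[OF kpos g(3) g(3)]) auto
  obtain Rm where Rm: "Rm > 0" "\<And>s. s \<in> {0..L} \<Longrightarrow> R s \<le> Rm" using R_upper by blast
  \<comment> \<open>Rm^2 accounts for the function itself, n^2 for its angular derivative n w / R,
    and 1 for the radial derivative.\<close>
  define B where "B = Rm\<^sup>2 + (real n)\<^sup>2 + 1"
  have B: "B \<ge> 1" by (simp add: B_def)
  have alg: "w\<^sup>2 + (y\<^sup>2 + (real n)\<^sup>2 * w\<^sup>2 / (R s)\<^sup>2) \<le> B * ((w / R s)\<^sup>2 + y\<^sup>2)" if "s \<in> {0<..<L}" for s w y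
  proof -
    have R: "R s > 0" "R s \<le> Rm" using R_pos Rm(2) that by auto
    define v where "v = w / R s"
    have w: "w = v * R s" using R by (simp add: v_def)
    have "v\<^sup>2 * (R s)\<^sup>2 \<le> v\<^sup>2 * Rm\<^sup>2" using R by (intro mult_left_mono power_mono) auto
    moreover have "(real n)\<^sup>2 * w\<^sup>2 / (R s)\<^sup>2 = (real n)\<^sup>2 * v\<^sup>2" using R by (simp add: w power_mult_distrib)
    moreover have "y\<^sup>2 \<le> B * y\<^sup>2" using B by (simp add: mult_le_cancel_right1)
    moreover have "B * v\<^sup>2 = v\<^sup>2 * Rm\<^sup>2 + (real n)\<^sup>2 * v\<^sup>2 + v\<^sup>2" by (simp add: B_def algebra_simps)
    moreover have "w\<^sup>2 = v\<^sup>2 * (R s)\<^sup>2" by (simp add: w power_mult_distrib)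
    moreover have "0 \<le> v\<^sup>2" by simp
    ultimately show ?thesis unfolding v_def[symmetric] distrib_left by linarith
  qed
  define C' where "C' = 2 * B * C"
  have C': "C' \<ge> 0" using B C by (simp add: C'_def)
  show "((\<lambda>(j, k). H1sq L R P M (\<lambda>p. lift n (g j) (P p) - lift n (g k) (P p))) \<longlongrightarrow> 0) (sequentially \<times>\<^sub>F sequentially)"
    unfolding H1sq_def
  proof (rule tendsto_majorant_double[OF C' k0])
    fix j k s t assume s: "s \<in> {0<..<L}" "s \<noteq> s0"
    define h where "h p = lift n (g j) (P p) - lift n (g k) (P p)" for p
    define G where "G s = g j s - g k s" for s
    define G1 where "G1 s = g1 j s - g1 k s" for s
    have dG: "(G has_real_derivative G1 s) (at s)" for s
      unfolding G_def[abs_def] G1_def by (intro DERIV_diff g)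
    have hs: "h (s, t) = of_real (G s) * cis (real n * t)" if "s \<in> {0<..<L}" for s t
      using that by (simp add: h_def G_def lift_P algebra_simps)
    have "(norm (h (s, t)))\<^sup>2 + grad_sq R h (s, t) = (G s)\<^sup>2 + ((G1 s)\<^sup>2 + (real n)\<^sup>2 * (G s)\<^sup>2 / (R s)\<^sup>2)"
    proof -
      have gr: "grad_sq R h (s, t) = (G1 s)\<^sup>2 + (real n)\<^sup>2 * (G s)\<^sup>2 / (R s)\<^sup>2"
        by (rule sep_grad[OF open_greaterThanLessThan order_refl hs dG s(1)])
      show ?thesis unfolding gr hs[OF s(1)] by (simp add: norm_mult)
    qed
    also have "\<dots> \<le> B * ((G s / R s)\<^sup>2 + (G1 s)\<^sup>2)" by (rule alg[OF s(1)])
    also have "\<dots> \<le> B * (2 * majorant C (k0 + j) s + 2 * majorant C (k0 + k) s)"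
    proof -
      have "(G s / R s)\<^sup>2 \<le> 2 * ((g j s - F s) / R s)\<^sup>2 + 2 * ((g k s - F s) / R s)\<^sup>2"
        using sum_sq_le[of "g j s / R s" "g k s / R s" "F s / R s"] by (simp add: G_def diff_divide_distrib)
      moreover have "(G1 s)\<^sup>2 \<le> 2 * (g1 j s - F1 s)\<^sup>2 + 2 * (g1 k s - F1 s)\<^sup>2"
        using sum_sq_le[of "g1 j s" "g1 k s" "F1 s"] by (simp add: G1_def)
      ultimately have "(G s / R s)\<^sup>2 + (G1 s)\<^sup>2 \<le> 2 * majorant C (k0 + j) s + 2 * majorant C (k0 + k) s"
        using b[OF s, of j] b[OF s, of k] by linarith
      then show ?thesis using B by (intro mult_left_mono) auto
    qed
    also have "\<dots> = majorant C' (k0 + j) s + majorant C' (k0 + k) s"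
      by (simp add: C'_def majorant_scale[symmetric] distrib_left)
    finally have le: "(norm (h (s, t)))\<^sup>2 + grad_sq R h (s, t) \<le> majorant C' (k0 + j) s + majorant C' (k0 + k) s" .
    have "ennreal ((norm (h (s, t)))\<^sup>2 + grad_sq R h (s, t)) * indicator (P -` M) (s, t) \<le> ennreal ((norm (h (s, t)))\<^sup>2 + grad_sq R h (s, t))"
      by (auto simp: indicator_def)
    also have "\<dots> \<le> ennreal (majorant C' (k0 + j) s + majorant C' (k0 + k) s)" by (rule ennreal_leI[OF le])
    finally show "ennreal ((norm (h (s, t)))\<^sup>2 + grad_sq R h (s, t)) * indicator (P -` M) (s, t)
      \<le> ennreal (majorant C' (k0 + j) s + majorant C' (k0 + k) s)" .
  qed
  have "B * C \<ge> 0" using B C by simp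
  then show "(\<lambda>k. L2sq L R P M (\<lambda>p. lift n (g k) (P p) - lift n F (P p))) \<longlonglongrightarrow> 0"
    unfolding L2sq_def
  proof (rule tendsto_majorant[OF _ k0])
    fix k s t assume s: "s \<in> {0<..<L}" "s \<noteq> s0"
    have "lift n (g k) (P (s, t)) - lift n F (P (s, t)) = of_real (g k s - F s) * cis (real n * t)"
      using s by (simp add: lift_P algebra_simps)
    then have "(norm (lift n (g k) (P (s, t)) - lift n F (P (s, t))))\<^sup>2 = (g k s - F s)\<^sup>2"
      by (simp only: norm_mult norm_of_real norm_cis mult_1_right power2_abs)
    also have "\<dots> \<le> B * (((g k s - F s) / R s)\<^sup>2 + 0\<^sup>2)"
      using alg[OF s(1), of "g k s - F s" 0] by (smt (verit) divide_nonneg_nonneg mult_nonneg_nonneg zero_le_power2)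
    also have "\<dots> \<le> B * majorant C (k0 + k) s"
    proof (rule mult_left_mono)
      show "((g k s - F s) / R s)\<^sup>2 + 0\<^sup>2 \<le> majorant C (k0 + k) s"
        by (rule order_trans[OF _ b[OF s, of k]]) simp
    qed (use B in simp)
    finally have le: "(norm (lift n (g k) (P (s, t)) - lift n F (P (s, t))))\<^sup>2 \<le> majorant (B * C) (k0 + k) s"
      by (simp add: majorant_scale)
    have "ennreal ((norm (lift n (g k) (P (s, t)) - lift n F (P (s, t))))\<^sup>2) * indicator (P -` M) (s, t)
        \<le> ennreal ((norm (lift n (g k) (P (s, t)) - lift n F (P (s, t))))\<^sup>2)"
      by (auto simp: indicator_def)
    also have "\<dots> \<le> ennreal (majorant (B * C) (k0 + k) s)" by (rule ennreal_leI[OF le])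
    finally show "ennreal ((norm (lift n (g k) (P (s, t)) - lift n F (P (s, t))))\<^sup>2) * indicator (P -` M) (s, t)
      \<le> ennreal (majorant (B * C) (k0 + k) s)" .
  qed
qed

end

section \<open>Eigenfunctions on the surface\<close>

context profile
begin

definition glue :: "(real \<Rightarrow> real) \<Rightarrow> (real \<Rightarrow> real) \<Rightarrow> real \<Rightarrow> real" where
  "glue f h s = (if s \<le> s0 then f s else h s)"

lemma side_solution_scale:
  assumes "side_solution R R1 n c l J f f1 f2"
  shows "side_solution R R1 n c l J (\<lambda>s. A * f s) (\<lambda>s. A * f1 s) (\<lambda>s. A * f2 s)"
  unfolding side_solution_def
proof (intro conjI ballI)
  fix s assume s: "s \<in> J"
  then have d: "(f has_real_derivative f1 s) (at s within J)" "(f1 has_real_derivative f2 s) (at s within J)"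
    and o: "c * (f2 s + R1 s / R s * f1 s - n\<^sup>2 / (R s)\<^sup>2 * f s) = - l * f s"
    using assms unfolding side_solution_def by auto
  show "((\<lambda>s. A * f s) has_real_derivative A * f1 s) (at s within J)" by (rule DERIV_cmult[OF d(1)])
  show "((\<lambda>s. A * f1 s) has_real_derivative A * f2 s) (at s within J)" by (rule DERIV_cmult[OF d(2)])
  have "c * (A * f2 s + R1 s / R s * (A * f1 s) - n\<^sup>2 / (R s)\<^sup>2 * (A * f s)) =
      A * (c * (f2 s + R1 s / R s * f1 s - n\<^sup>2 / (R s)\<^sup>2 * f s))" by (simp add: algebra_simps)
  then show "c * (A * f2 s + R1 s / R s * (A * f1 s) - n\<^sup>2 / (R s)\<^sup>2 * (A * f s)) = - l * (A * f s)"
    unfolding o by simp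
next
  show "continuous_on J (\<lambda>s. A * f2 s)" using assms unfolding side_solution_def by (intro continuous_intros) auto
qed

lemma radial_mode_scale:
  assumes "radial_mode n l f f1 f2 h h1 h2" and A: "A > 0"
  shows "radial_mode n l (\<lambda>s. A * f s) (\<lambda>s. A * f1 s) (\<lambda>s. A * f2 s) (\<lambda>s. A * h s) (\<lambda>s. A * h1 s) (\<lambda>s. A * h2 s)"
proof -
  from assms(1) obtain C where C: "\<And>s. s \<in> {0<..s0} \<Longrightarrow> \<bar>f s\<bar> \<le> C * (R s)\<^sup>2 \<and> \<bar>f1 s\<bar> \<le> C * R s \<and> \<bar>f2 s\<bar> \<le> C"
    unfolding radial_mode_def by blast
  have "\<bar>A * f s\<bar> \<le> (A * C) * (R s)\<^sup>2 \<and> \<bar>A * f1 s\<bar> \<le> (A * C) * R s \<and> \<bar>A * f2 s\<bar> \<le> A * C" if "s \<in> {0<..s0}" for s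
    using C[OF that] A by (simp add: abs_mult mult.assoc)
  moreover have "cm * (A * f1 s0) = cp * (A * h1 s0)"
    using assms(1) unfolding radial_mode_def by (metis mult.left_commute)
  moreover from calculation(1) have "\<exists>C. \<forall>s\<in>{0<..s0}. \<bar>A * f s\<bar> \<le> C * (R s)\<^sup>2 \<and> \<bar>A * f1 s\<bar> \<le> C * R s \<and> \<bar>A * f2 s\<bar> \<le> C"
    by blast
  ultimately show ?thesis
    using assms side_solution_scale[of n cm l "{0<..s0}" f f1 f2 A] side_solution_scale[of n cp l "{s0..L}" h h1 h2 A]
    unfolding radial_mode_def by simp
qed

end

lemma borel_measurable_ennreal_indicator:
  fixes \<phi> :: "real \<Rightarrow> real"
  assumes "continuous_on A \<phi>" "A \<in> sets borel"
  shows "(\<lambda>s. ennreal (\<phi> s) * indicator A s) \<in> borel_measurable borel"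
proof -
  have "(\<lambda>s. indicator A s *\<^sub>R \<phi> s) \<in> borel_measurable borel"
    by (rule borel_measurable_continuous_on_indicator[OF assms(2,1)])
  then have "(\<lambda>s. ennreal (indicator A s *\<^sub>R \<phi> s)) \<in> borel_measurable borel" by simp
  moreover have "ennreal (indicator A s *\<^sub>R \<phi> s) = ennreal (\<phi> s) * indicator A s" for s by (simp add: indicator_def)
  ultimately show ?thesis by simp
qed

context setting
begin

lemma coeff_left: "s \<in> {0<..<s0} \<Longrightarrow> coeff_c L s0 cm cp s = cm"
  and coeff_right: "s \<in> {s0<..<L} \<Longrightarrow> coeff_c L s0 cm cp s = cp"
  using s0 by (auto simp: coeff_c_def)

text \<open>Covers both media: J reaches the pole or is a compact interval away from it. All three
  conclusions come from the same sequence of lifted approximants.\<close>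

lemma side_membership:
  assumes J: "J = {0<..\<beta>} \<or> (\<exists>\<alpha>>0. \<alpha> < \<beta> \<and> J = {\<alpha>..\<beta>})" and \<beta>: "0 < \<beta>" "\<beta> \<le> L"
    and s0J: "s0 \<in> J" "at s0 within J \<noteq> bot"
    and side: "side_solution R R1 (real n) c l J f f1 f2" and c': "c = cm \<or> c = cp"
    and C: "C \<ge> 0" "\<And>s. s \<in> J \<Longrightarrow> \<bar>f s\<bar> \<le> C * (R s)\<^sup>2 \<and> \<bar>f1 s\<bar> \<le> C * R s \<and> \<bar>f2 s\<bar> \<le> C"
    and \<Omega>: "\<And>s t. s \<in> {0<..<L} \<Longrightarrow> s \<noteq> s0 \<Longrightarrow> P (s, t) \<in> \<Omega> \<longleftrightarrow> s \<in> interior J" "closure \<Omega> \<subseteq> M"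
    and coeff: "\<And>s. s \<in> interior J \<Longrightarrow> coeff_c L s0 cm cp s = c"
    and u: "\<And>s t. s \<in> interior J \<Longrightarrow> u (P (s, t)) = of_real (f s) * cis (real n * t)"
  shows "\<exists>gs. H2_approx L R P \<Omega> gs u"
    "Delta_c_on L R P s0 cm cp \<Omega> u (\<lambda>m. - (of_real l * u m))"
    "normal_trace L R P s0 J \<Omega> u (\<lambda>\<theta>. of_real (f1 s0) * cis (real n * \<theta>))"
proof -
  have d: "\<And>s. s \<in> J \<Longrightarrow> (f has_real_derivative f1 s) (at s within J)"
    "\<And>s. s \<in> J \<Longrightarrow> (f1 has_real_derivative f2 s) (at s within J)" "continuous_on J f2"
    using side unfolding side_solution_def by auto
  obtain C' k0 where k0: "C' \<ge> 0" "k0 \<ge> 1" "\<And>k. k \<ge> k0 \<Longrightarrow> \<exists>g g1 g2. (\<forall>m. Ck_on m UNIV g) \<and>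
      (\<forall>x. (g has_real_derivative g1 x) (at x) \<and> (g1 has_real_derivative g2 x) (at x)) \<and>
      (\<forall>s. s < 1 / real k \<longrightarrow> g s = 0) \<and>
      (\<forall>s\<in>J. (g2 s - f2 s)\<^sup>2 + ((g1 s - f1 s) / R s)\<^sup>2 + ((g s - f s) / (R s)\<^sup>2)\<^sup>2
         \<le> C' * indicator {0..2 / real k} s + C' / real k)"
    using H2_approximation[OF J \<beta> d C] by metis
  have "\<forall>k. \<exists>g g1 g2. (\<forall>m. Ck_on m UNIV g) \<and>
      (\<forall>x. (g has_real_derivative g1 x) (at x) \<and> (g1 has_real_derivative g2 x) (at x)) \<and>
      (\<forall>s. s < 1 / real (k0 + k) \<longrightarrow> g s = 0) \<and>
      (\<forall>s\<in>J. Q s (g2 s - f2 s) (g1 s - f1 s) (g s - f s)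
         \<le> C' * indicator {0..2 / real (k0 + k)} s + C' / real (k0 + k))"
    unfolding Q_def by (intro allI k0(3)) simp
  then obtain g g1 g2 where g: "\<And>k m. Ck_on m UNIV (g k)" "\<And>k x. (g k has_real_derivative g1 k x) (at x)"
      "\<And>k x. (g1 k has_real_derivative g2 k x) (at x)"
      "\<And>k s. s < 1 / real (k0 + k) \<Longrightarrow> g k s = 0"
      "\<And>k s. s \<in> J \<Longrightarrow> Q s (g2 k s - f2 s) (g1 k s - f1 s) (g k s - f s) \<le> C' * indicator {0..2 / real (k0 + k)} s + C' / real (k0 + k)"
    by metis
  have IJ: "interior J \<subseteq> J" by (rule interior_subset)
  have "J \<subseteq> {0<..L}" using J \<beta> by auto
  have "interior J \<subseteq> {0<..<L}"
    using J \<beta> by auto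
  have bd: "Q s (g2 k s - f2 s) (g1 k s - f1 s) (g k s - f s) \<le> majorant C' (k0 + k) s" if "s \<in> interior J" for k s
  proof -
    have "C' * indicator {0..2 / real (k0 + k)} s \<le> C' * indicator (bad (k0 + k)) s"
      using k0(1) by (intro mult_left_mono) (auto simp: indicator_def bad_def)
    then show ?thesis using g(5)[of s k] that IJ unfolding majorant_def by fastforce
  qed
  note prem = open_interior \<open>interior J \<subseteq> {0<..<L}\<close> \<Omega> g(1-4) k0(1,2) bd u
  show "\<exists>gs. H2_approx L R P \<Omega> gs u"
    using H2_approx_lift[OF prem] by blast
  show "Delta_c_on L R P s0 cm cp \<Omega> u (\<lambda>m. - (of_real l * u m))"
    by (rule Delta_c_on_lift[OF prem c' coeff side_solution_at(3)[OF side]])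
  \<comment> \<open>The pole layer no longer contains s0 once 2 / (k0 + k) < s0; from then on the
    bound for Q at s0 is C' / (k0 + k), which makes the normal derivatives converge.\<close>
  have lim: "(\<lambda>k. (R s0)\<^sup>2 * (C' * (1 / real (k0 + k)))) \<longlonglongrightarrow> (R s0)\<^sup>2 * (C' * 0)"
    using LIMSEQ_ignore_initial_segment[OF lim_1_over_n, of k0] by (intro tendsto_intros) (simp add: add.commute)
  have "eventually (\<lambda>k. 2 / s0 < real k) sequentially"
    using filterlim_real_sequentially unfolding filterlim_at_top_dense by blast
  then have "eventually (\<lambda>k. (R s0)\<^sup>2 * (C' * (1 / real (k0 + k))) =
      (R s0)\<^sup>2 * (C' * indicator {0..2 / real (k0 + k)} s0 + C' / real (k0 + k))) sequentially"
  proof eventually_elim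
    case (elim k)
    have "2 / s0 < real (k0 + k)" using elim by simp
    then have "2 / real (k0 + k) < s0" using s0 k0(2) by (simp add: field_simps)
    then show ?case by simp
  qed
  from Lim_transform_eventually[OF lim this]
  have lim': "(\<lambda>k. (R s0)\<^sup>2 * (C' * indicator {0..2 / real (k0 + k)} s0 + C' / real (k0 + k))) \<longlonglongrightarrow> 0" by simp
  have "(\<lambda>k. (g1 k s0 - f1 s0)\<^sup>2) \<longlonglongrightarrow> 0"
  proof (rule tendsto_sandwich[OF _ _ tendsto_const lim'])
    show "eventually (\<lambda>k. 0 \<le> (g1 k s0 - f1 s0)\<^sup>2) sequentially" by simp
    have "(g1 k s0 - f1 s0)\<^sup>2 \<le> (R s0)\<^sup>2 * (C' * indicator {0..2 / real (k0 + k)} s0 + C' / real (k0 + k))" for k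
    proof -
      have "((g1 k s0 - f1 s0) / R s0)\<^sup>2 \<le> Q s0 (g2 k s0 - f2 s0) (g1 k s0 - f1 s0) (g k s0 - f s0)" by (simp add: Q_def)
      also have "\<dots> \<le> C' * indicator {0..2 / real (k0 + k)} s0 + C' / real (k0 + k)" by (rule g(5)[OF s0J(1)])
      finally have "(R s0)\<^sup>2 * ((g1 k s0 - f1 s0) / R s0)\<^sup>2 \<le> (R s0)\<^sup>2 * (C' * indicator {0..2 / real (k0 + k)} s0 + C' / real (k0 + k))"
        by (rule mult_left_mono) simp
      then show ?thesis using Rs0 by (simp add: power_divide)
    qed
    then show "eventually (\<lambda>k. (g1 k s0 - f1 s0)\<^sup>2 \<le> (R s0)\<^sup>2 * (C' * indicator {0..2 / real (k0 + k)} s0 + C' / real (k0 + k))) sequentially"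
      by (rule always_eventually[OF allI])
  qed
  note lim2 = this
  show "normal_trace L R P s0 J \<Omega> u (\<lambda>\<theta>. of_real (f1 s0) * cis (real n * \<theta>))"
    by (rule normal_trace_lift[where g = g and ?g1.0 = g1 and ?g2.0 = g2 and f = f and ?f1.0 = f1 and ?f2.0 = f2,
          OF prem s0J(1) \<open>J \<subseteq> {0<..L}\<close> s0J(2) lim2])
qed

context
  fixes n :: nat and l :: real and f f1 f2 h h1 h2 :: "real \<Rightarrow> real"
  assumes mode: "radial_mode (real n) l f f1 f2 h h1 h2"
begin

lemma mode_sides:
  "side_solution R R1 (real n) cm l {0<..s0} f f1 f2" "side_solution R R1 (real n) cp l {s0..L} h h1 h2"
  "f s0 = h s0" "cm * f1 s0 = cp * h1 s0" "h L = 0"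
  using mode unfolding radial_mode_def by auto

lemma glue_cont: "continuous_on {0<..L} (glue f h)"
  unfolding glue_def
  by (rule continuous_on_cases_le)
    (auto intro: continuous_on_subset[OF side_solution_cont(1)[OF mode_sides(1)]]
      continuous_on_subset[OF side_solution_cont(1)[OF mode_sides(2)]] continuous_on_id simp: mode_sides(3))

lemma mode_minus_Delta_c:
  "minus_Delta_c M N L R \<zeta> s0 cm cp (lift n (glue f h)) (\<lambda>m. of_real l * lift n (glue f h) m)"
proof -
  define u where "u = lift n (glue f h)"
  have uP: "u (P (s, t)) = of_real (glue f h s) * cis (real n * t)" if "s \<in> {0<..L}" for s t
    using that by (simp add: u_def lift_P)
  have um: "measurable_fun L R P u" unfolding u_def by (rule measurable_lift[OF glue_cont])
  obtain C where C: "\<And>s. s \<in> {0<..s0} \<Longrightarrow> \<bar>f s\<bar> \<le> C * (R s)\<^sup>2 \<and> \<bar>f1 s\<bar> \<le> C * R s \<and> \<bar>f2 s\<bar> \<le> C"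
    using mode unfolding radial_mode_def by blast
  have C0: "C \<ge> 0" using C[of s0] s0 by (smt (verit) greaterThanAtMost_iff)
  obtain r where r: "r > 0" "\<And>s. s \<in> {s0..L} \<Longrightarrow> r \<le> R s" using R_lower[of s0] s0 by auto
  have bd: "\<exists>B>0. \<forall>s\<in>{s0..L}. \<bar>v s\<bar> \<le> B" if "continuous_on {s0..L} v" for v :: "real \<Rightarrow> real"
    using compact_imp_bounded[OF compact_continuous_image[OF that compact_Icc]] by (auto simp: bounded_pos)
  note hc = side_solution_cont[OF mode_sides(2)]
  obtain B0 B1 B2 where B: "B0 > 0" "B1 > 0" "B2 > 0" "\<And>s. s \<in> {s0..L} \<Longrightarrow> \<bar>h s\<bar> \<le> B0"
    "\<And>s. s \<in> {s0..L} \<Longrightarrow> \<bar>h1 s\<bar> \<le> B1" "\<And>s. s \<in> {s0..L} \<Longrightarrow> \<bar>h2 s\<bar> \<le> B2"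
    using bd[OF hc(1)] bd[OF hc(2)] bd[OF hc(3)] by metis
  \<comment> \<open>On [s0, L] the profile R is bounded below by r, so mere boundedness of h, h' and
    h'' already has the shape of the estimate at the pole.\<close>
  define D where "D = B0 / r\<^sup>2 + B1 / r + B2"
  have D: "D \<ge> 0" using B r by (simp add: D_def)
  have Db: "\<bar>h s\<bar> \<le> D * (R s)\<^sup>2 \<and> \<bar>h1 s\<bar> \<le> D * R s \<and> \<bar>h2 s\<bar> \<le> D" if s: "s \<in> {s0..L}" for s
  proof -
    have rs: "r \<le> R s" "r\<^sup>2 \<le> (R s)\<^sup>2" using r s by (auto intro: power_mono)
    have "B0 / r\<^sup>2 \<le> D" "B1 / r \<le> D" "B2 \<le> D" using B r by (auto simp: D_def)
    then have "B0 / r\<^sup>2 * r\<^sup>2 \<le> D * (R s)\<^sup>2" "B1 / r * r \<le> D * R s"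
      using rs r(1) D mult_mono[of "B0 / r\<^sup>2" D "r\<^sup>2" "(R s)\<^sup>2"] mult_mono[of "B1 / r" D r "R s"] by simp_all
    then show ?thesis using B(4-6)[OF s] r \<open>B2 \<le> D\<close> by auto
  qed
  have s0L: "s0 \<in> {0<..<L}" using s0 by simp
  have left: "\<exists>gs. H2_approx L R P (Omega_minus M N \<zeta> s0) gs u"
    "Delta_c_on L R P s0 cm cp (Omega_minus M N \<zeta> s0) u (\<lambda>m. - (of_real l * u m))"
    "normal_trace L R P s0 {0<..s0} (Omega_minus M N \<zeta> s0) u (\<lambda>\<theta>. of_real (f1 s0) * cis (real n * \<theta>))"
  proof -
    have J: "{0<..s0} = {0<..s0} \<or> (\<exists>\<alpha>>0. \<alpha> < s0 \<and> {0<..s0} = {\<alpha>..s0})" by simp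
    have nb: "at s0 within {0<..s0} \<noteq> bot" using s0 by (simp add: trivial_limit_within)
    have \<Omega>: "P (s, t) \<in> Omega_minus M N \<zeta> s0 \<longleftrightarrow> s \<in> interior {0<..s0}" if "s \<in> {0<..<L}" "s \<noteq> s0" for s t
      using P_vimage_Omega(1)[OF _ s0L, of s t] that by auto
    have ui: "u (P (s, t)) = of_real (f s) * cis (real n * t)" if "s \<in> interior {0<..s0}" for s t
      using uP[of s t] that s0 by (auto simp: glue_def)
    have co: "coeff_c L s0 cm cp s = cm" if "s \<in> interior {0<..s0}" for s using coeff_left[of s] that by auto
    note m = side_membership[OF J s0(1) less_imp_le[OF s0(2)] _ nb mode_sides(1) _ C0 C \<Omega> closure_Omega(1)[OF s0] co ui]
    show "\<exists>gs. H2_approx L R P (Omega_minus M N \<zeta> s0) gs u"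
      "Delta_c_on L R P s0 cm cp (Omega_minus M N \<zeta> s0) u (\<lambda>m. - (of_real l * u m))"
      "normal_trace L R P s0 {0<..s0} (Omega_minus M N \<zeta> s0) u (\<lambda>\<theta>. of_real (f1 s0) * cis (real n * \<theta>))"
      using m s0 by auto
  qed
  have right: "\<exists>gs. H2_approx L R P (Omega_plus M N L \<zeta> s0) gs u"
    "Delta_c_on L R P s0 cm cp (Omega_plus M N L \<zeta> s0) u (\<lambda>m. - (of_real l * u m))"
    "normal_trace L R P s0 {s0..L} (Omega_plus M N L \<zeta> s0) u (\<lambda>\<theta>. of_real (h1 s0) * cis (real n * \<theta>))"
  proof -
    have J: "{s0..L} = {0<..L} \<or> (\<exists>\<alpha>>0. \<alpha> < L \<and> {s0..L} = {\<alpha>..L})" using s0 by blast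
    have nb: "at s0 within {s0..L} \<noteq> bot" using s0 by (simp add: trivial_limit_within)
    have \<Omega>: "P (s, t) \<in> Omega_plus M N L \<zeta> s0 \<longleftrightarrow> s \<in> interior {s0..L}" if "s \<in> {0<..<L}" "s \<noteq> s0" for s t
      using P_vimage_Omega(2)[OF _ s0L, of s t] that by auto
    have ui: "u (P (s, t)) = of_real (h s) * cis (real n * t)" if "s \<in> interior {s0..L}" for s t
      using uP[of s t] that s0 by (auto simp: glue_def)
    have co: "coeff_c L s0 cm cp s = cp" if "s \<in> interior {s0..L}" for s using coeff_right[of s] that by auto
    note m = side_membership[OF J L_pos order_refl _ nb mode_sides(2) _ D Db \<Omega> closure_Omega(2)[OF s0] co ui]
    show "\<exists>gs. H2_approx L R P (Omega_plus M N L \<zeta> s0) gs u"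
      "Delta_c_on L R P s0 cm cp (Omega_plus M N L \<zeta> s0) u (\<lambda>m. - (of_real l * u m))"
      "normal_trace L R P s0 {s0..L} (Omega_plus M N L \<zeta> s0) u (\<lambda>\<theta>. of_real (h1 s0) * cis (real n * \<theta>))"
      using m s0 by auto
  qed
  \<comment> \<open>Unlike the one-sided \<open>H2\<close> conditions, this one concerns a single
    function across the interface: continuity at s0 and the zero at L are used here.\<close>
  have H10: "u \<in> H10 M L R P"
  proof -
    have fd: "\<And>s. s \<in> {0<..s0} \<Longrightarrow> (f has_real_derivative f1 s) (at s within {0<..s0})"
      and hd: "\<And>s. s \<in> {s0..L} \<Longrightarrow> (h has_real_derivative h1 s) (at s within {s0..L})"
      using mode_sides(1,2) unfolding side_solution_def by auto
    have C2: "\<bar>f s\<bar> \<le> C * (R s)\<^sup>2 \<and> \<bar>f1 s\<bar> \<le> C * R s" if "s \<in> {0<..s0}" for s using C[OF that] by simp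
    obtain C' k0 where k0: "C' \<ge> 0" "k0 \<ge> 1" "\<And>k. k \<ge> k0 \<Longrightarrow> \<exists>g g1. (\<forall>m. Ck_on m UNIV g) \<and>
      (\<forall>x. (g has_real_derivative g1 x) (at x)) \<and> (\<forall>s. s < 1 / real k \<or> s > L - 1 / real k \<longrightarrow> g s = 0) \<and>
      (\<forall>s\<in>{0<..<s0}. ((g s - f s) / R s)\<^sup>2 + (g1 s - f1 s)\<^sup>2 \<le> majorant C' k s) \<and>
      (\<forall>s\<in>{s0<..<L}. ((g s - h s) / R s)\<^sup>2 + (g1 s - h1 s)\<^sup>2 \<le> majorant C' k s)"
      using H1_approximation[OF fd side_solution_cont(2)[OF mode_sides(1)] hd hc(2) mode_sides(3,5) C0 C2] by metis
    have "\<forall>k. \<exists>g g1. (\<forall>m. Ck_on m UNIV g) \<and>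
      (\<forall>x. (g has_real_derivative g1 x) (at x)) \<and> (\<forall>s. s < 1 / real (k0 + k) \<or> s > L - 1 / real (k0 + k) \<longrightarrow> g s = 0) \<and>
      (\<forall>s\<in>{0<..<s0}. ((g s - f s) / R s)\<^sup>2 + (g1 s - f1 s)\<^sup>2 \<le> majorant C' (k0 + k) s) \<and>
      (\<forall>s\<in>{s0<..<L}. ((g s - h s) / R s)\<^sup>2 + (g1 s - h1 s)\<^sup>2 \<le> majorant C' (k0 + k) s)"
      by (intro allI k0(3)) simp
    then obtain g g1 where g: "\<And>k m. Ck_on m UNIV (g k)" "\<And>k x. (g k has_real_derivative g1 k x) (at x)"
      "\<And>k s. s < 1 / real (k0 + k) \<or> s > L - 1 / real (k0 + k) \<Longrightarrow> g k s = 0"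
      "\<And>k s. s \<in> {0<..<s0} \<Longrightarrow> ((g k s - f s) / R s)\<^sup>2 + (g1 k s - f1 s)\<^sup>2 \<le> majorant C' (k0 + k) s"
      "\<And>k s. s \<in> {s0<..<L} \<Longrightarrow> ((g k s - h s) / R s)\<^sup>2 + (g1 k s - h1 s)\<^sup>2 \<le> majorant C' (k0 + k) s"
      by metis
    have b: "((g k s - glue f h s) / R s)\<^sup>2 + (g1 k s - glue f1 h1 s)\<^sup>2 \<le> majorant C' (k0 + k) s"
      if "s \<in> {0<..<L}" "s \<noteq> s0" for k s
      using g(4,5)[of s k] that by (cases "s < s0") (auto simp: glue_def)
    show ?thesis unfolding u_def by (rule H10_lift[OF g(1-3) k0(1,2) glue_cont b])
  qed
  \<comment> \<open>Both traces are multiples of exp(i n \<theta>), so the condition is the scalar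
    one at s0.\<close>
  have AE: "AE \<theta> in lebesgue_on {0..<2 * pi}. cm *\<^sub>R (of_real (f1 s0) * cis (real n * \<theta>)) = cp *\<^sub>R (of_real (h1 s0) * cis (real n * \<theta>))"
  proof -
    have "of_real cm * of_real (f1 s0) = (of_real cp * of_real (h1 s0) :: complex)"
      using mode_sides(4) by (metis of_real_mult)
    then show ?thesis by (simp add: scaleR_conv_of_real mult.assoc[symmetric])
  qed
  have dom: "u \<in> domain_A M N L R \<zeta> s0 cm cp"
    unfolding domain_A_def H2_def using H10 um left(1,3) right(1,3) AE by blast
  have "measurable_fun L R P (\<lambda>m. of_real l * u m)"
    using um unfolding measurable_fun_def o_def by (intro borel_measurable_times) auto
  with dom left(2) right(2) show ?thesis
    unfolding minus_Delta_c_def u_def by blast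
qed

section \<open>Norms of the lifted modes\<close>

lemma mode_mass_cont: "continuous_on {0..s0} (\<lambda>s. (f s)\<^sup>2 * R s)"
proof -
  obtain C where C: "\<And>s. s \<in> {0<..s0} \<Longrightarrow> \<bar>f s\<bar> \<le> C * (R s)\<^sup>2" using mode unfolding radial_mode_def by blast
  obtain Rm where Rm: "Rm > 0" "\<And>s. s \<in> {0..L} \<Longrightarrow> R s \<le> Rm" using R_upper by blast
  show ?thesis
  proof (rule continuous_on_zero_endI)
    show "\<bar>(f s)\<^sup>2 * R s\<bar> \<le> (C * Rm\<^sup>2)\<^sup>2 * R s" if "s \<in> {0<..s0}" for s
    proof -
      have R: "0 < R s" "R s \<le> Rm" using R_pos[of s] Rm(2)[of s] that s0 by auto
      have "0 \<le> C * (R s)\<^sup>2" using C[OF that] by linarith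
      then have "C \<ge> 0" using R by (simp add: zero_le_mult_iff)
      then have "C * (R s)\<^sup>2 \<le> C * Rm\<^sup>2" using R by (intro mult_left_mono power_mono) auto
      then have "\<bar>f s\<bar> \<le> C * Rm\<^sup>2" using C[OF that] by linarith
      then have "\<bar>f s\<bar>\<^sup>2 \<le> (C * Rm\<^sup>2)\<^sup>2" by (intro power_mono) auto
      then show ?thesis using R by (simp add: abs_mult)
    qed
    show "continuous_on {0<..s0} (\<lambda>s. (f s)\<^sup>2 * R s)"
      by (intro continuous_intros side_solution_cont(1)[OF mode_sides(1)] continuous_on_subset[OF R_cont]) (use s0 in auto)
  qed (simp add: R_0)
qed

text \<open>Since |exp(i n \<theta>)| = 1, the norm over B is at most 2 pi times the radial mass at
  distance at least \<delta> from s0. The case \<delta> = 0 gives finiteness of the full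
  norm.\<close>

lemma L2sq_mode_le:
  assumes \<delta>: "\<delta> \<ge> 0" and B: "\<And>s t. s \<in> {0<..<L} \<Longrightarrow> P (s, t) \<in> B \<Longrightarrow> \<delta> \<le> \<bar>s - s0\<bar>"
  shows "L2sq L R P B (lift n (glue f h) \<circ> P) \<le>
    ennreal (2 * pi * (integral {0..s0 - \<delta>} (\<lambda>s. (f s)\<^sup>2 * R s) + integral {s0 + \<delta>..L} (\<lambda>s. (h s)\<^sup>2 * R s)))"
proof -
  define W where "W = {..s0 - \<delta>} \<union> {s0 + \<delta>..}"
  define v where "v s = indicator W s * (indicator {0<..L} s * glue f h s)\<^sup>2" for s
  have "(\<lambda>s. indicator {0<..L} s *\<^sub>R glue f h s) \<in> borel_measurable borel"
    by (intro borel_measurable_continuous_on_indicator glue_cont) auto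
  then have gm: "(\<lambda>s. indicator {0<..L} s * glue f h s) \<in> borel_measurable borel" by simp
  have v: "v \<in> borel_measurable borel"
    unfolding v_def[abs_def] W_def
    by (intro borel_measurable_times borel_measurable_power gm borel_measurable_indicator) simp
  let ?F = "\<lambda>s. (f s)\<^sup>2 * R s" and ?H = "\<lambda>s. (h s)\<^sup>2 * R s"
  define a1 where "a1 = integral {0..s0 - \<delta>} ?F"
  define a2 where "a2 = integral {s0 + \<delta>..L} ?H"
  have m1: "continuous_on {0..s0 - \<delta>} ?F" "continuous_on {s0 + \<delta>..L} ?H"
  proof -
    have "continuous_on {0..s0} ?F" by (rule mode_mass_cont)
    then show "continuous_on {0..s0 - \<delta>} ?F" by (rule continuous_on_subset) (use \<delta> in auto)
    have "continuous_on {s0..L} ?H"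
      by (intro continuous_intros side_solution_cont(1)[OF mode_sides(2)] continuous_on_subset[OF R_cont]) (use s0 in auto)
    then show "continuous_on {s0 + \<delta>..L} ?H" by (rule continuous_on_subset) (use \<delta> in auto)
  qed
  have nn: "0 \<le> ?F s" if "s \<in> {0..s0 - \<delta>}" for s using R_nonneg[of s] that s0 \<delta> by auto
  have nn': "0 \<le> ?H s" if "s \<in> {s0 + \<delta>..L}" for s using R_nonneg[of s] that s0 \<delta> by auto
  have i1: "(\<integral>\<^sup>+ s. ennreal (?F s) * indicator {0..s0 - \<delta>} s \<partial>lborel) = ennreal a1"
    unfolding a1_def by (intro nn_integral_has_integral_lebesgue' nn integrable_integral integrable_continuous_real m1)
  have i2: "(\<integral>\<^sup>+ s. ennreal (?H s) * indicator {s0 + \<delta>..L} s \<partial>lborel) = ennreal a2"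
    unfolding a2_def by (intro nn_integral_has_integral_lebesgue' nn' integrable_integral integrable_continuous_real m1)
  have a: "a1 \<ge> 0" "a2 \<ge> 0" unfolding a1_def a2_def
    by (intro integral_nonneg integrable_continuous_real m1 nn nn'; simp)+
  have "L2sq L R P B (lift n (glue f h) \<circ> P) \<le> ennreal (2 * pi) * (\<integral>\<^sup>+ s. ennreal (v s) * ennreal (\<rho> s) \<partial>lborel)"
    unfolding L2sq_def
  proof (rule nn_integral_vol_le[OF v])
    fix s t assume s: "s \<in> {0<..<L}" "s \<noteq> s0"
    show "ennreal ((norm ((lift n (glue f h) \<circ> P) (s, t)))\<^sup>2) * indicator (P -` B) (s, t) \<le> ennreal (v s)"
    proof (cases "P (s, t) \<in> B")
      case True
      then have "s \<in> W" using B[of s t] s \<delta> by (auto simp: W_def)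
      then show ?thesis using s by (simp add: v_def lift_P norm_mult indicator_def)
    qed simp
  qed
  also have "(\<integral>\<^sup>+ s. ennreal (v s) * ennreal (\<rho> s) \<partial>lborel) \<le>
      (\<integral>\<^sup>+ s. ennreal (?F s) * indicator {0..s0 - \<delta>} s + ennreal (?H s) * indicator {s0 + \<delta>..L} s \<partial>lborel)"
  proof (rule nn_integral_mono)
    fix s
    show "ennreal (v s) * ennreal (\<rho> s) \<le> ennreal (?F s) * indicator {0..s0 - \<delta>} s + ennreal (?H s) * indicator {s0 + \<delta>..L} s"
    proof (cases "s \<in> {0<..L} \<and> s \<in> W")
      case True
      then have "ennreal (v s) * ennreal (\<rho> s) = ennreal ((glue f h s)\<^sup>2 * R s)"
        using R_nonneg[of s] by (simp add: v_def \<rho>_def ennreal_mult)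
      moreover have "s \<in> {0..s0 - \<delta>} \<and> glue f h s = f s \<or> s \<in> {s0 + \<delta>..L} \<and> glue f h s = h s"
        using True \<delta> mode_sides(3) by (auto simp: W_def glue_def)
      ultimately show ?thesis by (auto intro: add_increasing add_increasing2)
    next
      case False
      then show ?thesis by (auto simp: v_def \<rho>_def)
    qed
  qed
  also have "\<dots> = ennreal a1 + ennreal a2"
    unfolding i1[symmetric] i2[symmetric]
    by (rule nn_integral_add) (auto intro: borel_measurable_ennreal_indicator m1)
  also have "ennreal (2 * pi) * (ennreal a1 + ennreal a2) = ennreal (2 * pi * (a1 + a2))"
    using a by (simp add: ennreal_mult ennreal_plus[symmetric] del: ennreal_plus)
  finally show ?thesis by (simp add: a1_def a2_def mult_left_mono comp_def)
qed

text \<open>The mass inside suffices: the decay estimate is relative to it, and its positivity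
  permits the normalisation.\<close>

lemma L2sq_mode_ge:
  "L2sq L R P M (lift n (glue f h) \<circ> P) \<ge> ennreal (2 * pi * integral {0..s0} (\<lambda>s. (f s)\<^sup>2 * R s))"
proof -
  define v where "v s = ennreal ((indicator {0<..L} s * glue f h s)\<^sup>2)" for s
  have "(\<lambda>s. indicator {0<..L} s *\<^sub>R glue f h s) \<in> borel_measurable borel"
    by (intro borel_measurable_continuous_on_indicator glue_cont) auto
  then have v: "v \<in> borel_measurable borel" unfolding v_def[abs_def] by simp
  let ?F = "\<lambda>s. (f s)\<^sup>2 * R s"
  have nn: "0 \<le> ?F s" if "s \<in> {0..s0}" for s using R_nonneg[of s] that s0 by auto
  have i: "(\<integral>\<^sup>+ s. ennreal (?F s) * indicator {0..s0} s \<partial>lborel) = ennreal (integral {0..s0} ?F)"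
    by (intro nn_integral_has_integral_lebesgue' nn integrable_integral integrable_continuous_real mode_mass_cont)
  have a: "integral {0..s0} ?F \<ge> 0"
    by (intro integral_nonneg integrable_continuous_real mode_mass_cont nn)
  have "ennreal (2 * pi * integral {0..s0} ?F) = ennreal (2 * pi) * (\<integral>\<^sup>+ s. ennreal (?F s) * indicator {0..s0} s \<partial>lborel)"
    unfolding i using a by (simp add: ennreal_mult)
  also have "\<dots> \<le> ennreal (2 * pi) * (\<integral>\<^sup>+ s. v s * ennreal (\<rho> s) \<partial>lborel)"
  proof (intro mult_left_mono nn_integral_mono)
    fix s
    show "ennreal (?F s) * indicator {0..s0} s \<le> v s * ennreal (\<rho> s)"
    proof (cases "s \<in> {0<..s0}")
      case True
      then show ?thesis using s0 R_nonneg[of s] by (simp add: v_def \<rho>_def glue_def ennreal_mult)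
    next
      case False
      then show ?thesis using R_0 by (cases "s = 0") (auto simp: indicator_def)
    qed
  qed simp
  also have "\<dots> = (\<integral>\<^sup>+ p. v (fst p) \<partial>vol L R)" by (rule nn_integral_vol[OF v, symmetric])
  also have "\<dots> = L2sq L R P M (lift n (glue f h) \<circ> P)"
    unfolding L2sq_def
  proof (rule nn_integral_cong)
    fix p assume "p \<in> space (vol L R)"
    then obtain s t where "p = (s, t)" "s \<in> {0<..L}" by (auto simp: space_vol rect_def)
    then show "v (fst p) = ennreal ((norm ((lift n (glue f h) \<circ> P) p))\<^sup>2) * indicator (P -` M) p"
      using P_mem[of s t] by (simp add: v_def lift_P norm_mult)
  qed
  finally show ?thesis .
qed

lemma L2sq_mode_scale:
  "L2sq L R P M (lift n (glue (\<lambda>s. A * f s) (\<lambda>s. A * h s)) \<circ> P) = ennreal (A\<^sup>2) * L2sq L R P M (lift n (glue f h) \<circ> P)"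
proof -
  have m: "(\<lambda>p. ennreal ((norm ((lift n (glue f h) \<circ> P) p))\<^sup>2)) \<in> borel_measurable (vol L R)"
  proof -
    have [measurable]: "(lift n (glue f h) \<circ> P) \<in> borel_measurable (vol L R)"
      using measurable_lift[OF glue_cont, of n] unfolding measurable_fun_def .
    show ?thesis by measurable
  qed
  have "L2sq L R P M (lift n (glue (\<lambda>s. A * f s) (\<lambda>s. A * h s)) \<circ> P) =
      (\<integral>\<^sup>+ p. ennreal (A\<^sup>2) * ennreal ((norm ((lift n (glue f h) \<circ> P) p))\<^sup>2) \<partial>vol L R)"
    unfolding L2sq_def
  proof (rule nn_integral_cong)
    fix p assume "p \<in> space (vol L R)"
    then obtain s t where p: "p = (s, t)" "s \<in> {0<..L}" by (auto simp: space_vol rect_def)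
    moreover have "glue (\<lambda>s. A * f s) (\<lambda>s. A * h s) s = A * glue f h s" by (simp add: glue_def)
    ultimately show "ennreal ((norm ((lift n (glue (\<lambda>s. A * f s) (\<lambda>s. A * h s)) \<circ> P) p))\<^sup>2) * indicator (P -` M) p
      = ennreal (A\<^sup>2) * ennreal ((norm ((lift n (glue f h) \<circ> P) p))\<^sup>2)"
      using P_mem[of s t] by (simp add: lift_P norm_mult power_mult_distrib ennreal_mult)
  qed
  also have "\<dots> = ennreal (A\<^sup>2) * (\<integral>\<^sup>+ p. ennreal ((norm ((lift n (glue f h) \<circ> P) p))\<^sup>2) \<partial>vol L R)"
    by (rule nn_integral_cmult[OF m])
  also have "(\<integral>\<^sup>+ p. ennreal ((norm ((lift n (glue f h) \<circ> P) p))\<^sup>2) \<partial>vol L R) = L2sq L R P M (lift n (glue f h) \<circ> P)"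
    unfolding L2sq_def
  proof (rule nn_integral_cong)
    fix p assume "p \<in> space (vol L R)"
    then obtain s t where p: "p = (s, t)" "s \<in> {0<..L}" by (auto simp: space_vol rect_def)
    then show "ennreal ((norm ((lift n (glue f h) \<circ> P) p))\<^sup>2) = ennreal ((norm ((lift n (glue f h) \<circ> P) p))\<^sup>2) * indicator (P -` M) p"
      using P_mem[of s t] by simp
  qed
  finally show ?thesis .
qed

end

section \<open>Normalised eigenfunctions\<close>

definition mode :: "nat \<Rightarrow> real \<Rightarrow> (real^3 \<Rightarrow> complex) \<Rightarrow> bool" where
  "mode n l u \<longleftrightarrow> (\<exists>f f1 f2 h h1 h2. radial_mode (real n) l f f1 f2 h h1 h2 \<and>
     u = lift n (glue f h) \<and> L2norm L R P M u = 1)"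

lemma ex_mode: "\<exists>n0\<ge>1. \<forall>n\<ge>n0. \<exists>l u. mode n l u"
proof -
  obtain x0 where x0: "\<And>n. n \<ge> x0 \<Longrightarrow> \<exists>l f f1 f2 h h1 h2. radial_mode n l f f1 f2 h h1 h2"
    using ex_radial_mode by blast
  obtain n0 :: nat where n0: "x0 < real n0" using reals_Archimedean2 by blast
  have "\<exists>l u. mode n l u" if n: "n \<ge> max n0 1" for n
  proof -
    have "real n \<ge> x0" using n n0 by (smt (verit) max.bounded_iff of_nat_le_iff)
    then obtain l f f1 f2 h h1 h2 where m: "radial_mode (real n) l f f1 f2 h h1 h2" using x0 by blast
    have npos: "real n > 0" using n by simp
    \<comment> \<open>X is finite by the upper bound with \<delta> = 0 and positive by the mass
      inside, so division by its square root is possible.\<close>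
    define X where "X = L2sq L R P M (lift n (glue f h) \<circ> P)"
    have "X \<le> ennreal (2 * pi * (integral {0..s0 - 0} (\<lambda>s. (f s)\<^sup>2 * R s) + integral {s0 + 0..L} (\<lambda>s. (h s)\<^sup>2 * R s)))"
      unfolding X_def by (rule L2sq_mode_le[OF m]) auto
    then have "X < top" using ennreal_less_top le_less_trans by blast
    then obtain x where x: "X = ennreal x" "x \<ge> 0" by (cases X) auto
    have "0 < 2 * pi * integral {0..s0} (\<lambda>s. (f s)\<^sup>2 * R s)" using mode_mass_pos[OF npos m] by simp
    moreover have "ennreal (2 * pi * integral {0..s0} (\<lambda>s. (f s)\<^sup>2 * R s)) \<le> ennreal x"
      using L2sq_mode_ge[OF m] by (simp add: X_def x(1)[symmetric])
    ultimately have xpos: "x > 0" using x(2) by (simp add: ennreal_le_iff)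
    define A where "A = 1 / sqrt x"
    have A: "A > 0" "A\<^sup>2 * x = 1" using xpos by (auto simp: A_def power_divide)
    have "L2norm L R P M (lift n (glue (\<lambda>s. A * f s) (\<lambda>s. A * h s))) = sqrt (enn2real (ennreal (A\<^sup>2) * ennreal x))"
      unfolding L2norm_def L2sq_mode_scale[OF m] X_def[symmetric] x(1) ..
    also have "\<dots> = 1" using A(2) x(2) by (simp add: ennreal_mult[symmetric])
    finally show ?thesis using radial_mode_scale[OF m A(1)] unfolding mode_def by blast
  qed
  then show ?thesis by (intro exI[of _ "max n0 1"]) auto
qed

lemma mode_eigenfunction:
  assumes "mode n l u"
  shows "minus_Delta_c M N L R \<zeta> s0 cm cp u (\<lambda>m. of_real l * u m)" "u \<in> domain_A M N L R \<zeta> s0 cm cp"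
    "L2norm L R P M u = 1"
proof -
  from assms obtain f f1 f2 h h1 h2 where m: "radial_mode (real n) l f f1 f2 h h1 h2" "u = lift n (glue f h)" "L2norm L R P M u = 1"
    unfolding mode_def by blast
  show "minus_Delta_c M N L R \<zeta> s0 cm cp u (\<lambda>m. of_real l * u m)" unfolding m(2) by (rule mode_minus_Delta_c[OF m(1)])
  then show "u \<in> domain_A M N L R \<zeta> s0 cm cp" unfolding minus_Delta_c_def by blast
qed (use assms in \<open>auto simp: mode_def\<close>)

text \<open>The lower bound is exact, so the relative error r is needed above only. It is shared
  between Picone's \<epsilon> = E0 r / 2 and the O(1) term, which n^2 eventually dominates.\<close>

lemma mode_eigenvalue_asymp:
  assumes modes: "\<And>n. mode (max n n0) (lam n) (u n)" and n0: "n0 \<ge> 1"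
  shows "lam \<sim>[sequentially] (\<lambda>n. E0 * (real n)\<^sup>2)"
proof (rule asymp_equivI', rule LIMSEQ_I)
  fix r :: real assume r: "r > 0"
  obtain A where A: "\<And>n l f f1 f2. side_solution R R1 n cm l {0<..s0} f f1 f2 \<Longrightarrow> (\<forall>s\<in>{0<..s0}. f s > 0) \<Longrightarrow>
      l \<le> n\<^sup>2 * (E0 + E0 * r / 2) + A"
    using eigenvalue_upper_bound[of "E0 * r / 2"] E0_pos r by (metis half_gt_zero mult_pos_pos)
  obtain n1 :: nat where n1: "2 * \<bar>A\<bar> / (E0 * r) < real n1" using reals_Archimedean2 by blast
  have "norm (lam n / (E0 * (real n)\<^sup>2) - 1) < r" if n: "n \<ge> max n0 n1" for n
  proof -
    have n': "max n n0 = n" "real n \<ge> 1" "real n1 \<le> real n" using n n0 by auto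
    obtain f f1 f2 h h1 h2 where m: "radial_mode (real n) (lam n) f f1 f2 h h1 h2"
      using modes[of n] unfolding n' mode_def by blast
    have lo: "(real n)\<^sup>2 * E0 \<le> lam n" by (rule eigenvalue_lower_bound[OF _ m]) (use n' in auto)
    have hi: "lam n \<le> (real n)\<^sup>2 * (E0 + E0 * r / 2) + A" using A m unfolding radial_mode_def by blast
    define y where "y = E0 * (real n)\<^sup>2"
    have y: "y > 0" using E0_pos n' by (simp add: y_def)
    have "2 * \<bar>A\<bar> / (E0 * r) < (real n)\<^sup>2" using n1 n' self_le_power[of "real n" 2] by linarith
    then have "A < y * r / 2" using E0_pos r by (simp add: y_def field_simps)
    moreover have "lam n \<le> y + y * r / 2 + A" using hi by (simp add: y_def algebra_simps)
    ultimately have "lam n < y + y * r" by simp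
    moreover have "y \<le> lam n" using lo by (simp add: y_def mult.commute)
    ultimately show ?thesis unfolding y_def[symmetric] using y by (simp add: field_simps abs_if)
  qed
  then show "\<exists>no. \<forall>n\<ge>no. norm (lam n / (E0 * (real n)\<^sup>2) - 1) < r" by blast
qed

lemma mode_localised:
  assumes modes: "\<And>n. mode (max n n0) (lam n) (u n)" and n0: "n0 \<ge> 1"
    and \<omega>: "\<omega> \<subseteq> M" "setdist_g M (closure \<omega>) (interface M N \<zeta> s0) > 0"
  shows "\<exists>C>0. \<exists>d>0. \<forall>n. L2norm L R P \<omega> (u n) \<le> C * exp (- d * real n)"
proof -
  have s0L: "s0 \<in> {0<..<L}" using s0 by simp
  obtain \<delta> where \<delta>: "\<delta> > 0" "\<And>s t. s \<in> {0<..L} \<Longrightarrow> P (s, t) \<in> \<omega> \<Longrightarrow> \<delta> \<le> \<bar>s - s0\<bar>"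
    using away_from_interface[OF s0L \<omega>(2)] by blast
  obtain \<kappa> x1 where \<kappa>: "\<kappa> > 0" and dec: "\<And>n l f f1 f2 h h1 h2. n \<ge> x1 \<Longrightarrow> radial_mode n l f f1 f2 h h1 h2 \<Longrightarrow>
     integral {0..s0 - \<delta>} (\<lambda>s. (f s)\<^sup>2 * R s) + integral {s0 + \<delta>..L} (\<lambda>s. (h s)\<^sup>2 * R s)
       \<le> 2 * exp (- n * \<kappa>) * integral {0..s0} (\<lambda>s. (f s)\<^sup>2 * R s)"
    using decay_rate[OF \<delta>(1)] by blast
  obtain n1 :: nat where n1: "x1 < real n1" using reals_Archimedean2 by blast
  define n2 where "n2 = max n0 n1"
  \<comment> \<open>The decay estimate concerns squared norms, so the rate halves.\<close>
  define d where "d = \<kappa> / 2"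
  \<comment> \<open>sqrt 2 serves the large n. Below n2 the norm is at most 1, and exp(d n2)
    compensates the factor exp(- d n).\<close>
  define C where "C = max (sqrt 2) (exp (d * real n2))"
  have d: "d > 0" using \<kappa> by (simp add: d_def)
  have C: "C > 0" "sqrt 2 \<le> C" "exp (d * real n2) \<le> C" by (auto simp: C_def less_max_iff_disj)
  have "L2norm L R P \<omega> (u n) \<le> C * exp (- d * real n)" for n
  proof -
    from modes[of n] obtain f f1 f2 h h1 h2 where m: "radial_mode (real (max n n0)) (lam n) f f1 f2 h h1 h2"
      and un: "u n = lift (max n n0) (glue f h)" and nm: "L2norm L R P M (u n) = 1"
      unfolding mode_def by blast
    define XM where "XM = L2sq L R P M (u n \<circ> P)"
    \<comment> \<open>The norm 1 also excludes an infinite integral, which \<open>enn2real\<close>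
      would send to 0.\<close>
    have XM: "XM = 1"
    proof -
      have "enn2real XM = 1" using nm by (simp add: L2norm_def XM_def)
      then show ?thesis by (metis enn2real_top ennreal_1 ennreal_enn2real less_top zero_neq_one)
    qed
    show ?thesis
    proof (cases "n \<ge> n2")
      case False
      have "L2sq L R P \<omega> (u n \<circ> P) \<le> XM"
        unfolding XM_def L2sq_def using \<omega>(1) by (intro nn_integral_mono) (auto simp: indicator_def)
      then have "enn2real (L2sq L R P \<omega> (u n \<circ> P)) \<le> 1" unfolding XM by (intro enn2real_leI) auto
      then have "L2norm L R P \<omega> (u n) \<le> 1" by (simp add: L2norm_def)
      also have "1 \<le> exp (d * real n2) * exp (- d * real n)"
        using False d by (simp add: exp_add[symmetric] algebra_simps)
      also have "\<dots> \<le> C * exp (- d * real n)" using C by (intro mult_right_mono) auto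
      finally show ?thesis .
    next
      case True
      have nn: "max n n0 = n" using True by (simp add: n2_def)
      note m' = m[unfolded nn] and un' = un[unfolded nn]
      define If where "If = integral {0..s0} (\<lambda>s. (f s)\<^sup>2 * R s)"
      define Io where "Io = integral {0..s0 - \<delta>} (\<lambda>s. (f s)\<^sup>2 * R s) + integral {s0 + \<delta>..L} (\<lambda>s. (h s)\<^sup>2 * R s)"
      have "real n \<ge> x1" using True n1 by (simp add: n2_def)
      then have Io: "Io \<le> 2 * exp (- real n * \<kappa>) * If" unfolding Io_def If_def using dec[OF _ m'] by simp
      have "ennreal (2 * pi * If) \<le> ennreal 1"
        using L2sq_mode_ge[OF m'] XM unfolding XM_def un' If_def by simp
      then have If: "2 * pi * If \<le> 1" by (subst (asm) ennreal_le_iff) auto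
      have "2 * pi * Io \<le> 2 * pi * (2 * exp (- real n * \<kappa>) * If)" using Io by (intro mult_left_mono) auto
      also have "\<dots> = 2 * exp (- real n * \<kappa>) * (2 * pi * If)" by simp
      also have "\<dots> \<le> 2 * exp (- real n * \<kappa>) * 1" using If by (intro mult_left_mono) auto
      finally have Io2: "2 * pi * Io \<le> 2 * exp (- real n * \<kappa>)" by simp
      have "L2sq L R P \<omega> (u n \<circ> P) \<le> ennreal (2 * pi * Io)"
        unfolding un' Io_def by (rule L2sq_mode_le[OF m']) (use \<delta> in auto)
      also have "\<dots> \<le> ennreal (2 * exp (- real n * \<kappa>))" by (rule ennreal_leI[OF Io2])
      finally have "enn2real (L2sq L R P \<omega> (u n \<circ> P)) \<le> 2 * exp (- real n * \<kappa>)" by (intro enn2real_leI) auto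
      then have "L2norm L R P \<omega> (u n) \<le> sqrt (2 * exp (- real n * \<kappa>))" by (simp add: L2norm_def)
      also have "\<dots> = sqrt 2 * exp (- d * real n)"
      proof -
        have "exp (- real n * \<kappa>) = (exp (- d * real n))\<^sup>2" by (simp add: d_def exp_double[symmetric] algebra_simps)
        then show ?thesis by (simp add: real_sqrt_mult)
      qed
      also have "\<dots> \<le> C * exp (- d * real n)" using C by (intro mult_right_mono) auto
      finally show ?thesis .
    qed
  qed
  then show ?thesis using C(1) d by blast
qed

text \<open>The minimum is attained at s0, where \<open>V_c\<close> takes the inner
  coefficient.\<close>

lemma E_0_eq:
  assumes "{s\<in>{0<..L}. V_c L R s0 cm cp s = E_0 L R s0 cm cp} = {s0}"
  shows "E_0 L R s0 cm cp = E0"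
proof -
  have "V_c L R s0 cm cp s0 = E_0 L R s0 cm cp" using assms by blast
  then show ?thesis by (simp add: V_c_def E0_def)
qed

end

theorem theorem3p3:
  fixes M :: "(real^3) set" and a e N :: "real^3" and L :: real and R :: "real \<Rightarrow> real"
    and \<zeta> :: "real^3 \<Rightarrow> real \<times> complex" and s0 cm cp :: real
  assumes surf: "surface_of_revolution M a e N L R \<zeta>"
    and s0: "0 < s0" "s0 < L"
    and c: "0 < cm" "cm < cp"
    and well: "{s\<in>{0<..L}. V_c L R s0 cm cp s = E_0 L R s0 cm cp} = {s0}"
    and well_minus: "\<forall>s\<in>{0<..<s0}. 1 / (R s)\<^sup>2 > 1 / (R s0)\<^sup>2"
    and well_plus: "cm / (R s0)\<^sup>2 < (INF s\<in>{s0..L}. cp / (R s)\<^sup>2)"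
  shows "\<exists>(lam :: nat \<Rightarrow> real) (u :: nat \<Rightarrow> real^3 \<Rightarrow> complex).
      (\<forall>n. u n \<in> domain_A M N L R \<zeta> s0 cm cp) \<and>
      (\<forall>n. minus_Delta_c M N L R \<zeta> s0 cm cp (u n) (\<lambda>m. of_real (lam n) * u n m)) \<and>
      lam \<sim>[sequentially] (\<lambda>n. E_0 L R s0 cm cp * (real n)\<^sup>2) \<and>
      (\<forall>n. L2norm L R (polar M N \<zeta>) M (u n) = 1) \<and>
      (\<forall>\<omega>. \<omega> \<subseteq> M \<and> measurable_subset L R (polar M N \<zeta>) \<omega> \<and>
            setdist_g M (closure \<omega>) (interface M N \<zeta> s0) > 0 \<longrightarrow>
         (\<exists>C>0. \<exists>d>0. \<forall>n. L2norm L R (polar M N \<zeta>) \<omega> (u n) \<le> C * exp (- d * real n)))"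
proof -
  interpret revolution M a e N L R \<zeta> by unfold_locales (rule surf)
  obtain R1 where R1: "\<And>s. s \<in> {0..L} \<Longrightarrow> (R has_real_derivative R1 s) (at s within {0..L})"
    "continuous_on {0..L} R1"
    using smooth_on_real_derivative[OF R_smooth L_pos] by blast
  have "bounded (R1 ` {0..L})" by (intro compact_imp_bounded compact_continuous_image R1(2) compact_Icc)
  then obtain K where "\<forall>x\<in>R1 ` {0..L}. norm x \<le> K" unfolding bounded_iff by blast
  then have K: "\<bar>R1 s\<bar> \<le> K" if "s \<in> {0..L}" for s using that by auto
  have R_less: "R s < R s0" if s: "s \<in> {0<..<s0}" for s
  proof (rule ccontr)
    assume "\<not> R s < R s0"
    moreover have "R s0 > 0" "R s > 0" using R_pos s s0 by auto
    ultimately have "1 / (R s)\<^sup>2 \<le> 1 / (R s0)\<^sup>2" by (intro divide_left_mono power_mono) auto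
    with bspec[OF well_minus s] show False by linarith
  qed
  \<comment> \<open>The inequality is strict against the infimum, so the difference is a gap uniform
    in s.\<close>
  have gap: "\<exists>\<epsilon>>0. \<forall>s\<in>{s0..L}. cm / (R s0)\<^sup>2 + \<epsilon> \<le> cp / (R s)\<^sup>2"
  proof (intro exI conjI ballI)
    show "(INF s\<in>{s0..L}. cp / (R s)\<^sup>2) - cm / (R s0)\<^sup>2 > 0" using well_plus by simp
    fix s assume s: "s \<in> {s0..L}"
    have "bdd_below ((\<lambda>s. cp / (R s)\<^sup>2) ` {s0..L})" using c by (intro bdd_belowI2[where m = 0]) auto
    from cINF_lower[OF this s] show "cm / (R s0)\<^sup>2 + ((INF s\<in>{s0..L}. cp / (R s)\<^sup>2) - cm / (R s0)\<^sup>2) \<le> cp / (R s)\<^sup>2" by simp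
  qed
  interpret setting M a e N L R \<zeta> R1 s0 cm cp K
    by unfold_locales (use s0 c R_0 R_pos R1 K R_less gap in auto)
  obtain n0 where n0: "n0 \<ge> 1" "\<And>n. n \<ge> n0 \<Longrightarrow> \<exists>l u. mode n l u" using ex_mode by blast
  \<comment> \<open>The indices below n0 share the angular number n0; the asymptotics do not see
    them, and C absorbs them.\<close>
  have "\<forall>n. \<exists>l u. mode (max n n0) l u" using n0(2) by simp
  then obtain lam u where m: "\<And>n. mode (max n n0) (lam n) (u n)" by metis
  show ?thesis
  proof (rule exI[of _ lam], rule exI[of _ u], intro conjI allI impI)
    show "u n \<in> domain_A M N L R \<zeta> s0 cm cp" for n by (rule mode_eigenfunction(2)[OF m])
    show "minus_Delta_c M N L R \<zeta> s0 cm cp (u n) (\<lambda>m. of_real (lam n) * u n m)" for n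
      by (rule mode_eigenfunction(1)[OF m])
    show "lam \<sim>[sequentially] (\<lambda>n. E_0 L R s0 cm cp * (real n)\<^sup>2)"
      unfolding E_0_eq[OF well] by (rule mode_eigenvalue_asymp[OF m n0(1)])
    show "L2norm L R P M (u n) = 1" for n by (rule mode_eigenfunction(3)[OF m])
    show "\<exists>C>0. \<exists>d>0. \<forall>n. L2norm L R P \<omega> (u n) \<le> C * exp (- d * real n)"
      if "\<omega> \<subseteq> M \<and> measurable_subset L R P \<omega> \<and> setdist_g M (closure \<omega>) (interface M N \<zeta> s0) > 0" for \<omega>
      by (rule mode_localised[OF m n0(1)]) (use that in auto)
  qed
qed

end
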